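(* Let $1\leq k\leq n$, let $\lambda\vdash k$ and $\mu\vdash n-k$, and let $V_{(\lambda,\mu)}$ be the corresponding irreducible $\mathfrak{S}_{n-1}$-global $\mathfrak{S}_n$-partial representation, where $\mathfrak{S}_{n-1}\subseteq\mathfrak{S}_n$ is the subgroup of permutations fixing $1$. Then, as representations of $\mathfrak{S}_{n-1}$, $$\mathsf{Res}_{\mathfrak{S}_{n-1}}^{\mathfrak{S}_n}V_{(\lambda,\mu)}\cong\bigoplus_{\lambda^1\to\lambda}\mathsf{Ind}_{\mathfrak{S}_{k-1}\times\mathfrak{S}_{n-k}}^{\mathfrak{S}_{n-1}}(V_{\lambda^1}\otimes V_\mu)\cong\bigoplus_{\nu\vdash n-1}V_\nu^{\oplus d_{\lambda\mu}^\nu},\qquad d_{\lambda\mu}^\nu:=\sum_{\lambda^1\to\lambda}c_{\lambda^1\mu}^\nu.$$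
   Context: All vector spaces are finite-dimensional over $\mathbb{C}$. For a subgroup $H$ of a finite group $G$, a $G$-partial representation $(V,\pi)$ is a map $\pi\colon G\to\operatorname{End}(V)$ such that for all $g,h\in G$: $\pi(1_G)=\mathrm{Id}_V$; $\pi(g^{-1})\pi(gh)=\pi(g^{-1})\pi(g)\pi(h)$; $\pi(gh)\pi(h^{-1})=\pi(g)\pi(h)\pi(h^{-1})$. It is $H$-global if the restriction of $\pi$ to $H$ is a (usual) representation of $H$, denoted $\mathsf{Res}_H^GV$. Definition of $V_{(\lambda,\mu)}$: let $\{V_\nu\}_{\nu\vdash m}$ be the standard irreducible representations of $\mathfrak{S}_m$. Let $[k]=\{1,\dots,k\}$, $K=\{\sigma\in\mathfrak{S}_n\mid\sigma([k])=[k]\}\equiv\mathfrak{S}_k\times\mathfrak{S}_{n-k}$ and $W=V_\lambda\otimes V_\mu$, a representation of $K$. Then $V_{(\lambda,\mu)}=\mathsf{Ind}_{[k]}W$ is the subspace $\bigoplus_{\sigma K:\,1\in\sigma([k])}\sigma\otimes W$ of $\mathsf{Ind}_K^{\mathfrak{S}_n}W=\mathbb{C}[\mathfrak{S}_n]\otimes_{\mathbb{C}[K]}W$, with $\pi(g)(\sigma\otimes w)=g\sigma\otimes w$ if $1\in g\sigma([k])$ and $0$ otherwise. $\lambda^1\to\lambda$ means that the partition $\lambda^1$ is obtained from $\lambda$ by removing a corner (i.e. $\lambda$ covers $\lambda^1$ in the Young lattice). $c_{\lambda^1\mu}^\nu$ are the Littlewood–Richardson coefficients. $\mathfrak{S}_{k-1}\times\mathfrak{S}_{n-k}\equiv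 K\cap\mathfrak{S}_{n-1}$, with $\mathfrak{S}_{k-1}$ permuting $\{2,\dots,k\}$ and $\mathfrak{S}_{n-k}$ permuting $\{k+1,\dots,n\}$. *)

theory Defs
  imports
    Complex_Main
    "HOL-Algebra.Sym_Groups"
    "HOL-Library.Function_Algebras"
    "HOL-Library.Poly_Mapping"
begin

section \<open>Representations on finite-dimensional complex vector spaces\<close>

text \<open>Every vector space below is a linear subspace of a space of functions \<open>'a \<Rightarrow> complex\<close>
  with the pointwise operations.\<close>

definition fscale :: "complex \<Rightarrow> ('a \<Rightarrow> complex) \<Rightarrow> 'a \<Rightarrow> complex"
  where "fscale c f = (\<lambda>x. c * f x)"

global_interpretation cfun: vector_space "fscale :: complex \<Rightarrow> ('a \<Rightarrow> complex) \<Rightarrow> 'a \<Rightarrow> complex"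
  by unfold_locales (auto simp: fscale_def algebra_simps fun_eq_iff)

definition fin_dim_subspace :: "('a \<Rightarrow> complex) set \<Rightarrow> bool"
  where "fin_dim_subspace V \<longleftrightarrow> (\<exists>B. finite B \<and> V = cfun.span B)"

definition linear_map :: "('a \<Rightarrow> complex) set \<Rightarrow> ('b \<Rightarrow> complex) set
    \<Rightarrow> (('a \<Rightarrow> complex) \<Rightarrow> 'b \<Rightarrow> complex) \<Rightarrow> bool"
  where "linear_map V W T \<longleftrightarrow> T ` V \<subseteq> W
    \<and> (\<forall>u\<in>V. \<forall>v\<in>V. T (u + v) = T u + T v)
    \<and> (\<forall>c. \<forall>v\<in>V. T (fscale c v) = fscale c (T v))"

text \<open>A pair \<open>(V, \<pi>)\<close>; only the values of \<open>\<pi> g\<close> on \<open>V\<close> are relevant.\<close>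

type_synonym ('g, 'a) rep =
  "('a \<Rightarrow> complex) set \<times> ('g \<Rightarrow> ('a \<Rightarrow> complex) \<Rightarrow> 'a \<Rightarrow> complex)"

definition representation :: "('g, 'm) monoid_scheme \<Rightarrow> ('g, 'a) rep \<Rightarrow> bool"
  where "representation G = (\<lambda>(V, \<pi>). fin_dim_subspace V
    \<and> (\<forall>g\<in>carrier G. linear_map V V (\<pi> g))
    \<and> (\<forall>v\<in>V. \<pi> \<one>\<^bsub>G\<^esub> v = v)
    \<and> (\<forall>g\<in>carrier G. \<forall>h\<in>carrier G. \<forall>v\<in>V. \<pi> (g \<otimes>\<^bsub>G\<^esub> h) v = \<pi> g (\<pi> h v)))"

definition partial_representation :: "('g, 'm) monoid_scheme \<Rightarrow> ('g, 'a) rep \<Rightarrow> bool"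
  where "partial_representation G = (\<lambda>(V, \<pi>). fin_dim_subspace V
    \<and> (\<forall>g\<in>carrier G. linear_map V V (\<pi> g))
    \<and> (\<forall>v\<in>V. \<pi> \<one>\<^bsub>G\<^esub> v = v)
    \<and> (\<forall>g\<in>carrier G. \<forall>h\<in>carrier G. \<forall>v\<in>V.
        \<pi> (inv\<^bsub>G\<^esub> g) (\<pi> (g \<otimes>\<^bsub>G\<^esub> h) v) = \<pi> (inv\<^bsub>G\<^esub> g) (\<pi> g (\<pi> h v))
      \<and> \<pi> (g \<otimes>\<^bsub>G\<^esub> h) (\<pi> (inv\<^bsub>G\<^esub> h) v) = \<pi> g (\<pi> h (\<pi> (inv\<^bsub>G\<^esub> h) v))))"

definition Res :: "'g set \<Rightarrow> ('g, 'a) rep \<Rightarrow> ('g, 'a) rep"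
  where "Res H = (\<lambda>(V, \<pi>). (V, restrict \<pi> H))"

definition global_on :: "'g set \<Rightarrow> ('g, 'm) monoid_scheme \<Rightarrow> ('g, 'a) rep \<Rightarrow> bool"
  where "global_on H G R \<longleftrightarrow> partial_representation G R \<and> representation (G\<lparr>carrier := H\<rparr>) (Res H R)"

definition rep_iso :: "('g, 'm) monoid_scheme \<Rightarrow> ('g, 'a) rep \<Rightarrow> ('g, 'b) rep \<Rightarrow> bool"
  where "rep_iso G R S \<longleftrightarrow> representation G R \<and> representation G S
    \<and> (\<exists>T. linear_map (fst R) (fst S) T \<and> bij_betw T (fst R) (fst S)
        \<and> (\<forall>g\<in>carrier G. \<forall>v\<in>fst R. T (snd R g v) = snd S g (T v)))"

text \<open>External direct sum over a finite index set: a vector is the family of its components,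
  curried into one function on pairs.\<close>

definition direct_sum :: "'i set \<Rightarrow> ('i \<Rightarrow> ('g, 'a) rep) \<Rightarrow> ('g, 'i \<times> 'a) rep"
  where "direct_sum I R =
    ({f. (\<forall>i\<in>I. (\<lambda>a. f (i, a)) \<in> fst (R i)) \<and> (\<forall>i a. i \<notin> I \<longrightarrow> f (i, a) = 0)},
     \<lambda>g f (i, a). if i \<in> I then snd (R i) g (\<lambda>a'. f (i, a')) a else 0)"

definition rep_multiple :: "nat \<Rightarrow> ('g, 'a) rep \<Rightarrow> ('g, nat \<times> 'a) rep"
  where "rep_multiple d R = direct_sum {..<d} (\<lambda>_. R)"

text \<open>\<open>V \<otimes> W\<close> is realised inside the functions on pairs. The map \<open>A \<otimes> B\<close> applies \<open>A\<close> in the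
  first variable and \<open>B\<close> in the second; see \<open>tensor_map_tensor\<close> below.\<close>

definition tensor :: "('a \<Rightarrow> complex) \<Rightarrow> ('b \<Rightarrow> complex) \<Rightarrow> 'a \<times> 'b \<Rightarrow> complex"
  where "tensor v w = (\<lambda>(a, b). v a * w b)"

definition tensor_map :: "(('a \<Rightarrow> complex) \<Rightarrow> 'a \<Rightarrow> complex) \<Rightarrow> (('b \<Rightarrow> complex) \<Rightarrow> 'b \<Rightarrow> complex)
    \<Rightarrow> ('a \<times> 'b \<Rightarrow> complex) \<Rightarrow> 'a \<times> 'b \<Rightarrow> complex"
  where "tensor_map A B t = (\<lambda>(a, b). B (\<lambda>b'. A (\<lambda>a'. t (a', b')) a) b)"

definition tensor_rep :: "('g, 'a) rep \<Rightarrow> ('g, 'b) rep \<Rightarrow> ('g, 'a \<times> 'b) rep"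
  where "tensor_rep R S =
    (cfun.span {tensor v w | v w. v \<in> fst R \<and> w \<in> fst S},
     \<lambda>g. tensor_map (snd R g) (snd S g))"

text \<open>For a representation \<open>(W, \<rho>)\<close> of a subgroup \<open>K\<close> of \<open>G\<close>, the tensor product of the group
  algebra of \<open>G\<close> with \<open>W\<close> over the group algebra of \<open>K\<close> is realised in its usual model of
  functions \<open>F\<close> from \<open>G\<close> to \<open>W\<close> with \<open>F (g k) = \<rho> (k\<^sup>-\<^sup>1) (F g)\<close>. In it, \<open>\<sigma> \<otimes> w\<close> is the function
  supported on the coset \<open>\<sigma> K\<close> with value \<open>w\<close> at \<open>\<sigma>\<close>.\<close>

definition ind_tensor ::
    "('g, 'm) monoid_scheme \<Rightarrow> 'g set \<Rightarrow> ('g, 'a) rep \<Rightarrow> 'g \<Rightarrow> ('a \<Rightarrow> complex) \<Rightarrow> 'g \<times> 'a \<Rightarrow> complex"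
  where "ind_tensor G K R \<sigma> w =
    (\<lambda>(g, a). if g \<in> \<sigma> <#\<^bsub>G\<^esub> K then snd R (inv\<^bsub>G\<^esub> g \<otimes>\<^bsub>G\<^esub> \<sigma>) w a else 0)"

text \<open>For a union \<open>C\<close> of left cosets of \<open>K\<close>: the sum of the spaces \<open>\<sigma> \<otimes> W\<close> with \<open>\<sigma> \<in> C\<close>,
  where \<open>h\<close> sends \<open>\<sigma> \<otimes> w\<close> to \<open>h \<sigma> \<otimes> w\<close> if \<open>h \<sigma> \<in> C\<close> and to \<open>0\<close> otherwise
  (see \<open>ind_on_action\<close> below).\<close>

definition ind_on ::
    "('g, 'm) monoid_scheme \<Rightarrow> 'g set \<Rightarrow> 'g set \<Rightarrow> ('g, 'a) rep \<Rightarrow> ('g, 'g \<times> 'a) rep"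
  where "ind_on G K C R =
    (cfun.span {ind_tensor G K R \<sigma> w | \<sigma> w. \<sigma> \<in> C \<and> w \<in> fst R},
     \<lambda>h F (g, a). if g \<in> C then F (inv\<^bsub>G\<^esub> h \<otimes>\<^bsub>G\<^esub> g, a) else 0)"

definition Ind :: "('g, 'm) monoid_scheme \<Rightarrow> 'g set \<Rightarrow> ('g, 'a) rep \<Rightarrow> ('g, 'g \<times> 'a) rep"
  where "Ind G K R = ind_on G K (carrier G) R"


section \<open>Partitions, Specht modules and Littlewood--Richardson coefficients\<close>

definition partitions :: "nat \<Rightarrow> nat list set"
  where "partitions m = {lam. sorted_wrt (\<ge>) lam \<and> 0 \<notin> set lam \<and> sum_list lam = m}"

definition diagram :: "nat list \<Rightarrow> (nat \<times> nat) set"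
  where "diagram lam = {(i, j). i < length lam \<and> j < lam ! i}"

definition corner :: "nat list \<Rightarrow> nat \<times> nat \<Rightarrow> bool"
  where "corner lam = (\<lambda>(i, j). (i, j) \<in> diagram lam
    \<and> (Suc i, j) \<notin> diagram lam \<and> (i, Suc j) \<notin> diagram lam)"

definition remove_corner :: "nat list \<Rightarrow> nat list set"
  where "remove_corner lam = {lam1. lam1 \<in> partitions (sum_list lam - 1)
    \<and> (\<exists>c. corner lam c \<and> diagram lam1 = diagram lam - {c})}"

text \<open>A Young tableau is encoded by the map sending each entry to its cell, and a tabloid by the map
  sending each entry to its row.\<close>

definition tableaux :: "nat list \<Rightarrow> (nat \<Rightarrow> nat \<times> nat) set"
  where "tableaux lam = {t. bij_betw t {1..sum_list lam} (diagram lam)}"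

definition tabloid :: "nat list \<Rightarrow> (nat \<Rightarrow> nat \<times> nat) \<Rightarrow> nat \<Rightarrow> nat"
  where "tabloid lam t = restrict (fst \<circ> t) {1..sum_list lam}"

definition column_stabilizer :: "nat list \<Rightarrow> (nat \<Rightarrow> nat \<times> nat) \<Rightarrow> (nat \<Rightarrow> nat) set"
  where "column_stabilizer lam t = {\<sigma>. \<sigma> permutes {1..sum_list lam}
    \<and> (\<forall>i\<in>{1..sum_list lam}. snd (t (\<sigma> i)) = snd (t i))}"

definition polytabloid :: "nat list \<Rightarrow> (nat \<Rightarrow> nat \<times> nat) \<Rightarrow> (nat \<Rightarrow> nat) \<Rightarrow> complex"
  where "polytabloid lam t = (\<lambda>r. \<Sum>\<sigma>\<in>column_stabilizer lam t.
    of_int (sign \<sigma>) * (if r = tabloid lam (t \<circ> inv' \<sigma>) then 1 else 0))"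

text \<open>The Specht module, a representation of \<open>sym_group (sum_list lam)\<close> on a space of functions on
  tabloids; a permutation \<open>\<sigma>\<close> sends the indicator function of a tabloid \<open>r\<close> to that of
  \<open>r \<circ> \<sigma>\<^sup>-\<^sup>1\<close>.\<close>

definition specht :: "nat list \<Rightarrow> (nat \<Rightarrow> nat, nat \<Rightarrow> nat) rep"
  where "specht lam = (cfun.span (polytabloid lam ` tableaux lam), \<lambda>\<sigma> f r. f (r \<circ> \<sigma>))"

definition semistandard :: "nat \<Rightarrow> nat list \<Rightarrow> (nat \<times> nat \<Rightarrow> nat) set"
  where "semistandard N lam = {T \<in> diagram lam \<rightarrow>\<^sub>E {..<N}.
      (\<forall>i j. (i, j) \<in> diagram lam \<and> (i, Suc j) \<in> diagram lam \<longrightarrow> T (i, j) \<le> T (i, Suc j))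
    \<and> (\<forall>i j. (i, j) \<in> diagram lam \<and> (Suc i, j) \<in> diagram lam \<longrightarrow> T (i, j) < T (Suc i, j))}"

definition var :: "nat \<Rightarrow> (nat \<Rightarrow>\<^sub>0 nat) \<Rightarrow>\<^sub>0 int"
  where "var i = Poly_Mapping.single (Poly_Mapping.single i 1) 1"

definition schur :: "nat \<Rightarrow> nat list \<Rightarrow> (nat \<Rightarrow>\<^sub>0 nat) \<Rightarrow>\<^sub>0 int"
  where "schur N lam = (\<Sum>T\<in>semistandard N lam. \<Prod>c\<in>diagram lam. var (T c))"

text \<open>The structure constants of the Schur functions. An identity of symmetric functions
  is the same as the corresponding identities of symmetric polynomials in \<open>N\<close> variables, for
  all \<open>N\<close>.\<close>

definition littlewood_richardson :: "nat list \<Rightarrow> nat list \<Rightarrow> nat list \<Rightarrow> nat"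
  where "littlewood_richardson lam mu = (THE c.
      (\<forall>nu. nu \<notin> partitions (sum_list lam + sum_list mu) \<longrightarrow> c nu = 0)
    \<and> (\<forall>N. schur N lam * schur N mu =
          (\<Sum>nu\<in>partitions (sum_list lam + sum_list mu). of_nat (c nu) * schur N nu)))"


section \<open>Representations of subgroups of the symmetric group\<close>

definition fix1 :: "nat \<Rightarrow> (nat \<Rightarrow> nat) set"
  where "fix1 n = {\<sigma>. \<sigma> permutes {1..n} \<and> \<sigma> 1 = 1}"

definition sym_group_fix1 :: "nat \<Rightarrow> (nat \<Rightarrow> nat) monoid"
  where "sym_group_fix1 n = (sym_group n)\<lparr>carrier := fix1 n\<rparr>"

definition block_stabilizer :: "nat \<Rightarrow> nat \<Rightarrow> (nat \<Rightarrow> nat) set"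
  where "block_stabilizer n k = {\<sigma>. \<sigma> permutes {1..n} \<and> \<sigma> ` {1..k} = {1..k}}"

text \<open>The permutation of \<open>{1..m}\<close> induced, along \<open>i \<mapsto> i + a\<close>, by a permutation which
  preserves \<open>{a+1..a+m}\<close>.\<close>

definition block_perm :: "nat \<Rightarrow> nat \<Rightarrow> (nat \<Rightarrow> nat) \<Rightarrow> nat \<Rightarrow> nat"
  where "block_perm a m \<sigma> = (\<lambda>i. if i \<in> {1..m} then \<sigma> (i + a) - a else i)"

definition specht_at :: "nat \<Rightarrow> nat list \<Rightarrow> (nat \<Rightarrow> nat, nat \<Rightarrow> nat) rep"
  where "specht_at a lam =
    (fst (specht lam), \<lambda>\<sigma>. snd (specht lam) (block_perm a (sum_list lam) \<sigma>))"

text \<open>Permutations preserving the adjacent blocks \<open>{a+1..a+|lam|}\<close> and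
  \<open>{a+|lam|+1..a+|lam|+|mu|}\<close> act on the tensor product of the two Specht modules,
  each block acting on its own factor.\<close>

definition specht_tensor :: "nat \<Rightarrow> nat list \<Rightarrow> nat list
    \<Rightarrow> (nat \<Rightarrow> nat, (nat \<Rightarrow> nat) \<times> (nat \<Rightarrow> nat)) rep"
  where "specht_tensor a lam mu = tensor_rep (specht_at a lam) (specht_at (a + sum_list lam) mu)"

definition V_pair :: "nat list \<Rightarrow> nat list
    \<Rightarrow> (nat \<Rightarrow> nat, (nat \<Rightarrow> nat) \<times> (nat \<Rightarrow> nat) \<times> (nat \<Rightarrow> nat)) rep"
  where "V_pair lam mu =
    (let k = sum_list lam; n = k + sum_list mu
     in ind_on (sym_group n) (block_stabilizer n k)
          {\<sigma>. \<sigma> permutes {1..n} \<and> 1 \<in> \<sigma> ` {1..k}} (specht_tensor 0 lam mu))"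

section \<open>Consistency of the models\<close>

text \<open>The realisations of \<open>\<otimes>\<close> above satisfy the defining relations, and \<open>V_pair lam mu\<close> is a
  partial representation which is global on the permutations fixing \<open>1\<close>.\<close>

context
  notes plus_fun_apply [simp del] zero_fun_apply [simp del]
begin

lemma zf: "(\<lambda>a. 0 :: complex) = 0"
  by (simp add: zero_fun_def)

lemma cspan_induct [consumes 1, case_names base step]:
  assumes x: "x \<in> cfun.span S" and "P 0"
    and "\<And>c x y. x \<in> S \<Longrightarrow> y \<in> cfun.span S \<Longrightarrow> P y \<Longrightarrow> P (fscale c x + y)"
  shows "P x"
proof -
  have "x \<in> cfun.span S \<and> P x"
    using x
  proof (rule cfun.span_induct_alt)
    show "0 \<in> cfun.span S \<and> P 0"
      using assms(2) cfun.span_zero by blast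
  next
    fix c x y assume "x \<in> S" "y \<in> cfun.span S \<and> P y"
    then show "fscale c x + y \<in> cfun.span S \<and> P (fscale c x + y)"
      using assms(3) by (blast intro: cfun.span_add cfun.span_scale cfun.span_base)
  qed
  then show ?thesis by blast
qed

lemma tensor_map_tensor:
  assumes "linear_map V V A" "linear_map W W B" "v \<in> V" "w \<in> W"
  shows "tensor_map A B (tensor v w) = tensor (A v) (B w)"
proof (rule ext, clarify)
  fix a b
  have 1: "(\<lambda>a'. v a' * w b') = fscale (w b') v" for b' by (auto simp: fscale_def)
  have 2: "A (\<lambda>a'. v a' * w b') a = w b' * A v a" for b'
    unfolding 1 using assms by (auto simp: linear_map_def fscale_def)
  have 3: "(\<lambda>b'. w b' * A v a) = fscale (A v a) w" by (auto simp: fscale_def)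
  show "tensor_map A B (tensor v w) (a, b) = tensor (A v) (B w) (a, b)"
    using assms unfolding tensor_map_def tensor_def by (simp add: 2 3) (simp add: linear_map_def fscale_def)
qed

lemma fin_dim_subspaceI:
  assumes "finite B" "V = cfun.span S" "S \<subseteq> cfun.span B"
  shows "fin_dim_subspace V"
proof -
  from cfun.maximal_independent_subset obtain C where C: "C \<subseteq> S" "cfun.independent C" "S \<subseteq> cfun.span C" 
    by (metis cfun.maximal_independent_subset)
  have "finite C" using C assms(1,3) cfun.independent_span_bound by blast
  moreover have "V = cfun.span C" using assms(2) C
    by (metis cfun.span_mono cfun.span_span subset_antisym)
  ultimately show ?thesis unfolding fin_dim_subspace_def by blast
qed

lemma fin_dim_subspaceD: "fin_dim_subspace V \<Longrightarrow> cfun.subspace V"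
  unfolding fin_dim_subspace_def using cfun.subspace_span by blast

lemma tensor_lin:
  "tensor (u + v) w = tensor u w + tensor v w" "tensor v (w + w') = tensor v w + tensor v w'"
  "tensor (fscale c v) w = fscale c (tensor v w)" "tensor v (fscale c w) = fscale c (tensor v w)"
  "tensor 0 w = 0" "tensor v 0 = 0"
  by (auto simp: tensor_def fscale_def fun_eq_iff algebra_simps plus_fun_apply zero_fun_apply)

lemma tensor_slice:
  assumes V: "cfun.subspace V" and t: "t \<in> cfun.span {tensor v w | v w. v \<in> V \<and> w \<in> W}"
  shows "(\<lambda>a. t (a, b)) \<in> V"
  using t
proof (induction rule: cspan_induct)
  case base then show ?case using cfun.subspace_0[OF V] by (simp add: zero_fun_def)
next
  case (step c x y)
  then obtain v w where x: "x = tensor v w" "v \<in> V" by blast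
  have "(\<lambda>a. (fscale c x + y) (a, b)) = fscale (c * w b) v + (\<lambda>a. y (a, b))"
    by (auto simp: x tensor_def fscale_def fun_eq_iff plus_fun_apply)
  then show ?case using step x V by (simp add: cfun.subspace_add cfun.subspace_scale)
qed

lemma tensor_map_slice:
  assumes V: "cfun.subspace V" and W: "cfun.subspace W" and A: "linear_map V V A"
  and t: "t \<in> cfun.span {tensor v w | v w. v \<in> V \<and> w \<in> W}"
  shows "(\<lambda>b. A (\<lambda>a. t (a, b)) a) \<in> W"
  using t
proof (induction rule: cspan_induct)
  case base 
  have "A (fscale 0 0) = fscale 0 (A 0)" using A cfun.subspace_0[OF V] unfolding linear_map_def by blast
  then have "A 0 = 0" by simp
  then show ?case using cfun.subspace_0[OF W] by (simp add: zero_fun_def)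
next
  case (step c x y)
  then obtain v w where x: "x = tensor v w" "v \<in> V" "w \<in> W" by blast
  have *: "(\<lambda>a. (fscale c x + y) (a, b)) = fscale (c * w b) v + (\<lambda>a. y (a, b))" for b
    by (auto simp: x tensor_def fscale_def fun_eq_iff plus_fun_apply)
  have "A (fscale (c * w b) v + (\<lambda>a. y (a, b))) = A (fscale (c * w b) v) + A (\<lambda>a. y (a, b))" for b
    using A tensor_slice[OF V step(2)] cfun.subspace_scale[OF V x(2)] unfolding linear_map_def by blast
  moreover have "A (fscale (c * w b) v) = fscale (c * w b) (A v)" for b
    using A x(2) unfolding linear_map_def by blast
  ultimately have "A (\<lambda>a. (fscale c x + y) (a, b)) a = c * w b * A v a + A (\<lambda>a. y (a, b)) a" for b
    unfolding * by (simp add: fscale_def plus_fun_apply)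
  then have "(\<lambda>b. A (\<lambda>a. (fscale c x + y) (a, b)) a) = fscale (c * A v a) w + (\<lambda>b. A (\<lambda>a. y (a, b)) a)"
    by (auto simp: fscale_def fun_eq_iff plus_fun_apply)
  then show ?case using step x W by (simp add: cfun.subspace_add cfun.subspace_scale)
qed

lemma linear_map_tensor_map:
  assumes V: "cfun.subspace V" and W: "cfun.subspace W" and A: "linear_map V V A" and B: "linear_map W W B"
  defines "U \<equiv> cfun.span {tensor v w | v w. v \<in> V \<and> w \<in> W}"
  shows "linear_map U U (tensor_map A B)"
proof -
  have add: "tensor_map A B (t + u) = tensor_map A B t + tensor_map A B u" if "t \<in> U" "u \<in> U" for t u
  proof (rule ext, clarify)
    fix a b
    have t: "t \<in> cfun.span {tensor v w | v w. v \<in> V \<and> w \<in> W}" and u: "u \<in> cfun.span {tensor v w | v w. v \<in> V \<and> w \<in> W}"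
      using that by (auto simp: U_def)
    have "(\<lambda>a. (t + u) (a, b)) = (\<lambda>a. t (a, b)) + (\<lambda>a. u (a, b))" for b by (auto simp: plus_fun_apply)
    then have "A (\<lambda>a. (t + u) (a, b)) = A (\<lambda>a. t (a, b)) + A (\<lambda>a. u (a, b))" for b
      using A tensor_slice[OF V t] tensor_slice[OF V u] by (simp add: linear_map_def)
    then have "(\<lambda>b. A (\<lambda>a. (t + u) (a, b)) a) = (\<lambda>b. A (\<lambda>a. t (a, b)) a) + (\<lambda>b. A (\<lambda>a. u (a, b)) a)"
      by (simp add: fun_eq_iff plus_fun_apply)
    then show "tensor_map A B (t + u) (a, b) = (tensor_map A B t + tensor_map A B u) (a, b)"
      using B tensor_map_slice[OF V W A t] tensor_map_slice[OF V W A u] unfolding tensor_map_def by (simp add: linear_map_def plus_fun_apply)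
  qed
  have sc: "tensor_map A B (fscale c t) = fscale c (tensor_map A B t)" if "t \<in> U" for c t
  proof (rule ext, clarify)
    fix a b
    have t: "t \<in> cfun.span {tensor v w | v w. v \<in> V \<and> w \<in> W}" 
      using that by (auto simp: U_def)
    have "(\<lambda>a. (fscale c t) (a, b)) = fscale c (\<lambda>a. t (a, b))" for b by (auto simp: fscale_def)
    then have "A (\<lambda>a. (fscale c t) (a, b)) = fscale c (A (\<lambda>a. t (a, b)))" for b
      using A tensor_slice[OF V t]  by (simp add: linear_map_def)
    then have "(\<lambda>b. A (\<lambda>a. (fscale c t) (a, b)) a) = fscale c (\<lambda>b. A (\<lambda>a. t (a, b)) a)"
      by (simp add: fun_eq_iff fscale_def)
    then show "tensor_map A B (fscale c t) (a, b) = (fscale c (tensor_map A B t)) (a, b)"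
      using B tensor_map_slice[OF V W A t] unfolding tensor_map_def by (simp add: linear_map_def) (simp add: fscale_def)
  qed
  have "tensor_map A B t \<in> U" if "t \<in> U" for t
    using that[unfolded U_def]
  proof (induction rule: cspan_induct)
    case base 
    have "tensor_map A B (fscale 0 0) = fscale 0 (tensor_map A B 0)" by (rule sc) (simp add: U_def cfun.span_zero)
    then show ?case by (simp add: zf U_def cfun.span_zero)
  next
    case (step c x y)
    then obtain v w where x: "x = tensor v w" "v \<in> V" "w \<in> W" by blast
    have xU: "x \<in> U" using x unfolding U_def by (auto intro!: cfun.span_base)
    have "tensor_map A B x \<in> U" unfolding x(1) tensor_map_tensor[OF A B x(2,3)]
      using A B x unfolding U_def linear_map_def by (intro cfun.span_base) blast
    moreover have "tensor_map A B (fscale c x + y) = fscale c (tensor_map A B x) + tensor_map A B y"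
      using xU step(2) by (subst add) (auto simp: U_def sc[unfolded U_def] intro: cfun.span_scale)
    ultimately show ?case using step unfolding U_def by (simp add: cfun.span_add cfun.span_scale)
  qed
  then show ?thesis using add sc by (auto simp: linear_map_def)
qed

lemma fin_dim_tensor:
  assumes "fin_dim_subspace V" "fin_dim_subspace W"
  shows "fin_dim_subspace (cfun.span {tensor v w | v w. v \<in> V \<and> w \<in> W})"
proof -
  from assms obtain B C where B: "finite B" "V = cfun.span B" and C: "finite C" "W = cfun.span C"
    unfolding fin_dim_subspace_def by blast
  let ?S = "(\<lambda>(v, w). tensor v w) ` (B \<times> C)"
  have 1: "tensor v w \<in> cfun.span ?S" if "v \<in> V" "w \<in> C" for v w
    using that(1)[unfolded B]
  proof (induction rule: cspan_induct)
    case base show ?case by (simp add: zf tensor_lin cfun.span_zero)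
  next
    case (step c x y)
    have "tensor x w \<in> cfun.span ?S" using step that by (intro cfun.span_base) auto
    then show ?case using step by (simp add: tensor_lin cfun.span_add cfun.span_scale)
  qed
  have 2: "tensor v w \<in> cfun.span ?S" if "v \<in> V" "w \<in> W" for v w
    using that(2)[unfolded C]
  proof (induction rule: cspan_induct)
    case base show ?case by (simp add: zf tensor_lin cfun.span_zero)
  next
    case (step c x y)
    then show ?case using 1[OF that(1)] by (simp add: tensor_lin cfun.span_add cfun.span_scale)
  qed
  show ?thesis
    by (rule fin_dim_subspaceI[of ?S, OF _ refl]) (use B C 2 in auto)
qed

lemma linear_map_cong_span:
  assumes "linear_map U U P" "linear_map U U Q" "U = cfun.span S" "\<And>x. x \<in> S \<Longrightarrow> P x = Q x" "t \<in> U"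
  shows "P t = Q t"
  using assms(5)[unfolded assms(3)]
proof (induction rule: cspan_induct)
  case base
  have "P (fscale 0 0) = Q (fscale 0 0)" using assms(1,2,3) cfun.span_zero unfolding linear_map_def
    by (metis cfun.scale_zero_left)
  then show ?case by (simp add: zf)
next
  case (step c x y)
  have "x \<in> U" "y \<in> U" "fscale c x \<in> U" using step assms(3) by (auto intro: cfun.span_base cfun.span_scale)
  then show ?case using assms(1,2,4) step by (simp add: linear_map_def)
qed

lemma representation_tensor_rep:
  assumes G: "group G" and R: "representation G R" and S: "representation G S"
  shows "representation G (tensor_rep R S)"
proof -
  obtain V \<pi> W \<rho> where RS: "R = (V, \<pi>)" "S = (W, \<rho>)" by force
  let ?T = "{tensor v w | v w. v \<in> V \<and> w \<in> W}"
  let ?U = "cfun.span ?T"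
  have fV: "fin_dim_subspace V" and fW: "fin_dim_subspace W" and lV: "\<And>g. g \<in> carrier G \<Longrightarrow> linear_map V V (\<pi> g)"
    and lW: "\<And>g. g \<in> carrier G \<Longrightarrow> linear_map W W (\<rho> g)"
    using R S by (auto simp: representation_def RS)
  note sV = fin_dim_subspaceD[OF fV] and sW = fin_dim_subspaceD[OF fW]
  have lin: "linear_map ?U ?U (tensor_map (\<pi> g) (\<rho> g))" if "g \<in> carrier G" for g
    by (rule linear_map_tensor_map[OF sV sW lV[OF that] lW[OF that]])
  have one: "\<one>\<^bsub>G\<^esub> \<in> carrier G" using G by (simp add: group.is_monoid)
  have 1: "tensor_map (\<pi> \<one>\<^bsub>G\<^esub>) (\<rho> \<one>\<^bsub>G\<^esub>) t = t" if "t \<in> ?U" for t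
    apply (rule linear_map_cong_span[OF lin[OF one] _ refl _ that])
     apply (simp add: linear_map_def)
    using R S lV[OF one] lW[OF one] by (auto simp: tensor_map_tensor[of V _ W] RS representation_def)
  have 2: "tensor_map (\<pi> (g \<otimes>\<^bsub>G\<^esub> h)) (\<rho> (g \<otimes>\<^bsub>G\<^esub> h)) t = tensor_map (\<pi> g) (\<rho> g) (tensor_map (\<pi> h) (\<rho> h) t)"
    if t: "t \<in> ?U" and g: "g \<in> carrier G" and h: "h \<in> carrier G" for t g h
  proof -
    have gh: "g \<otimes>\<^bsub>G\<^esub> h \<in> carrier G" using G g h by (simp add: group.is_monoid monoid.m_closed)
    have "linear_map ?U ?U (\<lambda>t. tensor_map (\<pi> g) (\<rho> g) (tensor_map (\<pi> h) (\<rho> h) t))"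
      using lin[OF g] lin[OF h] unfolding linear_map_def by (auto simp: image_subset_iff)
    then show ?thesis
      apply (rule linear_map_cong_span[OF lin[OF gh] _ refl _ t])
      apply clarify
      apply (subst tensor_map_tensor[OF lV[OF gh] lW[OF gh]], assumption+)
      apply (subst tensor_map_tensor[OF lV[OF h] lW[OF h]], assumption+)
      apply (subst tensor_map_tensor[OF lV[OF g] lW[OF g]])
      using lV[OF h] lW[OF h] R S g h by (auto simp: linear_map_def image_subset_iff representation_def RS)
  qed
  show ?thesis using lin 1 2 fin_dim_tensor[OF fV fW]
    by (simp add: representation_def tensor_rep_def RS)
qed


context
  fixes G :: "('g, 'm) monoid_scheme" (structure) and K C :: "'g set" and R :: "('g, 'a) rep"
  assumes G: "group G" and K: "subgroup K G" and R: "representation (G\<lparr>carrier := K\<rparr>) R"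
    and CG: "C \<subseteq> carrier G" and CK: "\<And>\<sigma> k. \<sigma> \<in> C \<Longrightarrow> k \<in> K \<Longrightarrow> \<sigma> \<otimes> k \<in> C"
begin

interpretation group G by (rule G)
interpretation K: subgroup K G by (rule K)

lemma mem_lcos: "\<sigma> \<in> carrier G \<Longrightarrow> g \<in> \<sigma> <# K \<longleftrightarrow> g \<in> carrier G \<and> inv g \<otimes> \<sigma> \<in> K"
proof safe
  assume s: "\<sigma> \<in> carrier G" and "g \<in> \<sigma> <# K"
  then obtain k where k: "k \<in> K" "g = \<sigma> \<otimes> k" by (auto simp: l_coset_def)
  then have "inv g \<otimes> \<sigma> = inv k" using s by (simp add: inv_mult_group m_assoc)
  then show "inv g \<otimes> \<sigma> \<in> K" "g \<in> carrier G" using k s by auto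
next
  assume s: "\<sigma> \<in> carrier G" "g \<in> carrier G" "inv g \<otimes> \<sigma> \<in> K"
  then have "inv (inv g \<otimes> \<sigma>) \<in> K" by blast
  then have "inv \<sigma> \<otimes> g \<in> K" using s by (simp add: inv_mult_group)
  moreover have "g = \<sigma> \<otimes> (inv \<sigma> \<otimes> g)" using s by (simp add: m_assoc[symmetric])
  ultimately show "g \<in> \<sigma> <# K" unfolding l_coset_def by auto
qed

lemma ind_tensor_eq:
  "\<sigma> \<in> carrier G \<Longrightarrow> ind_tensor G K R \<sigma> w (g, a) =
    (if g \<in> carrier G \<and> inv g \<otimes> \<sigma> \<in> K then snd R (inv g \<otimes> \<sigma>) w a else 0)"
  by (simp add: ind_tensor_def mem_lcos)

lemma R_mult: "g \<in> K \<Longrightarrow> h \<in> K \<Longrightarrow> w \<in> fst R \<Longrightarrow> snd R (g \<otimes> h) w = snd R g (snd R h w)"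
  and R_lin: "g \<in> K \<Longrightarrow> linear_map (fst R) (fst R) (snd R g)"
  and R_fin: "fin_dim_subspace (fst R)"
  using R by (auto simp: representation_def split: prod.splits)

lemma ind_tensor_balanced:
  assumes "\<sigma> \<in> carrier G" "k \<in> K" "w \<in> fst R"
  shows "ind_tensor G K R (\<sigma> \<otimes> k) w = ind_tensor G K R \<sigma> (snd R k w)"
proof (rule ext, clarify)
  fix g a
  have "inv g \<otimes> (\<sigma> \<otimes> k) \<in> K \<longleftrightarrow> inv g \<otimes> \<sigma> \<in> K" if "g \<in> carrier G"
  proof
    assume "inv g \<otimes> (\<sigma> \<otimes> k) \<in> K"
    then have "inv g \<otimes> (\<sigma> \<otimes> k) \<otimes> inv k \<in> K" using assms by blast
    then show "inv g \<otimes> \<sigma> \<in> K" using assms that by (simp add: m_assoc)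
  next
    assume "inv g \<otimes> \<sigma> \<in> K"
    then have "inv g \<otimes> \<sigma> \<otimes> k \<in> K" using assms by blast
    then show "inv g \<otimes> (\<sigma> \<otimes> k) \<in> K" using assms that by (simp add: m_assoc)
  qed
  moreover have "snd R (inv g \<otimes> (\<sigma> \<otimes> k)) w = snd R (inv g \<otimes> \<sigma>) (snd R k w)"
    if "g \<in> carrier G" "inv g \<otimes> \<sigma> \<in> K"
    using R_mult[OF that(2) assms(2,3)] assms that by (simp add: m_assoc)
  ultimately show "ind_tensor G K R (\<sigma> \<otimes> k) w (g, a) = ind_tensor G K R \<sigma> (snd R k w) (g, a)"
    using assms by (auto simp: ind_tensor_eq)
qed

lemma ind_on_action:
  assumes "h \<in> carrier G" "\<sigma> \<in> C"
  shows "snd (ind_on G K C R) h (ind_tensor G K R \<sigma> w) =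
    (if h \<otimes> \<sigma> \<in> C then ind_tensor G K R (h \<otimes> \<sigma>) w else 0)"
proof (rule ext, clarify)
  fix g a
  have s: "\<sigma> \<in> carrier G" using assms CG by blast
  have 1: "inv (inv h \<otimes> g) \<otimes> \<sigma> = inv g \<otimes> (h \<otimes> \<sigma>)" if "g \<in> carrier G"
    using assms s that by (simp add: inv_mult_group m_assoc)
  have 2: "g \<in> C \<longleftrightarrow> h \<otimes> \<sigma> \<in> C" if g: "g \<in> carrier G" and k: "inv g \<otimes> (h \<otimes> \<sigma>) \<in> K"
  proof -
    have a: "h \<otimes> \<sigma> = g \<otimes> (inv g \<otimes> (h \<otimes> \<sigma>))" using g assms s by (simp add: m_assoc[symmetric])
    have "inv (inv g \<otimes> (h \<otimes> \<sigma>)) \<in> K" using k by blast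
    moreover have "g = u \<otimes> inv (inv g \<otimes> u)" if "u \<in> carrier G" for u
      using g that by (simp add: inv_mult_group m_assoc[symmetric])
    then have "g = (h \<otimes> \<sigma>) \<otimes> inv (inv g \<otimes> (h \<otimes> \<sigma>))" using assms s by blast
    ultimately show ?thesis using CK a k by metis
  qed
  show "snd (ind_on G K C R) h (ind_tensor G K R \<sigma> w) (g, a) =
    (if h \<otimes> \<sigma> \<in> C then ind_tensor G K R (h \<otimes> \<sigma>) w else 0) (g, a)"
    using assms s 1 2 CG by (auto simp: ind_on_def ind_tensor_eq zero_fun_apply subset_iff)
qed

lemma ind_on_supp:
  assumes "F \<in> fst (ind_on G K C R)" "g \<notin> C"
  shows "F (g, a) = 0"
  using assms(1) unfolding ind_on_def fst_conv
proof (induction rule: cspan_induct)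
  case base show ?case by (simp add: zero_fun_apply)
next
  case (step c x y)
  then obtain \<sigma> w where x: "x = ind_tensor G K R \<sigma> w" "\<sigma> \<in> C" by blast
  have "x (g, a) = 0"
  proof (rule ccontr)
    assume "x (g, a) \<noteq> 0"
    then have g: "g \<in> \<sigma> <# K" by (auto simp: x ind_tensor_def split: if_splits)
    then show False using x(2) assms(2) CK by (auto simp: l_coset_def)
  qed
  then show ?case using step by (simp add: plus_fun_apply fscale_def)
qed

lemma ind_on_linear:
  assumes h: "h \<in> carrier G"
  shows "linear_map (fst (ind_on G K C R)) (fst (ind_on G K C R)) (snd (ind_on G K C R) h)"
proof -
  let ?U = "fst (ind_on G K C R)" and ?\<pi> = "snd (ind_on G K C R) h"
  have add: "?\<pi> (x + y) = ?\<pi> x + ?\<pi> y" and sc: "?\<pi> (fscale c x) = fscale c (?\<pi> x)" for c x y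
    by (auto simp: ind_on_def fun_eq_iff plus_fun_apply fscale_def)
  have "?\<pi> x \<in> ?U" if "x \<in> ?U" for x
    using that unfolding ind_on_def fst_conv
  proof (induction rule: cspan_induct)
    case base
    have "snd (ind_on G K C R) h 0 = 0" by (auto simp: ind_on_def fun_eq_iff zero_fun_apply)
    then show ?case by (simp add: zf ind_on_def cfun.span_zero)
  next
    case (step c x y)
    then obtain \<sigma> w where x: "x = ind_tensor G K R \<sigma> w" "\<sigma> \<in> C" "w \<in> fst R" by blast
    have "?\<pi> x \<in> ?U" unfolding x(1) ind_on_action[OF h x(2)] 
      using x(3) by (auto simp: ind_on_def intro!: cfun.span_base cfun.span_zero)
    then have "?\<pi> (fscale c x + y) \<in> ?U" unfolding add sc using step
      by (simp add: ind_on_def cfun.span_add cfun.span_scale)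
    then show ?case by (simp add: ind_on_def)
  qed
  then show ?thesis using add sc by (auto simp: linear_map_def)
qed

lemma ind_on_fin_dim:
  assumes "finite C"
  shows "fin_dim_subspace (fst (ind_on G K C R))"
proof -
  from R_fin obtain B where B: "finite B" "fst R = cfun.span B"
    unfolding fin_dim_subspace_def by blast
  let ?B = "(\<lambda>(\<sigma>, w). ind_tensor G K R \<sigma> w) ` (C \<times> B)"
  have 1: "ind_tensor G K R \<sigma> (fscale c x + y) = fscale c (ind_tensor G K R \<sigma> x) + ind_tensor G K R \<sigma> y"
    if "\<sigma> \<in> C" "x \<in> fst R" "y \<in> fst R" for \<sigma> c x y
  proof (rule ext, clarify)
    fix g a
    have "fscale c x \<in> fst R" using that B by (simp add: cfun.span_scale)
    then have "snd R k (fscale c x + y) = fscale c (snd R k x) + snd R k y" if "k \<in> K" for k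
      using R_lin[OF that] \<open>x \<in> fst R\<close> \<open>y \<in> fst R\<close> unfolding linear_map_def by simp
    then show "ind_tensor G K R \<sigma> (fscale c x + y) (g, a) = (fscale c (ind_tensor G K R \<sigma> x) + ind_tensor G K R \<sigma> y) (g, a)"
      using that CG by (auto simp: ind_tensor_eq plus_fun_apply fscale_def)
  qed
  have 0: "ind_tensor G K R \<sigma> 0 = 0" if "\<sigma> \<in> C" for \<sigma>
  proof -
    have "ind_tensor G K R \<sigma> (fscale (-1) 0 + 0) = fscale (-1) (ind_tensor G K R \<sigma> 0) + ind_tensor G K R \<sigma> 0"
      by (rule 1[OF that]) (use B in \<open>auto intro: cfun.span_zero\<close>)
    then show ?thesis by simp
  qed
  have "ind_tensor G K R \<sigma> w \<in> cfun.span ?B" if "\<sigma> \<in> C" "w \<in> fst R" for \<sigma> w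
    using that(2)[unfolded B(2)]
  proof (induction rule: cspan_induct)
    case base show ?case using 0[OF that(1)] by (simp add: zf cfun.span_zero)
  next
    case (step c x y)
    have "ind_tensor G K R \<sigma> x \<in> cfun.span ?B" using step that by (intro cfun.span_base) auto
    moreover have "ind_tensor G K R \<sigma> (fscale c x + y) = fscale c (ind_tensor G K R \<sigma> x) + ind_tensor G K R \<sigma> y"
      using step B(2) by (intro 1[OF that(1)]) (auto intro: cfun.span_base)
    ultimately show ?case using step by (simp add: cfun.span_add cfun.span_scale)
  qed
  then show ?thesis
    by (intro fin_dim_subspaceI[of ?B, OF _ _]) (use assms B in \<open>auto simp: ind_on_def\<close>)
qed

lemma ind_on_partial:
  assumes "finite C"
  shows "partial_representation G (ind_on G K C R)"
proof -
  let ?\<pi> = "snd (ind_on G K C R)"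
  have one: "?\<pi> \<one> F = F" if "F \<in> fst (ind_on G K C R)" for F
    using ind_on_supp[OF that] CG by (auto simp: ind_on_def fun_eq_iff subset_iff)
  have 1: "?\<pi> (inv g) (?\<pi> (g \<otimes> h) F) = ?\<pi> (inv g) (?\<pi> g (?\<pi> h F))" if "g \<in> carrier G" "h \<in> carrier G" for g h F
  proof (rule ext, clarify)
    fix x a
    have "inv (g \<otimes> h) \<otimes> (g \<otimes> x) = inv h \<otimes> x" if "x \<in> carrier G" 
    proof -
      have "inv (g \<otimes> h) \<otimes> (g \<otimes> x) = inv h \<otimes> (inv g \<otimes> g) \<otimes> x"
        using that \<open>g \<in> carrier G\<close> \<open>h \<in> carrier G\<close> by (simp only: inv_mult_group m_assoc inv_closed m_closed)
      then show ?thesis using that \<open>g \<in> carrier G\<close> \<open>h \<in> carrier G\<close> by simp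
    qed
    moreover have "inv g \<otimes> (g \<otimes> x) = x" if "x \<in> carrier G" 
      using that \<open>g \<in> carrier G\<close> by (simp add: m_assoc[symmetric])
    ultimately show "?\<pi> (inv g) (?\<pi> (g \<otimes> h) F) (x, a) = ?\<pi> (inv g) (?\<pi> g (?\<pi> h F)) (x, a)"
      using that CG by (auto simp: ind_on_def)
  qed
  have 2: "?\<pi> (g \<otimes> h) (?\<pi> (inv h) F) = ?\<pi> g (?\<pi> h (?\<pi> (inv h) F))" 
    if "F \<in> fst (ind_on G K C R)" "g \<in> carrier G" "h \<in> carrier G" for g h F
  proof (rule ext, clarify)
    fix x a
    have a: "inv (g \<otimes> h) \<otimes> x = inv h \<otimes> (inv g \<otimes> x)" if "x \<in> carrier G" 
      using that \<open>g \<in> carrier G\<close> \<open>h \<in> carrier G\<close> by (simp add: inv_mult_group m_assoc)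
    have b: "h \<otimes> (inv h \<otimes> (inv g \<otimes> x)) = inv g \<otimes> x" if "x \<in> carrier G" 
      using that \<open>g \<in> carrier G\<close> \<open>h \<in> carrier G\<close> by (simp add: m_assoc[symmetric])
    show "?\<pi> (g \<otimes> h) (?\<pi> (inv h) F) (x, a) = ?\<pi> g (?\<pi> h (?\<pi> (inv h) F)) (x, a)"
      using that CG a b ind_on_supp[OF that(1)] by (auto simp: ind_on_def subset_iff)
  qed
  show ?thesis
    using ind_on_linear ind_on_fin_dim[OF assms] one 1 2
    by (auto simp: partial_representation_def split: prod.splits)
qed

lemma ind_on_global:
  assumes "finite C" "subgroup H G" "\<And>h \<sigma>. h \<in> H \<Longrightarrow> \<sigma> \<in> C \<Longrightarrow> h \<otimes> \<sigma> \<in> C"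
  shows "global_on H G (ind_on G K C R)"
proof -
  interpret H: subgroup H G by fact
  let ?\<pi> = "snd (ind_on G K C R)"
  have P: "partial_representation G (ind_on G K C R)" by (rule ind_on_partial) fact
  have 2: "?\<pi> (g \<otimes> h) F = ?\<pi> g (?\<pi> h F)" if "g \<in> H" "h \<in> H" for g h F
  proof (rule ext, clarify)
    fix x a
    have "inv (g \<otimes> h) \<otimes> x = inv h \<otimes> (inv g \<otimes> x)" if "x \<in> carrier G" 
      using that \<open>g \<in> H\<close> \<open>h \<in> H\<close> by (simp add: inv_mult_group m_assoc)
    moreover have "inv g \<otimes> x \<in> C" if "x \<in> C"
      using that assms(3) \<open>g \<in> H\<close> by blast
    ultimately show "?\<pi> (g \<otimes> h) F (x, a) = ?\<pi> g (?\<pi> h F) (x, a)"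
      using CG by (auto simp: ind_on_def subset_iff)
  qed
  show ?thesis
    using P 2 H.m_closed H.one_closed
    by (auto simp: global_on_def representation_def partial_representation_def Res_def linear_map_def split: prod.splits)
qed

end

lemma linear_map_specht:
  assumes s: "\<sigma> permutes {1..sum_list lam}"
  shows "linear_map (fst (specht lam)) (fst (specht lam)) (snd (specht lam) \<sigma>)"
proof -
  let ?m = "sum_list lam" let ?U = "fst (specht lam)" let ?\<pi> = "snd (specht lam) \<sigma>"
  have add: "?\<pi> (x + y) = ?\<pi> x + ?\<pi> y" and sc: "?\<pi> (fscale c x) = fscale c (?\<pi> x)" for c x y
    by (auto simp: specht_def fun_eq_iff plus_fun_apply fscale_def)
  have poly: "?\<pi> (polytabloid lam t) = polytabloid lam (t \<circ> inv' \<sigma>)" if "t \<in> tableaux lam" for t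
  proof (rule ext)
    fix r
    let ?c = "\<lambda>\<tau>. \<sigma> \<circ> \<tau> \<circ> inv' \<sigma>"
    have bij: "bij_betw ?c (column_stabilizer lam t) (column_stabilizer lam (t \<circ> inv' \<sigma>))"
    proof (rule bij_betw_byWitness[where f' = "\<lambda>\<tau>. inv' \<sigma> \<circ> \<tau> \<circ> \<sigma>"])
      note s' = permutes_inv[OF s]
      have inv: "inv' \<sigma> (\<sigma> i) = i" "\<sigma> (inv' \<sigma> i) = i" for i using permutes_inverses[OF s] by blast+
      show "?c ` column_stabilizer lam t \<subseteq> column_stabilizer lam (t \<circ> inv' \<sigma>)"
      proof (rule image_subsetI)
        fix \<tau> assume "\<tau> \<in> column_stabilizer lam t"
        then have p: "\<tau> permutes {1..?m}" and q: "\<And>i. i \<in> {1..?m} \<Longrightarrow> snd (t (\<tau> i)) = snd (t i)"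
          unfolding column_stabilizer_def by blast+
        have "snd ((t \<circ> inv' \<sigma>) ((\<sigma> \<circ> \<tau> \<circ> inv' \<sigma>) i)) = snd ((t \<circ> inv' \<sigma>) i)" if "i \<in> {1..?m}" for i
          using q[of "inv' \<sigma> i"] that permutes_in_image[OF s', of i] unfolding comp_apply inv by blast
        moreover have "\<sigma> \<circ> \<tau> \<circ> inv' \<sigma> permutes {1..?m}"
          by (intro permutes_compose s s' p)
        ultimately show "\<sigma> \<circ> \<tau> \<circ> inv' \<sigma> \<in> column_stabilizer lam (t \<circ> inv' \<sigma>)"
          unfolding column_stabilizer_def by blast
      qed
      show "(\<lambda>\<tau>. inv' \<sigma> \<circ> \<tau> \<circ> \<sigma>) ` column_stabilizer lam (t \<circ> inv' \<sigma>) \<subseteq> column_stabilizer lam t"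
      proof (rule image_subsetI)
        fix \<tau> assume "\<tau> \<in> column_stabilizer lam (t \<circ> inv' \<sigma>)"
        then have p: "\<tau> permutes {1..?m}" and q: "\<And>i. i \<in> {1..?m} \<Longrightarrow> snd ((t \<circ> inv' \<sigma>) (\<tau> i)) = snd ((t \<circ> inv' \<sigma>) i)"
          unfolding column_stabilizer_def by blast+
        have "snd (t ((inv' \<sigma> \<circ> \<tau> \<circ> \<sigma>) i)) = snd (t i)" if "i \<in> {1..?m}" for i
          using q[of "\<sigma> i"] that permutes_in_image[OF s, of i] unfolding comp_apply inv by blast
        moreover have "inv' \<sigma> \<circ> \<tau> \<circ> \<sigma> permutes {1..?m}"
          by (intro permutes_compose s s' p)
        ultimately show "inv' \<sigma> \<circ> \<tau> \<circ> \<sigma> \<in> column_stabilizer lam t"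
          unfolding column_stabilizer_def by blast
      qed
    qed (auto simp: fun_eq_iff permutes_inverses[OF s])
    have sg: "sign (?c \<tau>) = sign \<tau>" if "\<tau> \<in> column_stabilizer lam t" for \<tau>
    proof -
      have p: "permutation \<sigma>" "permutation \<tau>" "permutation (inv' \<sigma>)"
        using that s permutes_inv[OF s] unfolding column_stabilizer_def permutation_permutes by blast+
      then show ?thesis
        by (simp add: sign_compose permutation_compose sign_inverse)
    qed
    have tb: "r \<circ> \<sigma> = tabloid lam (t \<circ> inv' \<tau>) \<longleftrightarrow> r = tabloid lam (t \<circ> inv' \<sigma> \<circ> inv' (?c \<tau>))"
      if "\<tau> \<in> column_stabilizer lam t" for \<tau>
    proof -
      have t: "\<tau> permutes {1..?m}" using that by (simp add: column_stabilizer_def)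
      have i: "inv' (?c \<tau>) = \<sigma> \<circ> inv' \<tau> \<circ> inv' \<sigma>"
        using s t permutes_inverses[OF s] permutes_inverses[OF t]
        by (intro inv_unique_comp) (auto simp: fun_eq_iff)
      have "tabloid lam (t \<circ> inv' \<sigma> \<circ> inv' (?c \<tau>)) = tabloid lam (t \<circ> inv' \<tau>) \<circ> inv' \<sigma>"
        unfolding i using permutes_in_image[OF permutes_inv[OF s]]
        by (auto simp: tabloid_def fun_eq_iff permutes_inverses[OF s] restrict_def)
      then show ?thesis using permutes_inverses[OF s] by (auto simp: fun_eq_iff) metis
    qed
    show "?\<pi> (polytabloid lam t) r = polytabloid lam (t \<circ> inv' \<sigma>) r"
      unfolding specht_def polytabloid_def snd_conv
      by (subst sum.reindex_bij_betw[OF bij, symmetric]) (intro sum.cong refl, simp only: sg tb)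
  qed
  have tab: "t \<circ> inv' \<sigma> \<in> tableaux lam" if "t \<in> tableaux lam" for t
    using that permutes_imp_bij[OF permutes_inv[OF s]] unfolding tableaux_def
    by (auto intro: bij_betw_trans)
  have "?\<pi> x \<in> ?U" if "x \<in> ?U" for x
    using that unfolding specht_def fst_conv
  proof (induction rule: cspan_induct)
    case base
    show ?case by (simp add: specht_def zero_fun_apply zf cfun.span_zero)
  next
    case (step c x y)
    then obtain t where x: "x = polytabloid lam t" "t \<in> tableaux lam" by blast
    have "?\<pi> x \<in> ?U" unfolding x(1) poly[OF x(2)]
      using tab[OF x(2)] by (auto simp: specht_def intro!: cfun.span_base)
    then have "?\<pi> (fscale c x + y) \<in> ?U" unfolding add sc using step
      by (simp add: specht_def comp_def cfun.span_add cfun.span_scale)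
    then show ?case by (simp add: specht_def comp_def)
  qed
  then show ?thesis using add sc by (auto simp: linear_map_def)
qed

lemma fin_dim_specht: "fin_dim_subspace (fst (specht lam))"
proof -
  let ?m = "sum_list lam"
  have "finite (diagram lam)"
    by (rule finite_subset[of _ "SIGMA i:{..<length lam}. {..<lam ! i}"]) (auto simp: diagram_def)
  then have "finite ({1..?m} \<rightarrow>\<^sub>E diagram lam)" by (intro finite_PiE) auto
  moreover have "polytabloid lam ` tableaux lam \<subseteq> polytabloid lam ` ({1..?m} \<rightarrow>\<^sub>E diagram lam)"
  proof clarify
    fix t assume t: "t \<in> tableaux lam"
    have e: "\<sigma> permutes {1..?m} \<Longrightarrow> i \<in> {1..?m} \<Longrightarrow> \<sigma> i \<in> {1..?m}" for \<sigma> i by (simp only: permutes_in_image)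
    have "column_stabilizer lam (restrict t {1..?m}) = column_stabilizer lam t"
      using e unfolding column_stabilizer_def by (auto simp del: atLeastAtMost_iff)
    moreover have "tabloid lam (restrict t {1..?m} \<circ> inv' \<sigma>) = tabloid lam (t \<circ> inv' \<sigma>)" if "\<sigma> permutes {1..?m}" for \<sigma>
      using e[OF permutes_inv[OF that]] by (auto simp: tabloid_def fun_eq_iff restrict_def)
    ultimately have "polytabloid lam (restrict t {1..?m}) = polytabloid lam t"
      unfolding polytabloid_def by (intro ext) (auto intro!: sum.cong simp: column_stabilizer_def)
    moreover have "restrict t {1..?m} \<in> {1..?m} \<rightarrow>\<^sub>E diagram lam"
      using t by (auto simp: tableaux_def bij_betw_def)
    ultimately show "polytabloid lam t \<in> polytabloid lam ` ({1..?m} \<rightarrow>\<^sub>E diagram lam)" by (metis image_eqI)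
  qed
  ultimately have "finite (polytabloid lam ` tableaux lam)" using finite_subset by blast
  then show ?thesis unfolding fin_dim_subspace_def specht_def by auto
qed

lemma representation_specht: "representation (sym_group (sum_list lam)) (specht lam)"
  using fin_dim_specht[of lam] linear_map_specht[of _ lam]
  by (auto simp: representation_def specht_def sym_group_carrier sym_group_one sym_group_mult o_assoc)

lemma block_perm_hom:
  assumes "\<sigma> permutes {1..n}" "\<sigma> ` {a+1..a+m} = {a+1..a+m}"
  shows "block_perm a m \<sigma> permutes {1..m}"
    and "block_perm a m (\<tau> \<circ> \<sigma>) = block_perm a m \<tau> \<circ> block_perm a m \<sigma>"
proof -
  have in_b: "a + 1 \<le> \<sigma> (i + a) \<and> \<sigma> (i + a) \<le> a + m" if "i \<in> {1..m}" for i
  proof -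
    have "i + a \<in> {a+1..a+m}" using that by simp
    then have "\<sigma> (i + a) \<in> \<sigma> ` {a+1..a+m}" by (rule imageI)
    then show ?thesis unfolding assms(2) by simp
  qed
  have "inj_on (block_perm a m \<sigma>) {1..m}"
  proof (rule inj_onI)
    fix i j assume ij: "i \<in> {1..m}" "j \<in> {1..m}" and eq: "block_perm a m \<sigma> i = block_perm a m \<sigma> j"
    have "\<sigma> (i + a) - a = \<sigma> (j + a) - a" using eq ij unfolding block_perm_def by (simp only: if_True)
    then have "\<sigma> (i + a) = \<sigma> (j + a)" using in_b[OF ij(1)] in_b[OF ij(2)] by linarith
    then have "i + a = j + a" by (rule injD[OF permutes_inj[OF assms(1)]])
    then show "i = j" by simp
  qed
  moreover have "block_perm a m \<sigma> ` {1..m} \<subseteq> {1..m}"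
  proof (rule image_subsetI)
    fix i assume i: "i \<in> {1..m}"
    then show "block_perm a m \<sigma> i \<in> {1..m}" using in_b[OF i] unfolding block_perm_def by (simp only: if_True) auto
  qed
  ultimately have "bij_betw (block_perm a m \<sigma>) {1..m} {1..m}"
    using endo_inj_surj[OF finite_atLeastAtMost] unfolding bij_betw_def by blast
  then show "block_perm a m \<sigma> permutes {1..m}"
    by (rule bij_imp_permutes) (simp only: block_perm_def if_False)
  show "block_perm a m (\<tau> \<circ> \<sigma>) = block_perm a m \<tau> \<circ> block_perm a m \<sigma>"
  proof
    fix i
    show "block_perm a m (\<tau> \<circ> \<sigma>) i = (block_perm a m \<tau> \<circ> block_perm a m \<sigma>) i"
    proof (cases "i \<in> {1..m}")
      case True
      then have "\<sigma> (i + a) - a \<in> {1..m}" "\<sigma> (i + a) - a + a = \<sigma> (i + a)" using in_b[OF True] by auto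
      with True show ?thesis unfolding block_perm_def by (simp only: comp_apply if_True)
    next
      case False
      then show ?thesis unfolding block_perm_def by (simp only: comp_apply if_False)
    qed
  qed
qed

lemma representation_specht_at:
  assumes "\<And>\<sigma>. \<sigma> \<in> H \<Longrightarrow> \<sigma> permutes {1..n} \<and> \<sigma> ` {a+1..a+sum_list lam} = {a+1..a+sum_list lam}"
  shows "representation ((sym_group n)\<lparr>carrier := H\<rparr>) (specht_at a lam)"
proof -
  have id: "block_perm a m id = id" for m by (auto simp: block_perm_def)
  have lin: "linear_map (fst (specht lam)) (fst (specht lam)) (snd (specht lam) (block_perm a (sum_list lam) \<sigma>))"
    if "\<sigma> \<in> H" for \<sigma>
    using assms[OF that] by (intro linear_map_specht block_perm_hom(1)[of _ n]) auto
  have mult: "block_perm a (sum_list lam) (\<sigma> \<circ> \<tau>) =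
      block_perm a (sum_list lam) \<sigma> \<circ> block_perm a (sum_list lam) \<tau>" if "\<tau> \<in> H" for \<sigma> \<tau>
    using assms[OF that] by (intro block_perm_hom(2)[of _ n]) auto
  have "snd (specht lam) id v = v" "snd (specht lam) (\<sigma> \<circ> \<tau>) v = snd (specht lam) \<sigma> (snd (specht lam) \<tau> v)"
    for \<sigma> \<tau> v
    by (simp_all add: specht_def o_assoc)
  then show ?thesis
    using fin_dim_specht[of lam]
    by (simp add: representation_def specht_at_def sym_group_one sym_group_mult id lin mult)
qed

lemma subgroup_sym_groupI:
  assumes "H \<subseteq> {\<sigma>. \<sigma> permutes {1..n}}" "id \<in> H" "\<And>\<sigma>. \<sigma> \<in> H \<Longrightarrow> inv' \<sigma> \<in> H"
    "\<And>\<sigma> \<tau>. \<sigma> \<in> H \<Longrightarrow> \<tau> \<in> H \<Longrightarrow> \<sigma> \<circ> \<tau> \<in> H"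
  shows "subgroup H (sym_group n)"
proof (rule group.subgroupI[OF sym_group_is_group])
  show "H \<subseteq> carrier (sym_group n)" using assms(1) by (auto simp: sym_group_carrier)
  show "H \<noteq> {}" using assms(2) by blast
  show "inv\<^bsub>sym_group n\<^esub> \<sigma> \<in> H" if "\<sigma> \<in> H" for \<sigma>
  proof -
    have "\<sigma> \<in> carrier (sym_group n)" using assms(1) that by (auto simp: sym_group_carrier)
    then show ?thesis using assms(3)[OF that] by simp
  qed
  show "\<sigma> \<otimes>\<^bsub>sym_group n\<^esub> \<tau> \<in> H" if "\<sigma> \<in> H" "\<tau> \<in> H" for \<sigma> \<tau>
    using assms(4)[OF that] by (simp add: sym_group_mult)
qed

lemma subgroup_fix1: "subgroup (fix1 n) (sym_group n)"
proof (rule subgroup_sym_groupI)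
  show "inv' \<sigma> \<in> fix1 n" if "\<sigma> \<in> fix1 n" for \<sigma>
  proof -
    have "\<sigma> permutes {1..n}" "\<sigma> 1 = 1" using that unfolding fix1_def by blast+
    moreover have "inv' \<sigma> (\<sigma> 1) = 1" by (rule permutes_inverses(2)) fact
    ultimately show ?thesis using permutes_inv[of \<sigma> "{1..n}"] unfolding fix1_def by simp
  qed
qed (auto simp: fix1_def permutes_id intro: permutes_compose simp del: One_nat_def)

lemma subgroup_block_stabilizer: "subgroup (block_stabilizer n k) (sym_group n)"
proof (rule subgroup_sym_groupI)
  show "inv' \<sigma> \<in> block_stabilizer n k" if "\<sigma> \<in> block_stabilizer n k" for \<sigma>
  proof -
    have s: "\<sigma> permutes {1..n}" "\<sigma> ` {1..k} = {1..k}" using that by (auto simp: block_stabilizer_def)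
    have "inv' \<sigma> ` (\<sigma> ` {1..k}) = {1..k}"
      by (simp add: image_comp permutes_inv_o(2)[OF s(1)])
    then show ?thesis using permutes_inv[OF s(1)] s(2) unfolding block_stabilizer_def by simp
  qed
  show "\<sigma> \<circ> \<tau> \<in> block_stabilizer n k" if "\<sigma> \<in> block_stabilizer n k" "\<tau> \<in> block_stabilizer n k" for \<sigma> \<tau>
  proof -
    have "(\<sigma> \<circ> \<tau>) ` {1..k} = {1..k}"
      using that by (simp only: block_stabilizer_def mem_Collect_eq image_comp[symmetric])
    moreover have "\<sigma> \<circ> \<tau> permutes {1..n}"
      using that unfolding block_stabilizer_def by (intro permutes_compose) blast+
    ultimately show ?thesis unfolding block_stabilizer_def by blast
  qed
qed (auto simp: block_stabilizer_def permutes_id)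

lemma V_pair_global: "global_on (fix1 (sum_list lam + sum_list mu))
  (sym_group (sum_list lam + sum_list mu)) (V_pair lam mu)"
proof -
  let ?k = "sum_list lam"
  define n where "n = sum_list lam + sum_list mu"
  let ?K = "block_stabilizer n ?k" and ?C = "{\<sigma>. \<sigma> permutes {1..n} \<and> 1 \<in> \<sigma> ` {1..?k}}"
  have b: "\<sigma> permutes {1..n} \<and> \<sigma> ` {0+1..0+?k} = {0+1..0+?k}"
    "\<sigma> permutes {1..n} \<and> \<sigma> ` {?k+1..?k+sum_list mu} = {?k+1..?k+sum_list mu}" if "\<sigma> \<in> ?K" for \<sigma>
  proof -
    have s: "\<sigma> permutes {1..n}" "\<sigma> ` {1..?k} = {1..?k}" using that by (auto simp: block_stabilizer_def)
    then show "\<sigma> permutes {1..n} \<and> \<sigma> ` {0+1..0+?k} = {0+1..0+?k}" by simp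
    have e: "{?k+1..?k+sum_list mu} = {1..n} - {1..?k}" by (auto simp: n_def)
    have "\<sigma> ` ({1..n} - {1..?k}) = {1..n} - {1..?k}"
      using image_set_diff[OF permutes_inj[OF s(1)]] permutes_image[OF s(1)] s(2) by simp
    then show "\<sigma> permutes {1..n} \<and> \<sigma> ` {?k+1..?k+sum_list mu} = {?k+1..?k+sum_list mu}"
      using s(1) unfolding e by blast
  qed
  have R: "representation ((sym_group n)\<lparr>carrier := ?K\<rparr>) (specht_tensor 0 lam mu)"
    unfolding specht_tensor_def add_0
    by (intro representation_tensor_rep representation_specht_at subgroup.subgroup_is_group
        subgroup_block_stabilizer sym_group_is_group b)
  have "global_on (fix1 n) (sym_group n) (ind_on (sym_group n) ?K ?C (specht_tensor 0 lam mu))"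
  proof (rule ind_on_global[OF sym_group_is_group subgroup_block_stabilizer R _ _ _ subgroup_fix1])
    show "?C \<subseteq> carrier (sym_group n)" by (auto simp: sym_group_carrier)
    show "finite ?C" using finite_permutations[of "{1..n}"] by simp
    show "\<sigma> \<otimes>\<^bsub>sym_group n\<^esub> \<tau> \<in> ?C" if "\<sigma> \<in> ?C" "\<tau> \<in> ?K" for \<sigma> \<tau>
    proof -
      have "(\<sigma> \<circ> \<tau>) ` {1..?k} = \<sigma> ` {1..?k}"
        using that(2) by (simp only: block_stabilizer_def mem_Collect_eq image_comp[symmetric])
      moreover have "\<sigma> \<circ> \<tau> permutes {1..n}"
        using that unfolding block_stabilizer_def by (intro permutes_compose) blast+
      ultimately show ?thesis using that(1) unfolding sym_group_mult by blast
    qed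
    show "\<sigma> \<otimes>\<^bsub>sym_group n\<^esub> \<tau> \<in> ?C" if "\<sigma> \<in> fix1 n" "\<tau> \<in> ?C" for \<sigma> \<tau>
    proof -
      from that obtain j where "j \<in> {1..?k}" "\<tau> j = 1" "\<sigma> 1 = 1" "\<sigma> permutes {1..n}" "\<tau> permutes {1..n}"
        by (auto simp: fix1_def simp del: One_nat_def)
      then have "(\<sigma> \<circ> \<tau>) j = 1" "\<sigma> \<circ> \<tau> permutes {1..n}" by (auto intro: permutes_compose simp del: One_nat_def)
      then have "1 \<in> (\<sigma> \<circ> \<tau>) ` {1..?k}" using \<open>j \<in> {1..?k}\<close> by (metis imageI)
      with \<open>\<sigma> \<circ> \<tau> permutes {1..n}\<close> show ?thesis by (simp add: sym_group_mult)
    qed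
  qed
  then show ?thesis by (simp add: V_pair_def Let_def n_def)
qed

end

end

theory Submission
  imports Defs
begin

text \<open>A representation of \<open>S\<^sub>m\<close> is determined by the dimensions of its invariants under the Young
  subgroups, i.e. under the stabilizers of words \<open>c\<close> of length \<open>m\<close>. Indeed, a nonzero representation
  contains a Specht module which can be read off from these dimensions: choose \<open>c\<close> with nonzero invariants such that
  the letters are as concentrated as possible; then the Specht module for the sorted multiplicities of the
  letters of \<open>c\<close> embeds. By Maschke's theorem one can split it off and argue by induction.

  For a Specht module these dimensions are Kostka numbers, the coefficients of the
  Schur polynomial. For an induced representation they are convolutions, by a double coset computation, so that
  induction corresponds to multiplication of Schur polynomials. Restriction from \<open>S\<^sub>k\<close> to \<open>S\<^bsub>k-1\<^esub>\<close>
  corresponds to words with one new largest letter, which in a semistandard tableau occupies a corner. Hence all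
  three representations of the theorem have the same dimensions of invariants.\<close>

section \<open>Interpolation and dimension in spaces of functions\<close>

text \<open>Since all spaces consist of functions, a finite-dimensional space has a finite set of
  points such that restriction to it is an isomorphism onto all functions on that set; dimensions
  are counts of points. For the invariants in a Specht module the points are tabloids indexed by
  semistandard tableaux, and two bounds meet there. Averaged polytabloids realise all values, being
  triangular for a weight on tabloids. Conversely, the Garnir relations, linear equations satisfied
  by polytabloids, leave no nonzero invariant vanishing at all points. Hence the Specht module is
  exactly the solution space of these relations, which is what makes embeddings possible: a
  homomorphism from the tabloid module that kills both the Garnir sets and the Specht module is
  zero. Concentration is measured by \<open>block_stat\<close>, chosen so that merging the letters
  of a Garnir set increases it. The Littlewood-Richardson coefficients are given by a definite
  description: existence comes from multiplicities in an induced representation, uniqueness from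
  triangularity of Kostka numbers for the sum of row indices.\<close>

declare plus_fun_apply [simp del] zero_fun_apply [simp del] minus_apply [simp del] uminus_apply [simp del]

text \<open>Restriction to \<open>X\<close> is a linear isomorphism from \<open>V\<close> onto the
  functions on \<open>X\<close>. This replaces bases throughout: a dimension is found by exhibiting
  points, and two vectors are compared at finitely many of them.\<close>

definition interpolating :: "('a \<Rightarrow> complex) set \<Rightarrow> 'a set \<Rightarrow> bool"
  where "interpolating V X \<longleftrightarrow> cfun.subspace V \<and> finite X
    \<and> (\<forall>v\<in>V. (\<forall>x\<in>X. v x = 0) \<longrightarrow> v = 0) \<and> (\<forall>\<phi>. \<exists>v\<in>V. \<forall>x\<in>X. v x = \<phi> x)"

lemma fscale_apply: "fscale c v x = c * v x"
  by (simp add: fscale_def)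

lemma interpolatingD:
  assumes "interpolating V X"
  shows "cfun.subspace V" "finite X" "v \<in> V \<Longrightarrow> (\<And>x. x \<in> X \<Longrightarrow> v x = 0) \<Longrightarrow> v = 0"
    "\<exists>v\<in>V. \<forall>x\<in>X. v x = \<phi> x"
  using assms by (simp_all add: interpolating_def)

lemmas pointwise = fscale_apply plus_fun_apply zero_fun_apply minus_apply uminus_apply

lemma sum_fun_apply: "(\<Sum>i\<in>I. f i) x = (\<Sum>i\<in>I. f i x)"
  for f :: "'i \<Rightarrow> 'a \<Rightarrow> 'b::comm_monoid_add"
  by (induction I rule: infinite_finite_induct) (auto simp: pointwise)

lemma interpolating_eq:
  assumes "interpolating V X" "u \<in> V" "v \<in> V" "\<And>x. x \<in> X \<Longrightarrow> u x = v x"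
  shows "u = v"
proof -
  have "u - v \<in> V" "\<forall>x\<in>X. (u - v) x = 0"
    using assms by (auto simp: interpolating_def cfun.subspace_diff minus_apply)
  then have "u - v = 0" using assms(1) unfolding interpolating_def by blast
  then show ?thesis by simp
qed

lemma linear_map_zero: "linear_map V W T \<Longrightarrow> cfun.subspace V \<Longrightarrow> T 0 = 0"
proof -
  assume T: "linear_map V W T" and V: "cfun.subspace V"
  have "T (fscale 0 0) = fscale 0 (T 0)" using T cfun.subspace_0[OF V] unfolding linear_map_def by blast
  then show ?thesis by simp
qed

lemma linear_map_add: "linear_map V W T \<Longrightarrow> u \<in> V \<Longrightarrow> v \<in> V \<Longrightarrow> T (u + v) = T u + T v"
  and linear_map_scale: "linear_map V W T \<Longrightarrow> v \<in> V \<Longrightarrow> T (fscale c v) = fscale c (T v)"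
  and linear_map_in: "linear_map V W T \<Longrightarrow> v \<in> V \<Longrightarrow> T v \<in> W"
  by (auto simp: linear_map_def)

lemma linear_map_uminus:
  "linear_map V W T \<Longrightarrow> v \<in> V \<Longrightarrow> T (- v) = - T v"
  using linear_map_scale[of V W T v "-1"] by simp

lemma linear_map_diff:
  assumes "linear_map V W T" "cfun.subspace V" "u \<in> V" "v \<in> V"
  shows "T (u - v) = T u - T v"
  using linear_map_add[OF assms(1), of u "- v"] linear_map_uminus[OF assms(1,4)] assms
  by (simp add: cfun.subspace_neg)

lemma linear_map_sum:
  assumes T: "linear_map V W T" and V: "cfun.subspace V" and "\<And>i. i \<in> I \<Longrightarrow> v i \<in> V"
  shows "T (\<Sum>i\<in>I. v i) = (\<Sum>i\<in>I. T (v i))"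
  using assms(3)
proof (induction I rule: infinite_finite_induct)
  case (insert i I)
  then show ?case using linear_map_add[OF T, of "v i" "\<Sum>i\<in>I. v i"] by (simp add: cfun.subspace_sum[OF V])
qed (auto simp: linear_map_zero[OF T V])

section \<open>Dimension as the number of interpolation points\<close>

lemma dim_eq_card_family:
  assumes W: "cfun.subspace W" and X: "finite X" and b: "\<And>x. x \<in> X \<Longrightarrow> b x \<in> W"
    and span: "\<And>w. w \<in> W \<Longrightarrow> \<exists>a. w = (\<Sum>x\<in>X. fscale (a x) (b x))"
    and ind: "\<And>a. (\<Sum>x\<in>X. fscale (a x) (b x)) = 0 \<Longrightarrow> \<forall>x\<in>X. a x = 0"
  shows "cfun.dim W = card X"
proof -
  have inj: "inj_on b X"
  proof (rule inj_onI, rule ccontr)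
    fix x y assume xy: "x \<in> X" "y \<in> X" "b x = b y" "x \<noteq> y"
    define a where "a = (\<lambda>z. if z = x then 1 else if z = y then -1 else (0::complex))"
    have "(\<Sum>z\<in>X. fscale (a z) (b z)) = (\<Sum>z\<in>{x, y}. fscale (a z) (b z))"
      by (rule sum.mono_neutral_right) (use xy X in \<open>auto simp: a_def\<close>)
    also have "\<dots> = 0" using xy by (simp add: a_def)
    finally show False using ind[of a] xy by (auto simp: a_def)
  qed
  have indep: "cfun.independent (b ` X)"
  proof
    assume "cfun.dependent (b ` X)"
    then obtain u where u: "\<exists>v\<in>b ` X. u v \<noteq> 0" "(\<Sum>v\<in>b ` X. fscale (u v) v) = 0"
      using cfun.dependent_finite[of "b ` X"] X by auto
    then show False using ind[of "u \<circ> b"] by (auto simp: sum.reindex[OF inj])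
  qed
  have "W \<subseteq> cfun.span (b ` X)"
  proof
    fix w assume "w \<in> W"
    then obtain a where "w = (\<Sum>x\<in>X. fscale (a x) (b x))" using span by blast
    then show "w \<in> cfun.span (b ` X)"
      by (simp add: cfun.span_sum cfun.span_scale cfun.span_base)
  qed
  then show ?thesis
    using cfun.dim_unique[of "b ` X" W "card X"] b indep card_image[OF inj] by auto
qed

text \<open>The Lagrange basis: \<open>b x\<close> is 1 at \<open>x\<close> and 0 at the other
  points of \<open>X\<close>.\<close>

lemma interpolating_dual_basis:
  assumes "interpolating V X"
  obtains b where "\<And>x. x \<in> X \<Longrightarrow> b x \<in> V" and "\<And>v. v \<in> V \<Longrightarrow> v = (\<Sum>x\<in>X. fscale (v x) (b x))"
    and "\<And>a y. y \<in> X \<Longrightarrow> (\<Sum>x\<in>X. fscale (a x) (b x)) y = a y"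
proof -
  have V: "cfun.subspace V" and X: "finite X" using assms by (auto simp: interpolating_def)
  have "\<exists>v\<in>V. \<forall>y\<in>X. v y = (if y = x then 1 else 0)" for x
    by (rule interpolatingD(4)[OF assms])
  then obtain b where b: "\<And>x. b x \<in> V" "\<And>x y. y \<in> X \<Longrightarrow> b x y = (if y = x then 1 else 0)"
    by metis
  have *: "(\<Sum>x\<in>X. fscale (a x) (b x)) y = a y" if "y \<in> X" for a y
    using that X by (simp add: sum_fun_apply pointwise b(2) if_distrib cong: if_cong)
  have "v = (\<Sum>x\<in>X. fscale (v x) (b x))" if "v \<in> V" for v
    by (rule interpolating_eq[OF assms that])
      (use b V * in \<open>auto intro!: cfun.subspace_sum cfun.subspace_scale\<close>)
  then show thesis using that b(1) * by blast
qed

text \<open>The images of the Lagrange basis form a basis. Allowing an image in another function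
  space yields both the dimension of \<open>V\<close> itself and the invariance of dimension under
  isomorphisms.\<close>

lemma dim_eq_card_interpolating_image:
  assumes V: "interpolating V X" and T: "linear_map V W T" and bij: "bij_betw T V W" and W: "cfun.subspace W"
  shows "cfun.dim W = card X"
proof -
  have sV: "cfun.subspace V" and X: "finite X" using V by (auto simp: interpolating_def)
  obtain b where b: "\<And>x. x \<in> X \<Longrightarrow> b x \<in> V" "\<And>v. v \<in> V \<Longrightarrow> v = (\<Sum>x\<in>X. fscale (v x) (b x))"
    "\<And>a y. y \<in> X \<Longrightarrow> (\<Sum>x\<in>X. fscale (a x) (b x)) y = a y"
    by (rule interpolating_dual_basis[OF V]) (rule that)
  have T_sum: "T (\<Sum>x\<in>X. fscale (a x) (b x)) = (\<Sum>x\<in>X. fscale (a x) (T (b x)))" for a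
    using linear_map_sum[OF T sV, of X "\<lambda>x. fscale (a x) (b x)"] b(1)
    by (simp add: cfun.subspace_scale[OF sV] linear_map_scale[OF T])
  show ?thesis
  proof (rule dim_eq_card_family[OF W X, where b = "T \<circ> b"])
    fix w assume "w \<in> W"
    then obtain v where v: "v \<in> V" "w = T v" using bij by (auto simp: bij_betw_def)
    show "\<exists>a. w = (\<Sum>x\<in>X. fscale (a x) ((T \<circ> b) x))"
      using arg_cong[OF b(2)[OF v(1)], of T] v(2) T_sum[of v] by (intro exI[of _ v]) (simp only: comp_apply)
  next
    fix a assume "(\<Sum>x\<in>X. fscale (a x) ((T \<circ> b) x)) = 0"
    then have "T (\<Sum>x\<in>X. fscale (a x) (b x)) = T 0"
      by (simp add: T_sum linear_map_zero[OF T sV])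
    moreover have "(\<Sum>x\<in>X. fscale (a x) (b x)) \<in> V"
      using b(1) by (auto intro!: cfun.subspace_sum[OF sV] cfun.subspace_scale[OF sV])
    ultimately have "(\<Sum>x\<in>X. fscale (a x) (b x)) = 0"
      using bij cfun.subspace_0[OF sV] by (metis bij_betw_def inj_onD)
    then show "\<forall>x\<in>X. a x = 0" using b(3)[of _ a] by (simp add: zero_fun_apply)
  qed (use b(1) T in \<open>auto simp: linear_map_def\<close>)
qed

lemma interpolating_dim: "interpolating V X \<Longrightarrow> cfun.dim V = card X"
  by (rule dim_eq_card_interpolating_image[where T = "\<lambda>v. v"])
    (auto simp: interpolating_def linear_map_def bij_betw_def)

lemma interpolating_fin_dim:
  assumes V: "interpolating V X"
  shows "fin_dim_subspace V"
proof -
  have sV: "cfun.subspace V" and X: "finite X" using V by (auto simp: interpolating_def)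
  obtain b where b: "\<And>x. x \<in> X \<Longrightarrow> b x \<in> V" "\<And>v. v \<in> V \<Longrightarrow> v = (\<Sum>x\<in>X. fscale (v x) (b x))"
    by (rule interpolating_dual_basis[OF V]) (rule that)
  have "V = cfun.span (b ` X)"
  proof
    show "V \<subseteq> cfun.span (b ` X)"
    proof
      fix v assume "v \<in> V"
      have "(\<Sum>x\<in>X. fscale (v x) (b x)) \<in> cfun.span (b ` X)"
        by (intro cfun.span_sum cfun.span_scale cfun.span_base) auto
      then show "v \<in> cfun.span (b ` X)" using b(2)[OF \<open>v \<in> V\<close>] by simp
    qed
    show "cfun.span (b ` X) \<subseteq> V" using b(1) by (intro cfun.span_minimal sV) auto
  qed
  then show ?thesis using X unfolding fin_dim_subspace_def by blast
qed

text \<open>The spanning set is built up vector by vector. A new vector outside the span, minus its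
  interpolant on the old points, is nonzero somewhere, and such a place is the new point.\<close>

lemma fin_dim_interpolating:
  assumes "fin_dim_subspace V"
  obtains X where "interpolating V X"
proof -
  obtain B where B: "finite B" "V = cfun.span B" using assms by (auto simp: fin_dim_subspace_def)
  have "\<exists>X. interpolating (cfun.span B) X"
    using B(1)
  proof (induction B)
    case empty
    show ?case by (auto simp: interpolating_def intro!: exI[of _ "{}"] bexI[of _ 0])
  next
    case (insert b B)
    then obtain X where X: "interpolating (cfun.span B) X" by blast
    show ?case
    proof (cases "b \<in> cfun.span B")
      case True
      then show ?thesis using X by (metis cfun.span_redundant)
    next
      case False
      obtain u0 where u0: "u0 \<in> cfun.span B" "\<forall>x\<in>X. u0 x = b x"
        using interpolatingD(4)[OF X, of b] by blast
      define u where "u = b - u0"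
      have "u \<noteq> 0" using False u0 by (auto simp: u_def)
      then obtain z where z: "u z \<noteq> 0" by (auto simp: fun_eq_iff zero_fun_apply)
      have uX: "u x = 0" if "x \<in> X" for x using u0 that by (simp add: u_def minus_apply)
      have uI: "u \<in> cfun.span (insert b B)"
        unfolding u_def using u0(1) cfun.span_mono[of B "insert b B"]
        by (intro cfun.span_diff) (auto simp: cfun.span_base)
      have sB: "cfun.span B \<subseteq> cfun.span (insert b B)" by (intro cfun.span_mono) auto
      have "interpolating (cfun.span (insert b B)) (insert z X)"
        unfolding interpolating_def
      proof (intro conjI ballI impI allI)
        fix v assume v: "v \<in> cfun.span (insert b B)" "\<forall>x\<in>insert z X. v x = 0"
        from v(1) obtain k where k: "v - fscale k b \<in> cfun.span B" by (auto simp: cfun.span_insert)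
        have "v - fscale k u = (v - fscale k b) + fscale k u0"
          by (simp add: u_def fun_eq_iff pointwise algebra_simps)
        also have "\<dots> \<in> cfun.span B" using k u0(1) by (intro cfun.span_add cfun.span_scale)
        finally have "v - fscale k u \<in> cfun.span B" .
        moreover have "\<forall>x\<in>X. (v - fscale k u) x = 0" using v(2) uX by (auto simp: pointwise)
        ultimately have "v - fscale k u = 0" using X unfolding interpolating_def by blast
        then have e: "v = fscale k u" by simp
        have "v z = 0" using v(2) by simp
        with e z have "k = 0" by (simp add: pointwise)
        with e show "v = 0" by simp
      next
        fix \<phi> :: "_ \<Rightarrow> complex"
        obtain v where v: "v \<in> cfun.span B" "\<forall>x\<in>X. v x = \<phi> x"
          using interpolatingD(4)[OF X, of \<phi>] by blast
        \<comment> \<open>\<open>u\<close> vanishes on the old points, so it corrects the value at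
          \<open>z\<close> alone.\<close>
        have "v + fscale ((\<phi> z - v z) / u z) u \<in> cfun.span (insert b B)"
          using v(1) uI sB by (intro cfun.span_add cfun.span_scale) auto
        moreover have "\<forall>x\<in>insert z X. (v + fscale ((\<phi> z - v z) / u z) u) x = \<phi> x"
          using v(2) uX z by (auto simp: pointwise)
        ultimately show "\<exists>v\<in>cfun.span (insert b B). \<forall>x\<in>insert z X. v x = \<phi> x" by blast
      qed (use X in \<open>auto simp: interpolating_def\<close>)
      then show ?thesis by blast
    qed
  qed
  then show thesis using that B by auto
qed

lemma span_subspace: "cfun.subspace U \<Longrightarrow> cfun.span U = U"
  by (rule subset_antisym[OF cfun.span_minimal cfun.span_superset]) auto

lemma subspace_fin_dim:
  assumes "cfun.subspace U" "U \<subseteq> V" "fin_dim_subspace V"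
  shows "fin_dim_subspace U"
proof -
  obtain B where B: "finite B" "V = cfun.span B" using assms by (auto simp: fin_dim_subspace_def)
  show ?thesis
    by (rule fin_dim_subspaceI[OF B(1), of U U]) (use assms B in \<open>auto simp: span_subspace\<close>)
qed

lemma linear_map_image_subspace:
  assumes T: "linear_map V W T" and V: "cfun.subspace V"
  shows "cfun.subspace (T ` V)"
  unfolding cfun.subspace_def
proof (intro conjI ballI allI)
  show "0 \<in> T ` V" using linear_map_zero[OF T V] cfun.subspace_0[OF V] by force
  fix x y assume "x \<in> T ` V" "y \<in> T ` V"
  then obtain u v where "u \<in> V" "v \<in> V" "x = T u" "y = T v" by blast
  then show "x + y \<in> T ` V" using linear_map_add[OF T] cfun.subspace_add[OF V] by (metis imageI)
next
  fix c x assume "x \<in> T ` V"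
  then obtain u where "u \<in> V" "x = T u" by blast
  then show "fscale c x \<in> T ` V" using linear_map_scale[OF T] cfun.subspace_scale[OF V] by (metis imageI)
qed

lemma linear_bij_dim:
  assumes T: "linear_map V W T" and bij: "bij_betw T V W" and V: "fin_dim_subspace V"
  shows "cfun.dim W = cfun.dim V"
proof -
  obtain X where X: "interpolating V X" using fin_dim_interpolating[OF V] .
  have "cfun.subspace W"
    using linear_map_image_subspace[OF T] bij X by (auto simp: bij_betw_def interpolating_def)
  then show ?thesis using dim_eq_card_interpolating_image[OF X T bij] interpolating_dim[OF X] by simp
qed

text \<open>The underlying space of \<open>direct_sum\<close>, separated from the action so that it
  also describes the invariants of a direct sum and the target of evaluation at double coset
  representatives.\<close>

definition family_space :: "'i set \<Rightarrow> ('i \<Rightarrow> ('a \<Rightarrow> complex) set) \<Rightarrow> ('i \<times> 'a \<Rightarrow> complex) set"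
  where "family_space I V = {f. (\<forall>i\<in>I. (\<lambda>a. f (i, a)) \<in> V i) \<and> (\<forall>i a. i \<notin> I \<longrightarrow> f (i, a) = 0)}"

lemma subspace_family_space:
  fixes V :: "'i \<Rightarrow> ('a \<Rightarrow> complex) set"
  assumes "\<And>i. i \<in> I \<Longrightarrow> cfun.subspace (V i)"
  shows "cfun.subspace (family_space I V)"
proof -
  have slices: "(\<lambda>a. (0 :: 'i \<times> 'a \<Rightarrow> complex) (i, a)) = 0"
    "(\<lambda>a. (f + g) (i, a)) = (\<lambda>a. f (i, a)) + (\<lambda>a. g (i, a))"
    "(\<lambda>a. fscale c f (i, a)) = fscale c (\<lambda>a. f (i, a))" for f g :: "'i \<times> 'a \<Rightarrow> complex" and c i
    by (simp_all add: fun_eq_iff pointwise)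
  have "0 \<in> V i" "x \<in> V i \<Longrightarrow> y \<in> V i \<Longrightarrow> x + y \<in> V i" "x \<in> V i \<Longrightarrow> fscale c x \<in> V i" if "i \<in> I" for i x y c
    using assms[OF that] by (simp_all add: cfun.subspace_0 cfun.subspace_add cfun.subspace_scale)
  then show ?thesis
    unfolding cfun.subspace_def family_space_def mem_Collect_eq slices
    by (simp add: pointwise)
qed

lemma interpolating_family_space:
  assumes I: "finite I" and V: "\<And>i. i \<in> I \<Longrightarrow> interpolating (V i) (X i)"
  shows "interpolating (family_space I V) (Sigma I X)"
  unfolding interpolating_def
proof (intro conjI ballI impI allI)
  show "cfun.subspace (family_space I V)" "finite (Sigma I X)"
    using V I by (auto intro: subspace_family_space simp: interpolating_def)
next
  fix f assume f: "f \<in> family_space I V" "\<forall>x\<in>Sigma I X. f x = 0"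
  have "(\<lambda>a. f (i, a)) = 0" if "i \<in> I" for i
    by (rule interpolatingD(3)[OF V[OF that]]) (use f that in \<open>auto simp: family_space_def\<close>)
  then have "f (i, a) = 0" for i a
    by (cases "i \<in> I") (use f(1) in \<open>auto simp: family_space_def fun_eq_iff pointwise\<close>)
  then show "f = 0" by (simp add: fun_eq_iff pointwise split_paired_all)
next
  fix \<phi> :: "_ \<Rightarrow> complex"
  have "\<forall>i\<in>I. \<exists>v\<in>V i. \<forall>x\<in>X i. v x = \<phi> (i, x)"
    by (intro ballI interpolatingD(4) V)
  then obtain v where v: "\<And>i. i \<in> I \<Longrightarrow> v i \<in> V i" "\<And>i x. i \<in> I \<Longrightarrow> x \<in> X i \<Longrightarrow> v i x = \<phi> (i, x)"
    by metis
  show "\<exists>f\<in>family_space I V. \<forall>x\<in>Sigma I X. f x = \<phi> x"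
    by (rule bexI[of _ "\<lambda>(i, a). if i \<in> I then v i a else 0"]) (use v in \<open>auto simp: family_space_def\<close>)
qed

lemma dim_family_space:
  assumes I: "finite I" and V: "\<And>i. i \<in> I \<Longrightarrow> fin_dim_subspace (V i)"
  shows "cfun.dim (family_space I V) = (\<Sum>i\<in>I. cfun.dim (V i))" and "fin_dim_subspace (family_space I V)"
proof -
  have "\<forall>i\<in>I. \<exists>X. interpolating (V i) X" using V fin_dim_interpolating by metis
  then obtain X where X: "\<And>i. i \<in> I \<Longrightarrow> interpolating (V i) (X i)" by metis
  then have f: "\<And>i. i \<in> I \<Longrightarrow> finite (X i)" by (auto simp: interpolating_def)
  show "cfun.dim (family_space I V) = (\<Sum>i\<in>I. cfun.dim (V i))"
    using interpolating_dim[OF interpolating_family_space[OF I X]] interpolating_dim[OF X] I f by simp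
  show "fin_dim_subspace (family_space I V)"
    by (rule interpolating_fin_dim[OF interpolating_family_space[OF I X]])
qed

text \<open>Addition maps the external sum of \<open>U\<close> and \<open>U'\<close>, indexed by
  \<open>bool\<close>, onto \<open>W\<close>; it is injective because the intersection is
  zero.\<close>

lemma dim_internal_sum:
  fixes U U' W :: "('a \<Rightarrow> complex) set"
  assumes U: "fin_dim_subspace U" and U': "fin_dim_subspace U'"
    and W: "W = {u + u' | u u'. u \<in> U \<and> u' \<in> U'}" and int: "U \<inter> U' = {0}"
  shows "cfun.dim W = cfun.dim U + cfun.dim U'"
proof -
  note sU = fin_dim_subspaceD[OF U] and sU' = fin_dim_subspaceD[OF U']
  define F where "F = family_space (UNIV :: bool set) (\<lambda>b. if b then U else U')"
  define T where "T = (\<lambda>f (a :: 'a). f (True, a) + f (False, a) :: complex)"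
  have T_eq: "T f = (\<lambda>a. f (True, a)) + (\<lambda>a. f (False, a))" for f by (simp add: T_def fun_eq_iff pointwise)
  have FD: "(\<lambda>a. f (True, a)) \<in> U" "(\<lambda>a. f (False, a)) \<in> U'" if "f \<in> F" for f
    using that by (auto simp: F_def family_space_def split: if_splits)
  have F: "fin_dim_subspace F" "cfun.dim F = cfun.dim U + cfun.dim U'"
    using dim_family_space[of "UNIV :: bool set" "\<lambda>b. if b then U else U'"] U U' unfolding F_def
    by (auto simp: UNIV_bool)
  have lin: "linear_map F W T"
    unfolding linear_map_def
  proof (intro conjI ballI allI image_subsetI)
    fix f assume "f \<in> F"
    then show "T f \<in> W" unfolding W T_eq using FD by blast
  qed (simp_all add: T_def fun_eq_iff pointwise algebra_simps)
  have "inj_on T F"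
  proof (rule inj_onI)
    fix f g assume fg: "f \<in> F" "g \<in> F" "T f = T g"
    have "(\<lambda>a. f (True, a)) - (\<lambda>a. g (True, a)) = (\<lambda>a. g (False, a)) - (\<lambda>a. f (False, a))"
      using fg(3) by (auto simp: T_def fun_eq_iff pointwise algebra_simps)
    moreover have "(\<lambda>a. f (True, a)) - (\<lambda>a. g (True, a)) \<in> U" "(\<lambda>a. g (False, a)) - (\<lambda>a. f (False, a)) \<in> U'"
      using FD[OF fg(1)] FD[OF fg(2)] cfun.subspace_diff[OF sU] cfun.subspace_diff[OF sU'] by blast+
    ultimately have "(\<lambda>a. f (True, a)) - (\<lambda>a. g (True, a)) \<in> U \<inter> U'"
      "(\<lambda>a. g (False, a)) - (\<lambda>a. f (False, a)) \<in> U \<inter> U'" by simp_all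
    then have "(\<lambda>a. f (True, a)) - (\<lambda>a. g (True, a)) = 0" "(\<lambda>a. g (False, a)) - (\<lambda>a. f (False, a)) = 0"
      unfolding int by simp_all
    then have "f (b, a) = g (b, a)" for a b by (cases b) (auto simp: fun_eq_iff pointwise)
    then show "f = g" by (simp add: fun_eq_iff pointwise split_paired_all)
  qed
  moreover have "T ` F = W"
  proof (intro subset_antisym subsetI)
    fix w assume "w \<in> W"
    then obtain u u' where u: "w = u + u'" "u \<in> U" "u' \<in> U'" using W by blast
    have "(\<lambda>(b, a). if b then u a else u' a) \<in> F"
      using u by (auto simp: F_def family_space_def)
    moreover have "T (\<lambda>(b, a). if b then u a else u' a) = w" using u(1) by (simp add: T_def fun_eq_iff pointwise)
    ultimately show "w \<in> T ` F" by blast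
  qed (use lin in \<open>auto simp: linear_map_def\<close>)
  ultimately show ?thesis using linear_bij_dim[OF lin _ F(1)] F(2) by (simp add: bij_betw_def)
qed

text \<open>Slices of a tensor in either variable lie in the corresponding factor. Vanishing on the
  product of the point sets therefore spreads first along the second variable and then along the
  first; prescribed values come from products of the two Lagrange bases.\<close>

lemma interpolating_tensor:
  assumes V: "interpolating V X" and W: "interpolating W Y"
  shows "interpolating (cfun.span {tensor v w | v w. v \<in> V \<and> w \<in> W}) (X \<times> Y)"
proof -
  let ?U = "cfun.span {tensor v w | v w. v \<in> V \<and> w \<in> W}"
  have sV: "cfun.subspace V" and sW: "cfun.subspace W" using V W by (auto simp: interpolating_def)
  show ?thesis unfolding interpolating_def
  proof (intro conjI ballI impI allI)
    show "finite (X \<times> Y)" using V W by (auto simp: interpolating_def)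
  next
    fix t assume t: "t \<in> ?U" "\<forall>p\<in>X \<times> Y. t p = 0"
    have slice: "(\<lambda>a. t (a, b)) \<in> V" for b using tensor_slice[OF sV t(1)] .
    have slice2: "(\<lambda>b. t (a, b)) \<in> W" for a
      using t(1)
    proof (induction rule: cspan_induct)
      case base then show ?case using cfun.subspace_0[OF sW] by (simp add: zero_fun_def)
    next
      case (step c x y)
      then obtain v w where x: "x = tensor v w" "w \<in> W" by blast
      have "(\<lambda>b. (fscale c x + y) (a, b)) = fscale (c * v a) w + (\<lambda>b. y (a, b))"
        by (auto simp: x tensor_def fun_eq_iff pointwise)
      then show ?case using step x by (simp add: cfun.subspace_add[OF sW] cfun.subspace_scale[OF sW])
    qed
    have "(\<lambda>b. t (a, b)) = 0" if "a \<in> X" for a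
      by (rule interpolatingD(3)[OF W slice2]) (use t(2) that in auto)
    then have 1: "t (a, b) = 0" if "a \<in> X" for a b using fun_cong[of _ 0 b] that by (fastforce simp: zero_fun_apply)
    have "(\<lambda>a. t (a, b)) = 0" for b
      by (rule interpolatingD(3)[OF V slice]) (rule 1)
    then show "t = 0" by (auto simp: fun_eq_iff pointwise)
  next
    fix \<phi> :: "_ \<Rightarrow> complex"
    have X: "finite X" and Y: "finite Y" using V W by (auto simp: interpolating_def)
    obtain bV where bV: "\<And>x. x \<in> X \<Longrightarrow> bV x \<in> V"
      "\<And>a y. y \<in> X \<Longrightarrow> (\<Sum>x\<in>X. fscale (a x) (bV x)) y = a y"
      by (rule interpolating_dual_basis[OF V]) (rule that)
    obtain bW where bW: "\<And>y. y \<in> Y \<Longrightarrow> bW y \<in> W"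
      "\<And>a y. y \<in> Y \<Longrightarrow> (\<Sum>x\<in>Y. fscale (a x) (bW x)) y = a y"
      by (rule interpolating_dual_basis[OF W]) (rule that)
    let ?t = "\<Sum>y\<in>Y. \<Sum>x\<in>X. fscale (\<phi> (x, y)) (tensor (bV x) (bW y))"
    have "?t \<in> ?U"
      by (intro cfun.span_sum cfun.span_scale cfun.span_base) (use bV(1) bW(1) in blast)
    moreover have "?t (x, y) = \<phi> (x, y)" if "x \<in> X" "y \<in> Y" for x y
    proof -
      have "?t (x, y) = (\<Sum>y'\<in>Y. (\<Sum>x'\<in>X. fscale (\<phi> (x', y')) (bV x')) x * bW y' y)"
        by (simp add: sum_fun_apply pointwise tensor_def sum_distrib_right mult.assoc)
      also have "\<dots> = (\<Sum>y'\<in>Y. fscale (\<phi> (x, y')) (bW y')) y"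
        by (simp only: bV(2)[OF that(1)]) (simp add: sum_fun_apply pointwise)
      also have "\<dots> = \<phi> (x, y)" by (rule bW(2)[OF that(2)])
      finally show ?thesis .
    qed
    ultimately show "\<exists>t\<in>?U. \<forall>p\<in>X \<times> Y. t p = \<phi> p" by (intro bexI[of _ ?t]) auto
  qed auto
qed

section \<open>Representations of finite groups\<close>

definition fixed :: "'g set \<Rightarrow> ('g, 'a) rep \<Rightarrow> ('a \<Rightarrow> complex) set"
  where "fixed H R = {v \<in> fst R. \<forall>h\<in>H. snd R h v = v}"

definition invariant_subspace :: "('g, 'm) monoid_scheme \<Rightarrow> ('g, 'a) rep \<Rightarrow> ('a \<Rightarrow> complex) set \<Rightarrow> bool"
  where "invariant_subspace G R U \<longleftrightarrow> cfun.subspace U \<and> U \<subseteq> fst R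
    \<and> (\<forall>g\<in>carrier G. \<forall>v\<in>U. snd R g v \<in> U)"

definition direct_decomposition :: "('g, 'm) monoid_scheme \<Rightarrow> ('g, 'a) rep \<Rightarrow>
    ('a \<Rightarrow> complex) set \<Rightarrow> ('a \<Rightarrow> complex) set \<Rightarrow> bool"
  where "direct_decomposition G R U U' \<longleftrightarrow> invariant_subspace G R U \<and> invariant_subspace G R U'
    \<and> U \<inter> U' = {0} \<and> fst R = {u + u' | u u'. u \<in> U \<and> u' \<in> U'}"

lemma representationD:
  assumes "representation G R"
  shows "fin_dim_subspace (fst R)" "cfun.subspace (fst R)"
    "g \<in> carrier G \<Longrightarrow> linear_map (fst R) (fst R) (snd R g)"
    "v \<in> fst R \<Longrightarrow> snd R \<one>\<^bsub>G\<^esub> v = v"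
    "g \<in> carrier G \<Longrightarrow> h \<in> carrier G \<Longrightarrow> v \<in> fst R \<Longrightarrow> snd R (g \<otimes>\<^bsub>G\<^esub> h) v = snd R g (snd R h v)"
    "g \<in> carrier G \<Longrightarrow> v \<in> fst R \<Longrightarrow> snd R g v \<in> fst R"
  using assms by (auto simp: representation_def linear_map_def image_subset_iff split: prod.splits intro: fin_dim_subspaceD)

lemma subspace_fixed:
  assumes R: "representation G R" and H: "H \<subseteq> carrier G"
  shows "cfun.subspace (fixed H R)" "fin_dim_subspace (fixed H R)"
proof -
  note sub = representationD(2)[OF R]
  show 1: "cfun.subspace (fixed H R)"
    unfolding cfun.subspace_def
  proof (intro conjI ballI allI)
    show "0 \<in> fixed H R"
      using linear_map_zero[OF representationD(3)[OF R] sub] cfun.subspace_0[OF sub] H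
      by (auto simp: fixed_def)
  next
    fix x y assume "x \<in> fixed H R" "y \<in> fixed H R"
    then show "x + y \<in> fixed H R"
      using H linear_map_add[OF representationD(3)[OF R]] cfun.subspace_add[OF sub]
      by (auto simp: fixed_def subset_iff)
  next
    fix c x assume "x \<in> fixed H R"
    then show "fscale c x \<in> fixed H R"
      using H linear_map_scale[OF representationD(3)[OF R]] cfun.subspace_scale[OF sub]
      by (auto simp: fixed_def subset_iff)
  qed
  show "fin_dim_subspace (fixed H R)"
    by (rule subspace_fin_dim[OF 1 _ representationD(1)[OF R]]) (auto simp: fixed_def)
qed

lemma invariant_subspaceD:
  assumes "invariant_subspace G R U"
  shows "cfun.subspace U" "U \<subseteq> fst R" "g \<in> carrier G \<Longrightarrow> v \<in> U \<Longrightarrow> snd R g v \<in> U"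
  using assms by (auto simp: invariant_subspace_def)

lemma representation_invariant_subspace:
  assumes R: "representation G R" and U: "invariant_subspace G R U"
  shows "representation G (U, snd R)"
proof -
  note D = invariant_subspaceD[OF U] and RD = representationD[OF R]
  have "linear_map U U (snd R g)" if "g \<in> carrier G" for g
    using D(2) D(3)[OF that] RD(3)[OF that] by (auto simp: linear_map_def subset_iff)
  moreover have "fin_dim_subspace U" by (rule subspace_fin_dim[OF D(1,2) RD(1)])
  ultimately show ?thesis using D(2) RD(4,5) by (auto simp: representation_def)
qed

text \<open>The complement is the kernel of the average of the projection onto \<open>U\<close> that interpolates at
  a set of points determining the elements of \<open>U\<close>.\<close>

lemma maschke:
  assumes G: "group G" "finite (carrier G)" and R: "representation G R" and U: "invariant_subspace G R U"
  obtains U' where "direct_decomposition G R U U'"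
proof -
  interpret group G by (rule G(1))
  note D = invariant_subspaceD[OF U] and RD = representationD[OF R]
  obtain X where X: "interpolating U X"
    using fin_dim_interpolating subspace_fin_dim[OF D(1,2) RD(1)] by blast
  have "\<exists>u. u \<in> U \<and> (\<forall>x\<in>X. u x = w x)" for w using interpolatingD(4)[OF X, of w] by blast
  then obtain p where p: "\<And>w. p w \<in> U" "\<And>w x. x \<in> X \<Longrightarrow> p w x = w x" by metis
  \<comment> \<open>\<open>p\<close> is chosen separately for each function; that it is linear and
    the identity on \<open>U\<close> follows because elements of \<open>U\<close> agreeing on
    \<open>X\<close> are equal.\<close>
  have p_id: "p u = u" if "u \<in> U" for u
    by (rule interpolating_eq[OF X]) (use p that in auto)
  have p_add: "p (u + v) = p u + p v" for u v
    by (rule interpolating_eq[OF X]) (use p in \<open>auto simp: pointwise cfun.subspace_add[OF D(1)]\<close>)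
  have p_scale: "p (fscale c v) = fscale c (p v)" for c v
    by (rule interpolating_eq[OF X]) (use p in \<open>auto simp: pointwise cfun.subspace_scale[OF D(1)]\<close>)
  define N where "N = complex_of_nat (card (carrier G))"
  have N: "N \<noteq> 0" using G(2) one_closed by (auto simp: N_def)
  \<comment> \<open>Not divided by the group order: on \<open>U\<close> this is multiplication by
    \<open>N\<close>, and the division takes place where \<open>u\<close> is defined.\<close>
  define avg where "avg w = (\<Sum>g\<in>carrier G. snd R g (p (snd R (inv\<^bsub>G\<^esub> g) w)))" for w
  have pR: "p w \<in> fst R" for w using p(1) D(2) by blast
  have avg_lin: "linear_map (fst R) U avg"
    unfolding linear_map_def
  proof (intro conjI ballI allI image_subsetI)
    show "avg w \<in> U" for w
      unfolding avg_def by (intro cfun.subspace_sum D p)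
  next
    fix u v assume uv: "u \<in> fst R" "v \<in> fst R"
    show "avg (u + v) = avg u + avg v"
      unfolding avg_def sum.distrib[symmetric]
    proof (rule sum.cong[OF refl])
      fix g assume g: "g \<in> carrier G"
      then show "snd R g (p (snd R (inv\<^bsub>G\<^esub> g) (u + v))) =
        snd R g (p (snd R (inv\<^bsub>G\<^esub> g) u)) + snd R g (p (snd R (inv\<^bsub>G\<^esub> g) v))"
        by (simp add: linear_map_add[OF RD(3)] uv p_add pR)
    qed
  next
    fix c v assume v: "v \<in> fst R"
    show "avg (fscale c v) = fscale c (avg v)"
      unfolding avg_def cfun.scale_sum_right
    proof (rule sum.cong[OF refl])
      fix g assume g: "g \<in> carrier G"
      then show "snd R g (p (snd R (inv\<^bsub>G\<^esub> g) (fscale c v))) =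
        fscale c (snd R g (p (snd R (inv\<^bsub>G\<^esub> g) v)))"
        by (simp add: linear_map_scale[OF RD(3)] v p_scale pR)
    qed
  qed
  have avg_id: "avg u = fscale N u" if "u \<in> U" for u
  proof -
    have "snd R g (p (snd R (inv\<^bsub>G\<^esub> g) u)) = u" if g: "g \<in> carrier G" for g
    proof -
      have u: "u \<in> fst R" using D(2) \<open>u \<in> U\<close> by blast
      have "p (snd R (inv\<^bsub>G\<^esub> g) u) = snd R (inv\<^bsub>G\<^esub> g) u"
        using g \<open>u \<in> U\<close> by (intro p_id D(3)) auto
      then show ?thesis using RD(5)[of g "inv\<^bsub>G\<^esub> g" u] RD(4)[of u] g u by simp
    qed
    then have "avg u = (\<Sum>g\<in>carrier G. u)" by (simp add: avg_def)
    also have "\<dots> = fscale N u" by (simp add: fun_eq_iff pointwise sum_fun_apply N_def)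
    finally show ?thesis .
  qed
  have avg_equiv: "avg (snd R h w) = snd R h (avg w)" if h: "h \<in> carrier G" and w: "w \<in> fst R" for h w
  proof -
    have bij: "bij_betw ((\<otimes>\<^bsub>G\<^esub>) h) (carrier G) (carrier G)"
      by (rule bij_betw_byWitness[where f' = "(\<otimes>\<^bsub>G\<^esub>) (inv\<^bsub>G\<^esub> h)"])
        (use h in \<open>auto simp: m_assoc[symmetric]\<close>)
    have "avg (snd R h w) = (\<Sum>g\<in>carrier G. snd R (h \<otimes>\<^bsub>G\<^esub> g) (p (snd R (inv\<^bsub>G\<^esub> (h \<otimes>\<^bsub>G\<^esub> g)) (snd R h w))))"
      unfolding avg_def by (rule sum.reindex_bij_betw[OF bij, symmetric])
    also have "\<dots> = (\<Sum>g\<in>carrier G. snd R h (snd R g (p (snd R (inv\<^bsub>G\<^esub> g) w))))"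
    proof (rule sum.cong[OF refl])
      fix g assume g: "g \<in> carrier G"
      have "snd R (inv\<^bsub>G\<^esub> (h \<otimes>\<^bsub>G\<^esub> g)) (snd R h w) = snd R (inv\<^bsub>G\<^esub> g) w"
        using RD(5)[of "inv\<^bsub>G\<^esub> (h \<otimes>\<^bsub>G\<^esub> g)" h w] g h w by (simp add: inv_mult_group m_assoc)
      then show "snd R (h \<otimes>\<^bsub>G\<^esub> g) (p (snd R (inv\<^bsub>G\<^esub> (h \<otimes>\<^bsub>G\<^esub> g)) (snd R h w))) =
          snd R h (snd R g (p (snd R (inv\<^bsub>G\<^esub> g) w)))"
        using RD(5)[OF h g pR] by simp
    qed
    also have "\<dots> = snd R h (avg w)"
      unfolding avg_def
      by (rule linear_map_sum[OF RD(3)[OF h] RD(2), symmetric]) (use RD(6) pR in auto)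
    finally show ?thesis .
  qed
  define U' where "U' = {w \<in> fst R. avg w = 0}"
  have "cfun.subspace U'"
    using linear_map_zero[OF avg_lin RD(2)] linear_map_add[OF avg_lin] linear_map_scale[OF avg_lin] RD(2)
    by (auto simp: U'_def cfun.subspace_def)
  then have inv: "invariant_subspace G R U'"
    using avg_equiv RD(6) linear_map_zero[OF RD(3) RD(2)]
    by (auto simp: invariant_subspace_def U'_def)
  have int: "U \<inter> U' = {0}"
    using avg_id N cfun.subspace_0[OF D(1)] cfun.subspace_0[OF \<open>cfun.subspace U'\<close>] by (auto simp: U'_def)
  have "fst R = {u + u' | u u'. u \<in> U \<and> u' \<in> U'}"
  proof (intro subset_antisym subsetI)
    fix w assume w: "w \<in> fst R"
    define u where "u = fscale (1 / N) (avg w)"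
    have avgU: "avg w \<in> U" using linear_map_in[OF avg_lin w] .
    have u: "u \<in> U" unfolding u_def by (rule cfun.subspace_scale[OF D(1) avgU])
    have "avg (w - u) = avg w - avg u"
      using linear_map_diff[OF avg_lin RD(2) w] u D(2) by blast
    also have "avg u = avg w" using avg_id[OF u] N by (simp add: u_def)
    finally have "avg (w - u) = 0" by simp
    then have "w - u \<in> U'" using w u D(2) cfun.subspace_diff[OF RD(2)] by (auto simp: U'_def)
    moreover have "w = u + (w - u)" by simp
    ultimately show "w \<in> {u + u' | u u'. u \<in> U \<and> u' \<in> U'}" using u by blast
  next
    fix w assume "w \<in> {u + u' | u u'. u \<in> U \<and> u' \<in> U'}"
    then show "w \<in> fst R" using D(2) cfun.subspace_add[OF RD(2)] by (auto simp: U'_def)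
  qed
  then show thesis using that[of U'] U inv int by (simp add: direct_decomposition_def)
qed

section \<open>Isomorphisms of representations and internal direct sums\<close>

lemma rep_isoI:
  assumes "representation G R" "representation G S" "linear_map (fst R) (fst S) T" "bij_betw T (fst R) (fst S)"
    and "\<And>g v. g \<in> carrier G \<Longrightarrow> v \<in> fst R \<Longrightarrow> T (snd R g v) = snd S g (T v)"
  shows "rep_iso G R S"
  using assms unfolding rep_iso_def by blast

lemma rep_isoE:
  assumes "rep_iso G R S"
  obtains T where "linear_map (fst R) (fst S) T" "bij_betw T (fst R) (fst S)"
    and "\<And>g v. g \<in> carrier G \<Longrightarrow> v \<in> fst R \<Longrightarrow> T (snd R g v) = snd S g (T v)"
  using assms unfolding rep_iso_def by blast

lemma rep_iso_trans:
  assumes "rep_iso G R S" "rep_iso G S Q"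
  shows "rep_iso G R Q"
proof -
  obtain T where T: "linear_map (fst R) (fst S) T" "bij_betw T (fst R) (fst S)"
    "\<And>g v. g \<in> carrier G \<Longrightarrow> v \<in> fst R \<Longrightarrow> T (snd R g v) = snd S g (T v)" by (rule rep_isoE[OF assms(1)]) (rule that, assumption, assumption, simp)
  obtain T' where T': "linear_map (fst S) (fst Q) T'" "bij_betw T' (fst S) (fst Q)"
    "\<And>g v. g \<in> carrier G \<Longrightarrow> v \<in> fst S \<Longrightarrow> T' (snd S g v) = snd Q g (T' v)" by (rule rep_isoE[OF assms(2)]) (rule that, assumption, assumption, simp)
  show ?thesis
  proof (rule rep_isoI[where T = "T' \<circ> T"])
    show "linear_map (fst R) (fst Q) (T' \<circ> T)" using T(1) T'(1) by (auto simp: linear_map_def image_subset_iff)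
    show "bij_betw (T' \<circ> T) (fst R) (fst Q)" by (rule bij_betw_trans[OF T(2) T'(2)])
    show "(T' \<circ> T) (snd R g v) = snd Q g ((T' \<circ> T) v)" if "g \<in> carrier G" "v \<in> fst R" for g v
      using that T(3) T'(3) linear_map_in[OF T(1)] by simp
  qed (use assms in \<open>auto simp: rep_iso_def\<close>)
qed

lemma rep_iso_sym:
  assumes "rep_iso G R S"
  shows "rep_iso G S R"
proof -
  obtain T where T: "linear_map (fst R) (fst S) T" "bij_betw T (fst R) (fst S)"
    "\<And>g v. g \<in> carrier G \<Longrightarrow> v \<in> fst R \<Longrightarrow> T (snd R g v) = snd S g (T v)" by (rule rep_isoE[OF assms]) (rule that, assumption, assumption, simp)
  have R: "representation G R" and S: "representation G S" using assms by (auto simp: rep_iso_def)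
  define T' where "T' = inv_into (fst R) T"
  have T': "T' w \<in> fst R" "T (T' w) = w" if "w \<in> fst S" for w
    using that T(2) by (auto simp: T'_def bij_betw_def inv_into_into f_inv_into_f)
  have T'T: "T' (T v) = v" if "v \<in> fst R" for v
    using that T(2) by (simp add: T'_def bij_betw_def)
  note sub = representationD(2)[OF R]
  show ?thesis
  proof (rule rep_isoI[OF S R, where T = T'])
    show "linear_map (fst S) (fst R) T'"
      unfolding linear_map_def
    proof (intro conjI ballI allI image_subsetI)
      fix u v assume uv: "u \<in> fst S" "v \<in> fst S"
      have "T' (T (T' u + T' v)) = T' u + T' v" by (intro T'T cfun.subspace_add[OF sub] T' uv)
      then show "T' (u + v) = T' u + T' v" using uv by (simp add: linear_map_add[OF T(1)] T')
    next
      fix c v assume v: "v \<in> fst S"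
      have "T' (T (fscale c (T' v))) = fscale c (T' v)" by (intro T'T cfun.subspace_scale[OF sub] T' v)
      then show "T' (fscale c v) = fscale c (T' v)" using v by (simp add: linear_map_scale[OF T(1)] T')
    qed (rule T')
    show "bij_betw T' (fst S) (fst R)" unfolding T'_def by (rule bij_betw_inv_into[OF T(2)])
    fix g v assume gv: "g \<in> carrier G" "v \<in> fst S"
    have "T' (T (snd R g (T' v))) = snd R g (T' v)"
      by (intro T'T representationD(6)[OF R] gv T')
    then show "T' (snd S g v) = snd R g (T' v)" using gv T(3) T' by simp
  qed
qed

lemma rep_iso_dim_fixed:
  assumes iso: "rep_iso G R S" and H: "H \<subseteq> carrier G"
  shows "cfun.dim (fixed H S) = cfun.dim (fixed H R)"
proof -
  obtain T where T: "linear_map (fst R) (fst S) T" "bij_betw T (fst R) (fst S)"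
    "\<And>g v. g \<in> carrier G \<Longrightarrow> v \<in> fst R \<Longrightarrow> T (snd R g v) = snd S g (T v)" by (rule rep_isoE[OF iso]) (rule that, assumption, assumption, simp)
  have R: "representation G R" using iso by (auto simp: rep_iso_def)
  have fixed: "T v \<in> fixed H S \<longleftrightarrow> v \<in> fixed H R" if v: "v \<in> fst R" for v
  proof -
    have "snd S h (T v) = T v \<longleftrightarrow> snd R h v = v" if "h \<in> H" for h
    proof -
      have h: "h \<in> carrier G" using that H by blast
      have "T (snd R h v) = T v \<longleftrightarrow> snd R h v = v"
        using T(2) representationD(6)[OF R h v] v by (auto simp: bij_betw_def dest: inj_onD)
      then show ?thesis using T(3)[OF h v] by simp
    qed
    then show ?thesis using v linear_map_in[OF T(1)] by (auto simp: fixed_def)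
  qed
  have "T ` fixed H R = fixed H S"
  proof (intro subset_antisym subsetI)
    fix w assume w: "w \<in> fixed H S"
    then obtain v where "v \<in> fst R" "w = T v" using T(2) by (auto simp: fixed_def bij_betw_def)
    then show "w \<in> T ` fixed H R" using fixed w by blast
  qed (use fixed in \<open>auto simp: fixed_def\<close>)
  moreover have "inj_on T (fixed H R)" using T(2) by (auto simp: bij_betw_def fixed_def inj_on_def)
  ultimately show ?thesis
    using T(1) subspace_fixed(2)[OF R H]
    by (intro linear_bij_dim[where T = T]) (auto simp: linear_map_def bij_betw_def fixed_def)
qed

lemma direct_decomposition_unique:
  assumes R: "representation G R" and dec: "direct_decomposition G R U U'"
    and "u \<in> U" "v \<in> U" "u' \<in> U'" "v' \<in> U'" "u + u' = v + v'"
  shows "u = v" "u' = v'"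
proof -
  have e: "u - v = v' - u'" using assms(7) by (simp add: algebra_simps)
  have "u - v \<in> U" "v' - u' \<in> U'"
    using dec assms(3-6) by (auto simp: direct_decomposition_def invariant_subspace_def cfun.subspace_diff)
  then have "u - v \<in> U \<inter> U'" "v' - u' \<in> U \<inter> U'" using e by simp_all
  then have "u - v = 0" "v' - u' = 0" using dec unfolding direct_decomposition_def by simp_all
  then show "u = v" "u' = v'" by auto
qed

text \<open>Components in a direct decomposition are unique, so the components of an invariant
  vector are invariant themselves.\<close>

lemma direct_decomposition_dim_fixed:
  assumes R: "representation G R" and dec: "direct_decomposition G R U U'" and H: "H \<subseteq> carrier G"
  shows "cfun.dim (fixed H R) = cfun.dim (fixed H (U, snd R)) + cfun.dim (fixed H (U', snd R))"
proof (rule dim_internal_sum)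
  have U: "invariant_subspace G R U" and U': "invariant_subspace G R U'"
    using dec by (auto simp: direct_decomposition_def)
  note RU = representation_invariant_subspace[OF R U] and RU' = representation_invariant_subspace[OF R U']
  show "fin_dim_subspace (fixed H (U, snd R))" "fin_dim_subspace (fixed H (U', snd R))"
    using subspace_fixed(2)[OF RU H] subspace_fixed(2)[OF RU' H] by auto
  show "fixed H (U, snd R) \<inter> fixed H (U', snd R) = {0}"
    using cfun.subspace_0[OF subspace_fixed(1)[OF RU H]] cfun.subspace_0[OF subspace_fixed(1)[OF RU' H]] dec
    by (auto simp: direct_decomposition_def fixed_def)
  have add: "snd R h (u + u') = snd R h u + snd R h u'" if "h \<in> H" "u \<in> U" "u' \<in> U'" for h u u'
    using that H invariant_subspaceD(2)[OF U] invariant_subspaceD(2)[OF U']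
    by (intro linear_map_add[OF representationD(3)[OF R]]) auto
  show "fixed H R = {u + u' | u u'. u \<in> fixed H (U, snd R) \<and> u' \<in> fixed H (U', snd R)}"
  proof (intro subset_antisym subsetI)
    fix w assume w: "w \<in> fixed H R"
    then obtain u u' where u: "w = u + u'" "u \<in> U" "u' \<in> U'"
      using dec by (auto simp: direct_decomposition_def fixed_def)
    have "snd R h u = u \<and> snd R h u' = u'" if h: "h \<in> H" for h
    proof -
      have "snd R h u + snd R h u' = u + u'" using w h add[OF h u(2,3)] u(1) by (auto simp: fixed_def)
      then show ?thesis
        using direct_decomposition_unique[OF R dec] invariant_subspaceD(3)[OF U, of h u]
          invariant_subspaceD(3)[OF U', of h u'] u h H by blast
    qed
    then show "w \<in> {u + u' | u u'. u \<in> fixed H (U, snd R) \<and> u' \<in> fixed H (U', snd R)}"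
      using u by (auto simp: fixed_def)
  next
    fix w assume "w \<in> {u + u' | u u'. u \<in> fixed H (U, snd R) \<and> u' \<in> fixed H (U', snd R)}"
    then obtain u u' where "w = u + u'" "u \<in> fixed H (U, snd R)" "u' \<in> fixed H (U', snd R)" by blast
    moreover from this have "u \<in> fst R" "u' \<in> fst R"
      using invariant_subspaceD(2)[OF U] invariant_subspaceD(2)[OF U'] by (auto simp: fixed_def)
    ultimately show "w \<in> fixed H R"
      using add cfun.subspace_add[OF representationD(2)[OF R]] by (auto simp: fixed_def)
  qed
qed

text \<open>The two isomorphisms are glued along the component maps \<open>q\<close> and
  \<open>q'\<close>. These are merely chosen; their linearity and equivariance again come from
  uniqueness of components.\<close>

lemma rep_iso_direct_decomposition:
  assumes R: "representation G R" and S: "representation G S"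
    and dR: "direct_decomposition G R U U'" and dS: "direct_decomposition G S W W'"
    and iso: "rep_iso G (U, snd R) (W, snd S)" and iso': "rep_iso G (U', snd R) (W', snd S)"
  shows "rep_iso G R S"
proof -
  obtain T where T: "linear_map U W T" "bij_betw T U W"
    "\<And>g v. g \<in> carrier G \<Longrightarrow> v \<in> U \<Longrightarrow> T (snd R g v) = snd S g (T v)" by (rule rep_isoE[OF iso, unfolded fst_conv snd_conv]) (rule that, assumption, assumption, simp)
  obtain T' where T': "linear_map U' W' T'" "bij_betw T' U' W'"
    "\<And>g v. g \<in> carrier G \<Longrightarrow> v \<in> U' \<Longrightarrow> T' (snd R g v) = snd S g (T' v)" by (rule rep_isoE[OF iso', unfolded fst_conv snd_conv]) (rule that, assumption, assumption, simp)
  have U: "invariant_subspace G R U" "invariant_subspace G R U'" and W: "invariant_subspace G S W" "invariant_subspace G S W'"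
    using dR dS by (auto simp: direct_decomposition_def)
  note UD = invariant_subspaceD[OF U(1)] and UD' = invariant_subspaceD[OF U(2)]
    and WD = invariant_subspaceD[OF W(1)] and WD' = invariant_subspaceD[OF W(2)]
  have "\<exists>u u'. v \<in> fst R \<longrightarrow> v = u + u' \<and> u \<in> U \<and> u' \<in> U'" for v
    using dR by (auto simp: direct_decomposition_def)
  then obtain q q' where q: "\<And>v. v \<in> fst R \<Longrightarrow> v = q v + q' v" "\<And>v. v \<in> fst R \<Longrightarrow> q v \<in> U"
      "\<And>v. v \<in> fst R \<Longrightarrow> q' v \<in> U'" by metis
  have R_eq: "u + u' \<in> fst R" if "u \<in> U" "u' \<in> U'" for u u' using dR that by (auto simp: direct_decomposition_def)
  have q_eq: "q (u + u') = u" "q' (u + u') = u'" if "u \<in> U" "u' \<in> U'" for u u'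
    using direct_decomposition_unique[OF R dR, of "q (u + u')" u "q' (u + u')" u'] q[OF R_eq[OF that]] that
    by auto
  define P where "P v = T (q v) + T' (q' v)" for v
  have P_eq: "P (u + u') = T u + T' u'" if "u \<in> U" "u' \<in> U'" for u u' using q_eq that by (simp add: P_def)
  show ?thesis
  proof (rule rep_isoI[OF R S, where T = P])
    show "linear_map (fst R) (fst S) P"
      unfolding linear_map_def
    proof (intro conjI ballI allI image_subsetI)
      fix v assume "v \<in> fst R"
      then have "T (q v) \<in> W" "T' (q' v) \<in> W'" using q linear_map_in[OF T(1)] linear_map_in[OF T'(1)] by auto
      then show "P v \<in> fst S" unfolding P_def using dS by (auto simp: direct_decomposition_def)
    next
      fix u v assume uv: "u \<in> fst R" "v \<in> fst R"
      have "u + v = (q u + q' u) + (q v + q' v)" using q(1)[OF uv(1)] q(1)[OF uv(2)] by (rule arg_cong2)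
      also have "\<dots> = (q u + q v) + (q' u + q' v)" by (simp only: ac_simps)
      finally have "u + v = (q u + q v) + (q' u + q' v)" .
      moreover have "q u + q v \<in> U" "q' u + q' v \<in> U'"
        using uv q cfun.subspace_add UD(1) UD'(1) by blast+
      ultimately have "P (u + v) = T (q u + q v) + T' (q' u + q' v)" using P_eq by simp
      then show "P (u + v) = P u + P v"
        using q uv by (simp add: linear_map_add[OF T(1)] linear_map_add[OF T'(1)] P_def algebra_simps)
    next
      fix c v assume v: "v \<in> fst R"
      have "fscale c v = fscale c (q v) + fscale c (q' v)" using q(1)[OF v] by (metis cfun.scale_right_distrib)
      moreover have "fscale c (q v) \<in> U" "fscale c (q' v) \<in> U'"
        using v q cfun.subspace_scale UD(1) UD'(1) by blast+
      ultimately have "P (fscale c v) = T (fscale c (q v)) + T' (fscale c (q' v))" using P_eq by simp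
      then show "P (fscale c v) = fscale c (P v)"
        using q v by (simp add: linear_map_scale[OF T(1)] linear_map_scale[OF T'(1)] P_def cfun.scale_right_distrib)
    qed
    show "bij_betw P (fst R) (fst S)"
      unfolding bij_betw_def
    proof
      show "inj_on P (fst R)"
      proof (rule inj_onI)
        fix u v assume uv: "u \<in> fst R" "v \<in> fst R" "P u = P v"
        have "T (q u) = T (q v)" "T' (q' u) = T' (q' v)"
          using direct_decomposition_unique[OF S dS _ _ _ _ uv(3)[unfolded P_def]]
            linear_map_in[OF T(1)] linear_map_in[OF T'(1)] q uv by auto
        then have "q u = q v" "q' u = q' v" using T(2) T'(2) q uv by (auto simp: bij_betw_def dest: inj_onD)
        then show "u = v" using q(1) uv by metis
      qed
      show "P ` fst R = fst S"
      proof (intro subset_antisym subsetI)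
        fix w assume "w \<in> P ` fst R"
        then obtain v where v: "v \<in> fst R" "w = P v" by blast
        then have "T (q v) \<in> W" "T' (q' v) \<in> W'" using q linear_map_in[OF T(1)] linear_map_in[OF T'(1)] by auto
        then show "w \<in> fst S" unfolding v(2) P_def using dS by (auto simp: direct_decomposition_def)
      next
        fix w assume "w \<in> fst S"
        then obtain x x' where x: "w = x + x'" "x \<in> W" "x' \<in> W'" using dS by (auto simp: direct_decomposition_def)
        then obtain u u' where "u \<in> U" "u' \<in> U'" "x = T u" "x' = T' u'" using T(2) T'(2) by (auto simp: bij_betw_def)
        then show "w \<in> P ` fst R" using x P_eq R_eq by (metis imageI)
      qed
    qed
    fix g v assume g: "g \<in> carrier G" and v: "v \<in> fst R"
    have "q v \<in> fst R" "q' v \<in> fst R" using q v UD(2) UD'(2) by auto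
    then have "snd R g v = snd R g (q v) + snd R g (q' v)"
      using q(1)[OF v] linear_map_add[OF representationD(3)[OF R g]] by metis
    then have "P (snd R g v) = T (snd R g (q v)) + T' (snd R g (q' v))"
      using P_eq UD(3)[OF g] UD'(3)[OF g] q v by simp
    also have "\<dots> = snd S g (T (q v)) + snd S g (T' (q' v))" using T(3) T'(3) g q v by simp
    also have "\<dots> = snd S g (T (q v) + T' (q' v))"
      using linear_map_in[OF T(1)] linear_map_in[OF T'(1)] q v WD(2) WD'(2)
      by (intro linear_map_add[OF representationD(3)[OF S g], symmetric]) auto
    finally show "P (snd R g v) = snd S g (P v)" by (simp add: P_def)
  qed
qed

section \<open>External direct sums, averages and pullbacks\<close>

lemma fst_direct_sum: "fst (direct_sum I R) = family_space I (\<lambda>i. fst (R i))"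
  by (simp add: direct_sum_def family_space_def)

lemma snd_direct_sum_slice: "i \<in> I \<Longrightarrow> (\<lambda>a. snd (direct_sum I R) g f (i, a)) = snd (R i) g (\<lambda>a. f (i, a))"
  by (simp add: direct_sum_def)

lemma family_eqI:
  assumes "\<And>i. i \<in> I \<Longrightarrow> (\<lambda>a. f (i, a)) = (\<lambda>a. g (i, a))" "\<And>i a. i \<notin> I \<Longrightarrow> f (i, a) = g (i, a)"
  shows "f = g"
proof (rule ext, clarify)
  fix i a show "f (i, a) = g (i, a)" by (cases "i \<in> I") (use assms(2) fun_cong[OF assms(1), of i a] in auto)
qed

lemma representation_direct_sum:
  fixes R :: "'i \<Rightarrow> ('g, 'a) rep"
  assumes I: "finite I" and R: "\<And>i. i \<in> I \<Longrightarrow> representation G (R i)"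
  shows "representation G (direct_sum I R)"
proof -
  let ?S = "direct_sum I R"
  have F: "f \<in> fst ?S \<longleftrightarrow> (\<forall>i\<in>I. (\<lambda>a. f (i, a)) \<in> fst (R i)) \<and> (\<forall>i a. i \<notin> I \<longrightarrow> f (i, a) = 0)" for f
    by (simp add: direct_sum_def)
  have off: "snd ?S g f (i, a) = 0" if "i \<notin> I" for g f i a using that by (simp add: direct_sum_def)
  note slice = snd_direct_sum_slice[of _ I R]
  have slice_add: "(\<lambda>a. (f + g) (i, a)) = (\<lambda>a. f (i, a)) + (\<lambda>a. g (i, a))"
    and slice_scale: "(\<lambda>a. fscale c f (i, a)) = fscale c (\<lambda>a. f (i, a))" for f g :: "'i \<times> 'a \<Rightarrow> complex" and c i
    by (simp_all add: fun_eq_iff pointwise)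
  have lin: "linear_map (fst ?S) (fst ?S) (snd ?S g)" if g: "g \<in> carrier G" for g
    unfolding linear_map_def
  proof (intro conjI ballI allI image_subsetI)
    fix f assume "f \<in> fst ?S"
    then show "snd ?S g f \<in> fst ?S" unfolding F by (auto simp: slice off intro!: representationD(6)[OF R g])
  next
    fix f h assume "f \<in> fst ?S" "h \<in> fst ?S"
    then show "snd ?S g (f + h) = snd ?S g f + snd ?S g h"
      unfolding F by (intro family_eqI[of I])
        (auto simp: slice slice_add linear_map_add[OF representationD(3)[OF R g]], simp add: off pointwise)
  next
    fix c f assume "f \<in> fst ?S"
    then show "snd ?S g (fscale c f) = fscale c (snd ?S g f)"
      unfolding F by (intro family_eqI[of I])
        (auto simp: slice slice_scale linear_map_scale[OF representationD(3)[OF R g]], simp add: off pointwise)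
  qed
  have one: "snd ?S \<one>\<^bsub>G\<^esub> f = f" if "f \<in> fst ?S" for f
    using that unfolding F by (intro family_eqI[of I]) (auto simp: slice off representationD(4)[OF R])
  have mult: "snd ?S (g \<otimes>\<^bsub>G\<^esub> h) f = snd ?S g (snd ?S h f)"
    if "f \<in> fst ?S" "g \<in> carrier G" "h \<in> carrier G" for f g h
    using that unfolding F by (intro family_eqI[of I]) (auto simp: slice off representationD(5)[OF R])
  have "fin_dim_subspace (fst ?S)"
    unfolding fst_direct_sum using I representationD(1)[OF R] by (rule dim_family_space(2))
  then show ?thesis using lin one mult by (auto simp: representation_def split: prod.splits)
qed

lemma fixed_direct_sum: "fixed H (direct_sum I R) = family_space I (\<lambda>i. fixed H (R i))"
proof -
  have "snd (direct_sum I R) h f = f \<longleftrightarrow> (\<forall>i\<in>I. snd (R i) h (\<lambda>a. f (i, a)) = (\<lambda>a. f (i, a)))"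
    if "\<forall>i a. i \<notin> I \<longrightarrow> f (i, a) = 0" for h f
  proof
    assume e: "snd (direct_sum I R) h f = f"
    show "\<forall>i\<in>I. snd (R i) h (\<lambda>a. f (i, a)) = (\<lambda>a. f (i, a))"
      by (metis e snd_direct_sum_slice)
  next
    assume "\<forall>i\<in>I. snd (R i) h (\<lambda>a. f (i, a)) = (\<lambda>a. f (i, a))"
    then show "snd (direct_sum I R) h f = f"
      using that by (intro family_eqI[of I]) (auto simp: snd_direct_sum_slice, simp add: direct_sum_def)
  qed
  then show ?thesis unfolding fixed_def fst_direct_sum family_space_def by auto
qed

lemma dim_fixed_direct_sum:
  assumes I: "finite I" and R: "\<And>i. i \<in> I \<Longrightarrow> representation G (R i)" and H: "H \<subseteq> carrier G"
  shows "cfun.dim (fixed H (direct_sum I R)) = (\<Sum>i\<in>I. cfun.dim (fixed H (R i)))"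
  unfolding fixed_direct_sum using I subspace_fixed(2)[OF R H] by (rule dim_family_space(1))

text \<open>Left translation permutes the summands. The average stays unnormalised, since only
  membership and nonvanishing matter later.\<close>

lemma fixed_average:
  assumes G: "group G" and R: "representation G R" and H: "subgroup H G" "finite H" and v: "v \<in> fst R"
  shows "(\<Sum>h\<in>H. snd R h v) \<in> fixed H R"
proof -
  interpret group G by (rule G)
  interpret H: subgroup H G by (rule H)
  note RD = representationD[OF R]
  have "snd R g (\<Sum>h\<in>H. snd R h v) = (\<Sum>h\<in>H. snd R h v)" if g: "g \<in> H" for g
  proof -
    have bij: "bij_betw ((\<otimes>\<^bsub>G\<^esub>) g) H H"
      by (rule bij_betw_byWitness[where f' = "(\<otimes>\<^bsub>G\<^esub>) (inv\<^bsub>G\<^esub> g)"])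
        (use g in \<open>auto simp: m_assoc[symmetric]\<close>)
    have "snd R g (\<Sum>h\<in>H. snd R h v) = (\<Sum>h\<in>H. snd R g (snd R h v))"
      using g v RD(6) by (intro linear_map_sum[OF RD(3) RD(2)]) auto
    also have "\<dots> = (\<Sum>h\<in>H. snd R (g \<otimes>\<^bsub>G\<^esub> h) v)"
      using g v RD(5) by (intro sum.cong) auto
    also have "\<dots> = (\<Sum>h\<in>H. snd R h v)" by (rule sum.reindex_bij_betw[OF bij])
    finally show ?thesis .
  qed
  then show ?thesis using v RD(6) by (auto simp: fixed_def intro!: cfun.subspace_sum[OF RD(2)])
qed

text \<open>Expresses every change of group in the proof: \<open>shift\<close> turns representations
  of the stabilizer of 1 into representations of a full symmetric group, and
  \<open>block_perm\<close> lets a Young subgroup act through one of its factors.\<close>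

definition pullback :: "('h \<Rightarrow> 'g) \<Rightarrow> ('g, 'a) rep \<Rightarrow> ('h, 'a) rep"
  where "pullback \<phi> R = (fst R, \<lambda>h. snd R (\<phi> h))"

lemma fst_pullback [simp]: "fst (pullback \<phi> R) = fst R" and snd_pullback [simp]: "snd (pullback \<phi> R) h = snd R (\<phi> h)"
  by (simp_all add: pullback_def)

lemma representation_pullback:
  assumes "representation G R" "\<phi> \<in> hom H G" "\<phi> \<one>\<^bsub>H\<^esub> = \<one>\<^bsub>G\<^esub>"
  shows "representation H (pullback \<phi> R)"
  using representationD[OF assms(1)] assms(2,3)
  by (simp add: representation_def pullback_def hom_def Pi_iff)

lemma fixed_pullback: "fixed H (pullback \<phi> R) = fixed (\<phi> ` H) R"
  by (auto simp: fixed_def)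

lemma rep_iso_pullback:
  assumes iso: "rep_iso H (pullback \<phi> R) (pullback \<phi> S)" and "representation G R" "representation G S"
    and \<phi>: "\<phi> ` carrier H = carrier G"
  shows "rep_iso G R S"
proof -
  obtain T where T: "linear_map (fst R) (fst S) T" "bij_betw T (fst R) (fst S)"
    "\<And>h v. h \<in> carrier H \<Longrightarrow> v \<in> fst R \<Longrightarrow> T (snd R (\<phi> h) v) = snd S (\<phi> h) (T v)"
    by (rule rep_isoE[OF iso, unfolded fst_pullback snd_pullback]) (rule that, assumption, assumption, simp)
  have "T (snd R g v) = snd S g (T v)" if gv: "g \<in> carrier G" "v \<in> fst R" for g v
  proof -
    have "g \<in> \<phi> ` carrier H" using \<phi> gv(1) by simp
    then obtain h where "h \<in> carrier H" "g = \<phi> h" by (rule imageE)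
    then show ?thesis using T(3)[of h v] gv(2) by simp
  qed
  then show ?thesis by (intro rep_isoI[of G R S T] assms(2,3) T)
qed

section \<open>Tabloids\<close>

text \<open>A constant of its own, so that the simplifier does not break membership in the interval
  into inequalities unless told to.\<close>

definition letters :: "nat \<Rightarrow> nat set"
  where "letters m = {1..m}"

lemma finite_letters [simp, intro]: "finite (letters m)" and card_letters [simp]: "card (letters m) = m"
  by (simp_all add: letters_def)

definition word_stab :: "nat \<Rightarrow> (nat \<Rightarrow> 'b) \<Rightarrow> (nat \<Rightarrow> nat) set"
  where "word_stab m c = {\<sigma>. \<sigma> permutes letters m \<and> (\<forall>x\<in>letters m. c (\<sigma> x) = c x)}"

text \<open>Equal fibre sizes mean equal image multisets, which yields the permutation. The
  statements below on conjugacy of tabloids and on double cosets get their permutations from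
  here.\<close>

lemma permutes_matching:
  assumes A: "finite A" and eq: "\<And>y. card {x \<in> A. f x = y} = card {x \<in> A. g x = y}"
  obtains \<sigma> where "\<sigma> permutes A" "\<And>x. x \<in> A \<Longrightarrow> f (\<sigma> x) = g x"
proof -
  have c: "count (image_mset f (mset_set A)) y = card {x \<in> A. f x = y}" for f :: "'a \<Rightarrow> 'b" and y
  proof -
    have "{x. x \<in># mset_set A \<and> y = f x} = {x \<in> A. f x = y}" using A by auto
    then show ?thesis using A by (simp add: count_image_mset')
  qed
  have "image_mset g (mset_set A) = image_mset f (mset_set A)"
    by (rule multiset_eqI) (simp add: c eq)
  then show thesis using image_mset_eq_implies_permutes[OF A] that by metis
qed

text \<open>A weakly increasing sequence is the sorted list of its values. This is how a row of a
  semistandard tableau is recovered from the number of occurrences of each entry.\<close>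

lemma mono_eq_if_counts_eq:
  fixes f g :: "nat \<Rightarrow> 'b :: linorder"
  assumes f: "\<And>i j. i \<le> j \<Longrightarrow> j < n \<Longrightarrow> f i \<le> f j" and g: "\<And>i j. i \<le> j \<Longrightarrow> j < n \<Longrightarrow> g i \<le> g j"
    and eq: "\<And>y. card {j. j < n \<and> f j = y} = card {j. j < n \<and> g j = y}" and j: "j < n"
  shows "f j = g j"
proof -
  have c: "count (mset (map f [0..<n])) y = card {j. j < n \<and> f j = y}" for f :: "nat \<Rightarrow> 'b" and y
  proof -
    have "{x. x \<in># mset_set {0..<n} \<and> y = f x} = {j. j < n \<and> f j = y}" by auto
    moreover have "mset (map f [0..<n]) = image_mset f (mset_set {0..<n})" by simp
    ultimately show ?thesis by (simp only: count_image_mset') simp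
  qed
  have "mset (map f [0..<n]) = mset (map g [0..<n])"
    by (rule multiset_eqI) (simp only: c eq)
  moreover have "sorted (map f [0..<n])" "sorted (map g [0..<n])"
    using f g by (auto simp: sorted_iff_nth_mono)
  ultimately have "map f [0..<n] = map g [0..<n]" by (metis properties_for_sort)
  then show ?thesis using j by (simp add: list_eq_iff_nth_eq)
qed

text \<open>Continues the partition by zeros, so that rows beyond the last need no separate
  treatment.\<close>

definition row_length :: "nat list \<Rightarrow> nat \<Rightarrow> nat"
  where "row_length lam i = (if i < length lam then lam ! i else 0)"

lemma diagram_iff: "(i, j) \<in> diagram lam \<longleftrightarrow> j < row_length lam i"
  by (auto simp: diagram_def row_length_def)

lemma diagram_eq_Sigma: "diagram lam = Sigma {..<length lam} (\<lambda>i. {..<lam ! i})"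
  by (auto simp: diagram_def)

lemma finite_diagram [simp, intro]: "finite (diagram lam)"
  by (simp add: diagram_eq_Sigma)

lemma card_diagram: "card (diagram lam) = sum_list lam"
  by (simp add: diagram_eq_Sigma sum_list_sum_nth atLeast0LessThan)

lemma card_row: "card {p \<in> diagram lam. fst p = i} = row_length lam i"
proof -
  have "{p \<in> diagram lam. fst p = i} = Pair i ` {..<row_length lam i}" by (auto simp: diagram_iff)
  then show ?thesis by (simp add: card_image inj_on_def)
qed

lemma partitionsD:
  assumes "lam \<in> partitions m"
  shows "sum_list lam = m" "i \<le> i' \<Longrightarrow> row_length lam i' \<le> row_length lam i" "length lam \<le> m"
    "i < length lam \<Longrightarrow> 0 < row_length lam i"
proof -
  have s: "sorted_wrt (\<ge>) lam" and z: "0 \<notin> set lam" and m: "sum_list lam = m"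
    using assms by (auto simp: partitions_def)
  show "sum_list lam = m" by (rule m)
  show "row_length lam i' \<le> row_length lam i" if "i \<le> i'"
  proof (cases "i = i'")
    case False
    then show ?thesis using that sorted_wrt_nth_less[OF s, of i i'] by (auto simp: row_length_def)
  qed simp
  show p: "0 < row_length lam i" if "i < length lam" for i
    by (metis z nth_mem that gr0I row_length_def)
  have "length lam = (\<Sum>i<length lam. 1)" by simp
  also have "\<dots> \<le> (\<Sum>i<length lam. lam ! i)"
    using p by (intro sum_mono) (simp add: row_length_def Suc_le_eq)
  also have "\<dots> = m" using m by (simp add: sum_list_sum_nth atLeast0LessThan)
  finally show "length lam \<le> m" .
qed

text \<open>\<open>u\<close> is the inverse of a tableau.\<close>

lemma sorted_arrangement:
  fixes c :: "nat \<Rightarrow> nat"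
  assumes r: "\<And>i. card {x \<in> letters m. r x = i} = row_length lam i"
  obtains u where "bij_betw u (diagram lam) (letters m)" "\<And>i j. (i, j) \<in> diagram lam \<Longrightarrow> r (u (i, j)) = i"
    and "\<And>i j j'. (i, j') \<in> diagram lam \<Longrightarrow> j \<le> j' \<Longrightarrow> c (u (i, j)) \<le> c (u (i, j'))"
proof -
  define xs where "xs i = sort_key c (sorted_list_of_set {x \<in> letters m. r x = i})" for i
  have set: "set (xs i) = {x \<in> letters m. r x = i}" for i by (simp add: xs_def)
  have dist: "distinct (xs i)" for i by (simp add: xs_def)
  have len: "length (xs i) = row_length lam i" for i by (simp add: xs_def r)
  have sorted: "sorted (map c (xs i))" for i by (simp add: xs_def)
  define u where "u = (\<lambda>(i, j). xs i ! j)"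
  have u: "u (i, j) \<in> letters m \<and> r (u (i, j)) = i" if "(i, j) \<in> diagram lam" for i j
    using nth_mem[of j "xs i"] that set[of i] by (auto simp: u_def len diagram_iff)
  have "bij_betw u (diagram lam) (letters m)"
    unfolding bij_betw_def
  proof
    show "inj_on u (diagram lam)"
    proof (rule inj_onI, clarify)
      fix i j i' j' assume *: "(i, j) \<in> diagram lam" "(i', j') \<in> diagram lam" "u (i, j) = u (i', j')"
      then have "i = i'" using u by metis
      with * show "i = i' \<and> j = j'" using dist[of i] by (simp add: u_def nth_eq_iff_index_eq len diagram_iff)
    qed
    show "u ` diagram lam = letters m"
    proof (intro subset_antisym subsetI)
      fix x assume "x \<in> letters m"
      then have "x \<in> set (xs (r x))" by (simp add: set)
      then obtain j where "j < length (xs (r x))" "xs (r x) ! j = x" by (auto simp: in_set_conv_nth)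
      then have "(r x, j) \<in> diagram lam" "u (r x, j) = x" by (auto simp: len diagram_iff u_def)
      then show "x \<in> u ` diagram lam" by (metis imageI)
    qed (use u in auto)
  qed
  moreover have "c (u (i, j)) \<le> c (u (i, j'))" if "(i, j') \<in> diagram lam" "j \<le> j'" for i j j'
    using sorted_nth_mono[OF sorted[of i], of j j'] that by (simp add: u_def len diagram_iff)
  ultimately show thesis using that u by blast
qed

definition tabloids :: "nat list \<Rightarrow> (nat \<Rightarrow> nat) set"
  where "tabloids lam = tabloid lam ` tableaux lam"

lemma tableaux_iff: "t \<in> tableaux lam \<longleftrightarrow> bij_betw t (letters (sum_list lam)) (diagram lam)"
  by (simp add: tableaux_def letters_def)

lemma tableauxD:
  assumes "t \<in> tableaux lam"
  shows "x \<in> letters (sum_list lam) \<Longrightarrow> t x \<in> diagram lam"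
    "x \<in> letters (sum_list lam) \<Longrightarrow> fst (t x) < length lam"
    "x \<in> letters (sum_list lam) \<Longrightarrow> y \<in> letters (sum_list lam) \<Longrightarrow> t x = t y \<Longrightarrow> x = y"
    "p \<in> diagram lam \<Longrightarrow> \<exists>x\<in>letters (sum_list lam). t x = p"
proof -
  have bij: "bij_betw t (letters (sum_list lam)) (diagram lam)" using assms by (simp add: tableaux_iff)
  show 1: "t x \<in> diagram lam" if "x \<in> letters (sum_list lam)" for x using bij that by (auto simp: bij_betw_def)
  show "fst (t x) < length lam" if "x \<in> letters (sum_list lam)"
    using 1[OF that] by (auto simp: diagram_def)
  show "x = y" if "x \<in> letters (sum_list lam)" "y \<in> letters (sum_list lam)" "t x = t y"
    using bij that by (auto simp: bij_betw_def dest: inj_onD)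
  show "\<exists>x\<in>letters (sum_list lam). t x = p" if "p \<in> diagram lam"
  proof -
    have "p \<in> t ` letters (sum_list lam)" using bij that by (simp add: bij_betw_def)
    then show ?thesis by auto
  qed
qed

lemma tabloid_eq: "tabloid lam t = restrict (fst \<circ> t) (letters (sum_list lam))"
  by (simp add: tabloid_def letters_def)

lemma tabloid_apply: "x \<in> letters (sum_list lam) \<Longrightarrow> tabloid lam t x = fst (t x)"
  by (simp add: tabloid_eq)

text \<open>Characterises tabloids without tableaux: a row assignment with the right row sizes is
  turned into a tableau by listing the letters of each row in an arbitrary order, whence the
  constant key passed to \<open>sorted_arrangement\<close>.\<close>

lemma tabloids_iff:
  "r \<in> tabloids lam \<longleftrightarrow> r \<in> extensional (letters (sum_list lam))
    \<and> (\<forall>i. card {x \<in> letters (sum_list lam). r x = i} = row_length lam i)"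
proof (intro iffI conjI allI)
  assume "r \<in> tabloids lam"
  then obtain t where t: "t \<in> tableaux lam" "r = tabloid lam t" by (auto simp: tabloids_def)
  then show "r \<in> extensional (letters (sum_list lam))" by (simp add: tabloid_eq)
  fix i
  have bij: "bij_betw t (letters (sum_list lam)) (diagram lam)" using t(1) by (simp add: tableaux_iff)
  have "t ` {x \<in> letters (sum_list lam). r x = i} = {p \<in> diagram lam. fst p = i}"
  proof (intro subset_antisym subsetI)
    fix p assume "p \<in> {p \<in> diagram lam. fst p = i}"
    then obtain x where "x \<in> letters (sum_list lam)" "t x = p" "fst p = i"
      using tableauxD(4)[OF t(1), of p] by auto
    then show "p \<in> t ` {x \<in> letters (sum_list lam). r x = i}" by (auto simp: t(2) tabloid_apply)
  qed (auto simp: t(2) tabloid_apply tableauxD(1)[OF t(1)])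
  moreover have "inj_on t {x \<in> letters (sum_list lam). r x = i}"
    using bij by (auto simp: bij_betw_def inj_on_def)
  ultimately show "card {x \<in> letters (sum_list lam). r x = i} = row_length lam i"
    using card_image[of t "{x \<in> letters (sum_list lam). r x = i}"] card_row[of lam i] by simp
next
  assume r: "r \<in> extensional (letters (sum_list lam))
    \<and> (\<forall>i. card {x \<in> letters (sum_list lam). r x = i} = row_length lam i)"
  then obtain u where u: "bij_betw u (diagram lam) (letters (sum_list lam))"
      "\<And>i j. (i, j) \<in> diagram lam \<Longrightarrow> r (u (i, j)) = i"
    using sorted_arrangement[of "sum_list lam" r lam "\<lambda>x. 0"] by metis
  define t where "t = inv_into (diagram lam) u"
  have t: "t \<in> tableaux lam" unfolding tableaux_iff t_def by (rule bij_betw_inv_into[OF u(1)])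
  have "r x = fst (t x)" if "x \<in> letters (sum_list lam)" for x
  proof -
    have "x \<in> u ` diagram lam" using u(1) that by (simp add: bij_betw_def)
    then have "t x \<in> diagram lam" "u (t x) = x" unfolding t_def by (auto intro: inv_into_into f_inv_into_f)
    then show ?thesis using u(2)[of "fst (t x)" "snd (t x)"] by simp
  qed
  then have "r = tabloid lam t" using r by (auto simp: tabloid_eq extensional_def fun_eq_iff)
  then show "r \<in> tabloids lam" using t by (auto simp: tabloids_def)
qed

lemma finite_tabloids [simp, intro]: "finite (tabloids lam)"
proof -
  have "tabloids lam \<subseteq> letters (sum_list lam) \<rightarrow>\<^sub>E {..<length lam}"
  proof
    fix r assume "r \<in> tabloids lam"
    then obtain t where t: "t \<in> tableaux lam" "r = tabloid lam t" by (auto simp: tabloids_def)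
    then show "r \<in> letters (sum_list lam) \<rightarrow>\<^sub>E {..<length lam}"
      by (auto simp: tabloid_eq tableauxD(2))
  qed
  then show ?thesis by (rule finite_subset) (auto intro: finite_PiE)
qed

lemma permutes_letters:
  assumes "\<sigma> permutes letters m"
  shows "x \<in> letters m \<Longrightarrow> \<sigma> x \<in> letters m" "x \<in> letters m \<Longrightarrow> inv' \<sigma> x \<in> letters m"
    "\<sigma> (inv' \<sigma> x) = x" "inv' \<sigma> (\<sigma> x) = x" "inv' \<sigma> permutes letters m" "\<sigma> x \<in> letters m \<Longrightarrow> x \<in> letters m"
    "bij_betw \<sigma> (letters m) (letters m)" "\<sigma> \<circ> inv' \<sigma> = id" "inv' \<sigma> \<circ> \<sigma> = id"
  using permutes_in_image[OF assms] permutes_in_image[OF permutes_inv[OF assms]] permutes_inverses[OF assms]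
    permutes_inv[OF assms] permutes_imp_bij[OF assms] permutes_inv_o[OF assms]
  by simp_all

lemma card_permute:
  assumes "\<sigma> permutes letters m"
  shows "card {x \<in> letters m. P (\<sigma> x)} = card {x \<in> letters m. P x}"
proof -
  have "\<sigma> ` {x \<in> letters m. P (\<sigma> x)} = {x \<in> letters m. P x}"
  proof (intro subset_antisym subsetI)
    fix y assume y: "y \<in> {x \<in> letters m. P x}"
    then have "inv' \<sigma> y \<in> {x \<in> letters m. P (\<sigma> x)}"
      using permutes_letters(2,3)[OF assms, of y] by simp
    then show "y \<in> \<sigma> ` {x \<in> letters m. P (\<sigma> x)}"
      by (rule rev_image_eqI) (simp only: permutes_letters(3)[OF assms])
  qed (use permutes_letters(1)[OF assms] in auto)
  moreover have "inj_on \<sigma> {x \<in> letters m. P (\<sigma> x)}"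
    using permutes_inj[OF assms] by (rule inj_on_subset) simp
  ultimately show ?thesis using card_image[of \<sigma> "{x \<in> letters m. P (\<sigma> x)}"] by simp
qed

lemma tabloids_permute:
  assumes "\<sigma> permutes letters (sum_list lam)" "r \<in> tabloids lam"
  shows "r \<circ> \<sigma> \<in> tabloids lam"
proof -
  have "r \<circ> \<sigma> \<in> extensional (letters (sum_list lam))"
    using assms permutes_not_in[OF assms(1)] by (auto simp: tabloids_iff extensional_def)
  then show ?thesis using assms card_permute[OF assms(1), of "\<lambda>x. r x = _"] by (simp add: tabloids_iff)
qed

lemma tabloids_conjugate:
  assumes "r \<in> tabloids lam" "r' \<in> tabloids lam"
  obtains \<sigma> where "\<sigma> permutes letters (sum_list lam)" "r' = r \<circ> \<sigma>"
proof -
  obtain \<sigma> where s: "\<sigma> permutes letters (sum_list lam)" "\<And>x. x \<in> letters (sum_list lam) \<Longrightarrow> r (\<sigma> x) = r' x"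
    using permutes_matching[of "letters (sum_list lam)" r r'] assms by (auto simp: tabloids_iff)
  have "r' = r \<circ> \<sigma>"
  proof
    fix x show "r' x = (r \<circ> \<sigma>) x"
      using s assms permutes_not_in[OF s(1), of x] by (cases "x \<in> letters (sum_list lam)") (auto simp: tabloids_iff extensional_def)
  qed
  then show thesis using that s(1) by blast
qed

lemma tabloids_less:
  assumes "r \<in> tabloids lam" "x \<in> letters (sum_list lam)"
  shows "r x < length lam"
  using assms by (auto simp: tabloids_def tabloid_apply tableauxD(2))

lemma sum_tabloid_eq:
  assumes "r \<in> tabloids lam" "r' \<in> tabloids lam"
  shows "(\<Sum>x\<in>letters (sum_list lam). f (r x)) = (\<Sum>x\<in>letters (sum_list lam). f (r' x))"
proof -
  obtain \<sigma> where s: "\<sigma> permutes letters (sum_list lam)" "r' = r \<circ> \<sigma>" using tabloids_conjugate[OF assms] .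
  then show ?thesis
    using sum.reindex_bij_betw[OF permutes_letters(7)[OF s(1)], of "\<lambda>x. f (r x)"] by simp
qed

section \<open>Column stabilizers and polytabloids\<close>

lemma column_stabilizer_iff:
  "\<sigma> \<in> column_stabilizer lam t \<longleftrightarrow> \<sigma> permutes letters (sum_list lam)
    \<and> (\<forall>x\<in>letters (sum_list lam). snd (t (\<sigma> x)) = snd (t x))"
  by (simp add: column_stabilizer_def letters_def)

lemma column_stabilizer_closed:
  "id \<in> column_stabilizer lam t"
  "\<sigma> \<in> column_stabilizer lam t \<Longrightarrow> \<tau> \<in> column_stabilizer lam t \<Longrightarrow> \<sigma> \<circ> \<tau> \<in> column_stabilizer lam t"
  "\<sigma> \<in> column_stabilizer lam t \<Longrightarrow> inv' \<sigma> \<in> column_stabilizer lam t"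
  "finite (column_stabilizer lam t)"
proof -
  show "finite (column_stabilizer lam t)"
    by (rule finite_subset[OF _ finite_permutations[of "letters (sum_list lam)"]]) (auto simp: column_stabilizer_iff)
  show "inv' \<sigma> \<in> column_stabilizer lam t" if s: "\<sigma> \<in> column_stabilizer lam t"
  proof -
    have p: "\<sigma> permutes letters (sum_list lam)" using s by (simp add: column_stabilizer_iff)
    have "snd (t (inv' \<sigma> x)) = snd (t x)" if "x \<in> letters (sum_list lam)" for x
      using s permutes_letters(2)[OF p that] permutes_letters(3)[OF p, of x] by (metis column_stabilizer_iff)
    then show ?thesis using permutes_letters(5)[OF p] by (simp add: column_stabilizer_iff)
  qed
next
  show "id \<in> column_stabilizer lam t" by (simp add: column_stabilizer_iff permutes_id)
  show "\<sigma> \<circ> \<tau> \<in> column_stabilizer lam t" if "\<sigma> \<in> column_stabilizer lam t" "\<tau> \<in> column_stabilizer lam t"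
    using that permutes_letters(1)[of \<tau>] by (simp add: column_stabilizer_iff permutes_compose)
qed

lemma tabloid_permute:
  assumes "\<sigma> permutes letters (sum_list lam)"
  shows "tabloid lam t \<circ> \<sigma> = tabloid lam (t \<circ> \<sigma>)"
  by (auto simp: tabloid_eq fun_eq_iff restrict_def permutes_in_image[OF assms])

lemma tableaux_permute:
  assumes "\<sigma> permutes letters (sum_list lam)" "t \<in> tableaux lam"
  shows "t \<circ> \<sigma> \<in> tableaux lam"
  using assms bij_betw_trans[OF permutes_letters(7)[OF assms(1)]] by (auto simp: tableaux_iff)

lemma polytabloid_support:
  assumes "polytabloid lam t r \<noteq> 0"
  obtains \<sigma> where "\<sigma> \<in> column_stabilizer lam t" "r = tabloid lam (t \<circ> \<sigma>)"
proof -
  obtain \<sigma> where "\<sigma> \<in> column_stabilizer lam t" "r = tabloid lam (t \<circ> inv' \<sigma>)"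
  proof -
    from assms obtain \<sigma> where "\<sigma> \<in> column_stabilizer lam t"
        "of_int (sign \<sigma>) * (if r = tabloid lam (t \<circ> inv' \<sigma>) then 1 else (0 :: complex)) \<noteq> 0"
      unfolding polytabloid_def by (rule sum.not_neutral_contains_not_neutral)
    then show thesis using that by (auto split: if_splits)
  qed
  then show thesis using that column_stabilizer_closed(3) by blast
qed

text \<open>Left multiplication by the inverse of \<open>\<pi>\<close> reindexes the defining sum
  and multiplies each sign by that of \<open>\<pi>\<close>.\<close>

lemma polytabloid_antisymmetric:
  assumes p: "\<pi> \<in> column_stabilizer lam t"
  shows "polytabloid lam t (r \<circ> \<pi>) = of_int (sign \<pi>) * polytabloid lam t r"
proof -
  let ?CS = "column_stabilizer lam t"
  have P: "\<sigma> permutes letters (sum_list lam)" if "\<sigma> \<in> ?CS" for \<sigma> using that by (simp add: column_stabilizer_iff)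
  note pp = permutes_letters[OF P[OF p]]
  have perm: "permutation \<sigma>" if "\<sigma> \<in> ?CS" for \<sigma>
    using P[OF that] finite_letters permutation_permutes by blast
  have bij: "bij_betw ((\<circ>) (inv' \<pi>)) ?CS ?CS"
  proof (rule bij_betw_byWitness[where f' = "(\<circ>) \<pi>"])
    show "\<forall>\<sigma>\<in>?CS. \<pi> \<circ> (inv' \<pi> \<circ> \<sigma>) = \<sigma>" "\<forall>\<sigma>\<in>?CS. inv' \<pi> \<circ> (\<pi> \<circ> \<sigma>) = \<sigma>"
      using pp(8,9) by (auto simp: o_assoc[symmetric] fun_eq_iff pp(3,4))
    show "(\<circ>) (inv' \<pi>) ` ?CS \<subseteq> ?CS" "(\<circ>) \<pi> ` ?CS \<subseteq> ?CS"
      using column_stabilizer_closed p by blast+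
  qed
  have "polytabloid lam t (r \<circ> \<pi>) = (\<Sum>\<sigma>\<in>?CS. of_int (sign (inv' \<pi> \<circ> \<sigma>)) *
      (if r \<circ> \<pi> = tabloid lam (t \<circ> inv' (inv' \<pi> \<circ> \<sigma>)) then 1 else 0))"
    unfolding polytabloid_def by (rule sum.reindex_bij_betw[OF bij, symmetric])
  also have "\<dots> = (\<Sum>\<sigma>\<in>?CS. of_int (sign \<pi>) * (of_int (sign \<sigma>) * (if r = tabloid lam (t \<circ> inv' \<sigma>) then 1 else 0)))"
  proof (rule sum.cong[OF refl])
    fix \<sigma> assume s: "\<sigma> \<in> ?CS"
    have "inv' (inv' \<pi> \<circ> \<sigma>) = inv' \<sigma> \<circ> \<pi>"
      using o_inv_distrib[OF permutes_bij[OF pp(5)] permutes_bij[OF P[OF s]]] permutes_inv_inv[OF P[OF p]] by simp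
    then have "tabloid lam (t \<circ> inv' (inv' \<pi> \<circ> \<sigma>)) = tabloid lam (t \<circ> inv' \<sigma>) \<circ> \<pi>"
      by (simp add: tabloid_permute[OF P[OF p]] o_assoc)
    moreover have "r \<circ> \<pi> = q \<circ> \<pi> \<longleftrightarrow> r = q" for q
      using pp(8) by (metis comp_assoc comp_id)
    moreover have "sign (inv' \<pi> \<circ> \<sigma>) = sign \<pi> * sign \<sigma>"
      using sign_compose[of "inv' \<pi>" \<sigma>] sign_inverse[of \<pi>] perm[OF s] perm[OF p] perm[OF column_stabilizer_closed(3)[OF p]]
      by simp
    ultimately show "of_int (sign (inv' \<pi> \<circ> \<sigma>)) * (if r \<circ> \<pi> = tabloid lam (t \<circ> inv' (inv' \<pi> \<circ> \<sigma>)) then 1 else 0) =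
      of_int (sign \<pi>) * (of_int (sign \<sigma>) * (if r = tabloid lam (t \<circ> inv' \<sigma>) then 1 else (0::complex)))"
      by simp
  qed
  also have "\<dots> = of_int (sign \<pi>) * polytabloid lam t r"
    by (simp add: polytabloid_def sum_distrib_left)
  finally show ?thesis .
qed

text \<open>A permutation preserving both the rows and the columns of a tableau is the identity, so
  just one summand survives.\<close>

lemma polytabloid_self:
  assumes t: "t \<in> tableaux lam"
  shows "polytabloid lam t (tabloid lam t) = 1"
proof -
  have "\<sigma> = id" if s: "\<sigma> \<in> column_stabilizer lam t" and e: "tabloid lam t = tabloid lam (t \<circ> inv' \<sigma>)" for \<sigma>
  proof -
    have p: "\<sigma> permutes letters (sum_list lam)" using s by (simp add: column_stabilizer_iff)
    have "inv' \<sigma> x = x" for x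
    proof (cases "x \<in> letters (sum_list lam)")
      case True
      have "fst (t (inv' \<sigma> x)) = fst (t x)" using fun_cong[OF e, of x] True by (simp add: tabloid_apply)
      moreover have "snd (t (inv' \<sigma> x)) = snd (t x)"
        using column_stabilizer_closed(3)[OF s] True by (simp add: column_stabilizer_iff)
      ultimately have "t (inv' \<sigma> x) = t x" by (simp add: prod_eq_iff)
      then show ?thesis using t True permutes_letters(2)[OF p True] by (auto simp: tableaux_iff bij_betw_def inj_on_def)
    next
      case False
      then show ?thesis using permutes_not_in[OF permutes_letters(5)[OF p]] by simp
    qed
    then have "inv' \<sigma> = id" by auto
    then show ?thesis using permutes_inv_inv[OF p] by (metis inv_id)
  qed
  then have "polytabloid lam t (tabloid lam t) =
      (\<Sum>\<sigma>\<in>column_stabilizer lam t. if \<sigma> = id then 1 else 0)"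
    unfolding polytabloid_def by (intro sum.cong) (auto simp: inv_id)
  then show ?thesis using column_stabilizer_closed(1,4) by simp
qed

section \<open>Garnir relations\<close>

text \<open>All ways of redistributing the letters of \<open>F\<close> over the rows
  \<open>i\<close> and \<open>Suc i\<close> without changing the row sizes. The sum of these
  tabloids plays the part of a Garnir element.\<close>

definition garnir_set :: "nat list \<Rightarrow> nat \<Rightarrow> (nat \<Rightarrow> nat) \<Rightarrow> nat set \<Rightarrow> (nat \<Rightarrow> nat) set"
  where "garnir_set lam i r F = {r' \<in> tabloids lam. (\<forall>x\<in>letters (sum_list lam) - F. r' x = r x)
    \<and> (\<forall>x\<in>F. r' x \<in> {i, Suc i})}"

text \<open>The two rows together contain \<open>row_length lam i + row_length lam (Suc i)\<close>
  letters, so the cardinality condition says that \<open>F\<close> has more letters than fit into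
  row \<open>i\<close>. This is Garnir's condition; it drives both the pigeonhole argument for
  polytabloids and the comparison in \<open>block_stat_garnir\<close>.\<close>

definition garnir_index :: "nat list \<Rightarrow> nat \<Rightarrow> (nat \<Rightarrow> nat) \<Rightarrow> nat set \<Rightarrow> bool"
  where "garnir_index lam i r F \<longleftrightarrow> r \<in> tabloids lam \<and> Suc i < length lam
    \<and> F \<subseteq> {x \<in> letters (sum_list lam). r x \<in> {i, Suc i}}
    \<and> card ({x \<in> letters (sum_list lam). r x \<in> {i, Suc i}} - F) < row_length lam (Suc i)"

text \<open>The functions on tabloids that are orthogonal, for the bilinear pairing, to all Garnir
  elements. Being cut out by equations, this space is suited to bounding the Specht module from
  above; \<open>specht_eq_garnir_kernel\<close> shows that the two are equal.\<close>

definition garnir_kernel :: "nat list \<Rightarrow> ((nat \<Rightarrow> nat) \<Rightarrow> complex) set"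
  where "garnir_kernel lam = {v. (\<forall>r. r \<notin> tabloids lam \<longrightarrow> v r = 0)
    \<and> (\<forall>i r F. garnir_index lam i r F \<longrightarrow> (\<Sum>r'\<in>garnir_set lam i r F. v r') = 0)}"

lemma garnir_set_subset: "garnir_set lam i r F \<subseteq> tabloids lam"
  by (auto simp: garnir_set_def)

lemma finite_garnir_set [simp, intro]: "finite (garnir_set lam i r F)"
  by (rule finite_subset[OF garnir_set_subset finite_tabloids])

lemma subspace_garnir_kernel: "cfun.subspace (garnir_kernel lam)"
  unfolding cfun.subspace_def garnir_kernel_def
  by (auto simp: pointwise sum.distrib simp flip: sum_distrib_left)

text \<open>Some column of the tableau has both its entries of the rows \<open>i\<close> and \<open>i + 1\<close> in \<open>F\<close>; exchanging
  them is a sign-reversing bijection of the summands.\<close>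

lemma polytabloid_garnir:
  assumes lam: "lam \<in> partitions m" and t: "t \<in> tableaux lam" and idx: "garnir_index lam i r F"
  shows "(\<Sum>r'\<in>garnir_set lam i r F. polytabloid lam t r') = 0"
proof (cases "\<exists>r1\<in>garnir_set lam i r F. polytabloid lam t r1 \<noteq> 0")
  case True
  define L where "L = letters (sum_list lam)"
  define E where "E = garnir_set lam i r F"
  define n where "n = row_length lam (Suc i)"
  obtain r1 where r1: "r1 \<in> E" "polytabloid lam t r1 \<noteq> 0" using True by (auto simp: E_def)
  obtain \<sigma> where s: "\<sigma> \<in> column_stabilizer lam t" "r1 = tabloid lam (t \<circ> \<sigma>)" using polytabloid_support[OF r1(2)] .
  have sp: "\<sigma> permutes letters (sum_list lam)" using s(1) by (simp add: column_stabilizer_iff)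
  \<comment> \<open>\<open>t1\<close> has the columns of \<open>t\<close>, but its tabloid is
    \<open>r1\<close>; so the Garnir set tells which letters stand in the rows \<open>i\<close> and
    \<open>Suc i\<close> of \<open>t1\<close>.\<close>
  define t1 where "t1 = t \<circ> \<sigma>"
  have t1: "t1 \<in> tableaux lam" unfolding t1_def by (rule tableaux_permute[OF sp t])
  have snd_t1: "snd (t1 x) = snd (t x)" if "x \<in> L" for x
    using s(1) that by (simp add: column_stabilizer_iff t1_def L_def)
  have r1_t1: "r1 x = fst (t1 x)" if "x \<in> L" for x
    using that by (simp add: s(2) tabloid_apply t1_def L_def)
  define R where "R = {x \<in> L. r x \<in> {i, Suc i}}"
  have FR: "F \<subseteq> R" and card: "card (R - F) < n"
    using idx by (auto simp: garnir_index_def R_def L_def n_def)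
  have finR: "finite R" by (simp add: R_def L_def)
  have R_eq: "x \<in> R \<longleftrightarrow> r1 x \<in> {i, Suc i}" if "x \<in> L" for x
    using that r1(1) FR unfolding R_def E_def garnir_set_def L_def by (cases "x \<in> F") auto
  have le: "n \<le> row_length lam i" unfolding n_def by (rule partitionsD(2)[OF lam]) simp
  have "\<forall>c. \<exists>x y. c < n \<longrightarrow> x \<in> L \<and> y \<in> L \<and> t1 x = (i, c) \<and> t1 y = (Suc i, c)"
  proof
    fix c
    show "\<exists>x y. c < n \<longrightarrow> x \<in> L \<and> y \<in> L \<and> t1 x = (i, c) \<and> t1 y = (Suc i, c)"
    proof (cases "c < n")
      case True
      then have "(i, c) \<in> diagram lam" "(Suc i, c) \<in> diagram lam" using le by (auto simp: diagram_iff n_def)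
      then show ?thesis using tableauxD(4)[OF t1] unfolding L_def by meson
    qed auto
  qed
  then obtain x y where xy: "\<And>c. c < n \<Longrightarrow> x c \<in> L" "\<And>c. c < n \<Longrightarrow> y c \<in> L"
    "\<And>c. c < n \<Longrightarrow> t1 (x c) = (i, c)" "\<And>c. c < n \<Longrightarrow> t1 (y c) = (Suc i, c)" by metis
  \<comment> \<open>Pigeonhole: otherwise each of the \<open>n\<close> columns meeting row
    \<open>Suc i\<close> would supply its own letter of \<open>R - F\<close>, which has fewer than
    \<open>n\<close>.\<close>
  have "\<exists>c<n. x c \<in> F \<and> y c \<in> F"
  proof (rule ccontr)
    assume no: "\<not> (\<exists>c<n. x c \<in> F \<and> y c \<in> F)"
    define z where "z c = (if x c \<in> F then y c else x c)" for c
    have z: "z c \<in> R - F" "snd (t1 (z c)) = c" if "c < n" for c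
      using no that xy R_eq r1_t1 by (auto simp: z_def)
    have "inj_on z {..<n}" by (rule inj_onI) (metis z(2) lessThan_iff)
    then have "card (z ` {..<n}) = n" by (simp add: card_image)
    moreover have "card (z ` {..<n}) \<le> card (R - F)" using z(1) finR by (intro card_mono) auto
    ultimately show False using card by simp
  qed
  then obtain c where c: "c < n" "x c \<in> F" "y c \<in> F" by blast
  define \<pi> where "\<pi> = transpose (x c) (y c)"
  have pp: "\<pi> permutes letters (sum_list lam)"
    using xy(1,2)[OF c(1)] unfolding \<pi>_def L_def by (rule permutes_swap_id)
  have snd_eq: "snd (t (x c)) = snd (t (y c))"
    using snd_t1[OF xy(1)[OF c(1)]] snd_t1[OF xy(2)[OF c(1)]] xy(3,4)[OF c(1)] by simp
  have "\<pi> \<in> column_stabilizer lam t"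
    using pp snd_eq by (auto simp: column_stabilizer_iff \<pi>_def transpose_def)
  moreover have "sign \<pi> = -1"
    using xy(3,4)[OF c(1)] by (auto simp: \<pi>_def sign_swap_id)
  ultimately have anti: "polytabloid lam t (r' \<circ> \<pi>) = - polytabloid lam t r'" for r'
    using polytabloid_antisymmetric[of \<pi> lam t r'] by simp
  have invol: "\<pi> \<circ> \<pi> = id" by (simp add: \<pi>_def fun_eq_iff)
  have piF: "\<pi> z = z" if "z \<notin> F" for z using that c by (auto simp: \<pi>_def transpose_def)
  have piF': "\<pi> z \<in> F" if "z \<in> F" for z using that c by (auto simp: \<pi>_def transpose_def)
  have closed: "r' \<circ> \<pi> \<in> E" if "r' \<in> E" for r'
    using that tabloids_permute[OF pp] piF piF' by (auto simp: E_def garnir_set_def)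
  have "bij_betw (\<lambda>r'. r' \<circ> \<pi>) E E"
    by (rule bij_betw_byWitness[where f' = "\<lambda>r'. r' \<circ> \<pi>"]) (auto simp: comp_assoc invol closed)
  then have "(\<Sum>r'\<in>E. polytabloid lam t r') = (\<Sum>r'\<in>E. polytabloid lam t (r' \<circ> \<pi>))"
    using sum.reindex_bij_betw[of "\<lambda>r'. r' \<circ> \<pi>" E E "polytabloid lam t"] by simp
  also have "\<dots> = - (\<Sum>r'\<in>E. polytabloid lam t r')" by (simp add: anti sum_negf)
  finally show ?thesis unfolding E_def by simp
qed (simp add: sum.neutral)

lemma specht_subset_garnir_kernel:
  assumes lam: "lam \<in> partitions m"
  shows "fst (specht lam) \<subseteq> garnir_kernel lam"
proof -
  have "polytabloid lam t \<in> garnir_kernel lam" if t: "t \<in> tableaux lam" for t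
  proof -
    have "polytabloid lam t r = 0" if "r \<notin> tabloids lam" for r
    proof (rule ccontr)
      assume "polytabloid lam t r \<noteq> 0"
      then obtain \<sigma> where s: "\<sigma> \<in> column_stabilizer lam t" "r = tabloid lam (t \<circ> \<sigma>)"
        by (rule polytabloid_support)
      then have "r \<in> tabloids lam"
        using tableaux_permute[OF _ t, of \<sigma>] by (auto simp: tabloids_def column_stabilizer_iff)
      then show False using that by simp
    qed
    then show ?thesis using polytabloid_garnir[OF lam t] by (simp add: garnir_kernel_def)
  qed
  then show ?thesis unfolding specht_def fst_conv
    by (intro cfun.span_minimal subspace_garnir_kernel) auto
qed

text \<open>The base exceeds any possible sum of lower terms, so that weights compare the tabloids at the
  largest letter of \<open>c\<close> where they differ.\<close>

definition word_weight :: "nat list \<Rightarrow> (nat \<Rightarrow> nat) \<Rightarrow> (nat \<Rightarrow> nat) \<Rightarrow> nat"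
  where "word_weight lam c r = (\<Sum>x\<in>letters (sum_list lam). (sum_list lam * sum_list lam + 1) ^ c x * r x)"

lemma sorted_tableau:
  fixes c :: "nat \<Rightarrow> nat"
  assumes r: "r \<in> tabloids lam"
  obtains t where "t \<in> tableaux lam" "r = tabloid lam t"
    and "\<And>x y. x \<in> letters (sum_list lam) \<Longrightarrow> y \<in> letters (sum_list lam) \<Longrightarrow> fst (t x) = fst (t y) \<Longrightarrow>
      snd (t x) \<le> snd (t y) \<Longrightarrow> c x \<le> c y"
proof -
  have card_r: "\<And>i. card {x \<in> letters (sum_list lam). r x = i} = row_length lam i"
    using r by (simp add: tabloids_iff)
  obtain u where u: "bij_betw u (diagram lam) (letters (sum_list lam))"
      "\<And>i j. (i, j) \<in> diagram lam \<Longrightarrow> r (u (i, j)) = i"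
      "\<And>i j j'. (i, j') \<in> diagram lam \<Longrightarrow> j \<le> j' \<Longrightarrow> c (u (i, j)) \<le> c (u (i, j'))"
    by (rule sorted_arrangement[of "sum_list lam" r lam c, OF card_r]) (rule that)
  define t where "t = inv_into (diagram lam) u"
  have t: "t \<in> tableaux lam" unfolding tableaux_iff t_def by (rule bij_betw_inv_into[OF u(1)])
  have ut: "t x \<in> diagram lam" "u (t x) = x" if "x \<in> letters (sum_list lam)" for x
  proof -
    have "x \<in> u ` diagram lam" using u(1) that by (simp add: bij_betw_def)
    then show "t x \<in> diagram lam" "u (t x) = x" unfolding t_def by (auto intro: inv_into_into f_inv_into_f)
  qed
  have "r x = fst (t x)" if "x \<in> letters (sum_list lam)" for x
    using ut[OF that] u(2)[of "fst (t x)" "snd (t x)"] by simp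
  then have r_eq: "r = tabloid lam t" using r by (auto simp: tabloids_iff tabloid_eq extensional_def fun_eq_iff)
  have "c x \<le> c y" if xy: "x \<in> letters (sum_list lam)" "y \<in> letters (sum_list lam)" "fst (t x) = fst (t y)"
      "snd (t x) \<le> snd (t y)" for x y
  proof -
    have "c (u (fst (t y), snd (t x))) \<le> c (u (fst (t y), snd (t y)))"
      using ut(1)[OF xy(2)] xy(4) by (intro u(3)) auto
    moreover have "u (fst (t y), snd (t x)) = x" using ut(2)[OF xy(1)] xy(3)[symmetric] by simp
    ultimately show ?thesis using ut(2)[OF xy(2)] by simp
  qed
  then show thesis using that t r_eq by blast
qed

text \<open>The straightening step. A Garnir relation is chosen at the cell where column strictness
  fails; it involves only tabloids of weight at least that of \<open>tabloid lam t\<close>. By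
  maximality, those in the support of \<open>v\<close> have the same weight, and this makes them
  conjugate to \<open>tabloid lam t\<close> under the stabilizer of \<open>c\<close>. So a nonzero
  value there would have a positive multiple equal to zero.\<close>

lemma garnir_kernel_vanishes:
  assumes lam: "lam \<in> partitions m" and v: "v \<in> garnir_kernel lam"
    and inv: "\<And>\<sigma> r. \<sigma> \<in> word_stab (sum_list lam) c \<Longrightarrow> v (r \<circ> \<sigma>) = v r"
    and t: "t \<in> tableaux lam"
    and sorted: "\<And>x y. x \<in> letters (sum_list lam) \<Longrightarrow> y \<in> letters (sum_list lam) \<Longrightarrow> fst (t x) = fst (t y) \<Longrightarrow>
      snd (t x) \<le> snd (t y) \<Longrightarrow> c x \<le> c y"
    and max: "\<And>r. v r \<noteq> 0 \<Longrightarrow> word_weight lam c r \<le> word_weight lam c (tabloid lam t)"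
    and x0: "x0 \<in> letters (sum_list lam)" "t x0 = (i, j)" and y0: "y0 \<in> letters (sum_list lam)" "t y0 = (Suc i, j)"
    and viol: "c y0 \<le> c x0"
  shows "v (tabloid lam t) = 0"
proof -
  define L where "L = letters (sum_list lam)"
  define r where "r = tabloid lam t"
  define n where "n = row_length lam (Suc i)"
  \<comment> \<open>These are \<open>row_length lam i - j\<close> letters of the upper row and
    \<open>j + 1\<close> of the lower row, one more than the upper row holds.\<close>
  define F where "F = {x \<in> L. (fst (t x) = i \<and> j \<le> snd (t x)) \<or> (fst (t x) = Suc i \<and> snd (t x) \<le> j)}"
  define R where "R = {x \<in> L. r x \<in> {i, Suc i}}"
  define w where "w = (\<lambda>y. int (sum_list lam * sum_list lam + 1) ^ y)"
  have finL: "finite L" by (simp add: L_def)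
  have r: "r \<in> tabloids lam" using t by (simp add: r_def tabloids_def)
  have rt: "r x = fst (t x)" if "x \<in> L" for x using that by (simp add: r_def tabloid_apply L_def)
  have jn: "j < n" using tableauxD(1)[OF t y0(1)] y0(2) by (simp add: diagram_iff n_def)
  have pos: "sum_list lam > 0" using y0(1) by (cases "sum_list lam") (auto simp: letters_def)
  have idx: "garnir_index lam i r F"
  proof -
    have "Suc i < length lam" using tableauxD(2)[OF t y0(1)] y0(2) by simp
    moreover have "card (R - F) < n"
    proof -
      have "t ` (R - F) \<subseteq> ({i} \<times> {..<j}) \<union> ({Suc i} \<times> {j<..<n})"
      proof
        fix p assume "p \<in> t ` (R - F)"
        then obtain x where x: "x \<in> L" "x \<in> R" "x \<notin> F" "p = t x" by (auto simp: R_def)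
        have "t x \<in> diagram lam" using tableauxD(1)[OF t] x(1) by (simp add: L_def)
        then have "snd (t x) < row_length lam (fst (t x))" by (metis diagram_iff prod.collapse)
        then show "p \<in> ({i} \<times> {..<j}) \<union> ({Suc i} \<times> {j<..<n})"
          using x by (cases "t x") (auto simp: R_def F_def rt n_def)
      qed
      then have "card (t ` (R - F)) \<le> card (({i} \<times> {..<j}) \<union> ({Suc i} \<times> {j<..<n}))"
        by (intro card_mono) auto
      also have "\<dots> \<le> card ({i} \<times> {..<j}) + card ({Suc i} \<times> {j<..<n})" by (rule card_Un_le)
      also have "\<dots> < n" using jn by (simp add: card_cartesian_product)
      finally have "card (t ` (R - F)) < n" .
      moreover have "inj_on t (R - F)"
        by (rule inj_onI) (auto simp: R_def L_def intro: tableauxD(3)[OF t])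
      ultimately show ?thesis by (simp add: card_image)
    qed
    moreover have "F \<subseteq> R" by (auto simp: F_def R_def rt)
    ultimately show ?thesis using r by (simp add: garnir_index_def R_def L_def n_def)
  qed
  define E where "E = garnir_set lam i r F"
  have E: "r' \<in> tabloids lam" "\<And>x. x \<in> L \<Longrightarrow> x \<notin> F \<Longrightarrow> r' x = r x" "\<And>x. x \<in> F \<Longrightarrow> r' x \<in> {i, Suc i}"
    if "r' \<in> E" for r' using that by (auto simp: E_def garnir_set_def L_def)
  have rE: "r \<in> E" using r by (auto simp: E_def garnir_set_def F_def rt)
  have w_mono: "w a \<le> w b" if "a \<le> b" for a b
    unfolding w_def using that by (intro power_increasing) auto
  have w_inj: "a = b" if "w a = w b" for a b
    using that pos unfolding w_def by (subst (asm) power_inject_exp) auto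
  have "v r' = 0 \<or> v r' = v r" if r': "r' \<in> E" for r'
  proof (rule disjCI)
    assume nz: "v r' \<noteq> v r"
    show "v r' = 0"
    proof (rule ccontr)
      assume "v r' \<noteq> 0"
      then have le: "word_weight lam c r' \<le> word_weight lam c r" using max by (simp add: r_def)
      \<comment> \<open>Summing gives the difference of the weights: the constant
        \<open>w (c y0)\<close> contributes nothing because both tabloids have the same sum of row
        indices. With it every term is nonnegative: letters of \<open>F\<close> in row
        \<open>i\<close> can only move down and have \<open>c\<close> at least \<open>c y0\<close>,
        those in row \<open>Suc i\<close> can only move up and have \<open>c\<close> at most
        \<open>c y0\<close>.\<close>
      let ?f = "\<lambda>x. (int (r' x) - int (r x)) * (w (c x) - w (c y0))"
      have nonneg: "0 \<le> ?f x" if x: "x \<in> L" for x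
      proof (cases "x \<in> F")
        case True
        show ?thesis
        proof (cases "fst (t x) = i")
          case i: True
          then have "c x0 \<le> c x" using True x x0 by (intro sorted) (auto simp: F_def L_def)
          then have "w (c y0) \<le> w (c x)" using viol by (intro w_mono) simp
          moreover have "r x \<le> r' x" using E(3)[OF r' True] rt[OF x] i by auto
          ultimately show ?thesis by (intro mult_nonneg_nonneg) auto
        next
          case False
          then have f: "fst (t x) = Suc i" "snd (t x) \<le> j" using True by (auto simp: F_def)
          then have "c x \<le> c y0" using x y0 by (intro sorted) (auto simp: L_def)
          then have "w (c x) \<le> w (c y0)" by (rule w_mono)
          moreover have "r' x \<le> r x" using E(3)[OF r' True] rt[OF x] f by auto
          ultimately show ?thesis by (intro mult_nonpos_nonpos) auto
        qed
      qed (use E(2)[OF r' x] in simp)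
      have sum_r: "(\<Sum>x\<in>L. int (r' x)) = (\<Sum>x\<in>L. int (r x))"
        unfolding L_def by (rule sum_tabloid_eq[OF E(1)[OF r'] r])
      have ww: "int (word_weight lam c q) = (\<Sum>x\<in>L. w (c x) * int (q x))" for q
        by (simp add: word_weight_def L_def w_def)
      have "(\<Sum>x\<in>L. ?f x) = (\<Sum>x\<in>L. w (c x) * int (r' x)) - (\<Sum>x\<in>L. w (c x) * int (r x))
          - w (c y0) * ((\<Sum>x\<in>L. int (r' x)) - (\<Sum>x\<in>L. int (r x)))"
        unfolding sum_distrib_left sum_subtractf[symmetric] by (rule sum.cong) (auto simp: algebra_simps)
      also have "\<dots> \<le> 0" unfolding sum_r ww[symmetric] using le by simp
      finally have "(\<Sum>x\<in>L. ?f x) = 0" using nonneg by (intro antisym sum_nonneg) auto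
      then have "\<forall>x\<in>L. ?f x = 0" using sum_nonneg_eq_0_iff[OF finL, of ?f] nonneg by blast
      then have ceq: "c x = c y0" if "x \<in> L" "r' x \<noteq> r x" for x using that w_inj by fastforce
      \<comment> \<open>All moved letters carry the value \<open>c y0\<close>. For other values the
        counts agree letter by letter, and for \<open>c y0\<close> they agree as the remainders of
        equal row sizes.\<close>
      have card_eq: "card {x \<in> L. (r x, c x) = q} = card {x \<in> L. (r' x, c x) = q}" for q
      proof (cases "snd q = c y0")
        case True
        have split: "card {x \<in> L. p x = fst q} =
            card {x \<in> L. (p x, c x) = q} + card {x \<in> L. p x = fst q \<and> c x \<noteq> c y0}" for p
          by (subst card_Un_disjoint[symmetric]) (use True finL in \<open>auto intro!: arg_cong[of _ _ card] simp: prod_eq_iff\<close>)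
        have "x \<in> L \<Longrightarrow> c x \<noteq> c y0 \<Longrightarrow> r' x = r x" for x using ceq by blast
        then have "{x \<in> L. r x = fst q \<and> c x \<noteq> c y0} = {x \<in> L. r' x = fst q \<and> c x \<noteq> c y0}" by auto
        moreover have "card {x \<in> L. r x = fst q} = card {x \<in> L. r' x = fst q}"
          using r E(1)[OF r'] by (simp add: tabloids_iff L_def)
        ultimately show ?thesis using split[of r] split[of r'] by simp
      next
        case False
        then have "x \<in> L \<Longrightarrow> c x = snd q \<Longrightarrow> r' x = r x" for x using ceq[of x] by metis
        then have "{x \<in> L. (r x, c x) = q} = {x \<in> L. (r' x, c x) = q}" by (auto simp: prod_eq_iff)
        then show ?thesis by simp
      qed
      obtain \<sigma> where s: "\<sigma> permutes L" "\<And>x. x \<in> L \<Longrightarrow> (r (\<sigma> x), c (\<sigma> x)) = (r' x, c x)"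
        using permutes_matching[OF finL, of "\<lambda>x. (r x, c x)" "\<lambda>x. (r' x, c x)"] card_eq by blast
      have "r' = r \<circ> \<sigma>"
      proof
        fix x show "r' x = (r \<circ> \<sigma>) x"
          using s r E(1)[OF r'] permutes_not_in[OF s(1), of x]
          by (cases "x \<in> L") (auto simp: tabloids_iff extensional_def L_def)
      qed
      moreover have "\<sigma> \<in> word_stab (sum_list lam) c" using s by (simp add: word_stab_def L_def)
      ultimately show False using inv nz by simp
    qed
  qed
  then have "(\<Sum>r'\<in>E. v r') = (\<Sum>r'\<in>E. if v r' \<noteq> 0 then v r else 0)" by (intro sum.cong) auto
  also have "\<dots> = of_nat (card {r' \<in> E. v r' \<noteq> 0}) * v r"
    by (subst sum.inter_filter[symmetric]) (auto simp: E_def)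
  finally have "of_nat (card {r' \<in> E. v r' \<noteq> 0}) * v r = 0"
    using v idx by (simp add: garnir_kernel_def E_def)
  moreover have "card {r' \<in> E. v r' \<noteq> 0} \<noteq> 0" if "v r \<noteq> 0"
    using that rE finite_garnir_set[of lam i r F] by (auto simp: E_def)
  ultimately have "v r = 0" by (metis mult_eq_0_iff of_nat_eq_0_iff)
  then show ?thesis by (simp only: r_def)
qed

text \<open>Its cardinality is the Kostka number of \<open>lam\<close> and the content of
  \<open>c\<close>. Only the multiplicities of the values of \<open>c\<close> enter; a word is used
  instead of a composition so that the same \<open>c\<close> also defines a Young subgroup.\<close>

definition ssyt_word :: "nat list \<Rightarrow> (nat \<Rightarrow> nat) \<Rightarrow> (nat \<times> nat \<Rightarrow> nat) set"
  where "ssyt_word lam c = {T \<in> extensional (diagram lam).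
      (\<forall>i j. (i, j) \<in> diagram lam \<and> (i, Suc j) \<in> diagram lam \<longrightarrow> T (i, j) \<le> T (i, Suc j))
    \<and> (\<forall>i j. (i, j) \<in> diagram lam \<and> (Suc i, j) \<in> diagram lam \<longrightarrow> T (i, j) < T (Suc i, j))
    \<and> (\<forall>a. card {p \<in> diagram lam. T p = a} = card {x \<in> letters (sum_list lam). c x = a})}"

lemma ssyt_row_mono:
  assumes rows: "\<forall>i j. (i, j) \<in> diagram lam \<and> (i, Suc j) \<in> diagram lam \<longrightarrow> T (i, j) \<le> T (i, Suc j)"
    and "(i, j') \<in> diagram lam" "j \<le> j'"
  shows "T (i, j) \<le> (T (i, j') :: nat)"
  using assms(3,2)
proof (induction j' rule: dec_induct)
  case (step n)
  then have n: "(i, n) \<in> diagram lam" by (auto simp: diagram_iff)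
  then have "T (i, n) \<le> T (i, Suc n)" using rows step by blast
  then show ?case using step n by simp
qed simp

lemma ssyt_column_strict:
  assumes lam: "lam \<in> partitions m"
    and cols: "\<forall>i j. (i, j) \<in> diagram lam \<and> (Suc i, j) \<in> diagram lam \<longrightarrow> T (i, j) < T (Suc i, j)"
    and "(i', j) \<in> diagram lam" "i < i'"
  shows "T (i, j) < (T (i', j) :: nat)"
proof -
  have down: "(a, j) \<in> diagram lam" if "a \<le> b" "(b, j) \<in> diagram lam" for a b
    using partitionsD(2)[OF lam that(1)] that(2) by (simp add: diagram_iff)
  have "Suc i \<le> i'" using assms(4) by simp
  then show ?thesis using assms(3)
  proof (induction i' rule: dec_induct)
    case base
    then show ?case using cols down[of i "Suc i"] by auto
  next
    case (step n)
    have "(n, j) \<in> diagram lam" using down[of n "Suc n"] step by auto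
    then have "T (i, j) < T (n, j)" "T (n, j) < T (Suc n, j)" using step cols by auto
    then show ?case by simp
  qed
qed

text \<open>An arbitrary bijection from letters to cells is corrected by a permutation matching the
  values. The result is unique up to the stabilizer of \<open>c\<close>, and its tabloid will be the
  interpolation point belonging to \<open>T\<close>.\<close>

lemma ssyt_wordD:
  assumes T: "T \<in> ssyt_word lam c"
  obtains t where "t \<in> tableaux lam" "\<And>x. x \<in> letters (sum_list lam) \<Longrightarrow> T (t x) = c x"
proof -
  obtain t0 where t0: "bij_betw t0 (letters (sum_list lam)) (diagram lam)"
    using finite_same_card_bij[of "letters (sum_list lam)" "diagram lam"] by (auto simp: card_diagram)
  have t0T: "t0 \<in> tableaux lam" using t0 by (simp add: tableaux_iff)
  have "card {x \<in> letters (sum_list lam). T (t0 x) = a} = card {x \<in> letters (sum_list lam). c x = a}" for a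
  proof -
    have "t0 ` {x \<in> letters (sum_list lam). T (t0 x) = a} = {p \<in> diagram lam. T p = a}"
    proof (intro subset_antisym subsetI)
      fix p assume p: "p \<in> {p \<in> diagram lam. T p = a}"
      then obtain x where "x \<in> letters (sum_list lam)" "t0 x = p" using tableauxD(4)[OF t0T, of p] by auto
      then show "p \<in> t0 ` {x \<in> letters (sum_list lam). T (t0 x) = a}" using p by auto
    qed (use tableauxD(1)[OF t0T] in auto)
    moreover have "inj_on t0 {x \<in> letters (sum_list lam). T (t0 x) = a}"
      by (rule inj_onI) (simp add: tableauxD(3)[OF t0T])
    ultimately have "card {x \<in> letters (sum_list lam). T (t0 x) = a} = card {p \<in> diagram lam. T p = a}"
      using card_image[of t0 "{x \<in> letters (sum_list lam). T (t0 x) = a}"] by simp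
    then show ?thesis using T by (simp add: ssyt_word_def)
  qed
  then obtain \<sigma> where s: "\<sigma> permutes letters (sum_list lam)"
      "\<And>x. x \<in> letters (sum_list lam) \<Longrightarrow> T (t0 (\<sigma> x)) = c x"
    using permutes_matching[of "letters (sum_list lam)" "\<lambda>x. T (t0 x)" c] by auto
  show thesis by (rule that[of "t0 \<circ> \<sigma>"]) (use s tableaux_permute[OF s(1) t0T] in auto)
qed

lemma ssyt_word_column_strict:
  assumes lam: "lam \<in> partitions m" and T: "T \<in> ssyt_word lam c"
    and t: "t \<in> tableaux lam" "\<And>x. x \<in> letters (sum_list lam) \<Longrightarrow> T (t x) = c x"
    and xy: "x \<in> letters (sum_list lam)" "y \<in> letters (sum_list lam)" "snd (t x) = snd (t y)" "fst (t x) < fst (t y)"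
  shows "c x < c y"
proof -
  have "T (fst (t x), snd (t y)) < T (fst (t y), snd (t y))"
    by (rule ssyt_column_strict[OF lam]) (use T xy tableauxD(1)[OF t(1), of y] in \<open>auto simp: ssyt_word_def\<close>)
  then show ?thesis using t(2) xy by (metis prod.collapse)
qed

lemma ssyt_wordI:
  assumes t: "t \<in> tableaux lam"
    and rows: "\<And>x y. x \<in> letters (sum_list lam) \<Longrightarrow> y \<in> letters (sum_list lam) \<Longrightarrow> fst (t x) = fst (t y) \<Longrightarrow>
      snd (t x) \<le> snd (t y) \<Longrightarrow> c x \<le> c y"
    and cols: "\<And>x y i j. x \<in> letters (sum_list lam) \<Longrightarrow> y \<in> letters (sum_list lam) \<Longrightarrow> t x = (i, j) \<Longrightarrow>
      t y = (Suc i, j) \<Longrightarrow> c x < c y"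
  shows "\<exists>T\<in>ssyt_word lam c. \<forall>x\<in>letters (sum_list lam). T (t x) = c x"
proof -
  define T where "T = restrict (\<lambda>p. c (inv_into (letters (sum_list lam)) t p)) (diagram lam)"
  have inj: "inj_on t (letters (sum_list lam))" using t by (simp add: tableaux_iff bij_betw_def)
  have Tt: "T (t x) = c x" if "x \<in> letters (sum_list lam)" for x
    using that inj tableauxD(1)[OF t that] by (simp add: T_def)
  have "T (i, j) \<le> T (i, Suc j)" if ij: "(i, j) \<in> diagram lam" "(i, Suc j) \<in> diagram lam" for i j
  proof -
    obtain x y where xy: "x \<in> letters (sum_list lam)" "t x = (i, j)" "y \<in> letters (sum_list lam)" "t y = (i, Suc j)"
      using tableauxD(4)[OF t ij(1)] tableauxD(4)[OF t ij(2)] by auto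
    then show ?thesis using rows[of x y] Tt[of x] Tt[of y] by simp
  qed
  moreover have "T (i, j) < T (Suc i, j)" if ij: "(i, j) \<in> diagram lam" "(Suc i, j) \<in> diagram lam" for i j
  proof -
    obtain x y where xy: "x \<in> letters (sum_list lam)" "t x = (i, j)" "y \<in> letters (sum_list lam)" "t y = (Suc i, j)"
      using tableauxD(4)[OF t ij(1)] tableauxD(4)[OF t ij(2)] by auto
    then show ?thesis using cols[of x y] Tt[of x] Tt[of y] by simp
  qed
  moreover have "card {p \<in> diagram lam. T p = a} = card {x \<in> letters (sum_list lam). c x = a}" for a
  proof -
    have "t ` {x \<in> letters (sum_list lam). c x = a} = {p \<in> diagram lam. T p = a}"
    proof (intro subset_antisym subsetI)
      fix p assume p: "p \<in> {p \<in> diagram lam. T p = a}"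
      then obtain x where "x \<in> letters (sum_list lam)" "t x = p" using tableauxD(4)[OF t, of p] by auto
      then show "p \<in> t ` {x \<in> letters (sum_list lam). c x = a}" using p Tt by auto
    qed (use tableauxD(1)[OF t] Tt in auto)
    moreover have "inj_on t {x \<in> letters (sum_list lam). c x = a}" using inj by (rule inj_on_subset) auto
    ultimately show ?thesis using card_image[of t "{x \<in> letters (sum_list lam). c x = a}"] by simp
  qed
  ultimately have "T \<in> ssyt_word lam c" by (auto simp: ssyt_word_def T_def)
  then show ?thesis using Tt by blast
qed

text \<open>Represent a tabloid of maximal weight in the support by a tableau with rows sorted by
  \<open>c\<close>. A failure of column strictness is excluded by
  \<open>garnir_kernel_vanishes\<close>. Otherwise the tableau is semistandard, and the stabilizer
  of \<open>c\<close> takes its tabloid to one where \<open>v\<close> is known to vanish. So the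
  invariants in the Garnir kernel have no more degrees of freedom than there are semistandard
  tableaux.\<close>

lemma garnir_kernel_eq_0:
  assumes lam: "lam \<in> partitions m" and v: "v \<in> garnir_kernel lam"
    and inv: "\<And>\<sigma> r. \<sigma> \<in> word_stab (sum_list lam) c \<Longrightarrow> v (r \<circ> \<sigma>) = v r"
    and p: "\<And>T. T \<in> ssyt_word lam c \<Longrightarrow> \<exists>t\<in>tableaux lam.
      (\<forall>x\<in>letters (sum_list lam). T (t x) = c x) \<and> v (tabloid lam t) = 0"
  shows "v = 0"
proof (rule ccontr)
  assume "v \<noteq> 0"
  then obtain r0 where "v r0 \<noteq> 0" by (auto simp: fun_eq_iff zero_fun_apply)
  define S where "S = {r \<in> tabloids lam. v r \<noteq> 0}"
  have supp: "r \<in> S" if "v r \<noteq> 0" for r using v that by (auto simp: garnir_kernel_def S_def)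
  have S: "finite S" "S \<noteq> {}" using supp[OF \<open>v r0 \<noteq> 0\<close>] by (auto simp: S_def)
  have "Max (word_weight lam c ` S) \<in> word_weight lam c ` S" using S by (intro Max_in) auto
  then obtain r where r: "r \<in> S" "word_weight lam c r = Max (word_weight lam c ` S)" by auto
  have max: "word_weight lam c r' \<le> word_weight lam c r" if "v r' \<noteq> 0" for r'
    using supp[OF that] S r by simp
  have rt: "r \<in> tabloids lam" "v r \<noteq> 0" using r by (auto simp: S_def)
  obtain t where t: "t \<in> tableaux lam" "r = tabloid lam t"
    and rows: "\<And>x y. x \<in> letters (sum_list lam) \<Longrightarrow> y \<in> letters (sum_list lam) \<Longrightarrow> fst (t x) = fst (t y) \<Longrightarrow>
      snd (t x) \<le> snd (t y) \<Longrightarrow> c x \<le> c y"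
    using sorted_tableau[OF rt(1), of c] by blast
  show False
  proof (cases "\<exists>x y i j. x \<in> letters (sum_list lam) \<and> y \<in> letters (sum_list lam) \<and> t x = (i, j) \<and>
      t y = (Suc i, j) \<and> c y \<le> c x")
    case True
    then obtain x y i j where "x \<in> letters (sum_list lam)" "t x = (i, j)" "y \<in> letters (sum_list lam)"
      "t y = (Suc i, j)" "c y \<le> c x" by blast
    then have "v (tabloid lam t) = 0"
      using max rows unfolding t(2) by (intro garnir_kernel_vanishes[OF lam v inv t(1)])
    then show False using rt(2) t(2) by simp
  next
    case False
    then have cols: "\<And>x y i j. x \<in> letters (sum_list lam) \<Longrightarrow> y \<in> letters (sum_list lam) \<Longrightarrow> t x = (i, j) \<Longrightarrow>
      t y = (Suc i, j) \<Longrightarrow> c x < c y" by (meson not_le)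
    have "\<exists>T\<in>ssyt_word lam c. \<forall>x\<in>letters (sum_list lam). T (t x) = c x"
      by (rule ssyt_wordI[OF t(1)]) (simp add: rows, erule (3) cols)
    then obtain T where T: "T \<in> ssyt_word lam c" "\<And>x. x \<in> letters (sum_list lam) \<Longrightarrow> T (t x) = c x" by auto
    then obtain t' where t': "t' \<in> tableaux lam" "\<And>x. x \<in> letters (sum_list lam) \<Longrightarrow> T (t' x) = c x"
      "v (tabloid lam t') = 0" using p by blast
    \<comment> \<open>Carries the placement \<open>t'\<close> to \<open>t\<close>. Both place the
      letters according to the same filling \<open>T\<close>, so \<open>\<sigma>\<close> preserves
      \<open>c\<close>.\<close>
    define \<sigma> where "\<sigma> x = (if x \<in> letters (sum_list lam) then inv_into (letters (sum_list lam)) t (t' x) else x)" for x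
    have bij: "bij_betw t (letters (sum_list lam)) (diagram lam)" "bij_betw t' (letters (sum_list lam)) (diagram lam)"
      using t(1) t'(1) by (auto simp: tableaux_iff)
    have "bij_betw \<sigma> (letters (sum_list lam)) (letters (sum_list lam))"
      using bij_betw_trans[OF bij(2) bij_betw_inv_into[OF bij(1)]]
      by (rule bij_betw_cong[THEN iffD1, rotated]) (simp add: \<sigma>_def)
    then have s: "\<sigma> permutes letters (sum_list lam)" by (rule bij_imp_permutes) (simp add: \<sigma>_def)
    have ts: "t (\<sigma> x) = t' x" if "x \<in> letters (sum_list lam)" for x
      using that bij tableauxD(1)[OF t'(1) that] by (simp add: \<sigma>_def bij_betw_def f_inv_into_f)
    have "c (\<sigma> x) = c x" if "x \<in> letters (sum_list lam)" for x
      using T(2)[OF permutes_letters(1)[OF s that]] ts[OF that] t'(2)[OF that] by simp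
    then have "\<sigma> \<in> word_stab (sum_list lam) c" using s by (simp add: word_stab_def)
    then have "v (r \<circ> \<sigma>) = v r" by (rule inv)
    moreover have "r \<circ> \<sigma> = tabloid lam t'"
      unfolding t(2) tabloid_permute[OF s] by (auto simp: tabloid_eq fun_eq_iff restrict_def ts)
    ultimately show False using t'(3) rt(2) by simp
  qed
qed

section \<open>Invariants of Young subgroups in Specht modules\<close>

lemma carrier_sym_group: "carrier (sym_group m) = {\<sigma>. \<sigma> permutes letters m}"
  by (auto simp: sym_group_carrier letters_def)

lemma finite_carrier_sym_group: "finite (carrier (sym_group m))"
  by (simp add: carrier_sym_group finite_permutations)

lemma subgroup_word_stab: "subgroup (word_stab m c) (sym_group m)"
proof (rule subgroup_sym_groupI)
  show "word_stab m c \<subseteq> {\<sigma>. \<sigma> permutes {1..m}}" by (auto simp: word_stab_def letters_def)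
  show "id \<in> word_stab m c" by (simp add: word_stab_def permutes_id)
  show "inv' \<sigma> \<in> word_stab m c" if "\<sigma> \<in> word_stab m c" for \<sigma>
  proof -
    have p: "\<sigma> permutes letters m" using that by (simp add: word_stab_def)
    have "c (inv' \<sigma> x) = c x" if x: "x \<in> letters m" for x
    proof -
      have "c (\<sigma> (inv' \<sigma> x)) = c (inv' \<sigma> x)"
        using \<open>\<sigma> \<in> word_stab m c\<close> permutes_letters(2)[OF p x] by (simp add: word_stab_def)
      then show ?thesis by (simp only: permutes_letters(3)[OF p])
    qed
    then show ?thesis using permutes_letters(5)[OF p] by (simp add: word_stab_def)
  qed
  show "\<sigma> \<circ> \<tau> \<in> word_stab m c" if "\<sigma> \<in> word_stab m c" "\<tau> \<in> word_stab m c" for \<sigma> \<tau>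
    using that permutes_letters(1)[of \<tau> m] by (simp add: word_stab_def permutes_compose)
qed

lemma word_stab_subset: "word_stab m c \<subseteq> carrier (sym_group m)"
  by (auto simp: word_stab_def carrier_sym_group)

lemma finite_word_stab: "finite (word_stab m c)"
  by (rule finite_subset[OF word_stab_subset finite_carrier_sym_group])

lemma word_weight_word_stab:
  assumes "\<sigma> \<in> word_stab (sum_list lam) c"
  shows "word_weight lam c (r \<circ> \<sigma>) = word_weight lam c r"
proof -
  have p: "\<sigma> permutes letters (sum_list lam)" using assms by (simp add: word_stab_def)
  let ?g = "\<lambda>x. (sum_list lam * sum_list lam + 1) ^ c x * r x"
  have "word_weight lam c (r \<circ> \<sigma>) = (\<Sum>x\<in>letters (sum_list lam). ?g (\<sigma> x))"
    unfolding word_weight_def using assms by (intro sum.cong) (auto simp: word_stab_def)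
  also have "\<dots> = (\<Sum>x\<in>letters (sum_list lam). ?g x)"
    by (rule sum.reindex_bij_betw[OF permutes_letters(7)[OF p]])
  finally show ?thesis by (simp add: word_weight_def)
qed

text \<open>Among the letters moved by the column permutation consider those with the largest value of \<open>c\<close>.
  Since larger values lie below in their columns and are not moved, they can only move up.\<close>

lemma word_weight_column_permutation:
  assumes lam: "lam \<in> partitions m" and T: "T \<in> ssyt_word lam c"
    and t: "t \<in> tableaux lam" "\<And>x. x \<in> letters (sum_list lam) \<Longrightarrow> T (t x) = c x"
    and s: "\<sigma> \<in> column_stabilizer lam t" and ne: "tabloid lam (t \<circ> \<sigma>) \<noteq> tabloid lam t"
  shows "word_weight lam c (tabloid lam (t \<circ> \<sigma>)) < word_weight lam c (tabloid lam t)"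
proof -
  define L where "L = letters (sum_list lam)"
  define r where "r = tabloid lam t"
  define r' where "r' = tabloid lam (t \<circ> \<sigma>)"
  define k where "k = sum_list lam"
  define B where "B = int (k * k + 1)"
  have finL: "finite L" and cardL: "card L = k" by (simp_all add: L_def k_def)
  have p: "\<sigma> permutes L" using s by (simp add: column_stabilizer_iff L_def)
  have pL: "\<sigma> x \<in> L" if "x \<in> L" for x using p that by (simp add: permutes_in_image)
  have r: "r x = fst (t x)" "r' x = fst (t (\<sigma> x))" "snd (t (\<sigma> x)) = snd (t x)" if "x \<in> L" for x
    using that s by (auto simp: r_def r'_def tabloid_apply L_def column_stabilizer_iff)
  define D where "D = {x \<in> L. r' x \<noteq> r x}"
  have "D \<noteq> {}"
  proof
    assume "D = {}"
    then have "fst (t (\<sigma> x)) = fst (t x)" if "x \<in> L" for x using that r by (auto simp: D_def)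
    then have "r' = r" by (auto simp: r_def r'_def tabloid_eq fun_eq_iff restrict_def L_def)
    then show False using ne by (simp add: r_def r'_def)
  qed
  have finD: "finite D" using finL by (simp add: D_def)
  define M where "M = Max (c ` D)"
  have M: "c x \<le> M" if "x \<in> D" for x using that finD by (simp add: M_def)
  have "M \<in> c ` D" unfolding M_def using finD \<open>D \<noteq> {}\<close> by (intro Max_in) auto
  then obtain x0 where x0: "x0 \<in> D" "c x0 = M" by auto
  have up: "r' x < r x" if x: "x \<in> D" "c x = M" for x
  proof (rule ccontr)
    assume "\<not> r' x < r x"
    moreover have xL: "x \<in> L" "r' x \<noteq> r x" using x by (auto simp: D_def)
    ultimately have gt: "r x < r' x" by simp
    have "c x < c (\<sigma> x)"
    proof (rule ssyt_word_column_strict[OF lam T t])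
      show "fst (t x) < fst (t (\<sigma> x))" using gt r[OF xL(1)] by simp
      show "snd (t x) = snd (t (\<sigma> x))" using r(3)[OF xL(1)] by simp
    qed (use xL pL in \<open>auto simp: L_def\<close>)
    then have "\<sigma> x \<notin> D" using M[of "\<sigma> x"] x(2) by auto
    then have "fst (t (\<sigma> (\<sigma> x))) = fst (t (\<sigma> x))" using pL[OF xL(1)] r[OF pL[OF xL(1)]] by (auto simp: D_def)
    then have "t (\<sigma> (\<sigma> x)) = t (\<sigma> x)" using r(3)[OF pL[OF xL(1)]] by (simp add: prod_eq_iff)
    then have "\<sigma> (\<sigma> x) = \<sigma> x" using tableauxD(3)[OF t(1)] pL xL(1) by (simp add: L_def)
    then have "\<sigma> x = x" using permutes_inj[OF p] by (simp add: inj_eq)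
    then show False using gt r[OF xL(1)] by simp
  qed
  have rk: "r x \<le> k" "r' x \<le> k" if "x \<in> L" for x
  proof -
    have "length lam \<le> k" using partitionsD(1,3)[OF lam] by (simp add: k_def)
    moreover have "fst (t x) < length lam" "fst (t (\<sigma> x)) < length lam"
      using tableauxD(2)[OF t(1)] that pL[OF that] by (auto simp: L_def)
    ultimately show "r x \<le> k" "r' x \<le> k" using r[OF that] by auto
  qed
  \<comment> \<open>Bounds the loss caused by one moved letter with \<open>c\<close> below
    \<open>M\<close>: rows differ by at most \<open>k\<close>, and the exponent is at most
    \<open>M - 1\<close>. For \<open>M = 0\<close> there is no such letter. At most \<open>k\<close>
    letters move and \<open>k * k < B\<close>, so the gain of at least \<open>B ^ M\<close> from
    \<open>x0\<close> prevails.\<close>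
  define P where "P = (if M = 0 then 0 else int k * B ^ (M - 1))"
  have B: "B > 0" unfolding B_def by linarith
  have kP: "int k * P < B ^ M"
  proof (cases "M = 0")
    case False
    then obtain M' where M': "M = Suc M'" by (cases M) auto
    have "int k * P = int k * int k * B ^ M'" by (simp add: P_def M')
    also have "\<dots> < B * B ^ M'"
      using zero_less_power[OF B, of M'] by (intro mult_strict_right_mono) (auto simp: B_def)
    finally show ?thesis by (simp add: M')
  qed (simp add: P_def)
  let ?f = "\<lambda>x. B ^ c x * (int (r x) - int (r' x))"
  have lower: "- P \<le> ?f x" if x: "x \<in> D" for x
  proof (cases "c x = M")
    case True
    have "0 \<le> ?f x" using up[OF x True] B by simp
    moreover have "0 \<le> P" using B by (simp add: P_def)
    ultimately show ?thesis by simp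
  next
    case False
    then have lt: "c x < M" using M[OF x] by simp
    have "B ^ c x * (int (r' x) - int (r x)) \<le> B ^ c x * int k"
      using rk[of x] x B by (intro mult_left_mono) (auto simp: D_def)
    also have "\<dots> \<le> B ^ (M - 1) * int k"
      using lt B by (intro mult_right_mono power_increasing) (auto simp: B_def)
    finally have "B ^ c x * (int (r' x) - int (r x)) \<le> B ^ (M - 1) * int k" .
    then show ?thesis using lt by (simp add: P_def algebra_simps)
  qed
  have "(\<Sum>x\<in>D - {x0}. - P) \<le> (\<Sum>x\<in>D - {x0}. ?f x)"
    by (rule sum_mono) (use lower in auto)
  moreover have "card (D - {x0}) \<le> k"
    using card_mono[OF finL, of "D - {x0}"] cardL by (auto simp: D_def)
  then have "int (card (D - {x0})) * P \<le> int k * P"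
    by (intro mult_right_mono) (use B in \<open>auto simp: P_def\<close>)
  moreover have "B ^ M * 1 \<le> ?f x0" unfolding x0(2) using up[OF x0] B by (intro mult_left_mono) auto
  moreover have "(\<Sum>x\<in>D. ?f x) = ?f x0 + (\<Sum>x\<in>D - {x0}. ?f x)" by (rule sum.remove[OF finD x0(1)])
  ultimately have "0 < (\<Sum>x\<in>D. ?f x)" using kP by simp
  also have "(\<Sum>x\<in>D. ?f x) = (\<Sum>x\<in>L. ?f x)"
    by (rule sum.mono_neutral_left[OF finL]) (auto simp: D_def)
  also have "\<dots> = int (word_weight lam c r) - int (word_weight lam c r')"
    by (simp add: word_weight_def B_def L_def k_def sum_subtractf right_diff_distrib)
  finally show ?thesis by (simp add: r_def r'_def)
qed

text \<open>A triangular system solved from the top level of \<open>\<Phi>\<close> downwards: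
  matching the values at the highest level disturbs only lower ones. The induction runs over a level
  from which on the prescribed values are zero.\<close>

lemma triangular_interpolation:
  fixes p :: "'i \<Rightarrow> 'a" and \<Phi> :: "'i \<Rightarrow> nat"
  assumes V: "cfun.subspace V" and I: "finite I" and w: "\<And>i. i \<in> I \<Longrightarrow> w i \<in> V"
    and nz: "\<And>i. i \<in> I \<Longrightarrow> w i (p i) \<noteq> 0"
    and tri: "\<And>i j. i \<in> I \<Longrightarrow> j \<in> I \<Longrightarrow> w i (p j) \<noteq> 0 \<Longrightarrow> \<Phi> j < \<Phi> i \<or> j = i"
  shows "\<exists>v\<in>V. \<forall>i\<in>I. v (p i) = \<phi> i"
proof -
  have "\<exists>v\<in>V. \<forall>i\<in>I. v (p i) = \<phi> i" if "\<forall>i\<in>I. n \<le> \<Phi> i \<longrightarrow> \<phi> i = 0" for n \<phi>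
    using that
  proof (induction n arbitrary: \<phi>)
    case 0
    then show ?case using cfun.subspace_0[OF V] by (intro bexI[of _ 0]) (auto simp: zero_fun_apply)
  next
    case (Suc n)
    define I' where "I' = {i \<in> I. \<Phi> i = n}"
    define u where "u = (\<Sum>i\<in>I'. fscale (\<phi> i / w i (p i)) (w i))"
    have fin: "finite I'" using I by (simp add: I'_def)
    have u: "u \<in> V" unfolding u_def
      by (intro cfun.subspace_sum[OF V] cfun.subspace_scale[OF V] w) (auto simp: I'_def)
    have ueq: "u (p j) = (\<Sum>i\<in>I'. \<phi> i / w i (p i) * w i (p j))" for j
      by (simp add: u_def sum_fun_apply fscale_apply)
    have zero: "\<phi> j - u (p j) = 0" if j: "j \<in> I" "n \<le> \<Phi> j" for j
    proof (cases "\<Phi> j = n")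
      case True
      have "w i (p j) = 0" if "i \<in> I' - {j}" for i using tri[of i j] that True j by (auto simp: I'_def)
      then have "u (p j) = (\<Sum>i\<in>{j}. \<phi> i / w i (p i) * w i (p j))"
        unfolding ueq by (intro sum.mono_neutral_right fin) (use True j in \<open>auto simp: I'_def\<close>)
      then show ?thesis using nz[OF j(1)] by simp
    next
      case False
      have "w i (p j) = 0" if "i \<in> I'" for i using tri[of i j] that False j by (auto simp: I'_def)
      then have "u (p j) = 0" unfolding ueq by (intro sum.neutral) auto
      then show ?thesis using Suc.prems False j by simp
    qed
    obtain v where "v \<in> V" "\<forall>i\<in>I. v (p i) = \<phi> i - u (p i)"
      using Suc.IH[of "\<lambda>i. \<phi> i - u (p i)"] zero by auto
    then show ?case using u cfun.subspace_add[OF V] by (intro bexI[of _ "v + u"]) (auto simp: plus_fun_apply)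
  qed
  note * = this
  have "\<Phi> i < Suc (Max (\<Phi> ` I))" if "i \<in> I" for i using that I by (simp add: less_Suc_eq_le)
  then have "\<forall>i\<in>I. Suc (Max (\<Phi> ` I)) \<le> \<Phi> i \<longrightarrow> \<phi> i = 0" by fastforce
  then show ?thesis using * by blast
qed

text \<open>Up to the stabilizer of \<open>c\<close>, the tabloid of \<open>t\<close> remembers how
  often each value occurs in each row, and a filling with weakly increasing rows is determined by
  that.\<close>

lemma ssyt_word_unique:
  assumes T: "T \<in> ssyt_word lam c" and T': "T' \<in> ssyt_word lam c"
    and t: "t \<in> tableaux lam" "\<And>x. x \<in> letters (sum_list lam) \<Longrightarrow> T (t x) = c x"
    and t': "t' \<in> tableaux lam" "\<And>x. x \<in> letters (sum_list lam) \<Longrightarrow> T' (t' x) = c x"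
    and s: "\<sigma> \<in> word_stab (sum_list lam) c" and e: "tabloid lam t' \<circ> \<sigma> = tabloid lam t"
  shows "T = T'"
proof
  fix q :: "nat \<times> nat"
  obtain i j where q: "q = (i, j)" by (cases q)
  have p: "\<sigma> permutes letters (sum_list lam)" using s by (simp add: word_stab_def)
  have count: "card {j. j < row_length lam i \<and> T (i, j) = a} =
      card {x \<in> letters (sum_list lam). tabloid lam t x = i \<and> c x = a}"
    if T: "T \<in> ssyt_word lam c" and t: "t \<in> tableaux lam" "\<And>x. x \<in> letters (sum_list lam) \<Longrightarrow> T (t x) = c x"
    for T t i a
  proof -
    let ?A = "{x \<in> letters (sum_list lam). tabloid lam t x = i \<and> c x = a}"
    have "t ` ?A = Pair i ` {j. j < row_length lam i \<and> T (i, j) = a}"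
    proof (intro subset_antisym subsetI)
      fix y assume "y \<in> t ` ?A"
      then obtain x where x: "x \<in> letters (sum_list lam)" "fst (t x) = i" "c x = a" "y = t x" by (auto simp: tabloid_apply)
      then have "y = (i, snd y)" "T y = a" "y \<in> diagram lam"
        using t(2)[OF x(1)] tableauxD(1)[OF t(1) x(1)] by (metis prod.collapse)+
      then show "y \<in> Pair i ` {j. j < row_length lam i \<and> T (i, j) = a}" by (metis (mono_tags, lifting) diagram_iff image_eqI mem_Collect_eq)
    next
      fix y assume "y \<in> Pair i ` {j. j < row_length lam i \<and> T (i, j) = a}"
      then have y: "y \<in> diagram lam" "fst y = i" "T y = a" by (auto simp: diagram_iff)
      then obtain x where "x \<in> letters (sum_list lam)" "t x = y" using tableauxD(4)[OF t(1)] by metis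
      then show "y \<in> t ` ?A" using y t(2) by (auto simp: tabloid_apply)
    qed
    moreover have "inj_on t ?A" by (rule inj_onI) (simp add: tableauxD(3)[OF t(1)])
    ultimately have "card ?A = card (Pair i ` {j. j < row_length lam i \<and> T (i, j) = a})"
      using card_image[of t ?A] by simp
    then show ?thesis by (simp add: card_image inj_on_def)
  qed
  have "card {x \<in> letters (sum_list lam). tabloid lam t x = i \<and> c x = a} =
      card {x \<in> letters (sum_list lam). tabloid lam t' x = i \<and> c x = a}" for a
  proof -
    have "{x \<in> letters (sum_list lam). tabloid lam t x = i \<and> c x = a} =
        {x \<in> letters (sum_list lam). tabloid lam t' (\<sigma> x) = i \<and> c (\<sigma> x) = a}"
      using s fun_cong[OF e] by (auto simp: word_stab_def)
    then show ?thesis using card_permute[OF p, of "\<lambda>x. tabloid lam t' x = i \<and> c x = a"] by simp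
  qed
  then have eq: "card {j. j < row_length lam i \<and> T (i, j) = a} = card {j. j < row_length lam i \<and> T' (i, j) = a}" for a
    using count[OF T t] count[OF T' t'] by simp
  show "T q = T' q"
  proof (cases "q \<in> diagram lam")
    case True
    have "T (i, j) = T' (i, j)"
      by (rule mono_eq_if_counts_eq[where n = "row_length lam i"])
        (use T T' eq True q ssyt_row_mono[of lam T] ssyt_row_mono[of lam T'] in \<open>auto simp: diagram_iff ssyt_word_def\<close>)
    then show ?thesis by (simp add: q)
  next
    case False
    then show ?thesis using T T' extensional_arb[of T "diagram lam" q] extensional_arb[of T' "diagram lam" q] unfolding ssyt_word_def by simp
  qed
qed

lemma finite_ssyt_word [simp, intro]: "finite (ssyt_word lam c)"
proof -
  have "ssyt_word lam c \<subseteq> diagram lam \<rightarrow>\<^sub>E c ` letters (sum_list lam)"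
  proof
    fix T assume T: "T \<in> ssyt_word lam c"
    obtain t where t: "t \<in> tableaux lam" "\<And>x. x \<in> letters (sum_list lam) \<Longrightarrow> T (t x) = c x"
      by (rule ssyt_wordD[OF T]) (rule that)
    have "T p \<in> c ` letters (sum_list lam)" if "p \<in> diagram lam" for p
      using tableauxD(4)[OF t(1) that] t(2) by force
    then show "T \<in> diagram lam \<rightarrow>\<^sub>E c ` letters (sum_list lam)"
      using T unfolding ssyt_word_def by (intro PiE_I) (auto simp: extensional_def)
  qed
  then show ?thesis by (rule finite_subset) (intro finite_PiE, auto)
qed

lemma specht_fixed_iff:
  "v \<in> fixed (word_stab (sum_list lam) c) (specht lam) \<longleftrightarrow>
    v \<in> fst (specht lam) \<and> (\<forall>\<sigma>\<in>word_stab (sum_list lam) c. \<forall>r. v (r \<circ> \<sigma>) = v r)"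
  by (auto simp: fixed_def specht_def fun_eq_iff)

text \<open>The basis theorem for invariants. Averages of polytabloids give the existence half by
  triangularity in \<open>word_weight\<close>, the Garnir relations the uniqueness half. The third
  conclusion keeps the latter for the whole Garnir kernel, which later forces the kernel to be the
  Specht module.\<close>

theorem specht_interpolation:
  assumes lam: "lam \<in> partitions m"
  obtains p where "inj_on p (ssyt_word lam c)"
    and "interpolating (fixed (word_stab (sum_list lam) c) (specht lam)) (p ` ssyt_word lam c)"
    and "\<forall>v\<in>garnir_kernel lam. (\<forall>\<sigma>\<in>word_stab (sum_list lam) c. \<forall>r. v (r \<circ> \<sigma>) = v r) \<longrightarrow>
      (\<forall>T\<in>ssyt_word lam c. v (p T) = 0) \<longrightarrow> v = 0"
proof -
  let ?S = "ssyt_word lam c" and ?W = "word_stab (sum_list lam) c"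
  let ?V = "fixed ?W (specht lam)"
  have "\<forall>T\<in>?S. \<exists>t\<in>tableaux lam. \<forall>x\<in>letters (sum_list lam). T (t x) = c x"
  proof
    fix T assume T: "T \<in> ?S"
    show "\<exists>t\<in>tableaux lam. \<forall>x\<in>letters (sum_list lam). T (t x) = c x" by (rule ssyt_wordD[OF T]) blast
  qed
  then obtain t where t: "\<And>T. T \<in> ?S \<Longrightarrow> t T \<in> tableaux lam"
      "\<And>T x. T \<in> ?S \<Longrightarrow> x \<in> letters (sum_list lam) \<Longrightarrow> T (t T x) = c x" by metis
  define p where "p T = tabloid lam (t T)" for T
  define w where "w T = (\<Sum>\<sigma>\<in>?W. snd (specht lam) \<sigma> (polytabloid lam (t T)))" for T
  note sub = subspace_fixed(1)[OF representation_specht word_stab_subset, of lam c]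
  have e_in: "polytabloid lam (t T) \<in> fst (specht lam)" if "T \<in> ?S" for T
    unfolding specht_def fst_conv using t(1)[OF that] by (intro cfun.span_base) auto
  have wV: "w T \<in> ?V" if "T \<in> ?S" for T
    unfolding w_def
    by (rule fixed_average[OF sym_group_is_group representation_specht subgroup_word_stab finite_word_stab e_in[OF that]])
  have w_eq: "w T r = (\<Sum>\<sigma>\<in>?W. polytabloid lam (t T) (r \<circ> \<sigma>))" for T r
    by (simp add: w_def sum_fun_apply specht_def)
  have e_supp: "word_weight lam c r < word_weight lam c (p T) \<or> r = p T"
    if T: "T \<in> ?S" and nz: "polytabloid lam (t T) r \<noteq> 0" for T r
  proof -
    obtain \<sigma> where "\<sigma> \<in> column_stabilizer lam (t T)" "r = tabloid lam (t T \<circ> \<sigma>)"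
      by (rule polytabloid_support[OF nz]) (rule that)
    then show ?thesis using word_weight_column_permutation[OF lam T t(1)[OF T] t(2)[OF T]] unfolding p_def by blast
  qed
  have nz: "w T (p T) \<noteq> 0" if T: "T \<in> ?S" for T
  proof -
    \<comment> \<open>No cancellation occurs in the average: the stabilizer preserves weights, and
      \<open>p T\<close> is the only tabloid of its weight in the support of its polytabloid, with
      coefficient 1.\<close>
    have "polytabloid lam (t T) (p T \<circ> \<sigma>) = (if p T \<circ> \<sigma> = p T then 1 else 0)" if s: "\<sigma> \<in> ?W" for \<sigma>
      using e_supp[OF T, of "p T \<circ> \<sigma>"] word_weight_word_stab[OF s, of "p T"] polytabloid_self[OF t(1)[OF T]]
      by (auto simp: p_def)
    then have "w T (p T) = (\<Sum>\<sigma>\<in>?W. if p T \<circ> \<sigma> = p T then 1 else 0)"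
      unfolding w_eq by (intro sum.cong) auto
    also have "\<dots> = of_nat (card {\<sigma> \<in> ?W. p T \<circ> \<sigma> = p T})"
      by (simp add: sum.inter_filter[OF finite_word_stab, symmetric])
    finally have "w T (p T) = of_nat (card {\<sigma> \<in> ?W. p T \<circ> \<sigma> = p T})" .
    moreover have "id \<in> {\<sigma> \<in> ?W. p T \<circ> \<sigma> = p T}" by (simp add: word_stab_def permutes_id)
    moreover have "finite {\<sigma> \<in> ?W. p T \<circ> \<sigma> = p T}" using finite_word_stab by (rule finite_subset[rotated]) auto
    ultimately have "card {\<sigma> \<in> ?W. p T \<circ> \<sigma> = p T} \<noteq> 0" "w T (p T) = of_nat (card {\<sigma> \<in> ?W. p T \<circ> \<sigma> = p T})"
      by (auto simp only: card_0_eq)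
    then show ?thesis by simp
  qed
  have tri: "word_weight lam c (p T') < word_weight lam c (p T) \<or> T' = T"
    if T: "T \<in> ?S" and T': "T' \<in> ?S" and wnz: "w T (p T') \<noteq> 0" for T T'
  proof -
    obtain \<sigma> where s: "\<sigma> \<in> ?W" "polytabloid lam (t T) (p T' \<circ> \<sigma>) \<noteq> 0"
      using wnz unfolding w_eq by (rule sum.not_neutral_contains_not_neutral)
    from e_supp[OF T s(2)] show ?thesis
    proof
      assume "p T' \<circ> \<sigma> = p T"
      then have "T = T'" unfolding p_def
        by (intro ssyt_word_unique[OF T T' t(1)[OF T] t(2)[OF T] t(1)[OF T'] t(2)[OF T'] s(1)])
      then show ?thesis by simp
    qed (simp add: word_weight_word_stab[OF s(1)])
  qed
  have exist: "\<exists>v\<in>?V. \<forall>T\<in>?S. v (p T) = \<phi> T" for \<phi>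
    by (rule triangular_interpolation[where w = w and \<Phi> = "\<lambda>T. word_weight lam c (p T)"])
      (use sub wV nz tri in auto)
  have inj: "inj_on p ?S"
  proof (rule inj_onI)
    fix T T' assume T: "T \<in> ?S" "T' \<in> ?S" "p T = p T'"
    then have "w T (p T') \<noteq> 0" using nz by metis
    then show "T = T'" using tri[OF T(1,2)] T(3) by auto
  qed
  have ker: "v = 0" if v: "v \<in> garnir_kernel lam" "\<And>\<sigma> r. \<sigma> \<in> ?W \<Longrightarrow> v (r \<circ> \<sigma>) = v r" "\<And>T. T \<in> ?S \<Longrightarrow> v (p T) = 0" for v
    by (rule garnir_kernel_eq_0[OF lam v(1,2)]) (use t v(3) p_def in auto)
  have "interpolating ?V (p ` ?S)"
    unfolding interpolating_def
  proof (intro conjI ballI impI allI)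
    fix v assume v: "v \<in> ?V" "\<forall>x\<in>p ` ?S. v x = 0"
    then show "v = 0"
      using ker[of v] specht_subset_garnir_kernel[OF lam] by (auto simp: specht_fixed_iff)
  next
    fix \<phi> :: "_ \<Rightarrow> complex"
    show "\<exists>v\<in>?V. \<forall>x\<in>p ` ?S. v x = \<phi> x" using exist[of "\<lambda>T. \<phi> (p T)"] by auto
  qed (use sub in auto)
  moreover have "\<forall>v\<in>garnir_kernel lam. (\<forall>\<sigma>\<in>?W. \<forall>r. v (r \<circ> \<sigma>) = v r) \<longrightarrow> (\<forall>T\<in>?S. v (p T) = 0) \<longrightarrow> v = 0"
    using ker by blast
  ultimately show thesis by (rule that[OF inj])
qed

corollary dim_fixed_specht:
  assumes "lam \<in> partitions m"
  shows "cfun.dim (fixed (word_stab (sum_list lam) c) (specht lam)) = card (ssyt_word lam c)"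
proof -
  obtain p where "inj_on p (ssyt_word lam c)"
    "interpolating (fixed (word_stab (sum_list lam) c) (specht lam)) (p ` ssyt_word lam c)"
    by (rule specht_interpolation[OF assms]) (rule that)
  then show ?thesis using interpolating_dim card_image by metis
qed

text \<open>For the word with distinct letters the stabilizer is trivial. An element of the kernel
  and the Specht vector with the same values at the points then differ by an element of the kernel
  vanishing at all points, hence not at all.\<close>

corollary specht_eq_garnir_kernel:
  assumes lam: "lam \<in> partitions m"
  shows "fst (specht lam) = garnir_kernel lam"
proof
  show "garnir_kernel lam \<subseteq> fst (specht lam)"
  proof
    fix v assume v: "v \<in> garnir_kernel lam"
    let ?c = "\<lambda>x :: nat. x"
    obtain p where "inj_on p (ssyt_word lam ?c)"
      and p: "interpolating (fixed (word_stab (sum_list lam) ?c) (specht lam)) (p ` ssyt_word lam ?c)"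
      and ker: "\<forall>v\<in>garnir_kernel lam. (\<forall>\<sigma>\<in>word_stab (sum_list lam) ?c. \<forall>r. v (r \<circ> \<sigma>) = v r) \<longrightarrow>
        (\<forall>T\<in>ssyt_word lam ?c. v (p T) = 0) \<longrightarrow> v = 0"
      by (rule specht_interpolation[OF lam, of ?c]) (rule that)
    obtain u where u: "u \<in> fixed (word_stab (sum_list lam) ?c) (specht lam)" "\<forall>x\<in>p ` ssyt_word lam ?c. u x = v x"
      using interpolatingD(4)[OF p, of v] by blast
    have id: "\<sigma> = id" if "\<sigma> \<in> word_stab (sum_list lam) ?c" for \<sigma>
    proof
      fix x show "\<sigma> x = id x"
        using that permutes_not_in[of \<sigma> "letters (sum_list lam)" x]
        by (cases "x \<in> letters (sum_list lam)") (auto simp: word_stab_def)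
    qed
    have uS: "u \<in> fst (specht lam)" using u(1) by (simp add: fixed_def)
    have "v - u = 0"
    proof (rule ker[rule_format])
      show "v - u \<in> garnir_kernel lam"
        using v uS specht_subset_garnir_kernel[OF lam] by (intro cfun.subspace_diff subspace_garnir_kernel) auto
      show "(v - u) (r \<circ> \<sigma>) = (v - u) r" if "\<sigma> \<in> word_stab (sum_list lam) ?c" for \<sigma> r
        using id[OF that] by simp
      show "(v - u) (p T) = 0" if "T \<in> ssyt_word lam ?c" for T using u(2) that by (simp add: minus_apply)
    qed
    then show "v \<in> fst (specht lam)" using uS by simp
  qed
qed (rule specht_subset_garnir_kernel[OF lam])

section \<open>Decomposition into Specht modules\<close>

lemma finite_partitions [simp, intro]: "finite (partitions m)"
proof (rule finite_subset)
  show "partitions m \<subseteq> {xs. set xs \<subseteq> {..m} \<and> length xs \<le> m}"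
    using partitionsD(1,3) member_le_sum_list by fastforce
qed (rule finite_lists_length_le, simp)

lemma dim_eq_0_iff:
  assumes "fin_dim_subspace V"
  shows "cfun.dim V = 0 \<longleftrightarrow> V = {0}"
proof -
  obtain X where X: "interpolating V X" using fin_dim_interpolating[OF assms] .
  show ?thesis
  proof
    assume "cfun.dim V = 0"
    then have "X = {}" using interpolating_dim[OF X] interpolatingD(2)[OF X] by simp
    then show "V = {0}" using interpolatingD(3)[OF X] cfun.subspace_0[OF interpolatingD(1)[OF X]] by auto
  next
    assume V: "V = {0}"
    have "X = {}"
    proof (rule ccontr)
      assume "X \<noteq> {}"
      then show False using interpolatingD(4)[OF X, of "\<lambda>_. 1"] V by (auto simp: zero_fun_apply)
    qed
    then show "cfun.dim V = 0" using interpolating_dim[OF X] by simp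
  qed
qed

text \<open>A block of \<open>s\<close> equal letters contributes \<open>s * 3 ^ s\<close>. The base
  3 serves the inequality \<open>(a + b) * 3 ^ a < Suc a * 3 ^ Suc a\<close> for
  \<open>b \<le> a\<close>, which compares two rows with one longer block.\<close>

definition block_stat :: "nat \<Rightarrow> (nat \<Rightarrow> nat) \<Rightarrow> nat"
  where "block_stat m c = (\<Sum>x\<in>letters m. 3 ^ card {y \<in> letters m. c y = c x})"

text \<open>The letters of \<open>F\<close> receive the value \<open>length lam\<close>, which
  \<open>r\<close> does not take. They form a block longer than row \<open>i\<close>, which alone
  outweighs the rows \<open>i\<close> and \<open>Suc i\<close>, while the other rows are
  unchanged.\<close>

lemma block_stat_garnir:
  assumes lam: "lam \<in> partitions m" and idx: "garnir_index lam i r F"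
  shows "block_stat (sum_list lam) r < block_stat (sum_list lam) (\<lambda>x. if x \<in> F then length lam else r x)"
proof -
  define L where "L = letters (sum_list lam)"
  define R where "R = {x \<in> L. r x \<in> {i, Suc i}}"
  define a where "a = row_length lam i"
  define b where "b = row_length lam (Suc i)"
  define c where "c x = (if x \<in> F then length lam else r x)" for x
  have finL: "finite L" by (simp add: L_def)
  have r: "r \<in> tabloids lam" and FR: "F \<subseteq> R" and lt: "card (R - F) < b"
    using idx by (auto simp: garnir_index_def R_def L_def b_def)
  have finR: "finite R" and RL: "R \<subseteq> L" using finL by (auto simp: R_def)
  have ba: "b \<le> a" unfolding a_def b_def by (rule partitionsD(2)[OF lam]) simp
  have row: "card {y \<in> L. r y = j} = row_length lam j" for j using r by (simp add: tabloids_iff L_def)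
  have less: "r y < length lam" if "y \<in> L" for y using tabloids_less[OF r] that by (simp add: L_def)
  have "R = {y \<in> L. r y = i} \<union> {y \<in> L. r y = Suc i}" "{y \<in> L. r y = i} \<inter> {y \<in> L. r y = Suc i} = {}"
    by (auto simp: R_def)
  then have cardR: "card R = a + b"
    using card_Un_disjoint[of "{y \<in> L. r y = i}" "{y \<in> L. r y = Suc i}"] finL row by (auto simp: a_def b_def)
  have "card R = card F + card (R - F)"
    using card_Un_disjoint[of F "R - F"] FR finR by (auto simp: finite_subset Un_absorb1)
  then have cardF: "Suc a \<le> card F" using lt cardR by simp
  have split: "(\<Sum>x\<in>L. g x) = (\<Sum>x\<in>R. g x) + (\<Sum>x\<in>L - R. g x)" for g :: "nat \<Rightarrow> nat"
    using sum.subset_diff[OF RL finL, of g] by simp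
  have same: "{y \<in> L. c y = c x} = {y \<in> L. r y = r x}" if x: "x \<in> L - R" for x
  proof -
    have "c y = c x \<longleftrightarrow> r y = r x" if "y \<in> L" for y
      using x FR less[of x] that unfolding c_def R_def by auto
    then show ?thesis by auto
  qed
  have "(\<Sum>x\<in>R. 3 ^ card {y \<in> L. r y = r x}) \<le> (\<Sum>x\<in>R. 3 ^ a :: nat)"
    by (rule sum_mono, rule power_increasing) (use ba row in \<open>auto simp: R_def a_def b_def\<close>)
  also have "\<dots> = (a + b) * 3 ^ a" by (simp add: cardR)
  also have "\<dots> < Suc a * 3 ^ Suc a" using ba by (simp add: algebra_simps add_strict_increasing)
  also have "\<dots> \<le> card F * 3 ^ card F" using cardF by (intro mult_mono power_increasing) auto
  also have "\<dots> = (\<Sum>x\<in>F. 3 ^ card {y \<in> L. c y = c x})"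
  proof -
    have "{y \<in> L. c y = c x} = F" if "x \<in> F" for x
    proof -
      have "c y = c x \<longleftrightarrow> y \<in> F" if "y \<in> L" for y using \<open>x \<in> F\<close> less[OF that] by (simp add: c_def)
      then show ?thesis using FR RL by auto
    qed
    then show ?thesis by simp
  qed
  also have "\<dots> \<le> (\<Sum>x\<in>R. 3 ^ card {y \<in> L. c y = c x})" by (rule sum_mono2[OF finR FR]) simp
  finally have "(\<Sum>x\<in>R. 3 ^ card {y \<in> L. r y = r x}) < (\<Sum>x\<in>R. 3 ^ card {y \<in> L. c y = c x} :: nat)" .
  then have "(\<Sum>x\<in>L. 3 ^ card {y \<in> L. r y = r x}) < (\<Sum>x\<in>L. 3 ^ card {y \<in> L. c y = c x} :: nat)"
    unfolding split using same by simp
  then show ?thesis by (simp add: block_stat_def L_def c_def[abs_def])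
qed

text \<open>Renaming the letters of a word in the order of decreasing multiplicity makes it a
  tabloid with the same fibres, hence with the same stabilizer and the same
  \<open>block_stat\<close>.\<close>

lemma sorted_blocks:
  fixes c :: "nat \<Rightarrow> nat"
  obtains lam r where "lam \<in> partitions m" "r \<in> tabloids lam"
    and "\<And>x y. x \<in> letters m \<Longrightarrow> y \<in> letters m \<Longrightarrow> r x = r y \<longleftrightarrow> c x = c y"
proof -
  define N where "N j = card {x \<in> letters m. c x = j}" for j
  \<comment> \<open>Sorting is ascending, so the multiplicities are subtracted from their bound
    \<open>m\<close> to obtain decreasing order.\<close>
  define js where "js = sort_key (\<lambda>j. m - N j) (sorted_list_of_set (c ` letters m))"
  define lam where "lam = map N js"
  have js: "set js = c ` letters m" "distinct js" "sorted (map (\<lambda>j. m - N j) js)" by (simp_all add: js_def)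
  have N_le: "N j \<le> m" for j unfolding N_def using card_mono[of "letters m" "{x \<in> letters m. c x = j}"] by auto
  have N_pos: "N j > 0" if "j \<in> set js" for j using that by (auto simp: N_def js card_gt_0_iff)
  have "sum_list lam = (\<Sum>j\<in>c ` letters m. N j)"
    unfolding lam_def using js by (simp add: sum_list_distinct_conv_sum_set)
  also have "\<dots> = (\<Sum>j\<in>c ` letters m. \<Sum>x | x \<in> letters m \<and> c x = j. 1)" by (simp add: N_def)
  also have "\<dots> = m" using sum.image_gen[of "letters m" "\<lambda>_. 1 :: nat" c] by simp
  finally have sum: "sum_list lam = m" .
  have "sorted_wrt (\<ge>) lam"
    unfolding sorted_wrt_iff_nth_less
  proof (intro allI impI)
    fix i j assume ij: "i < j" "j < length lam"
    then have "m - N (js ! i) \<le> m - N (js ! j)"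
      using sorted_nth_mono[OF js(3), of i j] by (simp add: lam_def)
    then show "lam ! j \<le> lam ! i" using N_le[of "js ! i"] N_le[of "js ! j"] ij by (simp add: lam_def)
  qed
  then have lam: "lam \<in> partitions m" using sum N_pos by (force simp: partitions_def lam_def)
  have "\<forall>x\<in>letters m. \<exists>i<length js. js ! i = c x" using js(1) by (auto simp: in_set_conv_nth[symmetric])
  then obtain r0 where r0: "\<And>x. x \<in> letters m \<Longrightarrow> r0 x < length js" "\<And>x. x \<in> letters m \<Longrightarrow> js ! r0 x = c x" by metis
  define r where "r = restrict r0 (letters m)"
  have r_iff: "r x = i \<longleftrightarrow> i < length js \<and> c x = js ! i" if "x \<in> letters m" for x i
    using r0[OF that] that js(2) by (auto simp: r_def nth_eq_iff_index_eq)
  have "card {x \<in> letters m. r x = i} = row_length lam i" for i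
  proof (cases "i < length js")
    case True
    then have "{x \<in> letters m. r x = i} = {x \<in> letters m. c x = js ! i}" using r_iff by auto
    then show ?thesis using True by (simp add: row_length_def lam_def N_def)
  next
    case False
    then have "{x \<in> letters m. r x = i} = {}" using r_iff by auto
    then show ?thesis using False by (simp add: row_length_def lam_def)
  qed
  then have "r \<in> tabloids lam" by (simp add: tabloids_iff sum r_def)
  moreover have "r x = r y \<longleftrightarrow> c x = c y" if "x \<in> letters m" "y \<in> letters m" for x y
  proof
    assume "r x = r y"
    then show "c x = c y" using r0(2)[OF that(1)] r0(2)[OF that(2)] that by (simp add: r_def)
  next
    assume "c x = c y"
    then show "r x = r y" using r_iff[OF that(1), of "r y"] r_iff[OF that(2), of "r y"] by simp
  qed
  ultimately show thesis using that[OF lam] by blast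
qed

lemma word_stab_cong:
  assumes "\<And>x y. x \<in> letters m \<Longrightarrow> y \<in> letters m \<Longrightarrow> r x = r y \<longleftrightarrow> c x = c y"
  shows "word_stab m r = word_stab m c"
  unfolding word_stab_def using assms permutes_letters(1) by blast

lemma block_stat_cong:
  assumes "\<And>x y. x \<in> letters m \<Longrightarrow> y \<in> letters m \<Longrightarrow> r x = r y \<longleftrightarrow> c x = c y"
  shows "block_stat m r = block_stat m c"
  unfolding block_stat_def
  by (intro sum.cong refl arg_cong[of _ _ "\<lambda>A. 3 ^ card A"]) (use assms in auto)

lemma block_stat_less: "block_stat m c < Suc (m * 3 ^ m)"
proof -
  have "card {y \<in> letters m. c y = c x} \<le> m" for x
    using card_mono[of "letters m" "{y \<in> letters m. c y = c x}"] by auto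
  then have "block_stat m c \<le> (\<Sum>x\<in>letters m. 3 ^ m)"
    unfolding block_stat_def by (intro sum_mono power_increasing) auto
  then show ?thesis by simp
qed

lemma word_stab_id: "word_stab m (\<lambda>x. x) = {id}"
proof -
  have "\<sigma> = id" if "\<sigma> \<in> word_stab m (\<lambda>x. x)" for \<sigma>
  proof
    fix x show "\<sigma> x = id x"
      using that permutes_not_in[of \<sigma> "letters m" x] by (cases "x \<in> letters m") (auto simp: word_stab_def)
  qed
  then show ?thesis by (auto simp: word_stab_def permutes_id)
qed

lemma fixed_word_stab_id:
  assumes "representation (sym_group m) W"
  shows "fixed (word_stab m (\<lambda>x. x)) W = fst W"
  using representationD(4)[OF assms] by (auto simp: fixed_def word_stab_id sym_group_one)

text \<open>The word with distinct letters has trivial stabilizer, so a nonzero \<open>W\<close> has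
  nonzero invariants for some word; the bound on \<open>block_stat\<close> provides a maximal
  one.\<close>

lemma maximal_tabloid:
  assumes W: "representation (sym_group m) W" and nz: "fst W \<noteq> {0}"
  obtains lam r where "lam \<in> partitions m" "r \<in> tabloids lam" "fixed (word_stab m r) W \<noteq> {0}"
    and "\<And>c :: nat \<Rightarrow> nat. block_stat m r < block_stat m c \<Longrightarrow> fixed (word_stab m c) W = {0}"
proof -
  let ?P = "\<lambda>c :: nat \<Rightarrow> nat. fixed (word_stab m c) W \<noteq> {0}"
  have "?P (\<lambda>x. x)" using fixed_word_stab_id[OF W] nz by simp
  then obtain c where c: "?P c" "\<And>c'. ?P c' \<Longrightarrow> block_stat m c' \<le> block_stat m c"
    using ex_has_greatest_nat[of ?P "\<lambda>x. x" "block_stat m" "Suc (m * 3 ^ m)"] block_stat_less by blast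
  obtain lam r where lr: "lam \<in> partitions m" "r \<in> tabloids lam"
    "\<And>x y. x \<in> letters m \<Longrightarrow> y \<in> letters m \<Longrightarrow> r x = r y \<longleftrightarrow> c x = c y" by (rule sorted_blocks[of m c]) (rule that)
  show thesis
  proof (rule that[OF lr(1,2)])
    show "fixed (word_stab m r) W \<noteq> {0}" using c(1) word_stab_cong[OF lr(3)] by simp
    fix c' :: "nat \<Rightarrow> nat" assume "block_stat m r < block_stat m c'"
    then show "fixed (word_stab m c') W = {0}" using c(2)[of c'] block_stat_cong[OF lr(3)] by auto
  qed
qed

text \<open>Column strictness makes each entry at least its row index. The sum of row indices thus
  stands in for the dominance order: it bounds the sum of the letters from below, and equality
  forces each row to be filled with its index.\<close>

lemma ssyt_word_sum:
  assumes lam: "lam \<in> partitions m" and T: "T \<in> ssyt_word lam c"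
  shows "(\<Sum>p\<in>diagram lam. fst p) \<le> (\<Sum>x\<in>letters (sum_list lam). c x)"
    and "(\<Sum>p\<in>diagram lam. fst p) = (\<Sum>x\<in>letters (sum_list lam). c x) \<Longrightarrow> T = restrict fst (diagram lam)"
proof -
  obtain t where t: "t \<in> tableaux lam" "\<And>x. x \<in> letters (sum_list lam) \<Longrightarrow> T (t x) = c x"
    by (rule ssyt_wordD[OF T]) (rule that)
  have bij: "bij_betw t (letters (sum_list lam)) (diagram lam)" using t(1) by (simp add: tableaux_iff)
  have sum: "(\<Sum>x\<in>letters (sum_list lam). c x) = (\<Sum>p\<in>diagram lam. T p)"
    using sum.reindex_bij_betw[OF bij, of T] t(2) by simp
  have cols: "\<forall>i j. (i, j) \<in> diagram lam \<and> (Suc i, j) \<in> diagram lam \<longrightarrow> T (i, j) < T (Suc i, j)"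
    using T by (simp add: ssyt_word_def)
  have "i \<le> T (i, j)" if "(i, j) \<in> diagram lam" for i j
    using that
  proof (induction i)
    case (Suc i)
    then have "(i, j) \<in> diagram lam" using partitionsD(2)[OF lam, of i "Suc i"] by (auto simp: diagram_iff)
    then have "i \<le> T (i, j)" "T (i, j) < T (Suc i, j)" using Suc cols by auto
    then show ?case by simp
  qed simp
  then have le: "fst p \<le> T p" if "p \<in> diagram lam" for p using that by (cases p) auto
  show "(\<Sum>p\<in>diagram lam. fst p) \<le> (\<Sum>x\<in>letters (sum_list lam). c x)" unfolding sum using le by (rule sum_mono)
  assume "(\<Sum>p\<in>diagram lam. fst p) = (\<Sum>x\<in>letters (sum_list lam). c x)"
  then have "\<forall>p\<in>diagram lam. T p = fst p"
    using sum_mono_inv[of "\<lambda>p. fst p" "diagram lam" T] le unfolding sum by fastforce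
  then show "T = restrict fst (diagram lam)" using T by (auto simp: ssyt_word_def extensional_def fun_eq_iff)
qed

lemma sum_tabloid:
  assumes "r \<in> tabloids lam"
  shows "(\<Sum>x\<in>letters (sum_list lam). r x) = (\<Sum>p\<in>diagram lam. fst p)"
proof -
  obtain t where t: "t \<in> tableaux lam" "r = tabloid lam t" using assms by (auto simp: tabloids_def)
  have bij: "bij_betw t (letters (sum_list lam)) (diagram lam)" using t(1) by (simp add: tableaux_iff)
  show ?thesis using sum.reindex_bij_betw[OF bij, of fst] by (simp add: t(2) tabloid_apply)
qed

text \<open>The equality case of the preceding bound: a Kostka number whose content equals its shape
  is at most 1.\<close>

lemma ssyt_word_tabloid:
  assumes lam: "lam \<in> partitions m" and r: "r \<in> tabloids lam"
  shows "ssyt_word lam r \<subseteq> {restrict fst (diagram lam)}"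
  using ssyt_word_sum(2)[OF lam] sum_tabloid[OF r] by auto

lemma tabloid_word_stab:
  assumes "r \<in> tabloids lam"
  shows "\<sigma> \<in> word_stab (sum_list lam) r \<longleftrightarrow> \<sigma> permutes letters (sum_list lam) \<and> r \<circ> \<sigma> = r"
proof -
  have "(r \<circ> \<sigma>) x = r x" if "\<sigma> permutes letters (sum_list lam)" "x \<notin> letters (sum_list lam)" for x
    using permutes_not_in[OF that] by simp
  then show ?thesis unfolding word_stab_def fun_eq_iff by auto
qed

text \<open>Averaging over the stabilizer of a tabloid \<open>r\<close> does not change the value at \<open>r\<close>, so every
  nonzero submodule of a Specht module contains nonzero invariants of such a stabilizer. These form a
  line in the Specht module.\<close>

lemma specht_irreducible:
  assumes lam: "lam \<in> partitions m" and dec: "direct_decomposition (sym_group (sum_list lam)) (specht lam) A B"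
  shows "A = {0} \<or> B = {0}"
proof (rule ccontr)
  assume no: "\<not> (A = {0} \<or> B = {0})"
  let ?G = "sym_group (sum_list lam)"
  note R = representation_specht[of lam]
  have inv: "invariant_subspace ?G (specht lam) A" "invariant_subspace ?G (specht lam) B" and int: "A \<inter> B = {0}"
    using dec by (auto simp: direct_decomposition_def)
  have ex: "\<exists>q\<in>tabloids lam. \<exists>a\<in>C. a q \<noteq> 0" if C: "invariant_subspace ?G (specht lam) C" "C \<noteq> {0}" for C
  proof -
    obtain a where a: "a \<in> C" "a \<noteq> 0" using C(2) cfun.subspace_0[OF invariant_subspaceD(1)[OF C(1)]] by auto
    then obtain q where q: "a q \<noteq> 0" by (auto simp: fun_eq_iff zero_fun_apply)
    have "a \<in> garnir_kernel lam" using a(1) invariant_subspaceD(2)[OF C(1)] specht_subset_garnir_kernel[OF lam] by auto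
    then have "q \<in> tabloids lam" using q by (auto simp: garnir_kernel_def)
    then show ?thesis using a q by blast
  qed
  obtain r where r: "r \<in> tabloids lam" using ex[OF inv(1)] no by blast
  let ?W = "word_stab (sum_list lam) r"
  have avg: "\<exists>u\<in>C. u \<in> fixed ?W (specht lam) \<and> u \<noteq> 0" if C: "invariant_subspace ?G (specht lam) C" "C \<noteq> {0}" for C
  proof -
    obtain q a where q: "q \<in> tabloids lam" "a \<in> C" "a q \<noteq> 0" using ex[OF C] by blast
    obtain \<sigma> where s: "\<sigma> permutes letters (sum_list lam)" "q = r \<circ> \<sigma>" using tabloids_conjugate[OF r q(1)] .
    define b where "b = snd (specht lam) \<sigma> a"
    have b: "b \<in> C" unfolding b_def using s(1) q(2) by (intro invariant_subspaceD(3)[OF C(1)]) (auto simp: carrier_sym_group)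
    have br: "b r = a q" by (simp add: b_def specht_def s(2))
    define u where "u = (\<Sum>h\<in>?W. snd (C, snd (specht lam)) h b)"
    have "u \<in> fixed ?W (C, snd (specht lam))"
      unfolding u_def
      by (rule fixed_average[OF sym_group_is_group representation_invariant_subspace[OF R C(1)] subgroup_word_stab
          finite_word_stab]) (use b in simp)
    then have u: "u \<in> C" "u \<in> fixed ?W (specht lam)" using invariant_subspaceD(2)[OF C(1)] by (auto simp: fixed_def)
    have "u r = (\<Sum>h\<in>?W. b (r \<circ> h))" by (simp add: u_def sum_fun_apply specht_def)
    also have "\<dots> = (\<Sum>h\<in>?W. b r)" by (intro sum.cong refl) (simp add: tabloid_word_stab[OF r])
    finally have "u r = of_nat (card ?W) * a q" by (simp add: br)
    moreover have "id \<in> ?W" by (simp add: word_stab_def permutes_id)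
    then have "card ?W \<noteq> 0" using finite_word_stab[of "sum_list lam" r] by (auto simp: card_eq_0_iff)
    ultimately have "u r \<noteq> 0" using q(3) by simp
    then have "u \<noteq> 0" by (auto simp: zero_fun_apply)
    then show ?thesis using u by blast
  qed
  obtain a where a: "a \<in> A" "a \<in> fixed ?W (specht lam)" "a \<noteq> 0" using avg[OF inv(1)] no by blast
  obtain b where b: "b \<in> B" "b \<in> fixed ?W (specht lam)" "b \<noteq> 0" using avg[OF inv(2)] no by blast
  obtain p where "inj_on p (ssyt_word lam r)" and p: "interpolating (fixed ?W (specht lam)) (p ` ssyt_word lam r)"
    by (rule specht_interpolation[OF lam, of r]) (rule that)
  define x where "x = p (restrict fst (diagram lam))"
  have X: "y = x" if "y \<in> p ` ssyt_word lam r" for y using that ssyt_word_tabloid[OF lam r] by (auto simp: x_def)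
  \<comment> \<open>Both sides are invariants agreeing at the only possible interpolation point; the
    common vector lies in both summands.\<close>
  have "fscale (a x) b = fscale (b x) a"
    by (rule interpolating_eq[OF p])
      (use a b X in \<open>auto intro!: cfun.subspace_scale[OF interpolatingD(1)[OF p]] simp: fscale_apply\<close>)
  moreover have "fscale (b x) a \<in> A" "fscale (a x) b \<in> B"
    using a(1) b(1) invariant_subspaceD(1)[OF inv(1)] invariant_subspaceD(1)[OF inv(2)] by (simp_all add: cfun.subspace_scale)
  ultimately have "fscale (a x) b \<in> A \<inter> B" by simp
  then have "fscale (a x) b = 0" using int by simp
  then have "a x = 0" using b(3) by (auto simp: fun_eq_iff pointwise)
  then have "a = 0" using X by (intro interpolatingD(3)[OF p a(2)]) auto
  then show False using a(3) by simp
qed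

text \<open>For an invariant \<open>w\<close> of the stabilizer of \<open>r\<close> consider the homomorphism \<open>f\<close> from the
  tabloid module that sends \<open>r\<close> to a multiple of \<open>w\<close>. By maximality it kills the indicator functions of the
  Garnir sets, i.e. its coordinates lie in the Garnir kernel, which is the Specht module. A coordinate
  which vanishes on the Specht module is therefore orthogonal to its own conjugate.\<close>

lemma specht_embeds:
  fixes W :: "(nat \<Rightarrow> nat, 'a) rep"
  assumes lam: "lam \<in> partitions m" and r: "r \<in> tabloids lam" and W: "representation (sym_group m) W"
    and nz: "fixed (word_stab m r) W \<noteq> {0}"
    and max: "\<And>c :: nat \<Rightarrow> nat. block_stat m r < block_stat m c \<Longrightarrow> fixed (word_stab m c) W = {0}"
  obtains U U' where "direct_decomposition (sym_group m) W U U'" "rep_iso (sym_group m) (specht lam) (U, snd W)" "U \<noteq> {0}"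
proof -
  have m: "sum_list lam = m" using partitionsD(1)[OF lam] .
  let ?G = "sym_group m"
  define S where "S = carrier ?G"
  have S: "\<sigma> \<in> S \<longleftrightarrow> \<sigma> permutes letters m" for \<sigma> by (simp add: S_def carrier_sym_group)
  have finS: "finite S" by (simp add: S_def finite_carrier_sym_group)
  note WD = representationD[OF W]
  have RS: "representation ?G (specht lam)" using representation_specht[of lam] m by simp
  obtain w where w: "w \<in> fixed (word_stab m r) W" "w \<noteq> 0"
    using nz cfun.subspace_0[OF subspace_fixed(1)[OF W word_stab_subset]] by blast
  have wW: "w \<in> fst W" using w(1) by (simp add: fixed_def)
  have sW: "snd W \<sigma> v \<in> fst W" if "\<sigma> \<in> S" "v \<in> fst W" for \<sigma> v using WD(6) that by (simp add: S_def)
  \<comment> \<open>Summing over the whole group instead of cosets sends the indicator function of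
    \<open>r\<close> to \<open>w\<close> times the order of the stabilizer of
    \<open>r\<close>.\<close>
  define f where "f v = (\<Sum>\<sigma>\<in>S. fscale (v (r \<circ> inv' \<sigma>)) (snd W \<sigma> w))" for v :: "(nat \<Rightarrow> nat) \<Rightarrow> complex"
  have f_in: "f v \<in> fst W" for v
    unfolding f_def by (intro cfun.subspace_sum[OF WD(2)] cfun.subspace_scale[OF WD(2)] sW wW)
  have f_add: "f (u + v) = f u + f v" and f_scale: "f (fscale k v) = fscale k (f v)" for u v k
    by (simp_all add: f_def pointwise cfun.scale_left_distrib sum.distrib cfun.scale_sum_right)
  have f_equiv: "f (\<lambda>q. v (q \<circ> \<tau>)) = snd W \<tau> (f v)" if t: "\<tau> \<in> S" for \<tau> v
  proof -
    have tp: "\<tau> permutes letters m" using t S by simp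
    have bij: "bij_betw ((\<circ>) \<tau>) S S"
    proof (rule bij_betw_byWitness[where f' = "(\<circ>) (inv' \<tau>)"])
      show "(\<circ>) \<tau> ` S \<subseteq> S" "(\<circ>) (inv' \<tau>) ` S \<subseteq> S"
        using tp permutes_letters(5)[OF tp] S by (auto intro: permutes_compose)
    qed (simp_all add: o_assoc permutes_letters(8,9)[OF tp])
    have "f (\<lambda>q. v (q \<circ> \<tau>)) = (\<Sum>\<sigma>\<in>S. fscale (v (r \<circ> inv' (\<tau> \<circ> \<sigma>) \<circ> \<tau>)) (snd W (\<tau> \<circ> \<sigma>) w))"
      unfolding f_def by (rule sum.reindex_bij_betw[OF bij, symmetric])
    also have "\<dots> = (\<Sum>\<sigma>\<in>S. snd W \<tau> (fscale (v (r \<circ> inv' \<sigma>)) (snd W \<sigma> w)))"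
    proof (rule sum.cong[OF refl])
      fix \<sigma> assume s: "\<sigma> \<in> S"
      then have sp: "\<sigma> permutes letters m" using S by simp
      have "inv' (\<tau> \<circ> \<sigma>) \<circ> \<tau> = inv' \<sigma>"
        using o_inv_distrib[OF permutes_bij[OF tp] permutes_bij[OF sp]] permutes_letters(9)[OF tp] by (simp add: comp_assoc)
      then have "r \<circ> inv' (\<tau> \<circ> \<sigma>) \<circ> \<tau> = r \<circ> inv' \<sigma>" by (simp add: comp_assoc)
      moreover have "snd W (\<tau> \<circ> \<sigma>) w = snd W \<tau> (snd W \<sigma> w)"
        using WD(5)[of \<tau> \<sigma> w] t s wW by (simp add: S_def sym_group_mult)
      ultimately show "fscale (v (r \<circ> inv' (\<tau> \<circ> \<sigma>) \<circ> \<tau>)) (snd W (\<tau> \<circ> \<sigma>) w) =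
          snd W \<tau> (fscale (v (r \<circ> inv' \<sigma>)) (snd W \<sigma> w))"
        using linear_map_scale[OF WD(3) sW[OF s wW], of \<tau>] t by (simp add: S_def)
    qed
    also have "\<dots> = snd W \<tau> (f v)"
      unfolding f_def
      by (rule linear_map_sum[OF WD(3) WD(2), symmetric])
        (use t sW wW cfun.subspace_scale[OF WD(2)] in \<open>auto simp: S_def\<close>)
    finally show ?thesis .
  qed
  have kills: "f (\<lambda>q. if q \<in> garnir_set lam i r0 F then 1 else 0) = 0" if idx: "garnir_index lam i r0 F" for i r0 F
  proof -
    define E where "E = garnir_set lam i r0 F"
    \<comment> \<open>The letters of \<open>F\<close> get a new common value. The stabilizer of this
      word permutes the Garnir set, so the image of its indicator function is an invariant, and
      \<open>c\<close> is too concentrated to have nonzero ones.\<close>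
    define c where "c x = (if x \<in> F then length lam else r0 x)" for x
    have r0: "r0 \<in> tabloids lam" and F: "F \<subseteq> letters m" using idx by (auto simp: garnir_index_def m)
    \<comment> \<open>Maximality is known for \<open>r\<close>, while the Garnir set belongs to
      \<open>r0\<close>; the block sizes of a tabloid depend on its shape alone.\<close>
    have "block_stat m r = block_stat m r0"
    proof -
      have "card {y \<in> letters m. q y = q x} = row_length lam (q x)" if "q \<in> tabloids lam" for q x
        using that by (simp add: tabloids_iff m)
      then have "block_stat m r = (\<Sum>x\<in>letters m. 3 ^ row_length lam (r x))"
        "block_stat m r0 = (\<Sum>x\<in>letters m. 3 ^ row_length lam (r0 x))" using r r0 by (simp_all add: block_stat_def)
      then show ?thesis using sum_tabloid_eq[OF r r0, of "\<lambda>i. 3 ^ row_length lam i"] by (simp add: m)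
    qed
    also have "\<dots> < block_stat m c"
      using block_stat_garnir[OF lam idx] by (simp add: m c_def[abs_def])
    finally have zero: "fixed (word_stab m c) W = {0}" by (rule max)
    have cF: "x \<in> F \<longleftrightarrow> c x = length lam" if "x \<in> letters m" for x
      using tabloids_less[OF r0, of x] that by (auto simp: c_def m)
    have step: "q \<circ> h \<in> E" if q: "q \<in> E" and h: "h \<in> word_stab m c" for q h
    proof -
      have hp: "h permutes letters m" and hc: "\<And>x. x \<in> letters m \<Longrightarrow> c (h x) = c x"
        using h by (auto simp: word_stab_def)
      have hF: "h x \<in> F \<longleftrightarrow> x \<in> F" if "x \<in> letters m" for x
        using cF[OF that] cF[OF permutes_letters(1)[OF hp that]] hc[OF that] by simp
      have "q \<circ> h \<in> tabloids lam" using tabloids_permute[of h lam q] hp q by (simp add: m E_def garnir_set_def)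
      moreover have "(q \<circ> h) x = r0 x" if x: "x \<in> letters m - F" for x
      proof -
        have "h x \<in> letters m - F" using x hF permutes_letters(1)[OF hp] by auto
        then have "q (h x) = r0 (h x)" using q by (simp add: E_def garnir_set_def m)
        then show ?thesis using hc[of x] x hF[of x] by (simp add: c_def)
      qed
      moreover have "(q \<circ> h) x \<in> {i, Suc i}" if "x \<in> F" for x
      proof -
        have "h x \<in> F" using that F hF by auto
        then show ?thesis using q unfolding E_def garnir_set_def by simp
      qed
      ultimately show ?thesis by (simp add: E_def garnir_set_def m)
    qed
    have "snd W h (f (\<lambda>q. if q \<in> E then 1 else 0)) = f (\<lambda>q. if q \<in> E then 1 else 0)" if h: "h \<in> word_stab m c" for h
    proof -
      have hp: "h permutes letters m" using h by (simp add: word_stab_def)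
      have h': "inv' h \<in> word_stab m c"
        using subgroup.m_inv_closed[OF subgroup_word_stab h] subsetD[OF word_stab_subset h] by simp
      have "q \<circ> h \<in> E \<longleftrightarrow> q \<in> E" for q
      proof
        assume "q \<circ> h \<in> E"
        then have "q \<circ> h \<circ> inv' h \<in> E" by (rule step[OF _ h'])
        then show "q \<in> E" by (simp add: comp_assoc permutes_letters(8)[OF hp])
      qed (rule step[OF _ h])
      then show ?thesis using f_equiv[of h "\<lambda>q. if q \<in> E then 1 else 0"] hp S by simp
    qed
    then have "f (\<lambda>q. if q \<in> E then 1 else 0) \<in> fixed (word_stab m c) W" using f_in by (simp add: fixed_def)
    then show ?thesis using zero by (simp add: E_def)
  qed
  have f_nz: "\<exists>v\<in>fst (specht lam). f v \<noteq> 0"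
  proof (rule ccontr)
    assume "\<not> (\<exists>v\<in>fst (specht lam). f v \<noteq> 0)"
    then have f0: "f v = 0" if "v \<in> garnir_kernel lam" for v using that specht_eq_garnir_kernel[OF lam] by auto
    have "w a = 0" for a
    proof -
      define g where "g s = (\<Sum>\<sigma> | \<sigma> \<in> S \<and> r \<circ> inv' \<sigma> = s. snd W \<sigma> w a)" for s
      have rt: "r \<circ> inv' \<sigma> \<in> tabloids lam" if "\<sigma> \<in> S" for \<sigma>
        using that S permutes_letters(5)[of \<sigma> m] by (intro tabloids_permute r) (simp add: m)
      have f_g: "f v a = (\<Sum>s\<in>tabloids lam. v s * g s)" for v
      proof -
        have "f v a = (\<Sum>\<sigma>\<in>S. v (r \<circ> inv' \<sigma>) * snd W \<sigma> w a)" by (simp add: f_def sum_fun_apply fscale_apply)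
        also have "\<dots> = (\<Sum>s\<in>tabloids lam. \<Sum>\<sigma> | \<sigma> \<in> S \<and> r \<circ> inv' \<sigma> = s. v (r \<circ> inv' \<sigma>) * snd W \<sigma> w a)"
          by (rule sum.group[symmetric]) (use finS rt in auto)
        also have "\<dots> = (\<Sum>s\<in>tabloids lam. v s * g s)"
          unfolding g_def sum_distrib_left by (intro sum.cong) auto
        finally show ?thesis .
      qed
      have g0: "g s = 0" if "s \<notin> tabloids lam" for s
      proof -
        have "{\<sigma>. \<sigma> \<in> S \<and> r \<circ> inv' \<sigma> = s} = {}" using rt that by auto
        then show ?thesis by (simp only: g_def sum.empty)
      qed
      have gE: "(\<Sum>s\<in>garnir_set lam i r0 F. g s) = 0" if idx: "garnir_index lam i r0 F" for i r0 F
      proof -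
        let ?E = "garnir_set lam i r0 F"
        have "(\<Sum>s\<in>?E. g s) = (\<Sum>s\<in>tabloids lam. (if s \<in> ?E then 1 else 0) * g s)"
          using garnir_set_subset[of lam i r0 F]
          by (intro sum.mono_neutral_cong_left) auto
        also have "\<dots> = 0" using f_g[of "\<lambda>s. if s \<in> ?E then 1 else 0"] kills[OF idx] by (simp add: zero_fun_apply)
        finally show ?thesis .
      qed
      have "(\<lambda>s. cnj (g s)) \<in> garnir_kernel lam"
        unfolding garnir_kernel_def using g0 gE by (auto simp flip: cnj_sum)
      then have "f (\<lambda>s. cnj (g s)) a = 0" using f0 by (simp add: zero_fun_apply)
      then have "(\<Sum>s\<in>tabloids lam. cnj (g s) * g s) = 0" using f_g by simp
      moreover have "cnj (g s) * g s = of_real ((cmod (g s))\<^sup>2)" for s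
        using complex_norm_square[of "g s"] by (simp add: mult.commute)
      ultimately have "complex_of_real (\<Sum>s\<in>tabloids lam. (cmod (g s))\<^sup>2) = 0" by simp
      then have "(\<Sum>s\<in>tabloids lam. (cmod (g s))\<^sup>2) = 0" by (simp only: of_real_eq_0_iff)
      then have "\<forall>s\<in>tabloids lam. (cmod (g s))\<^sup>2 = 0" by (subst (asm) sum_nonneg_eq_0_iff) auto
      then have gr: "g r = 0" using r by simp
      \<comment> \<open>Only elements of the stabilizer of \<open>r\<close> contribute to
        \<open>g r\<close>, so it is a positive multiple of \<open>w a\<close>.\<close>
      have "snd W \<sigma> w = w" if "\<sigma> \<in> S" "r \<circ> inv' \<sigma> = r" for \<sigma>
      proof -
        have sp: "\<sigma> permutes letters m" using that S by simp
        have "r \<circ> \<sigma> = r \<circ> inv' \<sigma> \<circ> \<sigma>" using that(2) by simp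
        then have "r \<circ> \<sigma> = r" by (simp add: comp_assoc permutes_letters(9)[OF sp])
        then have "\<sigma> \<in> word_stab m r" using tabloid_word_stab[OF r, of \<sigma>] sp m by simp
        then show ?thesis using w(1) by (simp add: fixed_def)
      qed
      then have "g r = of_nat (card {\<sigma>. \<sigma> \<in> S \<and> r \<circ> inv' \<sigma> = r}) * w a" by (simp add: g_def)
      moreover have "id \<in> {\<sigma>. \<sigma> \<in> S \<and> r \<circ> inv' \<sigma> = r}" using S by (simp add: permutes_id inv_id)
      then have "card {\<sigma>. \<sigma> \<in> S \<and> r \<circ> inv' \<sigma> = r} \<noteq> 0" using finS by (auto simp: card_eq_0_iff)
      ultimately show "w a = 0" using gr by simp
    qed
    then show False using w(2) by (auto simp: fun_eq_iff zero_fun_apply)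
  qed
  have lin: "linear_map (fst (specht lam)) (fst W) f"
    using f_in f_add f_scale by (auto simp: linear_map_def)
  have equiv: "f (snd (specht lam) g v) = snd W g (f v)" if "g \<in> carrier ?G" for g v
    using f_equiv[of g v] that by (simp add: specht_def S_def)
  note RD = representationD[OF RS]
  define B where "B = {v \<in> fst (specht lam). f v = 0}"
  have "cfun.subspace B"
    using linear_map_zero[OF lin RD(2)] cfun.subspace_0[OF RD(2)] cfun.subspace_add[OF RD(2)] cfun.subspace_scale[OF RD(2)]
    by (auto simp: cfun.subspace_def B_def f_add f_scale)
  then have invB: "invariant_subspace ?G (specht lam) B"
    using RD(6) equiv linear_map_zero[OF WD(3) WD(2)] by (auto simp: invariant_subspace_def B_def)
  \<comment> \<open>Irreducibility is available only in terms of direct decompositions, so the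
    kernel of \<open>f\<close> is first given a complement.\<close>
  obtain A where dA: "direct_decomposition ?G (specht lam) B A"
    by (rule maschke[OF sym_group_is_group finite_carrier_sym_group RS invB])
  have "B = {0}"
  proof (rule ccontr)
    assume "B \<noteq> {0}"
    then have "A = {0}" using specht_irreducible[OF lam, of B A] dA m by auto
    then have "fst (specht lam) = B" using dA by (auto simp: direct_decomposition_def)
    then show False using f_nz by (auto simp: B_def)
  qed
  have inj: "inj_on f (fst (specht lam))"
  proof (rule inj_onI)
    fix u v assume uv: "u \<in> fst (specht lam)" "v \<in> fst (specht lam)" "f u = f v"
    then have "u - v \<in> B"
      using linear_map_diff[OF lin RD(2)] cfun.subspace_diff[OF RD(2)] by (simp add: B_def)
    then show "u = v" using \<open>B = {0}\<close> by simp
  qed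
  define U where "U = f ` fst (specht lam)"
  have invU: "invariant_subspace ?G W U"
    unfolding invariant_subspace_def U_def
  proof (intro conjI ballI)
    show "cfun.subspace (f ` fst (specht lam))" by (rule linear_map_image_subspace[OF lin RD(2)])
    fix g u assume "g \<in> carrier ?G" "u \<in> f ` fst (specht lam)"
    then show "snd W g u \<in> f ` fst (specht lam)" using equiv RD(6) by (auto simp flip: equiv)
  qed (use f_in in auto)
  have iso: "rep_iso ?G (specht lam) (U, snd W)"
    by (rule rep_isoI[OF RS representation_invariant_subspace[OF W invU], where T = f])
      (use lin inj equiv in \<open>auto simp: U_def linear_map_def bij_betw_def\<close>)
  obtain U' where U': "direct_decomposition ?G W U U'"
    by (rule maschke[OF sym_group_is_group finite_carrier_sym_group W invU])
  have "U \<noteq> {0}" using f_nz by (auto simp: U_def)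
  then show thesis using that[OF U' iso] by simp
qed

section \<open>Splitting off Specht modules\<close>

lemma dim_fixed_eq_0_iff:
  assumes "representation (sym_group m) W"
  shows "cfun.dim (fixed (word_stab m c) W) = 0 \<longleftrightarrow> fixed (word_stab m c) W = {0}"
  by (rule dim_eq_0_iff[OF subspace_fixed(2)[OF assms word_stab_subset]])

lemma direct_decompositionD:
  assumes W: "representation (sym_group m) W" and dec: "direct_decomposition (sym_group m) W U U'"
  shows "representation (sym_group m) (U, snd W)" "representation (sym_group m) (U', snd W)"
    "cfun.dim (fixed (word_stab m c) W) = cfun.dim (fixed (word_stab m c) (U, snd W)) + cfun.dim (fixed (word_stab m c) (U', snd W))"
    "U \<noteq> {0} \<Longrightarrow> cfun.dim U' < cfun.dim (fst W)"
proof -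
  show RU: "representation (sym_group m) (U, snd W)" and RU': "representation (sym_group m) (U', snd W)"
    using dec representation_invariant_subspace[OF W] by (auto simp: direct_decomposition_def)
  show *: "cfun.dim (fixed (word_stab m c) W) = cfun.dim (fixed (word_stab m c) (U, snd W)) + cfun.dim (fixed (word_stab m c) (U', snd W))" for c :: "nat \<Rightarrow> 'z"
    by (rule direct_decomposition_dim_fixed[OF W dec word_stab_subset])
  \<comment> \<open>For the word with distinct letters the invariants are the whole space, so
    additivity of their dimensions is additivity of dimension.\<close>
  show "cfun.dim U' < cfun.dim (fst W)" if "U \<noteq> {0}"
    using *[of "\<lambda>x. x"] fixed_word_stab_id[OF W] fixed_word_stab_id[OF RU] fixed_word_stab_id[OF RU']
      dim_eq_0_iff[OF representationD(1)[OF RU]] that by simp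
qed

text \<open>The shape \<open>lam\<close> is chosen by looking only at which invariants are zero, so
  the same Specht module splits off from both sides, and the complements again have invariants of
  equal dimensions.\<close>

theorem rep_iso_if_dim_fixed_eq:
  fixes W :: "(nat \<Rightarrow> nat, 'a) rep" and W' :: "(nat \<Rightarrow> nat, 'b) rep"
  assumes "representation (sym_group m) W" "representation (sym_group m) W'"
    and "\<And>c :: nat \<Rightarrow> nat. cfun.dim (fixed (word_stab m c) W) = cfun.dim (fixed (word_stab m c) W')"
  shows "rep_iso (sym_group m) W W'"
  using assms
proof (induction "cfun.dim (fst W)" arbitrary: W W' rule: less_induct)
  case less
  note W = less.prems(1) and W' = less.prems(2) and eq = less.prems(3)
  have eq_dim: "cfun.dim (fst W) = cfun.dim (fst W')"
    using eq[of "\<lambda>x. x"] fixed_word_stab_id[OF W] fixed_word_stab_id[OF W'] by simp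
  show ?case
  proof (cases "fst W = {0}")
    case True
    then have W'0: "fst W' = {0}"
      using eq_dim dim_eq_0_iff[OF representationD(1)[OF W]] dim_eq_0_iff[OF representationD(1)[OF W']] by simp
    have "snd W' g 0 = 0" if "g \<in> carrier (sym_group m)" for g
      using linear_map_zero[OF representationD(3)[OF W' that] representationD(2)[OF W']] .
    then show ?thesis
      by (intro rep_isoI[OF W W', where T = "\<lambda>_. 0"]) (auto simp: True W'0 linear_map_def bij_betw_def)
  next
    case False
    obtain lam r where lr: "lam \<in> partitions m" "r \<in> tabloids lam" "fixed (word_stab m r) W \<noteq> {0}"
      "\<And>c :: nat \<Rightarrow> nat. block_stat m r < block_stat m c \<Longrightarrow> fixed (word_stab m c) W = {0}"
      by (rule maximal_tabloid[OF W False]) (rule that)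
    have fix_eq: "fixed (word_stab m c) W = {0} \<longleftrightarrow> fixed (word_stab m c) W' = {0}" for c :: "nat \<Rightarrow> nat"
      using dim_fixed_eq_0_iff[OF W, of c] dim_fixed_eq_0_iff[OF W', of c] eq[of c] by simp
    obtain U U' where U: "direct_decomposition (sym_group m) W U U'" "rep_iso (sym_group m) (specht lam) (U, snd W)" "U \<noteq> {0}"
      by (rule specht_embeds[OF lr(1,2) W lr(3,4)])
    obtain Y Y' where Y: "direct_decomposition (sym_group m) W' Y Y'" "rep_iso (sym_group m) (specht lam) (Y, snd W')" "Y \<noteq> {0}"
      using lr(3,4) unfolding fix_eq by (rule specht_embeds[OF lr(1,2) W'])
    note UD = direct_decompositionD[OF W U(1)] and YD = direct_decompositionD[OF W' Y(1)]
    have iso1: "rep_iso (sym_group m) (U, snd W) (Y, snd W')" by (rule rep_iso_trans[OF rep_iso_sym[OF U(2)] Y(2)])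
    have "rep_iso (sym_group m) (U', snd W) (Y', snd W')"
    proof (rule less.hyps)
      show "cfun.dim (fst (U', snd W)) < cfun.dim (fst W)" using UD(4)[OF U(3)] by simp
      fix c :: "nat \<Rightarrow> nat"
      show "cfun.dim (fixed (word_stab m c) (U', snd W)) = cfun.dim (fixed (word_stab m c) (Y', snd W'))"
        using UD(3)[of c] YD(3)[of c] eq[of c] rep_iso_dim_fixed[OF iso1 word_stab_subset, of c] by simp
    qed (use UD YD in auto)
    then show ?thesis by (rule rep_iso_direct_decomposition[OF W W' U(1) Y(1) iso1])
  qed
qed

text \<open>The same splitting, recorded only numerically. It provides the candidates for the
  Littlewood-Richardson coefficients.\<close>

theorem specht_multiplicities:
  fixes W :: "(nat \<Rightarrow> nat, 'a) rep"
  assumes "representation (sym_group m) W"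
  shows "\<exists>d. \<forall>c :: nat \<Rightarrow> nat. cfun.dim (fixed (word_stab m c) W) = (\<Sum>nu\<in>partitions m. d nu * card (ssyt_word nu c))"
  using assms
proof (induction "cfun.dim (fst W)" arbitrary: W rule: less_induct)
  case less
  note W = less.prems
  show ?case
  proof (cases "fst W = {0}")
    case True
    have "fixed (word_stab m c) W = {0}" for c :: "nat \<Rightarrow> nat"
      using True cfun.subspace_0[OF subspace_fixed(1)[OF W word_stab_subset, of c]] by (auto simp: fixed_def)
    then have "cfun.dim (fixed (word_stab m c) W) = 0" for c :: "nat \<Rightarrow> nat" using dim_fixed_eq_0_iff[OF W] by blast
    then show ?thesis by (intro exI[of _ "\<lambda>_. 0"]) simp
  next
    case False
    obtain lam r where lr: "lam \<in> partitions m" "r \<in> tabloids lam" "fixed (word_stab m r) W \<noteq> {0}"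
      "\<And>c :: nat \<Rightarrow> nat. block_stat m r < block_stat m c \<Longrightarrow> fixed (word_stab m c) W = {0}"
      by (rule maximal_tabloid[OF W False]) (rule that)
    obtain U U' where U: "direct_decomposition (sym_group m) W U U'" "rep_iso (sym_group m) (specht lam) (U, snd W)" "U \<noteq> {0}"
      by (rule specht_embeds[OF lr(1,2) W lr(3,4)])
    note UD = direct_decompositionD[OF W U(1)]
    obtain d where d: "\<And>c :: nat \<Rightarrow> nat. cfun.dim (fixed (word_stab m c) (U', snd W)) = (\<Sum>nu\<in>partitions m. d nu * card (ssyt_word nu c))"
      using less.hyps[of "(U', snd W)"] UD(2,4) U(3) by auto
    have "cfun.dim (fixed (word_stab m c) (U, snd W)) = card (ssyt_word lam c)" for c :: "nat \<Rightarrow> nat"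
      using rep_iso_dim_fixed[OF U(2) word_stab_subset, of c] dim_fixed_specht[OF lr(1), of c] partitionsD(1)[OF lr(1)] by simp
    then have "cfun.dim (fixed (word_stab m c) W) = (\<Sum>nu\<in>partitions m. (d nu + (if nu = lam then 1 else 0)) * card (ssyt_word nu c))" for c :: "nat \<Rightarrow> nat"
      using UD(3)[of c] d[of c] lr(1) by (simp add: distrib_right sum.distrib if_distrib[of "\<lambda>x. x * _"] cong: if_cong)
    then show ?thesis by (intro exI[of _ "\<lambda>nu. d nu + (if nu = lam then 1 else 0)"]) blast
  qed
qed

section \<open>Invariants of tensor products and induced representations\<close>

text \<open>If the operators of \<open>H\<close> split into their two factors, then every slice of an invariant of
  \<open>A \<otimes> B\<close> is an invariant of \<open>A\<close> or \<open>B\<close>.\<close>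

lemma dim_fixed_tensor:
  fixes A :: "('g, 'a) rep" and B :: "('g, 'b) rep"
  assumes A: "representation G A" and B: "representation G B" and H: "H \<subseteq> carrier G"
    and left: "\<And>h. h \<in> H \<Longrightarrow> \<exists>h'\<in>H. (\<forall>v\<in>fst A. snd A h' v = snd A h v) \<and> (\<forall>v\<in>fst B. snd B h' v = v)"
    and right: "\<And>h. h \<in> H \<Longrightarrow> \<exists>h'\<in>H. (\<forall>v\<in>fst B. snd B h' v = snd B h v) \<and> (\<forall>v\<in>fst A. snd A h' v = v)"
    and G: "group G"
  shows "cfun.dim (fixed H (tensor_rep A B)) = cfun.dim (fixed H A) * cfun.dim (fixed H B)"
proof -
  note AD = representationD[OF A] and BD = representationD[OF B]
  let ?U = "cfun.span {tensor v w | v w. v \<in> fst A \<and> w \<in> fst B}"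
  let ?U' = "cfun.span {tensor v w | v w. v \<in> fixed H A \<and> w \<in> fixed H B}"
  obtain X where X: "interpolating (fixed H A) X" using fin_dim_interpolating[OF subspace_fixed(2)[OF A H]] .
  obtain Y where Y: "interpolating (fixed H B) Y" using fin_dim_interpolating[OF subspace_fixed(2)[OF B H]] .
  have U': "interpolating ?U' (X \<times> Y)" by (rule interpolating_tensor[OF X Y])
  have R: "representation G (tensor_rep A B)" by (rule representation_tensor_rep[OF G A B])
  have sub: "cfun.subspace (fixed H (tensor_rep A B))" by (rule subspace_fixed(1)[OF R H])
  have incl: "?U' \<subseteq> fixed H (tensor_rep A B)"
  proof (rule cfun.span_minimal[OF _ sub], clarify)
    fix v w assume vw: "v \<in> fixed H A" "w \<in> fixed H B"
    then have vw': "v \<in> fst A" "w \<in> fst B" by (auto simp: fixed_def)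
    have "tensor_map (snd A h) (snd B h) (tensor v w) = tensor v w" if "h \<in> H" for h
      using tensor_map_tensor[OF AD(3) BD(3) vw', of h h] that H vw by (auto simp: fixed_def)
    moreover have "tensor v w \<in> ?U" using vw' by (intro cfun.span_base) blast
    ultimately show "tensor v w \<in> fixed H (tensor_rep A B)" by (simp add: fixed_def tensor_rep_def)
  qed
  have slices: "(\<lambda>a. t (a, b)) \<in> fixed H A" "(\<lambda>b. t (a, b)) \<in> fixed H B" if t: "t \<in> fixed H (tensor_rep A B)" for t a b
  proof -
    have tU: "t \<in> ?U" and tH: "\<And>h. h \<in> H \<Longrightarrow> tensor_map (snd A h) (snd B h) t = t"
      using t by (auto simp: fixed_def tensor_rep_def)
    have sl: "(\<lambda>a. t (a, b)) \<in> fst A" for b using tensor_slice[OF AD(2) tU] .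
    have id: "linear_map (fst A) (fst A) (\<lambda>v. v)" by (simp add: linear_map_def)
    have sl': "(\<lambda>b. t (a, b)) \<in> fst B" for a using tensor_map_slice[OF AD(2) BD(2) id tU] .
    have "snd A h (\<lambda>a. t (a, b)) = (\<lambda>a. t (a, b))" if h: "h \<in> H" for h
    proof
      fix a
      obtain h' where h': "h' \<in> H" "\<forall>v\<in>fst A. snd A h' v = snd A h v" "\<forall>v\<in>fst B. snd B h' v = v" using left[OF h] by blast
      have "(\<lambda>b. snd A h' (\<lambda>a. t (a, b)) a) \<in> fst B"
        using tensor_map_slice[OF AD(2) BD(2) AD(3) tU] h'(1) H by auto
      then have "tensor_map (snd A h') (snd B h') t (a, b) = snd A h' (\<lambda>a. t (a, b)) a"
        using h'(3) by (simp add: tensor_map_def)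
      then show "snd A h (\<lambda>a. t (a, b)) a = t (a, b)" using tH[OF h'(1)] h'(2) sl by simp
    qed
    then show "(\<lambda>a. t (a, b)) \<in> fixed H A" using sl by (simp add: fixed_def)
    have "snd B h (\<lambda>b. t (a, b)) = (\<lambda>b. t (a, b))" if h: "h \<in> H" for h
    proof
      fix b
      obtain h' where h': "h' \<in> H" "\<forall>v\<in>fst B. snd B h' v = snd B h v" "\<forall>v\<in>fst A. snd A h' v = v" using right[OF h] by blast
      have "tensor_map (snd A h') (snd B h') t (a, b) = snd B h' (\<lambda>b. t (a, b)) b"
        using h'(3) sl by (simp add: tensor_map_def)
      then show "snd B h (\<lambda>b. t (a, b)) b = t (a, b)" using tH[OF h'(1)] h'(2) sl' by simp
    qed
    then show "(\<lambda>b. t (a, b)) \<in> fixed H B" using sl' by (simp add: fixed_def)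
  qed
  have "interpolating (fixed H (tensor_rep A B)) (X \<times> Y)"
    unfolding interpolating_def
  proof (intro conjI ballI impI allI)
    fix t assume t: "t \<in> fixed H (tensor_rep A B)" "\<forall>x\<in>X \<times> Y. t x = 0"
    have 1: "(\<lambda>b. t (a, b)) = 0" if "a \<in> X" for a
      by (rule interpolatingD(3)[OF Y slices(2)[OF t(1)]]) (use t(2) that in auto)
    have "t (a, b) = 0" if "a \<in> X" for a b using fun_cong[OF 1[OF that], of b] by (simp add: zero_fun_apply)
    then have "(\<lambda>a. t (a, b)) = 0" for b by (intro interpolatingD(3)[OF X slices(1)[OF t(1)]])
    then have "t (a, b) = 0" for a b using fun_cong[of "\<lambda>a. t (a, b)" 0 a] by (simp add: zero_fun_apply)
    then show "t = 0" by (simp add: fun_eq_iff zero_fun_apply)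
  next
    fix \<phi> :: "_ \<Rightarrow> complex"
    show "\<exists>t\<in>fixed H (tensor_rep A B). \<forall>x\<in>X \<times> Y. t x = \<phi> x"
      using interpolatingD(4)[OF U', of \<phi>] incl by blast
  qed (use sub U' in \<open>auto simp: interpolating_def\<close>)
  from interpolating_dim[OF this] show ?thesis using interpolating_dim[OF X] interpolating_dim[OF Y]
    by (simp add: card_cartesian_product)
qed

section \<open>Induction from a subgroup and Mackey's formula for invariants\<close>

context
  fixes G :: "('g, 'm) monoid_scheme" (structure) and K C :: "'g set" and R :: "('g, 'a) rep"
  assumes G: "group G" and K: "subgroup K G" and R: "representation (G\<lparr>carrier := K\<rparr>) R"
    and CG: "C \<subseteq> carrier G" and CK: "\<And>\<sigma> k. \<sigma> \<in> C \<Longrightarrow> k \<in> K \<Longrightarrow> \<sigma> \<otimes> k \<in> C" and fin: "finite C"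
begin

interpretation group G by (rule G)
interpretation K: subgroup K G by (rule K)

lemma R_props:
  "cfun.subspace (fst R)" "k \<in> K \<Longrightarrow> linear_map (fst R) (fst R) (snd R k)" "v \<in> fst R \<Longrightarrow> snd R \<one> v = v"
  "h \<in> K \<Longrightarrow> k \<in> K \<Longrightarrow> v \<in> fst R \<Longrightarrow> snd R (h \<otimes> k) v = snd R h (snd R k v)"
  "k \<in> K \<Longrightarrow> v \<in> fst R \<Longrightarrow> snd R k v \<in> fst R"
  "k \<in> K \<Longrightarrow> v \<in> fst R \<Longrightarrow> snd R k (snd R (inv k) v) = v"
  "k \<in> K \<Longrightarrow> v \<in> fst R \<Longrightarrow> snd R (inv k) (snd R k v) = v"
proof -
  note RD = representationD[OF R]
  show "cfun.subspace (fst R)" "k \<in> K \<Longrightarrow> linear_map (fst R) (fst R) (snd R k)" "v \<in> fst R \<Longrightarrow> snd R \<one> v = v"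
    "k \<in> K \<Longrightarrow> v \<in> fst R \<Longrightarrow> snd R k v \<in> fst R"
    using RD(2,3,4,6) by auto
  show mult: "h \<in> K \<Longrightarrow> k \<in> K \<Longrightarrow> v \<in> fst R \<Longrightarrow> snd R (h \<otimes> k) v = snd R h (snd R k v)" for h k v
    using RD(5) by auto
  show "k \<in> K \<Longrightarrow> v \<in> fst R \<Longrightarrow> snd R k (snd R (inv k) v) = v"
    "k \<in> K \<Longrightarrow> v \<in> fst R \<Longrightarrow> snd R (inv k) (snd R k v) = v"
    using mult[of k "inv k" v] mult[of "inv k" k v] RD(4) by auto
qed

text \<open>Identifies the span of the pure tensors with the equivariant functions supported on
  \<open>C\<close>. For the converse, summing the pure tensors of \<open>\<sigma>\<close> and the
  value of \<open>F\<close> at \<open>\<sigma>\<close> over all of \<open>C\<close> counts each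
  coset \<open>card K\<close> times. As \<open>C\<close> is nonempty, the finite set
  \<open>C\<close> contains a translate of \<open>K\<close>, so \<open>K\<close> is finite.\<close>

lemma ind_on_mem_iff:
  assumes "C \<noteq> {}"
  shows "F \<in> fst (ind_on G K C R) \<longleftrightarrow> (\<forall>g a. g \<notin> C \<longrightarrow> F (g, a) = 0) \<and> (\<forall>g\<in>C. (\<lambda>a. F (g, a)) \<in> fst R)
    \<and> (\<forall>g\<in>C. \<forall>k\<in>K. (\<lambda>a. F (g \<otimes> k, a)) = snd R (inv k) (\<lambda>a. F (g, a)))"
    (is "?L \<longleftrightarrow> ?P F")
proof
  note tensor_eq = ind_tensor_eq[OF G K R CG CK]
  assume ?L
  then show "?P F"
    unfolding ind_on_def fst_conv
  proof (induction rule: cspan_induct)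
    case base
    have z: "(\<lambda>a. (0 :: 'g \<times> 'a \<Rightarrow> complex) (g, a)) = 0" for g by (simp add: fun_eq_iff zero_fun_apply)
    have "snd R (inv k) 0 = 0" if "k \<in> K" for k
      using linear_map_zero[OF R_props(2) R_props(1), of "inv k"] that by simp
    then show ?case unfolding z using cfun.subspace_0[OF R_props(1)] by (simp add: zero_fun_apply zf)
  next
    case (step c x y)
    then obtain \<sigma> w where x: "x = ind_tensor G K R \<sigma> w" "\<sigma> \<in> C" "w \<in> fst R" by blast
    have s: "\<sigma> \<in> carrier G" using x CG by blast
    have z: "(\<lambda>a. 0 :: complex) = (0 :: 'a \<Rightarrow> complex)" by (simp add: fun_eq_iff zero_fun_apply)
    have x_eq: "(\<lambda>a. x (g, a)) = (if inv g \<otimes> \<sigma> \<in> K then snd R (inv g \<otimes> \<sigma>) w else 0)" if "g \<in> carrier G" for g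
      using that by (auto simp: x(1) tensor_eq[OF _ _ s] fun_eq_iff zero_fun_apply)
    have Px: "?P x"
    proof (intro conjI ballI allI impI)
      fix g a assume g: "g \<notin> C"
      show "x (g, a) = 0"
      proof (rule ccontr)
        assume "x (g, a) \<noteq> 0"
        then have *: "g \<in> carrier G" "inv g \<otimes> \<sigma> \<in> K" by (auto simp: x(1) tensor_eq[OF _ _ s] split: if_splits)
        have "\<sigma> \<otimes> inv (inv g \<otimes> \<sigma>) = g" using s * by (simp add: inv_mult_group m_assoc[symmetric])
        moreover have "\<sigma> \<otimes> inv (inv g \<otimes> \<sigma>) \<in> C" by (rule CK[OF x(2) K.m_inv_closed[OF *(2)]])
        ultimately show False using g by simp
      qed
    next
      fix g assume g: "g \<in> C"
      then have gG: "g \<in> carrier G" using CG by blast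
      then show "(\<lambda>a. x (g, a)) \<in> fst R" using R_props(5) x(3) cfun.subspace_0[OF R_props(1)] by (simp add: x_eq)
      fix k assume k: "k \<in> K"
      have e: "inv (g \<otimes> k) \<otimes> \<sigma> = inv k \<otimes> (inv g \<otimes> \<sigma>)" using gG k s by (simp add: inv_mult_group m_assoc)
      have "inv k \<otimes> (inv g \<otimes> \<sigma>) \<in> K \<longleftrightarrow> inv g \<otimes> \<sigma> \<in> K"
      proof
        assume "inv k \<otimes> (inv g \<otimes> \<sigma>) \<in> K"
        then have "k \<otimes> (inv k \<otimes> (inv g \<otimes> \<sigma>)) \<in> K" using k by blast
        then show "inv g \<otimes> \<sigma> \<in> K" using k gG s by (simp add: m_assoc[symmetric])
      qed (use k in blast)
      then show "(\<lambda>a. x (g \<otimes> k, a)) = snd R (inv k) (\<lambda>a. x (g, a))"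
        using gG k x(3) R_props(4)[of "inv k" "inv g \<otimes> \<sigma>" w] linear_map_zero[OF R_props(2) R_props(1), of "inv k"]
        by (simp add: x_eq e)
    qed
    have add: "(\<lambda>a. (fscale c x + y) (g, a)) = fscale c (\<lambda>a. x (g, a)) + (\<lambda>a. y (g, a))" for g
      by (simp add: fun_eq_iff pointwise)
    show ?case
      unfolding add using Px step(3) linear_map_add[OF R_props(2)] linear_map_scale[OF R_props(2)] cfun.subspace_add[OF R_props(1)] cfun.subspace_scale[OF R_props(1)]
      by simp (simp add: pointwise)
  qed
next
  note tensor_eq = ind_tensor_eq[OF G K R CG CK]
  assume P: "?P F"
  obtain g0 where g0: "g0 \<in> C" using assms by blast
  have finK: "finite K"
  proof -
    have "(\<otimes>) g0 ` K \<subseteq> C" using CK[OF g0] by auto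
    moreover have "inj_on ((\<otimes>) g0) K" using g0 CG by (intro inj_onI) auto
    ultimately show ?thesis using finite_subset[OF _ fin] finite_imageD by blast
  qed
  have cardK: "card K \<noteq> 0" by (metis card_0_eq empty_iff K.one_closed finK)
  have "F = fscale (1 / of_nat (card K)) (\<Sum>\<sigma>\<in>C. ind_tensor G K R \<sigma> (\<lambda>a. F (\<sigma>, a)))"
  proof (rule ext, clarify)
    fix g a
    have t: "ind_tensor G K R \<sigma> (\<lambda>a. F (\<sigma>, a)) (g, a) =
        (if g \<in> carrier G \<and> inv g \<otimes> \<sigma> \<in> K then snd R (inv g \<otimes> \<sigma>) (\<lambda>a. F (\<sigma>, a)) a else 0)" if "\<sigma> \<in> C" for \<sigma>
      by (rule tensor_eq) (use that CG in auto)
    show "F (g, a) = fscale (1 / of_nat (card K)) (\<Sum>\<sigma>\<in>C. ind_tensor G K R \<sigma> (\<lambda>a. F (\<sigma>, a))) (g, a)"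
    proof (cases "g \<in> C")
      case True
      then have gG: "g \<in> carrier G" using CG by blast
      have img: "{\<sigma> \<in> C. inv g \<otimes> \<sigma> \<in> K} = (\<otimes>) g ` K"
      proof (intro subset_antisym subsetI)
        fix \<sigma> assume s: "\<sigma> \<in> {\<sigma> \<in> C. inv g \<otimes> \<sigma> \<in> K}"
        then have "\<sigma> = g \<otimes> (inv g \<otimes> \<sigma>)" using gG CG by (auto simp: m_assoc[symmetric])
        then show "\<sigma> \<in> (\<otimes>) g ` K" using s by (metis (mono_tags, lifting) image_eqI mem_Collect_eq)
      qed (use True gG CK in \<open>auto simp: m_assoc[symmetric]\<close>)
      have inj: "inj_on ((\<otimes>) g) K" using gG by (intro inj_onI) auto
      have "(\<Sum>\<sigma>\<in>C. ind_tensor G K R \<sigma> (\<lambda>a. F (\<sigma>, a)) (g, a)) =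
          (\<Sum>\<sigma>\<in>C. if inv g \<otimes> \<sigma> \<in> K then snd R (inv g \<otimes> \<sigma>) (\<lambda>a. F (\<sigma>, a)) a else 0)"
        by (rule sum.cong[OF refl]) (simp add: t gG)
      also have "\<dots> = (\<Sum>\<sigma>\<in>(\<otimes>) g ` K. snd R (inv g \<otimes> \<sigma>) (\<lambda>a. F (\<sigma>, a)) a)"
        unfolding img[symmetric] by (rule sum.inter_filter[OF fin, symmetric])
      also have "\<dots> = (\<Sum>k\<in>K. snd R (inv g \<otimes> (g \<otimes> k)) (\<lambda>a. F (g \<otimes> k, a)) a)"
        by (simp add: sum.reindex[OF inj])
      also have "\<dots> = (\<Sum>k\<in>K. F (g, a))"
      proof (rule sum.cong[OF refl])
        fix k assume k: "k \<in> K"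
        have "inv g \<otimes> (g \<otimes> k) = k" using gG k by (simp add: m_assoc[symmetric])
        moreover have "(\<lambda>a. F (g \<otimes> k, a)) = snd R (inv k) (\<lambda>a. F (g, a))" using P True k by blast
        ultimately show "snd R (inv g \<otimes> (g \<otimes> k)) (\<lambda>a. F (g \<otimes> k, a)) a = F (g, a)"
          using R_props(6)[OF k, of "\<lambda>a. F (g, a)"] P True by simp
      qed
      finally show ?thesis using cardK by (simp add: fscale_apply sum_fun_apply)
    next
      case False
      have "ind_tensor G K R \<sigma> (\<lambda>a. F (\<sigma>, a)) (g, a) = 0" if s: "\<sigma> \<in> C" for \<sigma>
      proof -
        have "\<not> (g \<in> carrier G \<and> inv g \<otimes> \<sigma> \<in> K)"
        proof
          assume a: "g \<in> carrier G \<and> inv g \<otimes> \<sigma> \<in> K"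
          have "\<sigma> \<in> carrier G" using s CG by blast
          then have "\<sigma> \<otimes> inv (inv g \<otimes> \<sigma>) = g" using a by (simp add: inv_mult_group m_assoc[symmetric])
          moreover have "\<sigma> \<otimes> inv (inv g \<otimes> \<sigma>) \<in> C" using a by (intro CK[OF s] K.m_inv_closed) simp
          ultimately show False using False by simp
        qed
        then show ?thesis unfolding t[OF s] by (rule if_not_P)
      qed
      then show ?thesis using P False by (simp add: fscale_apply sum_fun_apply)
    qed
  qed
  also have "\<dots> \<in> fst (ind_on G K C R)"
    unfolding ind_on_def fst_conv
    by (intro cfun.span_scale cfun.span_sum cfun.span_base) (use P in blast)
  finally show ?L .
qed

text \<open>Mackey's formula for invariants. An invariant function is determined by its values at
  representatives of the double cosets in \<open>C\<close>, and the value at \<open>d\<close> may be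
  any vector fixed by the elements of \<open>K\<close> that \<open>d\<close> conjugates into
  \<open>Y\<close>. The group \<open>G'\<close> is separate from \<open>G\<close> because
  \<open>V_pair\<close> is induced inside the full symmetric group but used as a representation of
  the stabilizer of 1.\<close>

theorem dim_fixed_ind_on:
  assumes G': "representation G' (ind_on G K C R)" "Y \<subseteq> carrier G'" and Y: "subgroup Y G"
    and YC: "\<And>y g. y \<in> Y \<Longrightarrow> g \<in> C \<Longrightarrow> y \<otimes> g \<in> C"
    and DC: "D \<subseteq> C" and cover: "\<And>g. g \<in> C \<Longrightarrow> \<exists>d\<in>D. \<exists>y\<in>Y. \<exists>k\<in>K. g = y \<otimes> d \<otimes> k"
    and uniq: "\<And>d d' y k. d \<in> D \<Longrightarrow> d' \<in> D \<Longrightarrow> y \<in> Y \<Longrightarrow> k \<in> K \<Longrightarrow> d' = y \<otimes> d \<otimes> k \<Longrightarrow> d = d'"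
    and ne: "C \<noteq> {}"
  shows "cfun.dim (fixed Y (ind_on G K C R)) = (\<Sum>d\<in>D. cfun.dim (fixed {k \<in> K. d \<otimes> k \<otimes> inv d \<in> Y} R))"
proof -
  interpret Y: subgroup Y G by (rule Y)
  let ?V = "fixed Y (ind_on G K C R)" and ?Kd = "\<lambda>d. {k \<in> K. d \<otimes> k \<otimes> inv d \<in> Y}"
  let ?W = "family_space D (\<lambda>d. fixed (?Kd d) R)"
  note mem = ind_on_mem_iff[OF ne]
  have DG: "d \<in> carrier G" if "d \<in> D" for d using that DC CG by blast
  have finD: "finite D" using finite_subset[OF DC fin] .
  have W_dim: "cfun.dim ?W = (\<Sum>d\<in>D. cfun.dim (fixed (?Kd d) R))"
    by (rule dim_family_space(1)[OF finD subspace_fixed(2)[OF R]]) auto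
  have V_iff: "F \<in> ?V \<longleftrightarrow> F \<in> fst (ind_on G K C R) \<and> (\<forall>y\<in>Y. \<forall>g\<in>C. \<forall>a. F (y \<otimes> g, a) = F (g, a))" for F
  proof
    assume F: "F \<in> ?V"
    have "F (y \<otimes> g, a) = F (g, a)" if y: "y \<in> Y" and g: "g \<in> C" for y g a
    proof -
      have "snd (ind_on G K C R) (inv y) F = F" using F y by (simp add: fixed_def)
      from fun_cong[OF this, of "(g, a)"] show ?thesis using g y by (simp add: ind_on_def)
    qed
    then show "F \<in> fst (ind_on G K C R) \<and> (\<forall>y\<in>Y. \<forall>g\<in>C. \<forall>a. F (y \<otimes> g, a) = F (g, a))" using F by (simp add: fixed_def)
  next
    assume F: "F \<in> fst (ind_on G K C R) \<and> (\<forall>y\<in>Y. \<forall>g\<in>C. \<forall>a. F (y \<otimes> g, a) = F (g, a))"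
    have "snd (ind_on G K C R) y F = F" if y: "y \<in> Y" for y
    proof (rule ext, clarify)
      fix g a
      have "F (inv y \<otimes> g, a) = F (g, a)" if "g \<in> C" using F y that by blast
      then show "snd (ind_on G K C R) y F (g, a) = F (g, a)" using F mem by (auto simp: ind_on_def)
    qed
    then show "F \<in> ?V" using F by (simp add: fixed_def)
  qed
  define T where "T = (\<lambda>F (d :: 'g, a :: 'a). if d \<in> D then F (d, a) else 0 :: complex)"
  have T_slice: "(\<lambda>a. T F (d, a)) = (\<lambda>a. F (d, a))" if "d \<in> D" for F and d using that by (simp add: T_def)
  have val: "(\<lambda>a. F (y \<otimes> d \<otimes> k, a)) = snd R (inv k) (\<lambda>a. F (d, a))"
    if F: "F \<in> ?V" and d: "d \<in> D" "y \<in> Y" "k \<in> K" for F d y k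
  proof -
    have "(\<lambda>a. F (y \<otimes> d \<otimes> k, a)) = snd R (inv k) (\<lambda>a. F (y \<otimes> d, a))"
      using F[unfolded V_iff mem] YC DC d by blast
    also have "(\<lambda>a. F (y \<otimes> d, a)) = (\<lambda>a. F (d, a))" using F[unfolded V_iff] d DC by blast
    finally show ?thesis .
  qed
  have T_in: "T F \<in> ?W" if F: "F \<in> ?V" for F
    unfolding family_space_def
  proof (intro CollectI conjI ballI allI impI)
    fix d assume d: "d \<in> D"
    have FR: "(\<lambda>a. F (d, a)) \<in> fst R" using F[unfolded V_iff mem] d DC by blast
    have "snd R k (\<lambda>a. F (d, a)) = (\<lambda>a. F (d, a))" if k: "k \<in> K" "d \<otimes> k \<otimes> inv d \<in> Y" for k
    proof -
      have "(d \<otimes> k \<otimes> inv d) \<otimes> d \<otimes> inv k = d" using DG[OF d] k(1) by (simp add: m_assoc)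
      then have "(\<lambda>a. F (d, a)) = snd R (inv (inv k)) (\<lambda>a. F (d, a))"
        using val[OF F d k(2), of "inv k"] k(1) by simp
      then show ?thesis using k(1) by simp
    qed
    then show "(\<lambda>a. T F (d, a)) \<in> fixed (?Kd d) R" using FR by (simp add: T_slice[OF d] fixed_def)
  qed (simp add: T_def)
  have lin: "linear_map ?V ?W T"
    using T_in by (auto simp: linear_map_def T_def fun_eq_iff pointwise)
  have inj: "inj_on T ?V"
  proof (rule inj_onI)
    fix F F' assume F: "F \<in> ?V" "F' \<in> ?V" "T F = T F'"
    show "F = F'"
    proof (rule ext, clarify)
      fix g a
      show "F (g, a) = F' (g, a)"
      proof (cases "g \<in> C")
        case True
        then obtain d y k where d: "d \<in> D" "y \<in> Y" "k \<in> K" "g = y \<otimes> d \<otimes> k" using cover by blast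
        have "(\<lambda>a. F (d, a)) = (\<lambda>a. F' (d, a))"
          using T_slice[OF d(1), of F] T_slice[OF d(1), of F'] F(3) by simp
        then show ?thesis
          using fun_cong[OF val[OF F(1) d(1-3)], of a] fun_cong[OF val[OF F(2) d(1-3)], of a] d(4) by simp
      next
        case False
        then show ?thesis using F(1,2) unfolding V_iff mem by auto
      qed
    qed
  qed
  have surj: "f \<in> T ` ?V" if f: "f \<in> ?W" for f
  proof -
    have fd: "(\<lambda>a. f (d, a)) \<in> fst R" "k \<in> ?Kd d \<Longrightarrow> snd R k (\<lambda>a. f (d, a)) = (\<lambda>a. f (d, a))" if "d \<in> D" for d k
      using f that by (auto simp: family_space_def fixed_def)
    \<comment> \<open>A decomposition of each \<open>g\<close> is chosen. \<open>F_eq\<close> shows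
      that the choice does not matter, since two decompositions differ by an element of
      \<open>K\<close> which \<open>d\<close> conjugates into \<open>Y\<close>.\<close>
    define Q where "Q g p \<longleftrightarrow> (case p of (d, y, k) \<Rightarrow> d \<in> D \<and> y \<in> Y \<and> k \<in> K \<and> g = y \<otimes> d \<otimes> k)" for g p
    define x where "x g = (SOME p. Q g p)" for g
    have x: "Q g (x g)" if g: "g \<in> C" for g
    proof -
      obtain d y k where "d \<in> D" "y \<in> Y" "k \<in> K" "g = y \<otimes> d \<otimes> k" using cover[OF g] by blast
      then have "Q g (d, y, k)" by (simp add: Q_def)
      then show ?thesis unfolding x_def by (rule someI)
    qed
    define F where "F = (\<lambda>(g, a). if g \<in> C then (case x g of (d, y, k) \<Rightarrow> snd R (inv k) (\<lambda>a. f (d, a)) a) else 0)"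
    have F_eq: "(\<lambda>a. F (y \<otimes> d \<otimes> k, a)) = snd R (inv k) (\<lambda>a. f (d, a))" if d: "d \<in> D" "y \<in> Y" "k \<in> K" for d y k
    proof -
      define g where "g = y \<otimes> d \<otimes> k"
      have g: "g \<in> C" using d YC CK DC by (auto simp: g_def)
      obtain d' y' k' where x': "x g = (d', y', k')" by (cases "x g")
      then have d': "d' \<in> D" "y' \<in> Y" "k' \<in> K" "g = y' \<otimes> d' \<otimes> k'" using x[OF g] by (simp_all add: Q_def)
      note cl = DG[OF d(1)] DG[OF d'(1)] Y.mem_carrier[OF d(2)] Y.mem_carrier[OF d'(2)] K.mem_carrier[OF d(3)] K.mem_carrier[OF d'(3)]
      have eq: "y \<otimes> d \<otimes> k = y' \<otimes> d' \<otimes> k'" using d'(4) g_def by simp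
      have "d' = inv y' \<otimes> (y' \<otimes> d' \<otimes> k') \<otimes> inv k'" using cl by (simp add: m_assoc inv_solve_left)
      also have "\<dots> = (inv y' \<otimes> y) \<otimes> d \<otimes> (k \<otimes> inv k')" unfolding eq[symmetric] using cl by (simp add: m_assoc)
      finally have "d = d'" using uniq[OF d(1) d'(1), of "inv y' \<otimes> y" "k \<otimes> inv k'"] d d' by simp
      note eq = eq[folded this]
      have "d \<otimes> (k \<otimes> inv k') \<otimes> inv d = inv y \<otimes> (y \<otimes> d \<otimes> k) \<otimes> inv k' \<otimes> inv d"
        using cl by (simp add: m_assoc inv_solve_left)
      also have "\<dots> = inv y \<otimes> y'" unfolding eq using cl by (simp add: m_assoc)
      finally have "k \<otimes> inv k' \<in> ?Kd d" using d d' by auto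
      then have "snd R (k \<otimes> inv k') (\<lambda>a. f (d, a)) = (\<lambda>a. f (d, a))" using fd(2)[OF d(1)] by blast
      then have "snd R k (snd R (inv k') (\<lambda>a. f (d, a))) = (\<lambda>a. f (d, a))"
        using R_props(4)[of k "inv k'" "\<lambda>a. f (d, a)"] d d' fd(1)[OF d(1)] by simp
      then have "snd R (inv k) (\<lambda>a. f (d, a)) = snd R (inv k') (\<lambda>a. f (d, a))"
        using R_props(7)[OF d(3), of "snd R (inv k') (\<lambda>a. f (d, a))"] R_props(5)[of "inv k'"] d' fd(1)[OF d(1)] by simp
      moreover have "(\<lambda>a. F (g, a)) = snd R (inv k') (\<lambda>a. f (d', a))" using g by (simp add: F_def x')
      ultimately show ?thesis using \<open>d = d'\<close> g_def by simp
    qed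
    have "F \<in> ?V"
      unfolding V_iff mem
    proof (intro conjI ballI allI impI)
      show "F (g, a) = 0" if "g \<notin> C" for g a using that by (simp add: F_def)
      fix g assume "g \<in> C"
      then obtain d y k where d: "d \<in> D" "y \<in> Y" "k \<in> K" "g = y \<otimes> d \<otimes> k" using cover by blast
      note cl = DG[OF d(1)] Y.mem_carrier[OF d(2)] K.mem_carrier[OF d(3)]
      show "(\<lambda>a. F (g, a)) \<in> fst R" unfolding d(4) F_eq[OF d(1-3)] using R_props(5) fd(1)[OF d(1)] d(3) by simp
      show "(\<lambda>a. F (g \<otimes> k', a)) = snd R (inv k') (\<lambda>a. F (g, a))" if k': "k' \<in> K" for k'
      proof -
        have e: "g \<otimes> k' = y \<otimes> d \<otimes> (k \<otimes> k')" using cl k' d(4) by (simp add: m_assoc)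
        have "(\<lambda>a. F (g \<otimes> k', a)) = snd R (inv (k \<otimes> k')) (\<lambda>a. f (d, a))"
          unfolding e by (rule F_eq) (use d k' in auto)
        also have "inv (k \<otimes> k') = inv k' \<otimes> inv k" using cl k' by (simp add: inv_mult_group)
        also have "snd R (inv k' \<otimes> inv k) (\<lambda>a. f (d, a)) = snd R (inv k') (snd R (inv k) (\<lambda>a. f (d, a)))"
          using R_props(4) k' d fd(1)[OF d(1)] by simp
        finally show ?thesis using F_eq[OF d(1-3)] d(4) by simp
      qed
      show "F (y' \<otimes> g, a) = F (g, a)" if y': "y' \<in> Y" for y' a
      proof -
        have e: "y' \<otimes> g = (y' \<otimes> y) \<otimes> d \<otimes> k" using cl y' d(4) by (simp add: m_assoc)
        have "(\<lambda>a. F (y' \<otimes> g, a)) = snd R (inv k) (\<lambda>a. f (d, a))" unfolding e by (rule F_eq) (use d y' in auto)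
        also have "\<dots> = (\<lambda>a. F (g, a))" using F_eq[OF d(1-3)] d(4) by simp
        finally show ?thesis by (rule fun_cong)
      qed
    qed
    moreover have "T F = f"
    proof (rule family_eqI[of D])
      fix d assume d: "d \<in> D"
      show "(\<lambda>a. T F (d, a)) = (\<lambda>a. f (d, a))"
        using F_eq[OF d Y.one_closed K.one_closed] R_props(3)[OF fd(1)[OF d]] DG[OF d] by (simp add: T_slice[OF d])
    next
      fix d a assume "d \<notin> D"
      then show "T F (d, a) = f (d, a)" using f by (simp add: T_def family_space_def)
    qed
    ultimately show ?thesis by (metis imageI)
  qed
  have "bij_betw T ?V ?W" using inj T_in surj by (auto simp: bij_betw_def)
  from linear_bij_dim[OF lin this subspace_fixed(2)[OF G']] show ?thesis using W_dim by simp
qed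

end

section \<open>Young subgroups and parabolic subgroups fixing 1\<close>

lemma letters_iff: "x \<in> letters m \<longleftrightarrow> 0 < x \<and> x \<le> m"
  by (auto simp: letters_def)

lemma fix1_iff: "g \<in> fix1 n \<longleftrightarrow> g permutes letters n \<and> g (Suc 0) = Suc 0"
  by (simp add: fix1_def letters_def)

lemma block_stabilizer_iff: "g \<in> block_stabilizer n k \<longleftrightarrow> g permutes letters n \<and> g ` letters k = letters k"
  by (simp add: block_stabilizer_def letters_def)

lemma block_perm_apply: "block_perm s m g x = (if x \<in> letters m then g (x + s) - s else x)"
  by (auto simp: block_perm_def letters_def)

text \<open>Truncated subtraction is harmless in these definitions, since \<open>0\<close> is not a letter.\<close>

definition shift :: "nat \<Rightarrow> (nat \<Rightarrow> nat) \<Rightarrow> nat \<Rightarrow> nat"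
  where "shift m \<sigma> i = (if i - 1 \<in> letters m then Suc (\<sigma> (i - 1)) else i)"

definition join :: "nat \<Rightarrow> nat \<Rightarrow> (nat \<Rightarrow> nat) \<Rightarrow> (nat \<Rightarrow> nat) \<Rightarrow> nat \<Rightarrow> nat"
  where "join a b \<alpha> \<beta> i = (if i - 1 \<in> letters a then Suc (\<alpha> (i - 1))
    else if i - Suc a \<in> letters b then Suc a + \<beta> (i - Suc a) else i)"

lemma permutesI_inverse:
  assumes "\<And>x. x \<in> A \<Longrightarrow> f x \<in> A" "\<And>x. x \<in> A \<Longrightarrow> g x \<in> A" "\<And>x. f (g x) = x" "\<And>x. g (f x) = x"
    and "\<And>x. x \<notin> A \<Longrightarrow> f x = x"
  shows "f permutes A"
proof (rule bij_imp_permutes)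
  show "bij_betw f A A" by (rule bij_betw_byWitness[where f' = g]) (use assms in auto)
qed (rule assms(5))

lemma fix1D:
  assumes g: "g \<in> fix1 (Suc m)"
  shows "g permutes letters (Suc m)" "x \<in> letters m \<Longrightarrow> g (Suc x) - 1 \<in> letters m" "x \<in> letters m \<Longrightarrow> Suc (g (Suc x) - 1) = g (Suc x)"
    "g (Suc 0) = Suc 0" "g 0 = 0"
proof -
  show p: "g permutes letters (Suc m)" and 1: "g (Suc 0) = Suc 0" using g by (auto simp: fix1_iff)
  show "g 0 = 0" using permutes_not_in[OF p, of 0] by (simp add: letters_iff)
  have *: "g (Suc x) \<in> letters (Suc m) \<and> g (Suc x) \<noteq> Suc 0" if "x \<in> letters m" for x
  proof -
    have "g (Suc x) \<noteq> g (Suc 0)" using that permutes_inj[OF p] by (auto simp: letters_iff dest: injD)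
    then show ?thesis using that permutes_letters(1)[OF p, of "Suc x"] 1 by (simp add: letters_iff)
  qed
  show "g (Suc x) - 1 \<in> letters m" "Suc (g (Suc x) - 1) = g (Suc x)" if "x \<in> letters m"
    using *[OF that] by (auto simp: letters_iff)
qed

lemma fix1_inv: "g \<in> fix1 n \<Longrightarrow> inv' g \<in> fix1 n"
  and fix1_comp: "g \<in> fix1 n \<Longrightarrow> h \<in> fix1 n \<Longrightarrow> g \<circ> h \<in> fix1 n"
  and fix1_id: "id \<in> fix1 n"
proof -
  show "inv' g \<in> fix1 n" if "g \<in> fix1 n"
    using that permutes_letters(4)[of g n "Suc 0"] permutes_letters(5)[of g n] by (simp add: fix1_iff)
qed (auto simp: fix1_iff permutes_compose permutes_id)

lemma shift_permutes:
  assumes "\<sigma> permutes letters m"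
  shows "shift m \<sigma> \<in> fix1 (Suc m)"
proof -
  have "shift m \<sigma> permutes letters (Suc m)"
  proof (rule permutesI_inverse[where g = "shift m (inv' \<sigma>)"])
    show "shift m \<sigma> x \<in> letters (Suc m)" "shift m (inv' \<sigma>) x \<in> letters (Suc m)" if "x \<in> letters (Suc m)" for x
      using that permutes_letters(1,2)[OF assms, of "x - 1"] by (auto simp: shift_def letters_iff)
    show "shift m \<sigma> (shift m (inv' \<sigma>) x) = x" "shift m (inv' \<sigma>) (shift m \<sigma> x) = x" for x
      using permutes_letters(1,2,3,4)[OF assms, of "x - 1"] by (auto simp: shift_def letters_iff)
    show "shift m \<sigma> x = x" if "x \<notin> letters (Suc m)" for x using that by (auto simp: shift_def letters_iff)
  qed
  then show ?thesis by (simp add: fix1_iff shift_def letters_iff)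
qed

lemma shift_comp:
  assumes "\<tau> permutes letters m"
  shows "shift m (\<sigma> \<circ> \<tau>) = shift m \<sigma> \<circ> shift m \<tau>"
  using permutes_letters(1)[OF assms] by (auto simp: shift_def fun_eq_iff)

lemma shift_id: "shift m id = id"
  by (auto simp: shift_def fun_eq_iff letters_iff)

lemma block_perm_shift:
  assumes "\<sigma> permutes letters m"
  shows "block_perm 1 m (shift m \<sigma>) = \<sigma>"
  using permutes_not_in[OF assms] by (auto simp: block_perm_apply shift_def fun_eq_iff)

lemma block_perm_fix1:
  assumes "g \<in> fix1 (Suc m)"
  shows "block_perm 1 m g permutes letters m" "shift m (block_perm 1 m g) = g"
proof -
  have img: "g ` {1 + 1..1 + m} = {1 + 1..1 + m}"
  proof (rule endo_inj_surj)
    show "g ` {1 + 1..1 + m} \<subseteq> {1 + 1..1 + m}"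
    proof clarify
      fix i assume "i \<in> {1 + 1..1 + m}"
      then have "i - 1 \<in> letters m" "Suc (i - 1) = i" by (auto simp: letters_iff)
      then show "g i \<in> {1 + 1..1 + m}" using fix1D(2,3)[OF assms, of "i - 1"] by (auto simp: letters_iff)
    qed
    show "inj_on g {1 + 1..1 + m}" using permutes_inj[OF fix1D(1)[OF assms]] by (rule inj_on_subset) simp
  qed simp
  show p: "block_perm 1 m g permutes letters m"
    using block_perm_hom(1)[of g "Suc m" 1 m] fix1D(1)[OF assms] img by (simp add: letters_def)
  show "shift m (block_perm 1 m g) = g"
  proof
    fix i show "shift m (block_perm 1 m g) i = g i"
    proof (cases "i - 1 \<in> letters m")
      case True
      then show ?thesis using fix1D(3)[OF assms True] by (auto simp: shift_def block_perm_apply letters_iff)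
    next
      case False
      then have "i = 0 \<or> i = Suc 0 \<or> i \<notin> letters (Suc m)" by (auto simp: letters_iff)
      then have "g i = i" using fix1D(4,5)[OF assms] permutes_not_in[OF fix1D(1)[OF assms]] by auto
      then show ?thesis using False by (simp add: shift_def)
    qed
  qed
qed

lemma shift_image: "shift m ` carrier (sym_group m) = fix1 (Suc m)"
proof (intro subset_antisym subsetI)
  fix g assume g: "g \<in> fix1 (Suc m)"
  then show "g \<in> shift m ` carrier (sym_group m)"
    using block_perm_fix1[OF g] by (intro rev_image_eqI[of "block_perm 1 m g"]) (auto simp: carrier_sym_group)
qed (auto simp: carrier_sym_group shift_permutes)

section \<open>The stabilizer of 1 and its Young subgroups\<close>

lemma sym_group_fix1_simps [simp]:
  "carrier (sym_group_fix1 n) = fix1 n" "mult (sym_group_fix1 n) = (\<circ>)" "one (sym_group_fix1 n) = id"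
  by (simp_all add: sym_group_fix1_def sym_group_mult sym_group_one)

lemma group_sym_group_fix1: "group (sym_group_fix1 n)"
  unfolding sym_group_fix1_def by (rule subgroup.subgroup_is_group[OF subgroup_fix1 sym_group_is_group])

lemma inv_sym_group_fix1: "g \<in> fix1 n \<Longrightarrow> inv\<^bsub>sym_group_fix1 n\<^esub> g = inv' g"
proof -
  assume g: "g \<in> fix1 n"
  have "inv' g \<circ> g = id" using g permutes_letters(9)[of g n] by (simp add: fix1_iff)
  then show ?thesis
    using g fix1_inv by (intro group.inv_equality[OF group_sym_group_fix1]) simp_all
qed

lemma inv_sym_group: "g permutes letters n \<Longrightarrow> inv\<^bsub>sym_group n\<^esub> g = inv' g"
  using sym_group_inv_equality[of g n] by (simp add: carrier_sym_group)

lemma representation_pullback_shift: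
  assumes "representation (sym_group_fix1 (Suc m)) R"
  shows "representation (sym_group m) (pullback (shift m) R)"
proof (rule representation_pullback[OF assms])
  show "shift m \<in> hom (sym_group m) (sym_group_fix1 (Suc m))"
    by (auto simp: hom_def carrier_sym_group shift_permutes shift_comp sym_group_mult)
qed (simp add: sym_group_one shift_id)

text \<open>The Young subgroup moved into the stabilizer of 1: the letter \<open>x\<close> of the
  word sits at the point \<open>Suc x\<close>.\<close>

definition young :: "nat \<Rightarrow> (nat \<Rightarrow> 'b) \<Rightarrow> (nat \<Rightarrow> nat) set"
  where "young m c = shift m ` word_stab m c"

lemma young_iff: "y \<in> young m c \<longleftrightarrow> y \<in> fix1 (Suc m) \<and> (\<forall>x\<in>letters m. c (y (Suc x) - 1) = c x)"
proof
  assume "y \<in> young m c"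
  then show "y \<in> fix1 (Suc m) \<and> (\<forall>x\<in>letters m. c (y (Suc x) - 1) = c x)"
    using shift_permutes by (auto simp: young_def word_stab_def shift_def)
next
  assume y: "y \<in> fix1 (Suc m) \<and> (\<forall>x\<in>letters m. c (y (Suc x) - 1) = c x)"
  then have "block_perm 1 m y \<in> word_stab m c"
    using block_perm_fix1(1)[of y m] by (auto simp: word_stab_def block_perm_apply)
  then show "y \<in> young m c" unfolding young_def using y block_perm_fix1(2)[of y m] by (metis imageI)
qed

lemma fixed_pullback_shift: "fixed (word_stab m c) (pullback (shift m) R) = fixed (young m c) R"
  by (simp add: fixed_pullback young_def)

lemma young_subset: "young m c \<subseteq> fix1 (Suc m)"
  by (auto simp: young_iff)

lemma young_closed:
  "id \<in> young m c" "y \<in> young m c \<Longrightarrow> inv' y \<in> young m c" "y \<in> young m c \<Longrightarrow> z \<in> young m c \<Longrightarrow> y \<circ> z \<in> young m c"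
proof -
  show "id \<in> young m c" by (simp add: young_iff fix1_id)
  show "inv' y \<in> young m c" if y: "y \<in> young m c"
  proof -
    have f: "y \<in> fix1 (Suc m)" "inv' y \<in> fix1 (Suc m)" using y fix1_inv by (auto simp: young_iff)
    have "c (inv' y (Suc x) - 1) = c x" if x: "x \<in> letters m" for x
    proof -
      let ?z = "inv' y (Suc x) - 1"
      have "?z \<in> letters m" "Suc ?z = inv' y (Suc x)" using fix1D(2,3)[OF f(2) x] by auto
      then have "c (y (inv' y (Suc x)) - 1) = c ?z" using y by (metis young_iff)
      then show ?thesis by (simp add: permutes_letters(3)[OF fix1D(1)[OF f(1)]])
    qed
    then show ?thesis using f by (simp add: young_iff)
  qed
  show "y \<circ> z \<in> young m c" if y: "y \<in> young m c" and z: "z \<in> young m c"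
  proof -
    have f: "y \<in> fix1 (Suc m)" "z \<in> fix1 (Suc m)" using y z by (auto simp: young_iff)
    have "c (y (z (Suc x)) - 1) = c x" if x: "x \<in> letters m" for x
    proof -
      let ?z = "z (Suc x) - 1"
      have "?z \<in> letters m" "Suc ?z = z (Suc x)" using fix1D(2,3)[OF f(2) x] by auto
      then have "c (y (z (Suc x)) - 1) = c ?z" using y by (metis young_iff)
      then show ?thesis using z x by (simp add: young_iff)
    qed
    then show ?thesis using f by (simp add: young_iff fix1_comp)
  qed
qed

text \<open>The subgroup of the theorem, indexed by the size \<open>a\<close> of its first
  nontrivial block, that is with \<open>k = Suc a\<close>.\<close>

definition parabolic :: "nat \<Rightarrow> nat \<Rightarrow> (nat \<Rightarrow> nat) set"
  where "parabolic a n = block_stabilizer n (Suc a) \<inter> fix1 n"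

text \<open>Reads \<open>c\<close> along \<open>d\<close> on the points from 2 to
  \<open>Suc a\<close>; subtracting 1 returns to the letters of the word. Together with
  \<open>right_word\<close> on the remaining points it describes which block permutations are
  conjugated by \<open>d\<close> into the Young subgroup.\<close>

definition left_word :: "(nat \<Rightarrow> 'b) \<Rightarrow> (nat \<Rightarrow> nat) \<Rightarrow> nat \<Rightarrow> 'b"
  where "left_word c d x = c (d (Suc x) - 1)"

definition right_word :: "nat \<Rightarrow> (nat \<Rightarrow> 'b) \<Rightarrow> (nat \<Rightarrow> nat) \<Rightarrow> nat \<Rightarrow> 'b"
  where "right_word a c d x = c (d (Suc (a + x)) - 1)"

definition content :: "nat \<Rightarrow> (nat \<Rightarrow> nat) \<Rightarrow> nat \<Rightarrow> nat"
  where "content l w j = card {x \<in> letters l. w x = j}"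

section \<open>Double cosets of Young and parabolic subgroups\<close>

context
  fixes a b m n :: nat
  assumes m: "m = a + b" and n: "n = Suc m"
begin

text \<open>\<open>join\<close> is inverse to the pair of block projections, so the parabolic
  subgroup maps onto the product of the two symmetric groups.\<close>

lemma join_parabolic:
  assumes al: "\<alpha> permutes letters a" and be: "\<beta> permutes letters b"
  shows "join a b \<alpha> \<beta> \<in> parabolic a n" "block_perm 1 a (join a b \<alpha> \<beta>) = \<alpha>" "block_perm (Suc a) b (join a b \<alpha> \<beta>) = \<beta>"
proof -
  let ?j = "join a b \<alpha> \<beta>" and ?j' = "join a b (inv' \<alpha>) (inv' \<beta>)"
  note A = permutes_letters[OF al] and B = permutes_letters[OF be]
  have val: "x \<in> letters a \<Longrightarrow> 0 < \<alpha> x \<and> \<alpha> x \<le> a" "x \<in> letters a \<Longrightarrow> 0 < inv' \<alpha> x \<and> inv' \<alpha> x \<le> a"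
     "x \<in> letters b \<Longrightarrow> 0 < \<beta> x \<and> \<beta> x \<le> b" "x \<in> letters b \<Longrightarrow> 0 < inv' \<beta> x \<and> inv' \<beta> x \<le> b" for x
    using A(1,2)[of x] B(1,2)[of x] by (auto simp: letters_iff)
  have j: "?j \<in> fix1 n"
  proof -
    have "?j permutes letters n"
    proof (rule permutesI_inverse[where g = ?j'])
      show "?j x \<in> letters n" "?j' x \<in> letters n" if "x \<in> letters n" for x
        using val[of "x - 1"] val[of "x - Suc a"] that by (auto simp: join_def m n letters_iff)
      show "?j (?j' x) = x" "?j' (?j x) = x" for x
        using val[of "x - 1"] val[of "x - Suc a"] A(3,4)[of "x - 1"] B(3,4)[of "x - Suc a"]
        by (auto simp: join_def letters_iff)
      show "?j x = x" if "x \<notin> letters n" for x using that by (auto simp: join_def letters_iff m n)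
    qed
    then show ?thesis by (simp add: fix1_iff join_def letters_iff)
  qed
  have "?j ` letters (Suc a) = letters (Suc a)"
  proof (rule endo_inj_surj)
    show "?j ` letters (Suc a) \<subseteq> letters (Suc a)"
      using val(1) by (auto simp: join_def letters_iff)
    show "inj_on ?j (letters (Suc a))" using permutes_inj[of ?j "letters n"] j by (auto simp: fix1_iff intro: inj_on_subset)
  qed simp
  then show "?j \<in> parabolic a n" using j by (auto simp: parabolic_def block_stabilizer_iff fix1_iff)
  show "block_perm 1 a ?j = \<alpha>"
    using permutes_not_in[OF al] by (auto simp: fun_eq_iff block_perm_apply join_def)
  show "block_perm (Suc a) b ?j = \<beta>"
    using permutes_not_in[OF be] by (auto simp: fun_eq_iff block_perm_apply join_def letters_iff)
qed

lemma parabolicD: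
  assumes g: "g \<in> parabolic a n"
  shows "g \<in> fix1 n" "block_perm 1 a g permutes letters a" "block_perm (Suc a) b g permutes letters b"
    "x \<in> letters a \<Longrightarrow> g (Suc x) = Suc (block_perm 1 a g x)"
    "x \<in> letters b \<Longrightarrow> g (Suc (a + x)) = Suc (a + block_perm (Suc a) b g x)"
    "g ` {1 + 1..1 + a} = {1 + 1..1 + a}" "g ` {Suc a + 1..Suc a + b} = {Suc a + 1..Suc a + b}"
proof -
  show f: "g \<in> fix1 n" using g by (simp add: parabolic_def)
  then have p: "g permutes letters n" and 1: "g (Suc 0) = Suc 0" by (auto simp: fix1_iff)
  have bl: "g ` letters (Suc a) = letters (Suc a)" using g by (simp add: parabolic_def block_stabilizer_iff)
  have e1: "{1 + 1..1 + a} = letters (Suc a) - {Suc 0}" and e2: "{Suc a + 1..Suc a + b} = letters n - letters (Suc a)"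
    by (auto simp: letters_iff m n)
  show i1: "g ` {1 + 1..1 + a} = {1 + 1..1 + a}"
    unfolding e1 using image_set_diff[OF permutes_inj[OF p], of "letters (Suc a)" "{Suc 0}"] bl 1 by simp
  show i2: "g ` {Suc a + 1..Suc a + b} = {Suc a + 1..Suc a + b}"
    unfolding e2 using image_set_diff[OF permutes_inj[OF p], of "letters n" "letters (Suc a)"] bl permutes_image[OF p] by simp
  have p': "g permutes {1..n}" using p by (simp add: letters_def)
  show q1: "block_perm 1 a g permutes letters a" using block_perm_hom(1)[OF p' i1] by (simp add: letters_def)
  show q2: "block_perm (Suc a) b g permutes letters b" using block_perm_hom(1)[OF p' i2] by (simp add: letters_def)
  show "g (Suc x) = Suc (block_perm 1 a g x)" if x: "x \<in> letters a"
  proof -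
    have "Suc x \<in> {1 + 1..1 + a}" using x by (auto simp: letters_iff)
    then have "g (Suc x) \<in> {1 + 1..1 + a}" using i1 by blast
    then show ?thesis using x by (auto simp: block_perm_apply)
  qed
  show "g (Suc (a + x)) = Suc (a + block_perm (Suc a) b g x)" if x: "x \<in> letters b"
  proof -
    have "Suc (a + x) \<in> {Suc a + 1..Suc a + b}" using x by (auto simp: letters_iff)
    then have "g (Suc (a + x)) \<in> {Suc a + 1..Suc a + b}" using i2 by blast
    then show ?thesis using x by (auto simp: block_perm_apply add.commute)
  qed
qed

lemma letters_split: "x \<in> letters m \<longleftrightarrow> x \<in> letters a \<or> (\<exists>y\<in>letters b. x = a + y)"
proof
  assume "x \<in> letters m"
  then have "x \<in> letters a \<or> (x - a \<in> letters b \<and> x = a + (x - a))" by (auto simp: letters_iff m)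
  then show "x \<in> letters a \<or> (\<exists>y\<in>letters b. x = a + y)" by blast
qed (auto simp: letters_iff m)

lemma ball_letters_split: "(\<forall>x\<in>letters m. P x) \<longleftrightarrow> (\<forall>x\<in>letters a. P x) \<and> (\<forall>y\<in>letters b. P (a + y))"
  by (auto simp: letters_split)

text \<open>Conjugation by \<open>d\<close> turns the word \<open>c\<close> into its reading along
  \<open>d\<close>; for an element preserving the blocks, the invariance condition separates into
  one for each block.\<close>

lemma parabolic_conjugate_iff:
  assumes d: "d \<in> fix1 n" and g: "g \<in> parabolic a n"
  shows "d \<circ> g \<circ> inv' d \<in> young m c \<longleftrightarrow> block_perm 1 a g \<in> word_stab a (left_word c d)
    \<and> block_perm (Suc a) b g \<in> word_stab b (right_word a c d)"
proof -
  note gD = parabolicD[OF g]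
  have dm: "d \<in> fix1 (Suc m)" using d n by simp
  note dp = permutes_letters[OF fix1D(1)[OF dm]]
  have "d \<circ> g \<circ> inv' d \<in> fix1 n" using d gD(1) by (intro fix1_comp fix1_inv)
  then have "d \<circ> g \<circ> inv' d \<in> young m c \<longleftrightarrow> (\<forall>x\<in>letters m. c (d (g (inv' d (Suc x))) - 1) = c x)"
    by (simp add: young_iff n)
  also have "\<dots> \<longleftrightarrow> (\<forall>x\<in>letters m. c (d (g (Suc x)) - 1) = c (d (Suc x) - 1))"
  proof (intro iffI ballI)
    fix x assume *: "\<forall>x\<in>letters m. c (d (g (inv' d (Suc x))) - 1) = c x" and x: "x \<in> letters m"
    have "d (Suc x) - 1 \<in> letters m" "Suc (d (Suc x) - 1) = d (Suc x)" using fix1D(2,3)[OF dm x] by auto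
    then show "c (d (g (Suc x)) - 1) = c (d (Suc x) - 1)" using *[rule_format, of "d (Suc x) - 1"] by (simp add: dp(4))
  next
    fix x assume *: "\<forall>x\<in>letters m. c (d (g (Suc x)) - 1) = c (d (Suc x) - 1)" and x: "x \<in> letters m"
    have i: "inv' d \<in> fix1 (Suc m)" by (rule fix1_inv[OF dm])
    have "inv' d (Suc x) - 1 \<in> letters m" "Suc (inv' d (Suc x) - 1) = inv' d (Suc x)" using fix1D(2,3)[OF i x] by auto
    then show "c (d (g (inv' d (Suc x))) - 1) = c x" using *[rule_format, of "inv' d (Suc x) - 1"] by (simp add: dp(3))
  qed
  also have "\<dots> \<longleftrightarrow> block_perm 1 a g \<in> word_stab a (left_word c d)
    \<and> block_perm (Suc a) b g \<in> word_stab b (right_word a c d)"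
    using gD(2,3) by (simp add: word_stab_def left_word_def right_word_def ball_letters_split gD(4,5))
  finally show ?thesis .
qed

text \<open>The content of the left word thus determines that of the right word, which is why the
  left one alone labels double cosets.\<close>

lemma content_sum:
  assumes d: "d \<in> fix1 n"
  shows "content a (left_word c d) j + content b (right_word a c d) j = content m c j"
proof -
  have dm: "d \<in> fix1 (Suc m)" using d n by simp
  note p = block_perm_fix1(1)[OF dm]
  have w: "c (block_perm 1 m d x) = c (d (Suc x) - 1)" if "x \<in> letters m" for x
    using that by (simp add: block_perm_apply)
  have "content m c j = card {x \<in> letters m. c (block_perm 1 m d x) = j}"
    unfolding content_def by (rule card_permute[OF p, symmetric])
  also have "{x \<in> letters m. c (block_perm 1 m d x) = j} = {x \<in> letters m. c (d (Suc x) - 1) = j}" using w by auto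
  also have "\<dots> = {x \<in> letters a. left_word c d x = j} \<union> (+) a ` {x \<in> letters b. right_word a c d x = j}"
    by (auto simp: letters_split left_word_def right_word_def)
  also have "card \<dots> = card {x \<in> letters a. left_word c d x = j} + card ((+) a ` {x \<in> letters b. right_word a c d x = j})"
    by (rule card_Un_disjoint) (auto simp: letters_iff)
  finally show ?thesis by (simp add: content_def card_image)
qed

text \<open>Double cosets correspond to ways of splitting the multiset of letters of
  \<open>c\<close> into two parts. Given equal contents, permutations matching the two pairs of
  words are joined to a block permutation \<open>k\<close>, and what remains of \<open>g\<close>
  lies in the Young subgroup.\<close>

lemma double_coset:
  assumes g: "g \<in> fix1 n" and d: "d \<in> fix1 n"
  shows "content a (left_word c g) = content a (left_word c d) \<longleftrightarrow> (\<exists>y\<in>young m c. \<exists>k\<in>parabolic a n. g = y \<circ> d \<circ> k)"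
proof
  have dp: "d permutes letters n" using d by (simp add: fix1_iff)
  assume e: "content a (left_word c g) = content a (left_word c d)"
  then have e': "content b (right_word a c g) j = content b (right_word a c d) j" for j
    using content_sum[OF g, of c j] content_sum[OF d, of c j] by simp
  obtain \<alpha> where al: "\<alpha> permutes letters a" "\<And>x. x \<in> letters a \<Longrightarrow> left_word c d (\<alpha> x) = left_word c g x"
    using permutes_matching[of "letters a" "left_word c d" "left_word c g"] fun_cong[OF e] by (auto simp: content_def)
  obtain \<beta> where be: "\<beta> permutes letters b" "\<And>x. x \<in> letters b \<Longrightarrow> right_word a c d (\<beta> x) = right_word a c g x"
    using permutes_matching[of "letters b" "right_word a c d" "right_word a c g"] e' by (auto simp: content_def)
  define k where "k = join a b \<alpha> \<beta>"
  note kj = join_parabolic[OF al(1) be(1), folded k_def]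
  note kD = parabolicD[OF kj(1)]
  have kp: "k permutes letters n" using kD(1) by (simp add: fix1_iff)
  have key: "c (d (k (Suc x)) - 1) = c (g (Suc x) - 1)" if "x \<in> letters m" for x
    using that[unfolded letters_split]
  proof (elim disjE bexE)
    assume x: "x \<in> letters a"
    then show ?thesis using kD(4)[OF x] al(2)[OF x] kj(2) by (simp add: left_word_def)
  next
    fix z assume z: "z \<in> letters b" "x = a + z"
    then show ?thesis using kD(5)[OF z(1)] be(2)[OF z(1)] kj(3) by (simp add: right_word_def)
  qed
  define y where "y = g \<circ> inv' k \<circ> inv' d"
  have y: "y \<in> fix1 n" unfolding y_def using g d kD(1) by (intro fix1_comp fix1_inv)
  have "c (y (Suc x) - 1) = c x" if x: "x \<in> letters m" for x
  proof -
    define z where "z = inv' k (inv' d (Suc x)) - 1"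
    have i: "inv' k \<circ> inv' d \<in> fix1 (Suc m)" using d kD(1) n by (intro fix1_comp fix1_inv) auto
    have z: "z \<in> letters m" "Suc z = inv' k (inv' d (Suc x))" using fix1D(2,3)[OF i x] by (auto simp: z_def)
    then have "c (d (k (inv' k (inv' d (Suc x)))) - 1) = c (g (inv' k (inv' d (Suc x))) - 1)" using key[OF z(1)] by simp
    then show ?thesis by (simp add: y_def permutes_letters(3)[OF kp] permutes_letters(3)[OF dp])
  qed
  then have "y \<in> young m c" using y by (simp add: young_iff n)
  moreover have "g = y \<circ> d \<circ> k"
    by (simp add: y_def fun_eq_iff permutes_letters(4)[OF dp] permutes_letters(4)[OF kp])
  ultimately show "\<exists>y\<in>young m c. \<exists>k\<in>parabolic a n. g = y \<circ> d \<circ> k" using kj(1) by blast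
next
  assume "\<exists>y\<in>young m c. \<exists>k\<in>parabolic a n. g = y \<circ> d \<circ> k"
  then obtain y k where y: "y \<in> young m c" and k: "k \<in> parabolic a n" and g_eq: "g = y \<circ> d \<circ> k" by blast
  note kD = parabolicD[OF k]
  have dm: "d \<in> fix1 (Suc m)" using d n by simp
  have "left_word c g x = left_word c d (block_perm 1 a k x)" if x: "x \<in> letters a" for x
  proof -
    define z where "z = block_perm 1 a k x"
    have z: "z \<in> letters m" using permutes_letters(1)[OF kD(2) x] by (simp add: z_def letters_split)
    have "d (Suc z) - 1 \<in> letters m" "Suc (d (Suc z) - 1) = d (Suc z)" using fix1D(2,3)[OF dm z] by auto
    then have "c (y (d (Suc z)) - 1) = c (d (Suc z) - 1)" using y by (metis young_iff)
    then show ?thesis using kD(4)[OF x] by (simp add: left_word_def g_eq z_def)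
  qed
  then have "{x \<in> letters a. left_word c g x = j} = {x \<in> letters a. left_word c d (block_perm 1 a k x) = j}" for j by auto
  then show "content a (left_word c g) = content a (left_word c d)"
    using card_permute[OF kD(2), of "\<lambda>x. left_word c d x = _"] by (simp add: content_def fun_eq_iff)
qed

lemma double_coset_representatives:
  fixes c :: "nat \<Rightarrow> nat"
  obtains D where "D \<subseteq> fix1 n"
    and "\<And>g. g \<in> fix1 n \<Longrightarrow> \<exists>d\<in>D. content a (left_word c g) = content a (left_word c d)"
    and "\<And>d d'. d \<in> D \<Longrightarrow> d' \<in> D \<Longrightarrow> content a (left_word c d) = content a (left_word c d') \<Longrightarrow> d = d'"
proof -
  let ?f = "\<lambda>g. content a (left_word c g)"
  define D where "D = inv_into (fix1 n) ?f ` (?f ` fix1 n)"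
  have 1: "D \<subseteq> fix1 n" by (auto simp: D_def inv_into_into)
  have 2: "\<exists>d\<in>D. ?f g = ?f d" if "g \<in> fix1 n" for g
    using that by (intro bexI[of _ "inv_into (fix1 n) ?f (?f g)"]) (auto simp: D_def f_inv_into_f[of "?f g" ?f])
  have 3: "d = d'" if "d \<in> D" "d' \<in> D" "?f d = ?f d'" for d d'
    using that f_inv_into_f[of _ ?f "fix1 n"] by (auto simp: D_def)
  show thesis by (rule that[OF 1 2 3])
qed

text \<open>Every splitting of the letters of \<open>c\<close> into two words occurs, because the
  concatenated word is a rearrangement of \<open>c\<close>.\<close>

lemma words_from_double_coset:
  assumes "\<And>j. content a w1 j + content b w2 j = content m c j"
  obtains d where "d \<in> fix1 n" "content a (left_word c d) = content a w1" "content b (right_word a c d) = content b w2"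
proof -
  define w where "w x = (if x \<in> letters a then w1 x else w2 (x - a))" for x
  have "card {x \<in> letters m. c x = j} = card {x \<in> letters m. w x = j}" for j
  proof -
    have "a + y \<notin> letters a" if "y \<in> letters b" for y using that by (auto simp: letters_iff)
    then have "{x \<in> letters m. w x = j} = {x \<in> letters a. w1 x = j} \<union> (+) a ` {x \<in> letters b. w2 x = j}"
      by (auto simp: letters_split w_def)
    then have "card {x \<in> letters m. w x = j} = card ({x \<in> letters a. w1 x = j} \<union> (+) a ` {x \<in> letters b. w2 x = j})"
      by simp
    also have "\<dots> = card {x \<in> letters a. w1 x = j} + card ((+) a ` {x \<in> letters b. w2 x = j})"
      by (rule card_Un_disjoint) (auto simp: letters_iff)
    finally show ?thesis using assms[of j] by (simp add: content_def card_image)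
  qed
  then obtain \<sigma> where s: "\<sigma> permutes letters m" "\<And>x. x \<in> letters m \<Longrightarrow> c (\<sigma> x) = w x"
    using permutes_matching[of "letters m" c w] by auto
  have "left_word c (shift m \<sigma>) x = w1 x" if "x \<in> letters a" for x
    using that s(2)[of x] by (auto simp: left_word_def shift_def letters_split w_def)
  moreover have "right_word a c (shift m \<sigma>) x = w2 x" if "x \<in> letters b" for x
    using that s(2)[of "a + x"] by (simp add: right_word_def shift_def w_def letters_iff m)
  ultimately have "content a (left_word c (shift m \<sigma>)) = content a w1" "content b (right_word a c (shift m \<sigma>)) = content b w2"
    by (auto simp: content_def fun_eq_iff intro!: arg_cong[of _ _ card])
  then show thesis using that shift_permutes[OF s(1)] n by blast
qed

lemma subgroup_parabolic: "subgroup (parabolic a n) (sym_group_fix1 n)"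
proof (rule group.subgroupI[OF group_sym_group_fix1])
  interpret B: subgroup "block_stabilizer n (Suc a)" "sym_group n" by (rule subgroup_block_stabilizer)
  show "parabolic a n \<subseteq> carrier (sym_group_fix1 n)" by (auto simp: parabolic_def)
  show "parabolic a n \<noteq> {}" using B.one_closed fix1_id by (auto simp: parabolic_def sym_group_one)
  fix g assume g: "g \<in> parabolic a n"
  then have gf: "g \<in> fix1 n" and gb: "g \<in> block_stabilizer n (Suc a)" by (auto simp: parabolic_def)
  have "inv' g \<in> block_stabilizer n (Suc a)"
    using B.m_inv_closed[OF gb] inv_sym_group[of g n] gf by (simp add: fix1_iff)
  then show "inv\<^bsub>sym_group_fix1 n\<^esub> g \<in> parabolic a n" using gf fix1_inv by (simp add: inv_sym_group_fix1 parabolic_def)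
  fix h assume "h \<in> parabolic a n"
  then show "g \<otimes>\<^bsub>sym_group_fix1 n\<^esub> h \<in> parabolic a n"
    using gf gb B.m_closed[OF gb, of h] by (auto simp: parabolic_def fix1_comp sym_group_mult)
qed

lemma representation_block_pullback:
  assumes A: "representation (sym_group l) A" and H: "\<And>g. g \<in> H \<Longrightarrow> g permutes {1..n} \<and> g ` {s+1..s+l} = {s+1..s+l}"
  shows "representation ((sym_group n)\<lparr>carrier := H\<rparr>) (pullback (block_perm s l) A)"
proof (rule representation_pullback[OF A])
  show "block_perm s l \<in> hom ((sym_group n)\<lparr>carrier := H\<rparr>) (sym_group l)"
    using H block_perm_hom[of _ n s l] by (auto simp: hom_def sym_group_carrier sym_group_mult)
  show "block_perm s l \<one>\<^bsub>(sym_group n)\<lparr>carrier := H\<rparr>\<^esub> = \<one>\<^bsub>sym_group l\<^esub>"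
    by (auto simp: sym_group_one block_perm_def fun_eq_iff)
qed

text \<open>The conjugated stabilizer is the full product of two word stabilizers: a permutation of
  one block can be joined with the identity on the other. This is the splitting that
  \<open>dim_fixed_tensor\<close> asks for.\<close>

lemma dim_fixed_parabolic_tensor:
  assumes A: "representation (sym_group a) A" and B: "representation (sym_group b) B" and d: "d \<in> fix1 n"
  shows "cfun.dim (fixed {g \<in> parabolic a n. d \<circ> g \<circ> inv' d \<in> young m c}
      (tensor_rep (pullback (block_perm 1 a) A) (pullback (block_perm (Suc a) b) B))) =
    cfun.dim (fixed (word_stab a (left_word c d)) A) * cfun.dim (fixed (word_stab b (right_word a c d)) B)"
proof -
  let ?H = "{g \<in> parabolic a n. d \<circ> g \<circ> inv' d \<in> young m c}"
  let ?G = "(sym_group n)\<lparr>carrier := parabolic a n\<rparr>"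
  have G_eq: "?G = (sym_group_fix1 n)\<lparr>carrier := parabolic a n\<rparr>" by (simp add: sym_group_fix1_def)
  have p: "g permutes {1..n}" if "g \<in> parabolic a n" for g using parabolicD(1)[OF that] by (simp add: fix1_iff letters_def)
  have RA: "representation ?G (pullback (block_perm 1 a) A)"
    by (rule representation_block_pullback[OF A]) (use p parabolicD(6) in blast)
  have RB: "representation ?G (pullback (block_perm (Suc a) b) B)"
    by (rule representation_block_pullback[OF B]) (use p parabolicD(7) in blast)
  have H_iff: "g \<in> ?H \<longleftrightarrow> g \<in> parabolic a n \<and> block_perm 1 a g \<in> word_stab a (left_word c d)
      \<and> block_perm (Suc a) b g \<in> word_stab b (right_word a c d)" for g
    using parabolic_conjugate_iff[OF d, of g c] by auto
  have id_a: "id \<in> word_stab a (left_word c d)" and id_b: "id \<in> word_stab b (right_word a c d)"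
    by (simp_all add: word_stab_def permutes_id)
  have one: "snd A id v = v" if "v \<in> fst A" for v using representationD(4)[OF A that] by (simp add: sym_group_one)
  have oneB: "snd B id v = v" if "v \<in> fst B" for v using representationD(4)[OF B that] by (simp add: sym_group_one)
  have joinH: "join a b \<alpha> \<beta> \<in> ?H" if "\<alpha> \<in> word_stab a (left_word c d)" "\<beta> \<in> word_stab b (right_word a c d)" for \<alpha> \<beta>
    using that join_parabolic[of \<alpha> \<beta>] unfolding H_iff by (simp add: word_stab_def)
  have perm_a: "g permutes letters a" if "g \<in> word_stab a (left_word c d)" for g using that by (simp add: word_stab_def)
  have perm_b: "g permutes letters b" if "g \<in> word_stab b (right_word a c d)" for g using that by (simp add: word_stab_def)
  have "cfun.dim (fixed ?H (tensor_rep (pullback (block_perm 1 a) A) (pullback (block_perm (Suc a) b) B))) =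
      cfun.dim (fixed ?H (pullback (block_perm 1 a) A)) * cfun.dim (fixed ?H (pullback (block_perm (Suc a) b) B))"
  proof (rule dim_fixed_tensor[OF RA RB])
    fix h assume h: "h \<in> ?H"
    then have h': "block_perm 1 a h \<in> word_stab a (left_word c d)" "block_perm (Suc a) b h \<in> word_stab b (right_word a c d)"
      unfolding H_iff by auto
    show "\<exists>h'\<in>?H. (\<forall>v\<in>fst (pullback (block_perm 1 a) A). snd (pullback (block_perm 1 a) A) h' v = snd (pullback (block_perm 1 a) A) h v)
        \<and> (\<forall>v\<in>fst (pullback (block_perm (Suc a) b) B). snd (pullback (block_perm (Suc a) b) B) h' v = v)"
      using joinH[OF h'(1) id_b] join_parabolic[OF perm_a[OF h'(1)] permutes_id[of "letters b"]] oneB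
      by (intro bexI[of _ "join a b (block_perm 1 a h) id"]) auto
    show "\<exists>h'\<in>?H. (\<forall>v\<in>fst (pullback (block_perm (Suc a) b) B). snd (pullback (block_perm (Suc a) b) B) h' v = snd (pullback (block_perm (Suc a) b) B) h v)
        \<and> (\<forall>v\<in>fst (pullback (block_perm 1 a) A). snd (pullback (block_perm 1 a) A) h' v = v)"
      using joinH[OF id_a h'(2)] join_parabolic[OF permutes_id[of "letters a"] perm_b[OF h'(2)]] one
      by (intro bexI[of _ "join a b id (block_perm (Suc a) b h)"]) auto
  next
    show "group ?G" unfolding G_eq by (rule subgroup.subgroup_is_group[OF subgroup_parabolic group_sym_group_fix1])
  qed auto
  also have "fixed ?H (pullback (block_perm 1 a) A) = fixed (word_stab a (left_word c d)) A"
  proof -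
    have "block_perm 1 a ` ?H = word_stab a (left_word c d)"
    proof (intro subset_antisym subsetI)
      fix \<alpha> assume al: "\<alpha> \<in> word_stab a (left_word c d)"
      then show "\<alpha> \<in> block_perm 1 a ` ?H"
        using join_parabolic(2)[OF perm_a[OF al] permutes_id] joinH[OF al id_b]
        by (intro image_eqI[where x = "join a b \<alpha> id"]) simp_all
    qed (use H_iff in auto)
    then show ?thesis by (simp add: fixed_pullback)
  qed
  also have "fixed ?H (pullback (block_perm (Suc a) b) B) = fixed (word_stab b (right_word a c d)) B"
  proof -
    have "block_perm (Suc a) b ` ?H = word_stab b (right_word a c d)"
    proof (intro subset_antisym subsetI)
      fix \<beta> assume be: "\<beta> \<in> word_stab b (right_word a c d)"
      then show "\<beta> \<in> block_perm (Suc a) b ` ?H"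
        using join_parabolic(3)[OF permutes_id perm_b[OF be]] joinH[OF id_a be]
        by (intro image_eqI[where x = "join a b id \<beta>"]) simp_all
    qed (use H_iff in auto)
    then show ?thesis by (simp add: fixed_pullback)
  qed
  finally show ?thesis .
qed

end

section \<open>Invariants of the induced representations\<close>

lemma representation_Res_iff:
  assumes "monoid (G\<lparr>carrier := H\<rparr>)"
  shows "representation (G\<lparr>carrier := H\<rparr>) (Res H R) \<longleftrightarrow> representation (G\<lparr>carrier := H\<rparr>) R"
proof -
  obtain V \<pi> where R: "R = (V, \<pi>)" by (cases R)
  have "\<one>\<^bsub>G\<^esub> \<in> H" "\<And>g h. g \<in> H \<Longrightarrow> h \<in> H \<Longrightarrow> g \<otimes>\<^bsub>G\<^esub> h \<in> H"
    using monoid.one_closed[OF assms] monoid.m_closed[OF assms] by auto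
  then show ?thesis by (simp add: representation_def Res_def R)
qed

lemma fixed_Res: "Y \<subseteq> H \<Longrightarrow> fixed Y (Res H R) = fixed Y R"
  by (cases R) (auto simp: fixed_def Res_def subset_iff)

lemma fixed_tensor_cong:
  assumes "fst A = fst A'" "fst B = fst B'" "\<And>h. h \<in> H \<Longrightarrow> snd A h = snd A' h" "\<And>h. h \<in> H \<Longrightarrow> snd B h = snd B' h"
  shows "fixed H (tensor_rep A B) = fixed H (tensor_rep A' B')"
  using assms by (auto simp: fixed_def tensor_rep_def)

lemma specht_at_eq: "specht_at s lam = pullback (block_perm s (sum_list lam)) (specht lam)"
  by (simp add: specht_at_def pullback_def)

definition prepend :: "'b \<Rightarrow> (nat \<Rightarrow> 'b) \<Rightarrow> nat \<Rightarrow> 'b"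
  where "prepend M w x = (if x = Suc 0 then M else w (x - 1))"

text \<open>A letter occurring just once must stay in place, so the stabilizer of the extended word
  fixes 1 by itself. Restriction to a smaller symmetric group thus becomes a mere change of
  word.\<close>

lemma young_eq_word_stab:
  assumes "M \<notin> w ` letters a"
  shows "young a w = word_stab (Suc a) (prepend M w)"
proof (intro subset_antisym subsetI)
  have split: "x \<in> letters (Suc a) \<longleftrightarrow> x = Suc 0 \<or> x - 1 \<in> letters a" for x by (auto simp: letters_iff)
  have ne: "Suc z \<noteq> Suc 0" if "z \<in> letters a" for z using that by (auto simp: letters_iff)
  fix g assume g: "g \<in> young a w"
  then have f: "g \<in> fix1 (Suc a)" by (simp add: young_iff)
  have "prepend M w (g x) = prepend M w x" if x: "x \<in> letters (Suc a)" for x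
  proof (cases "x = Suc 0")
    case False
    then have z: "x - 1 \<in> letters a" "x = Suc (x - 1)" using x split by (auto simp: letters_iff)
    then have "w (g x - 1) = w (x - 1)" using g by (metis young_iff)
    moreover have "g x \<noteq> Suc 0" using fix1D(2,3)[OF f z(1)] z(2) ne by metis
    ultimately show ?thesis using False by (simp add: prepend_def)
  qed (simp add: fix1D(4)[OF f])
  then show "g \<in> word_stab (Suc a) (prepend M w)" using fix1D(1)[OF f] by (simp add: word_stab_def)
next
  fix g assume g: "g \<in> word_stab (Suc a) (prepend M w)"
  then have p: "g permutes letters (Suc a)" and c: "\<And>x. x \<in> letters (Suc a) \<Longrightarrow> prepend M w (g x) = prepend M w x"
    by (auto simp: word_stab_def)
  have "g (Suc 0) = Suc 0"
  proof (rule ccontr)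
    assume no: "g (Suc 0) \<noteq> Suc 0"
    have "g (Suc 0) \<in> letters (Suc a)" by (rule permutes_letters(1)[OF p]) (simp add: letters_iff)
    then have "g (Suc 0) - 1 \<in> letters a" using no by (auto simp: letters_iff)
    moreover have "w (g (Suc 0) - 1) = M" using c[of "Suc 0"] no by (simp add: prepend_def letters_iff)
    ultimately show False using assms by auto
  qed
  then have f: "g \<in> fix1 (Suc a)" using p by (simp add: fix1_iff)
  have "w (g (Suc x) - 1) = w x" if x: "x \<in> letters a" for x
  proof -
    have "g (Suc x) \<noteq> Suc 0" using fix1D(2,3)[OF f x] by (auto simp: letters_iff)
    then show ?thesis using c[of "Suc x"] x by (auto simp: prepend_def letters_iff)
  qed
  then show "g \<in> young a w" using f by (simp add: young_iff)
qed

lemma dim_fixed_specht_shift: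
  assumes "lam \<in> partitions (Suc a)" "M \<notin> w ` letters a"
  shows "cfun.dim (fixed (word_stab a w) (pullback (shift a) (specht lam))) = card (ssyt_word lam (prepend M w))"
  using dim_fixed_specht[OF assms(1), of "prepend M w"] partitionsD(1)[OF assms(1)]
  by (simp add: fixed_pullback_shift young_eq_word_stab[OF assms(2)])

lemma representation_specht_shift:
  assumes "lam \<in> partitions (Suc a)"
  shows "representation (sym_group a) (pullback (shift a) (specht lam))"
proof (rule representation_pullback)
  show "representation (sym_group (Suc a)) (specht lam)"
    using representation_specht[of lam] partitionsD(1)[OF assms] by simp
  show "shift a \<in> hom (sym_group a) (sym_group (Suc a))"
    using fix1D(1)[OF shift_permutes] by (auto simp: hom_def carrier_sym_group shift_comp sym_group_mult)
qed (simp add: sym_group_one shift_id)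

lemma finite_fix1: "finite (fix1 n)"
  by (rule finite_subset[OF _ finite_permutations[of "letters n"]]) (auto simp: fix1_iff)

section \<open>Invariants of the induced and of the partial representation\<close>

context
  fixes a b m n :: nat
  assumes m: "m = a + b" and n: "n = Suc m"
begin

interpretation fix1_group: group "sym_group_fix1 n" by (rule group_sym_group_fix1)

lemma subgroup_young: "subgroup (young m c) (sym_group_fix1 n)"
proof (rule fix1_group.subgroupI)
  show "young m c \<subseteq> carrier (sym_group_fix1 n)" using young_subset n by simp
  show "young m c \<noteq> {}" using young_closed(1) by blast
  show "inv\<^bsub>sym_group_fix1 n\<^esub> y \<in> young m c" if "y \<in> young m c" for y
    using that young_subset[of m c] n young_closed(2) by (subst inv_sym_group_fix1) auto
  show "y \<otimes>\<^bsub>sym_group_fix1 n\<^esub> z \<in> young m c" if "y \<in> young m c" "z \<in> young m c" for y z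
    using that young_closed(3) by simp
qed

lemma representation_parabolic_tensor:
  assumes A: "representation (sym_group a) A" and B: "representation (sym_group b) B"
  shows "representation ((sym_group_fix1 n)\<lparr>carrier := parabolic a n\<rparr>)
    (tensor_rep (pullback (block_perm 1 a) A) (pullback (block_perm (Suc a) b) B))"
proof (rule representation_tensor_rep)
  have p: "g permutes {1..n}" if "g \<in> parabolic a n" for g
    using parabolicD(1)[OF m n that] by (simp add: fix1_iff letters_def)
  have eq: "(sym_group_fix1 n)\<lparr>carrier := parabolic a n\<rparr> = (sym_group n)\<lparr>carrier := parabolic a n\<rparr>"
    by (simp add: sym_group_fix1_def)
  show "group ((sym_group_fix1 n)\<lparr>carrier := parabolic a n\<rparr>)"
    by (rule subgroup.subgroup_is_group[OF subgroup_parabolic[OF m n] group_sym_group_fix1])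
  show "representation ((sym_group_fix1 n)\<lparr>carrier := parabolic a n\<rparr>) (pullback (block_perm 1 a) A)"
    unfolding eq by (rule representation_block_pullback[OF m n A]) (use p parabolicD(6)[OF m n] in blast)
  show "representation ((sym_group_fix1 n)\<lparr>carrier := parabolic a n\<rparr>) (pullback (block_perm (Suc a) b) B)"
    unfolding eq by (rule representation_block_pullback[OF m n B]) (use p parabolicD(7)[OF m n] in blast)
qed

lemma representation_Ind:
  assumes "representation ((sym_group_fix1 n)\<lparr>carrier := parabolic a n\<rparr>) R"
  shows "representation (sym_group_fix1 n) (Ind (sym_group_fix1 n) (parabolic a n) R)"
proof -
  interpret P: subgroup "parabolic a n" "sym_group_fix1 n" by (rule subgroup_parabolic[OF m n])
  have sub: "subgroup (carrier (sym_group_fix1 n)) (sym_group_fix1 n)" by (rule fix1_group.subgroup_self)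
  have "global_on (carrier (sym_group_fix1 n)) (sym_group_fix1 n) (Ind (sym_group_fix1 n) (parabolic a n) R)"
    unfolding Ind_def
    by (rule ind_on_global[OF group_sym_group_fix1 subgroup_parabolic[OF m n] assms _ _ _ sub])
      (use finite_fix1 P.mem_carrier in \<open>auto intro: fix1_comp\<close>)
  then have "representation ((sym_group_fix1 n)\<lparr>carrier := fix1 n\<rparr>)
      (Res (fix1 n) (Ind (sym_group_fix1 n) (parabolic a n) R))" by (simp add: global_on_def)
  moreover have eq: "(sym_group_fix1 n)\<lparr>carrier := fix1 n\<rparr> = sym_group_fix1 n" by (simp add: sym_group_fix1_def)
  moreover have "monoid ((sym_group_fix1 n)\<lparr>carrier := fix1 n\<rparr>)" unfolding eq by (rule fix1_group.monoid_axioms)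
  ultimately have "representation ((sym_group_fix1 n)\<lparr>carrier := fix1 n\<rparr>) (Ind (sym_group_fix1 n) (parabolic a n) R)"
    using representation_Res_iff by blast
  then show ?thesis by (simp only: eq)
qed

text \<open>The representatives are a parameter, so that the very same set can be used for the
  partial representation and for the product of Schur polynomials.\<close>

theorem dim_fixed_Ind:
  assumes A: "representation (sym_group a) A" and B: "representation (sym_group b) B"
    and D: "D \<subseteq> fix1 n"
      "\<And>g. g \<in> fix1 n \<Longrightarrow> \<exists>d\<in>D. content a (left_word c g) = content a (left_word c d)"
      "\<And>d d'. d \<in> D \<Longrightarrow> d' \<in> D \<Longrightarrow> content a (left_word c d) = content a (left_word c d') \<Longrightarrow> d = d'"
  shows "cfun.dim (fixed (young m c) (Ind (sym_group_fix1 n) (parabolic a n)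
      (tensor_rep (pullback (block_perm 1 a) A) (pullback (block_perm (Suc a) b) B)))) =
    (\<Sum>d\<in>D. cfun.dim (fixed (word_stab a (left_word c d)) A) * cfun.dim (fixed (word_stab b (right_word a c d)) B))"
proof -
  interpret P: subgroup "parabolic a n" "sym_group_fix1 n" by (rule subgroup_parabolic[OF m n])
  let ?R = "tensor_rep (pullback (block_perm 1 a) A) (pullback (block_perm (Suc a) b) B)"
  note R = representation_parabolic_tensor[OF A B]
  have "cfun.dim (fixed (young m c) (Ind (sym_group_fix1 n) (parabolic a n) ?R)) =
    (\<Sum>d\<in>D. cfun.dim (fixed {k \<in> parabolic a n. d \<otimes>\<^bsub>sym_group_fix1 n\<^esub> k \<otimes>\<^bsub>sym_group_fix1 n\<^esub> inv\<^bsub>sym_group_fix1 n\<^esub> d \<in> young m c} ?R))"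
    unfolding Ind_def
  proof (rule dim_fixed_ind_on[OF group_sym_group_fix1 subgroup_parabolic[OF m n] R _ _ _ representation_Ind[OF R, unfolded Ind_def] _ subgroup_young])
    show "finite (carrier (sym_group_fix1 n))" by (simp add: finite_fix1)
    show "young m c \<subseteq> carrier (sym_group_fix1 n)" using young_subset[of m c] n by simp
    show "D \<subseteq> carrier (sym_group_fix1 n)" using D(1) by simp
    show "carrier (sym_group_fix1 n) \<noteq> {}" using fix1_id by auto
    show "\<exists>d\<in>D. \<exists>y\<in>young m c. \<exists>k\<in>parabolic a n. g = y \<otimes>\<^bsub>sym_group_fix1 n\<^esub> d \<otimes>\<^bsub>sym_group_fix1 n\<^esub> k"
      if "g \<in> carrier (sym_group_fix1 n)" for g
    proof -
      have g: "g \<in> fix1 n" using that by simp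
      obtain d where "d \<in> D" "content a (left_word c g) = content a (left_word c d)" using D(2)[OF g] by blast
      then show ?thesis using double_coset[OF m n g, of d c] D(1) by auto
    qed
    show "d = d'" if "d \<in> D" "d' \<in> D" "y \<in> young m c" "k \<in> parabolic a n"
      "d' = y \<otimes>\<^bsub>sym_group_fix1 n\<^esub> d \<otimes>\<^bsub>sym_group_fix1 n\<^esub> k" for d d' y k
    proof -
      have f: "d \<in> fix1 n" "d' \<in> fix1 n" using that D(1) by auto
      have "content a (left_word c d') = content a (left_word c d)"
        unfolding double_coset[OF m n f(2,1)] using that(3-5) by auto
      then show ?thesis using D(3)[OF that(2,1)] by simp
    qed
  qed (use P.mem_carrier young_subset[of m c] n in \<open>auto intro: fix1_comp\<close>)
  also have "\<dots> = (\<Sum>d\<in>D. cfun.dim (fixed (word_stab a (left_word c d)) A) * cfun.dim (fixed (word_stab b (right_word a c d)) B))"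
  proof (rule sum.cong[OF refl])
    fix d assume "d \<in> D"
    then have d: "d \<in> fix1 n" using D(1) by blast
    have "{k \<in> parabolic a n. d \<otimes>\<^bsub>sym_group_fix1 n\<^esub> k \<otimes>\<^bsub>sym_group_fix1 n\<^esub> inv\<^bsub>sym_group_fix1 n\<^esub> d \<in> young m c} =
        {g \<in> parabolic a n. d \<circ> g \<circ> inv' d \<in> young m c}"
      by (simp add: inv_sym_group_fix1[OF d])
    then show "cfun.dim (fixed {k \<in> parabolic a n. d \<otimes>\<^bsub>sym_group_fix1 n\<^esub> k \<otimes>\<^bsub>sym_group_fix1 n\<^esub> inv\<^bsub>sym_group_fix1 n\<^esub> d \<in> young m c} ?R) =
        cfun.dim (fixed (word_stab a (left_word c d)) A) * cfun.dim (fixed (word_stab b (right_word a c d)) B)"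
      using dim_fixed_parabolic_tensor[OF m n A B d, of c] by simp
  qed
  finally show ?thesis .
qed

lemma representation_V_pair:
  assumes "lam \<in> partitions (Suc a)" "mu \<in> partitions b"
  shows "representation (sym_group_fix1 n) (V_pair lam mu)" "representation (sym_group_fix1 n) (Res (fix1 n) (V_pair lam mu))"
proof -
  have s: "sum_list lam + sum_list mu = n" using assms m n by (simp add: partitionsD(1))
  show R: "representation (sym_group_fix1 n) (Res (fix1 n) (V_pair lam mu))"
    using V_pair_global[of lam mu] by (simp add: s global_on_def sym_group_fix1_def)
  show "representation (sym_group_fix1 n) (V_pair lam mu)"
    by (rule iffD1[OF representation_Res_iff[where G = "sym_group n" and H = "fix1 n", folded sym_group_fix1_def,
        OF fix1_group.monoid_axioms] R])
qed

text \<open>The first \<open>Suc a\<close> points include the fixed point 1, so on the parabolic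
  subgroup the first tensor factor of \<open>V_pair\<close> is acted on only through the smaller
  symmetric group, embedded by \<open>shift\<close>.\<close>

lemma block_perm_0_parabolic:
  assumes g: "g \<in> parabolic a n"
  shows "block_perm 0 (Suc a) g = shift a (block_perm 1 a g)"
proof
  fix x
  note gD = parabolicD[OF m n g]
  have g1: "g (Suc 0) = Suc 0" using gD(1) by (simp add: fix1_iff)
  have "x = 0 \<or> x = Suc 0 \<or> x - 1 \<in> letters a \<and> x = Suc (x - 1) \<or> x > Suc a" by (simp add: letters_iff) arith
  then consider "x = 0" | "x = Suc 0" | "x - 1 \<in> letters a" "x = Suc (x - 1)" | "x > Suc a" by blast
  then show "block_perm 0 (Suc a) g x = shift a (block_perm 1 a g) x"
  proof cases
    case 3
    then show ?thesis using gD(4)[OF 3(1)] by (simp add: block_perm_apply[of 0] shift_def) (auto simp: letters_iff)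
  qed (auto simp: block_perm_apply shift_def letters_iff g1)
qed

text \<open>Representatives may be taken in the stabilizer of 1: an element of \<open>C\<close>
  sends some point of the first block to 1, and swapping that point with 1 happens inside
  \<open>K\<close>. For such representatives the conjugation condition cuts \<open>K\<close> down to
  the parabolic subgroup. So the invariants are those of a representation induced from there, with
  the first factor restricted.\<close>

theorem dim_fixed_V_pair:
  assumes lam: "lam \<in> partitions (Suc a)" and mu: "mu \<in> partitions b"
    and D: "D \<subseteq> fix1 n"
      "\<And>g. g \<in> fix1 n \<Longrightarrow> \<exists>d\<in>D. content a (left_word c g) = content a (left_word c d)"
      "\<And>d d'. d \<in> D \<Longrightarrow> d' \<in> D \<Longrightarrow> content a (left_word c d) = content a (left_word c d') \<Longrightarrow> d = d'"
  shows "cfun.dim (fixed (young m c) (V_pair lam mu)) =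
    (\<Sum>d\<in>D. cfun.dim (fixed (word_stab a (left_word c d)) (pullback (shift a) (specht lam))) *
      cfun.dim (fixed (word_stab b (right_word a c d)) (specht mu)))"
proof -
  let ?K = "block_stabilizer n (Suc a)" and ?G = "sym_group n" and ?R = "specht_tensor 0 lam mu"
  define C where "C = {\<sigma>. \<sigma> permutes letters n \<and> Suc 0 \<in> \<sigma> ` letters (Suc a)}"
  have k: "sum_list lam = Suc a" and l: "sum_list mu = b" using lam mu by (simp_all add: partitionsD(1))
  have V: "V_pair lam mu = ind_on ?G ?K C ?R"
    by (simp add: V_pair_def k l C_def letters_def m n)
  interpret G: group ?G by (rule sym_group_is_group)
  interpret K: subgroup ?K ?G by (rule subgroup_block_stabilizer)
  have KD: "g permutes letters n" "g ` letters (Suc a) = letters (Suc a)" if "g \<in> ?K" for g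
    using that by (auto simp: block_stabilizer_iff)
  have compl: "g ` {Suc a + 1..Suc a + b} = {Suc a + 1..Suc a + b}" if g: "g \<in> ?K" for g
  proof -
    have e: "{Suc a + 1..Suc a + b} = letters n - letters (Suc a)" by (auto simp: letters_iff m n)
    show ?thesis
      unfolding e using image_set_diff[OF permutes_inj[OF KD(1)[OF g]], of "letters n" "letters (Suc a)"] KD(2)[OF g] permutes_image[OF KD(1)[OF g]]
      by simp
  qed
  have R: "representation (?G\<lparr>carrier := ?K\<rparr>) ?R"
    unfolding specht_tensor_def k l add_0
  proof (intro representation_tensor_rep representation_specht_at subgroup.subgroup_is_group[OF subgroup_block_stabilizer sym_group_is_group])
    fix g assume g: "g \<in> ?K"
    show "g permutes {1..n} \<and> g ` {0 + 1..0 + sum_list lam} = {0 + 1..0 + sum_list lam}"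
      using KD[OF g] by (simp add: k letters_def)
    show "g permutes {1..n} \<and> g ` {Suc a + 1..Suc a + sum_list mu} = {Suc a + 1..Suc a + sum_list mu}"
      using KD(1)[OF g] compl[OF g] by (simp add: l letters_def)
  qed
  have fixC: "g \<in> C" if "g \<in> fix1 n" for g
  proof -
    have "Suc 0 \<in> letters (Suc a)" by (simp add: letters_iff)
    then have "g (Suc 0) \<in> g ` letters (Suc a)" by (rule imageI)
    then show ?thesis using that by (simp add: C_def fix1_iff)
  qed
  have fixG: "inv\<^bsub>?G\<^esub> d = inv' d" if "d \<in> fix1 n" for d using that by (intro inv_sym_group) (simp add: fix1_iff)
  \<comment> \<open>Passing to the larger group \<open>K\<close> merges no double cosets: an element
    of \<open>K\<close> linking two elements that fix 1 through the Young subgroup fixes 1 as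
    well.\<close>
  have parab: "k \<in> parabolic a n" if "d \<in> fix1 n" "y \<in> fix1 n" "k \<in> ?K" "d' \<in> fix1 n" "d' = y \<circ> d \<circ> k" for d d' y k
  proof -
    have p: "d permutes letters n" "y permutes letters n" using that by (auto simp: fix1_iff)
    have "k = inv' d \<circ> inv' y \<circ> d'"
      unfolding that(5) by (simp add: fun_eq_iff permutes_letters(4)[OF p(1)] permutes_letters(4)[OF p(2)])
    moreover have "inv' d \<circ> inv' y \<circ> d' \<in> fix1 n" by (intro fix1_comp fix1_inv that)
    ultimately have "k \<in> fix1 n" by (simp only:)
    then show ?thesis using that(3) by (simp add: parabolic_def)
  qed
  have "cfun.dim (fixed (young m c) (ind_on ?G ?K C ?R)) =
    (\<Sum>d\<in>D. cfun.dim (fixed {k \<in> ?K. d \<otimes>\<^bsub>?G\<^esub> k \<otimes>\<^bsub>?G\<^esub> inv\<^bsub>?G\<^esub> d \<in> young m c} ?R))"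
  proof (rule dim_fixed_ind_on[OF sym_group_is_group subgroup_block_stabilizer R, where G' = "sym_group_fix1 n"])
    show "C \<subseteq> carrier ?G" by (auto simp: C_def carrier_sym_group)
    show "finite C" by (rule finite_subset[OF _ finite_permutations[of "letters n"]]) (auto simp: C_def)
    show "\<sigma> \<otimes>\<^bsub>?G\<^esub> k \<in> C" if "\<sigma> \<in> C" "k \<in> ?K" for \<sigma> k
    proof -
      have "(\<sigma> \<circ> k) ` letters (Suc a) = \<sigma> ` letters (Suc a)"
        by (simp only: image_comp[symmetric] KD(2)[OF that(2)])
      then show ?thesis using that KD(1)[OF that(2)] by (simp add: C_def sym_group_mult permutes_compose del: image_comp)
    qed
    show "representation (sym_group_fix1 n) (ind_on ?G ?K C ?R)" using representation_V_pair(1)[OF lam mu] by (simp add: V)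
    show "young m c \<subseteq> carrier (sym_group_fix1 n)" using young_subset[of m c] n by simp
    show "subgroup (young m c) ?G"
      using group.incl_subgroup[OF sym_group_is_group subgroup_fix1, of "young m c" n] subgroup_young[of c] by (simp add: sym_group_fix1_def)
    show "y \<otimes>\<^bsub>?G\<^esub> g \<in> C" if yg: "y \<in> young m c" "g \<in> C" for y g
    proof -
      have y: "y \<in> fix1 n" using yg(1) young_subset[of m c] n by auto
      obtain j where j: "j \<in> letters (Suc a)" "g j = Suc 0" using yg(2) by (auto simp: C_def)
      then have "(y \<circ> g) j = Suc 0" using y by (simp add: fix1_iff)
      then have "Suc 0 \<in> (y \<circ> g) ` letters (Suc a)" using j(1) by (metis imageI)
      then show ?thesis using y yg(2) by (simp add: C_def sym_group_mult fix1_iff permutes_compose)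
    qed
    show "D \<subseteq> C" using D(1) fixC by blast
    show "C \<noteq> {}" using fixC fix1_id by blast
    show "\<exists>d\<in>D. \<exists>y\<in>young m c. \<exists>k\<in>?K. g = y \<otimes>\<^bsub>?G\<^esub> d \<otimes>\<^bsub>?G\<^esub> k" if g: "g \<in> C" for g
    proof -
      obtain j where j: "j \<in> letters (Suc a)" "g j = Suc 0" using g by (auto simp: C_def)
      define q where "q = transpose (Suc 0) j"
      have l1: "Suc 0 \<in> letters (Suc a)" by (simp add: letters_iff)
      have qp: "q permutes letters (Suc a)" unfolding q_def by (rule permutes_swap_id[OF l1 j(1)])
      have "letters (Suc a) \<subseteq> letters n" by (auto simp: letters_iff m n)
      then have qn: "q permutes letters n" using permutes_subset[OF qp] by blast
      have qK: "q \<in> ?K" using qn permutes_image[OF qp] by (simp add: block_stabilizer_iff)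
      have h: "g \<circ> q \<in> fix1 n" using qn g j(2) by (simp add: fix1_iff permutes_compose C_def q_def)
      obtain d where d: "d \<in> D" "content a (left_word c (g \<circ> q)) = content a (left_word c d)" using D(2)[OF h] by blast
      then obtain y k where yk: "y \<in> young m c" "k \<in> parabolic a n" "g \<circ> q = y \<circ> d \<circ> k"
        using double_coset[OF m n h, of d c] D(1) by auto
      have "g = g \<circ> q \<circ> q" by (simp add: q_def comp_assoc)
      then have "g = y \<circ> d \<circ> (k \<circ> q)" unfolding yk(3) by (simp add: comp_assoc)
      moreover have "k \<circ> q \<in> ?K" using K.m_closed[of k q] yk(2) qK by (simp add: parabolic_def sym_group_mult)
      ultimately show ?thesis using d(1) yk(1) unfolding sym_group_mult by blast
    qed
    show "d = d'" if "d \<in> D" "d' \<in> D" "y \<in> young m c" "k \<in> ?K" "d' = y \<otimes>\<^bsub>?G\<^esub> d \<otimes>\<^bsub>?G\<^esub> k" for d d' y k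
    proof -
      have f: "d \<in> fix1 n" "d' \<in> fix1 n" "y \<in> fix1 n" using that(1-3) D(1) young_subset[of m c] n by auto
      have e: "d' = y \<circ> d \<circ> k" using that(5) by (simp add: sym_group_mult)
      have "k \<in> parabolic a n" by (rule parab[OF f(1,3) that(4) f(2) e])
      then have "content a (left_word c d') = content a (left_word c d)"
        unfolding double_coset[OF m n f(2,1)] using that(3) e by auto
      then show ?thesis using D(3)[OF that(2,1)] by simp
    qed
  qed
  also have "\<dots> = (\<Sum>d\<in>D. cfun.dim (fixed (word_stab a (left_word c d)) (pullback (shift a) (specht lam))) *
      cfun.dim (fixed (word_stab b (right_word a c d)) (specht mu)))"
  proof (rule sum.cong[OF refl])
    fix d assume "d \<in> D"
    then have d: "d \<in> fix1 n" using D(1) by blast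
    then have dp: "d permutes letters n" by (simp add: fix1_iff)
    let ?H = "{g \<in> parabolic a n. d \<circ> g \<circ> inv' d \<in> young m c}"
    have "{k \<in> ?K. d \<otimes>\<^bsub>?G\<^esub> k \<otimes>\<^bsub>?G\<^esub> inv\<^bsub>?G\<^esub> d \<in> young m c} = ?H"
    proof (intro subset_antisym subsetI)
      fix k assume kK: "k \<in> {k \<in> ?K. d \<otimes>\<^bsub>?G\<^esub> k \<otimes>\<^bsub>?G\<^esub> inv\<^bsub>?G\<^esub> d \<in> young m c}"
      then have y: "d \<circ> k \<circ> inv' d \<in> young m c" by (simp add: fixG[OF d] sym_group_mult)
      then have *: "d \<circ> k \<circ> inv' d \<in> fix1 n" using young_subset[of m c] n by auto
      have "inv' d \<circ> (d \<circ> k \<circ> inv' d) \<circ> d \<in> fix1 n" by (rule fix1_comp[OF fix1_comp[OF fix1_inv[OF d] *] d])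
      moreover have "inv' d \<circ> (d \<circ> k \<circ> inv' d) \<circ> d = k" by (simp add: fun_eq_iff permutes_letters(4)[OF dp])
      ultimately have "k \<in> fix1 n" by (simp only:)
      then show "k \<in> ?H" using kK y by (simp add: parabolic_def)
    qed (auto simp: parabolic_def fixG[OF d] sym_group_mult)
    moreover have "fixed ?H ?R = fixed ?H (tensor_rep (pullback (block_perm 1 a) (pullback (shift a) (specht lam)))
        (pullback (block_perm (Suc a) b) (specht mu)))"
      unfolding specht_tensor_def specht_at_eq k l add_0
      by (rule fixed_tensor_cong) (auto simp: block_perm_0_parabolic)
    ultimately show "cfun.dim (fixed {k \<in> ?K. d \<otimes>\<^bsub>?G\<^esub> k \<otimes>\<^bsub>?G\<^esub> inv\<^bsub>?G\<^esub> d \<in> young m c} ?R) =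
        cfun.dim (fixed (word_stab a (left_word c d)) (pullback (shift a) (specht lam))) *
        cfun.dim (fixed (word_stab b (right_word a c d)) (specht mu))"
      using dim_fixed_parabolic_tensor[OF m n representation_specht_shift[OF lam] _ d, of "specht mu" c] representation_specht[of mu] l
      by simp
  qed
  finally show ?thesis by (simp add: V)
qed

end

subsection \<open>Removing corners\<close>

lemma partition_eqI:
  assumes lam: "lam \<in> partitions k" and mu: "mu \<in> partitions l" and eq: "\<And>i. row_length lam i = row_length mu i"
  shows "lam = mu"
proof -
  have len: "length p \<le> length q" if "p \<in> partitions k'" "\<And>i. row_length p i = row_length q i" for p q k'
  proof (rule ccontr)
    assume "\<not> length p \<le> length q"
    then show False using partitionsD(4)[OF that(1), of "length q"] that(2)[of "length q"] by (simp add: row_length_def)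
  qed
  have "length lam = length mu" using len[OF lam, of mu] len[OF mu, of lam] eq by (simp add: antisym)
  moreover have "lam ! i = mu ! i" if "i < length lam" for i
    using eq[of i] that calculation by (simp add: row_length_def)
  ultimately show ?thesis by (rule nth_equalityI)
qed

lemma diagram_row_length: "diagram lam = diagram mu \<Longrightarrow> row_length lam i = row_length mu i"
  using card_row[of lam i] card_row[of mu i] by simp

lemma partition_of_row_lengths:
  assumes "\<And>i. f (Suc i) \<le> (f i :: nat)" "f N = 0"
  obtains lam where "lam \<in> partitions (sum_list lam)" "\<And>i. row_length lam i = f i"
proof -
  define l where "l = (LEAST i. f i = 0)"
  have l: "f l = 0" "\<And>i. i < l \<Longrightarrow> f i \<noteq> 0" using LeastI[of "\<lambda>i. f i = 0", OF assms(2)] not_less_Least by (auto simp: l_def)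
  have mono: "f j \<le> f i" if "i \<le> j" for i j using lift_Suc_antimono_le[of f] assms(1) that by blast
  have zero: "f i = 0" if "l \<le> i" for i using mono[OF that] l(1) by simp
  define lam where "lam = map f [0..<l]"
  have "0 \<notin> set lam" using l(2) by (force simp: lam_def)
  then have "lam \<in> partitions (sum_list lam)"
    using mono by (auto simp: partitions_def lam_def sorted_wrt_iff_nth_less)
  moreover have "row_length lam i = f i" for i using zero[of i] by (auto simp: row_length_def lam_def)
  ultimately show thesis using that by blast
qed

lemma corner_removal:
  assumes lam: "lam \<in> partitions (Suc a)" and p: "corner lam p"
  obtains lam1 where "lam1 \<in> partitions a" "diagram lam1 = diagram lam - {p}"
proof -
  obtain i j where ij: "p = (i, j)" by (cases p)
  then have c: "j < row_length lam i" "row_length lam (Suc i) \<le> j" "row_length lam i \<le> Suc j"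
    using p by (auto simp: corner_def diagram_iff not_less)
  define f where "f i' = (if i' = i then j else row_length lam i')" for i'
  have le: "row_length lam (Suc i') \<le> row_length lam i'" for i' by (rule partitionsD(2)[OF lam]) simp
  have "f (Suc i') \<le> f i'" for i' using le[of i'] c by (auto simp: f_def)
  moreover have "f (max (Suc i) (length lam)) = 0" by (simp add: f_def row_length_def max_def)
  ultimately obtain lam1 where l1: "lam1 \<in> partitions (sum_list lam1)" "\<And>i. row_length lam1 i = f i"
    by (rule partition_of_row_lengths) (rule that)
  have d: "diagram lam1 = diagram lam - {p}"
    using c by (auto simp: diagram_iff l1(2) f_def ij split: if_splits)
  have "p \<in> diagram lam" using c by (simp add: ij diagram_iff)
  then have "sum_list lam1 = a"
    using card_diagram[of lam1] card_diagram[of lam] partitionsD(1)[OF lam] by (simp add: d)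
  then show thesis using that l1(1) d by simp
qed

lemma remove_corner_iff:
  assumes lam: "lam \<in> partitions (Suc a)"
  shows "lam1 \<in> remove_corner lam \<longleftrightarrow> lam1 \<in> partitions a \<and> (\<exists>p. corner lam p \<and> diagram lam1 = diagram lam - {p})"
  by (simp add: remove_corner_def partitionsD(1)[OF lam])

lemma finite_remove_corner: "finite (remove_corner lam)"
  by (rule finite_subset[OF _ finite_partitions[of "sum_list lam - 1"]]) (auto simp: remove_corner_def)

lemma ssyt_word_values:
  assumes "T \<in> ssyt_word lam c" "p \<in> diagram lam"
  shows "T p \<in> c ` letters (sum_list lam)"
proof -
  have fin: "finite {q \<in> diagram lam. T q = T p}" by (rule finite_subset[OF _ finite_diagram[of lam]]) auto
  have "p \<in> {q \<in> diagram lam. T q = T p}" using assms(2) by simp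
  then have "card {q \<in> diagram lam. T q = T p} \<noteq> 0" using card_0_eq[OF fin] by blast
  moreover have e: "card {q \<in> diagram lam. T q = T p} = card {x \<in> letters (sum_list lam). c x = T p}"
    using assms(1) unfolding ssyt_word_def by blast
  ultimately have "{x \<in> letters (sum_list lam). c x = T p} \<noteq> {}" by (metis card.empty)
  then obtain x where "x \<in> letters (sum_list lam)" "c x = T p" by blast
  then show ?thesis by (metis imageI)
qed

text \<open>The largest letter of a semistandard tableau, if it occurs once, lies in a corner.\<close>

theorem card_ssyt_word_prepend:
  assumes lam: "lam \<in> partitions (Suc a)" and M: "\<And>x. x \<in> letters a \<Longrightarrow> w x < M"
  shows "card (ssyt_word lam (prepend M w)) = (\<Sum>lam1\<in>remove_corner lam. card (ssyt_word lam1 w))"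
proof -
  let ?c = "prepend M w" let ?S = "ssyt_word lam ?c"
  have s: "sum_list lam = Suc a" by (rule partitionsD(1)[OF lam])
  have count: "card {x \<in> letters (Suc a). ?c x = j} = (if j = M then 1 else card {x \<in> letters a. w x = j})" for j
  proof (cases "j = M")
    case True
    have "{x \<in> letters (Suc a). ?c x = j} = {Suc 0}"
    proof -
      have "x = Suc 0" if x: "x \<in> letters (Suc a)" "?c x = M" for x
      proof (rule ccontr)
        assume n: "x \<noteq> Suc 0"
        then have "x - 1 \<in> letters a" using x(1) by (auto simp: letters_iff)
        then show False using M[of "x - 1"] x(2) n by (simp add: prepend_def)
      qed
      then show ?thesis using True by (auto simp: letters_iff prepend_def)
    qed
    then show ?thesis using True by simp
  next
    case False
    have "{x \<in> letters (Suc a). ?c x = j} = Suc ` {x \<in> letters a. w x = j}"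
    proof (intro subset_antisym subsetI)
      fix x assume x: "x \<in> {x \<in> letters (Suc a). ?c x = j}"
      then have "x \<noteq> Suc 0" using False by (auto simp: prepend_def)
      then have "x - 1 \<in> letters a" "x = Suc (x - 1)" "w (x - 1) = j" using x by (auto simp: letters_iff prepend_def)
      then show "x \<in> Suc ` {x \<in> letters a. w x = j}" by blast
    qed (auto simp: letters_iff prepend_def)
    then show ?thesis using False by (simp add: card_image)
  qed
  have S_iff: "T \<in> ?S \<longleftrightarrow> T \<in> extensional (diagram lam)
      \<and> (\<forall>i j. (i, j) \<in> diagram lam \<and> (i, Suc j) \<in> diagram lam \<longrightarrow> T (i, j) \<le> T (i, Suc j))
      \<and> (\<forall>i j. (i, j) \<in> diagram lam \<and> (Suc i, j) \<in> diagram lam \<longrightarrow> T (i, j) < T (Suc i, j))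
      \<and> (\<forall>j. card {p \<in> diagram lam. T p = j} = (if j = M then 1 else card {x \<in> letters a. w x = j}))" for T
    by (simp add: ssyt_word_def s count)
  have le_M: "T p \<le> M" if Tp: "T \<in> ?S" "p \<in> diagram lam" for T p
  proof -
    obtain x where "x \<in> letters (Suc a)" "T p = ?c x" using ssyt_word_values[OF Tp] s by auto
    moreover have "x \<noteq> Suc 0 \<Longrightarrow> x - 1 \<in> letters a" using calculation(1) by (auto simp: letters_iff)
    ultimately show ?thesis using M[of "x - 1"] by (auto simp: prepend_def less_imp_le)
  qed
  have ex1: "\<exists>p. {q \<in> diagram lam. T q = M} = {p}" if "T \<in> ?S" for T
  proof -
    have "card {q \<in> diagram lam. T q = M} = 1" using that by (simp add: S_iff)
    then show ?thesis by (rule card_1_singletonE) blast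
  qed
  have corner: "corner lam p" if T: "T \<in> ?S" and p: "{q \<in> diagram lam. T q = M} = {p}" for T p
  proof -
    obtain i j where ij: "p = (i, j)" by (cases p)
    have pd: "(i, j) \<in> diagram lam" "T (i, j) = M" using p ij by auto
    have "(i, Suc j) \<notin> diagram lam"
    proof
      assume r: "(i, Suc j) \<in> diagram lam"
      then have "T (i, Suc j) = M" using T pd le_M[OF T r] unfolding S_iff by fastforce
      then have "(i, Suc j) \<in> {p}" using r p by blast
      then show False by (simp add: ij)
    qed
    moreover have "(Suc i, j) \<notin> diagram lam"
    proof
      assume r: "(Suc i, j) \<in> diagram lam"
      then have "M < T (Suc i, j)" using T pd unfolding S_iff by fastforce
      then show False using le_M[OF T r] by simp
    qed
    ultimately show ?thesis using pd(1) by (simp add: corner_def ij)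
  qed
  \<comment> \<open>The cell that \<open>lam1\<close> lacks; tableaux are classified by which of
    these cells holds \<open>M\<close>.\<close>
  define cell where "cell lam1 = (THE p. diagram lam - diagram lam1 = {p})" for lam1
  have cell: "corner lam (cell lam1)" "diagram lam1 = diagram lam - {cell lam1}" "lam1 \<in> partitions a" "cell lam1 \<in> diagram lam"
    if l1: "lam1 \<in> remove_corner lam" for lam1
  proof -
    obtain p where p: "corner lam p" "diagram lam1 = diagram lam - {p}" "lam1 \<in> partitions a"
      using l1 unfolding remove_corner_iff[OF lam] by blast
    have pd: "p \<in> diagram lam" using p(1) by (auto simp: corner_def split: prod.splits)
    then have "diagram lam - diagram lam1 = {p}" using p(2) by auto
    then have "cell lam1 = p" by (simp add: cell_def)
    then show "corner lam (cell lam1)" "diagram lam1 = diagram lam - {cell lam1}" "lam1 \<in> partitions a" "cell lam1 \<in> diagram lam"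
      using p pd by auto
  qed
  define S1 where "S1 lam1 = {T \<in> ?S. T (cell lam1) = M}" for lam1
  have S_Un: "?S = (\<Union>lam1\<in>remove_corner lam. S1 lam1)"
  proof (intro subset_antisym subsetI)
    fix T assume T: "T \<in> ?S"
    obtain p where p: "{q \<in> diagram lam. T q = M} = {p}" using ex1[OF T] by blast
    note c = corner[OF T p]
    obtain lam1 where l1: "lam1 \<in> partitions a" "diagram lam1 = diagram lam - {p}" by (rule corner_removal[OF lam c])
    have l1r: "lam1 \<in> remove_corner lam" using l1 c remove_corner_iff[OF lam] by blast
    have pT: "p \<in> diagram lam" "T p = M" using p by auto
    then have "diagram lam - diagram lam1 = {p}" using l1(2) by auto
    then have "cell lam1 = p" by (simp add: cell_def)
    then show "T \<in> (\<Union>lam1\<in>remove_corner lam. S1 lam1)" using l1r pT T by (auto simp: S1_def)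
  qed (auto simp: S1_def)
  have disj: "S1 lam1 \<inter> S1 lam2 = {}" if l: "lam1 \<in> remove_corner lam" "lam2 \<in> remove_corner lam" "lam1 \<noteq> lam2" for lam1 lam2
  proof (rule ccontr)
    assume "S1 lam1 \<inter> S1 lam2 \<noteq> {}"
    then obtain T where T: "T \<in> ?S" "T (cell lam1) = M" "T (cell lam2) = M" by (auto simp: S1_def)
    obtain p where p: "{q \<in> diagram lam. T q = M} = {p}" using ex1[OF T(1)] by blast
    have "cell lam1 \<in> {p}" "cell lam2 \<in> {p}" using T cell(4)[OF l(1)] cell(4)[OF l(2)] p by blast+
    then have "diagram lam1 = diagram lam2" using cell(2)[OF l(1)] cell(2)[OF l(2)] by simp
    then have "lam1 = lam2" using partition_eqI[OF cell(3)[OF l(1)] cell(3)[OF l(2)]] diagram_row_length by blast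
    then show False using l(3) by simp
  qed
  have card1: "card (S1 lam1) = card (ssyt_word lam1 w)" if l1: "lam1 \<in> remove_corner lam" for lam1
  proof -
    note cl = cell[OF l1]
    define p where "p = cell lam1"
    have d: "diagram lam = insert p (diagram lam1)" "p \<notin> diagram lam1"
      using cl(4) unfolding p_def cl(2) by auto
    obtain i0 j0 where ij: "p = (i0, j0)" by (cases p)
    have corn: "(Suc i0, j0) \<notin> diagram lam" "(i0, Suc j0) \<notin> diagram lam"
      using cl(1) unfolding p_def[symmetric] ij by (simp_all add: corner_def)
    have s1: "sum_list lam1 = a" by (rule partitionsD(1)[OF cl(3)])
    have "bij_betw (\<lambda>T. restrict T (diagram lam1)) (S1 lam1) (ssyt_word lam1 w)"
    proof (rule bij_betw_byWitness[where f' = "\<lambda>T. T(p := M)"])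
      show "\<forall>T\<in>S1 lam1. (restrict T (diagram lam1))(p := M) = T"
      proof
        fix T assume T: "T \<in> S1 lam1"
        show "(restrict T (diagram lam1))(p := M) = T"
        proof
          fix q show "((restrict T (diagram lam1))(p := M)) q = T q"
            using T d extensional_arb[of T "diagram lam" q] by (auto simp: S1_def S_iff p_def)
        qed
      qed
      show "\<forall>T\<in>ssyt_word lam1 w. restrict (T(p := M)) (diagram lam1) = T"
      proof
        fix T assume T: "T \<in> ssyt_word lam1 w"
        show "restrict (T(p := M)) (diagram lam1) = T"
        proof
          fix q show "restrict (T(p := M)) (diagram lam1) q = T q"
            using T d extensional_arb[of T "diagram lam1" q] by (auto simp: ssyt_word_def)
        qed
      qed
      show "(\<lambda>T. restrict T (diagram lam1)) ` S1 lam1 \<subseteq> ssyt_word lam1 w"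
      proof (rule image_subsetI)
        fix T assume "T \<in> S1 lam1"
        then have T: "T \<in> ?S" "T p = M" by (auto simp: S1_def p_def)
        obtain p' where p': "{q \<in> diagram lam. T q = M} = {p'}" using ex1[OF T(1)] by blast
        have "p \<in> {q \<in> diagram lam. T q = M}" using T(2) d(1) by simp
        then have "p' = p" unfolding p' by simp
        have cnt: "card {q \<in> diagram lam1. restrict T (diagram lam1) q = j} = card {x \<in> letters a. w x = j}" for j
        proof (cases "j = M")
          case True
          have "{q \<in> diagram lam1. restrict T (diagram lam1) q = j} = {}"
            using p' d True unfolding \<open>p' = p\<close> by auto
          moreover have "{x \<in> letters a. w x = j} = {}" using M True by fastforce
          ultimately show ?thesis by (simp only: card.empty)
        next
          case False
          then have "{q \<in> diagram lam1. restrict T (diagram lam1) q = j} = {q \<in> diagram lam. T q = j}" using d T(2) by auto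
          then show ?thesis using T(1) False by (simp add: S_iff)
        qed
        show "restrict T (diagram lam1) \<in> ssyt_word lam1 w"
          unfolding ssyt_word_def s1 using T(1) d(1) cnt by (auto simp: S_iff)
      qed
      show "(\<lambda>T. T(p := M)) ` ssyt_word lam1 w \<subseteq> S1 lam1"
      proof (rule image_subsetI)
        fix T assume T: "T \<in> ssyt_word lam1 w"
        have less: "T q < M" if "q \<in> diagram lam1" for q
          using ssyt_word_values[OF T that] M by (auto simp: s1)
        have ne: "T q \<noteq> M" if "q \<in> diagram lam1" for q using less[OF that] by simp
        have cnt: "card {q \<in> diagram lam. (T(p := M)) q = j} = (if j = M then 1 else card {x \<in> letters a. w x = j})" for j
        proof (cases "j = M")
          case True
          have "{q \<in> diagram lam. (T(p := M)) q = j} = {p}" using ne d True by auto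
          then show ?thesis using True by simp
        next
          case False
          then have "{q \<in> diagram lam. (T(p := M)) q = j} = {q \<in> diagram lam1. T q = j}" using d by auto
          then show ?thesis using T False by (simp add: ssyt_word_def s1)
        qed
        have rows: "(T(p := M)) (i, j) \<le> (T(p := M)) (i, Suc j)" if ij1: "(i, j) \<in> diagram lam" "(i, Suc j) \<in> diagram lam" for i j
        proof -
          \<comment> \<open>A corner has no right neighbour, so the new largest entry can occur only
            as the larger side of the comparison.\<close>
          have np: "(i, j) \<noteq> p" using corn ij1 by (auto simp: ij)
          then have m1: "(i, j) \<in> diagram lam1" using ij1 d by auto
          show ?thesis
          proof (cases "(i, Suc j) = p")
            case True
            then show ?thesis using less[OF m1] np by simp
          next
            case False
            then have "(i, Suc j) \<in> diagram lam1" using ij1 d by auto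
            then show ?thesis using T m1 False np by (simp add: ssyt_word_def)
          qed
        qed
        have cols: "(T(p := M)) (i, j) < (T(p := M)) (Suc i, j)" if ij1: "(i, j) \<in> diagram lam" "(Suc i, j) \<in> diagram lam" for i j
        proof -
          have np: "(i, j) \<noteq> p" using corn ij1 by (auto simp: ij)
          then have m1: "(i, j) \<in> diagram lam1" using ij1 d by auto
          show ?thesis
          proof (cases "(Suc i, j) = p")
            case True
            then show ?thesis using less[OF m1] np by simp
          next
            case False
            then have "(Suc i, j) \<in> diagram lam1" using ij1 d by auto
            then show ?thesis using T m1 False np by (simp add: ssyt_word_def)
          qed
        qed
        have "T(p := M) \<in> extensional (diagram lam)"
          using T d(1) by (auto simp: ssyt_word_def extensional_def)
        then have "T(p := M) \<in> ?S" unfolding S_iff using rows cols cnt by blast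
        then show "T(p := M) \<in> S1 lam1" by (simp add: S1_def p_def)
      qed
    qed
    then show ?thesis by (rule bij_betw_same_card)
  qed
  have "card ?S = (\<Sum>lam1\<in>remove_corner lam. card (S1 lam1))"
    unfolding S_Un
  proof (rule card_UN_disjoint)
    show "\<forall>i\<in>remove_corner lam. finite (S1 i)" using finite_ssyt_word[of lam ?c] by (auto simp: S1_def)
  qed (use disj finite_remove_corner in auto)
  then show ?thesis using card1 by simp
qed

section \<open>Schur polynomials and the theorem\<close>

text \<open>An exponent vector, not a polynomial: exponent vectors are the keys of the polynomial
  mapping, and the product of the variables \<open>var (f p)\<close> is the \<open>single\<close> at
  this key.\<close>

definition monomial :: "'i set \<Rightarrow> ('i \<Rightarrow> nat) \<Rightarrow> nat \<Rightarrow>\<^sub>0 nat"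
  where "monomial A f = (\<Sum>p\<in>A. Poly_Mapping.single (f p) 1)"

lemma lookup_monomial:
  assumes "finite A"
  shows "Poly_Mapping.lookup (monomial A f) j = card {p \<in> A. f p = j}"
proof -
  have "Poly_Mapping.lookup (monomial A f) j = (\<Sum>p\<in>A. if f p = j then 1 else 0)"
    unfolding monomial_def lookup_sum by (intro sum.cong) (auto simp: lookup_single when_def)
  also have "\<dots> = card {p \<in> A. f p = j}" by (simp add: sum.inter_filter[OF assms, symmetric])
  finally show ?thesis .
qed

lemma monomial_eq_iff:
  assumes "finite A" "finite B"
  shows "monomial A f = monomial B g \<longleftrightarrow> (\<forall>j. card {p \<in> A. f p = j} = card {x \<in> B. g x = j})"
  by (simp add: poly_mapping_eq_iff fun_eq_iff lookup_monomial assms)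

lemma prod_var: "finite A \<Longrightarrow> (\<Prod>p\<in>A. var (f p)) = Poly_Mapping.single (monomial A f) 1"
  by (induction A rule: finite_induct) (auto simp: monomial_def var_def mult_single)

lemma schur_eq: "schur N lam = (\<Sum>T\<in>semistandard N lam. Poly_Mapping.single (monomial (diagram lam) T) 1)"
  by (simp add: schur_def prod_var)

lemma finite_semistandard: "finite (semistandard N lam)"
proof (rule finite_subset)
  show "semistandard N lam \<subseteq> diagram lam \<rightarrow>\<^sub>E {..<N}" by (auto simp: semistandard_def)
qed (auto intro: finite_PiE)

lemma lookup_schur:
  "Poly_Mapping.lookup (schur N lam) \<alpha> = int (card {T \<in> semistandard N lam. monomial (diagram lam) T = \<alpha>})"
proof -
  have "Poly_Mapping.lookup (schur N lam) \<alpha> = (\<Sum>T\<in>semistandard N lam. if monomial (diagram lam) T = \<alpha> then 1 else 0)"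
    unfolding schur_eq lookup_sum by (intro sum.cong) (auto simp: lookup_single when_def)
  also have "\<dots> = int (card {T \<in> semistandard N lam. monomial (diagram lam) T = \<alpha>})"
    by (simp add: sum.inter_filter[OF finite_semistandard, symmetric])
  finally show ?thesis .
qed

lemma lookup_schur_mult:
  "Poly_Mapping.lookup (schur N lam * schur N mu) \<alpha> = int (card {(T, U). T \<in> semistandard N lam \<and> U \<in> semistandard N mu
    \<and> monomial (diagram lam) T + monomial (diagram mu) U = \<alpha>})"
proof -
  let ?P = "semistandard N lam \<times> semistandard N mu"
  have fin: "finite ?P" by (simp add: finite_semistandard)
  have "schur N lam * schur N mu =
      (\<Sum>(T, U)\<in>?P. Poly_Mapping.single (monomial (diagram lam) T + monomial (diagram mu) U) 1)"
    by (simp add: schur_eq sum_product mult_single sum.cartesian_product)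
  note eq = this
  have "Poly_Mapping.lookup (schur N lam * schur N mu) \<alpha> =
      (\<Sum>q\<in>?P. if monomial (diagram lam) (fst q) + monomial (diagram mu) (snd q) = \<alpha> then 1 else 0)"
    unfolding eq lookup_sum by (intro sum.cong) (auto simp: lookup_single when_def split_def)
  also have "\<dots> = int (card {q \<in> ?P. monomial (diagram lam) (fst q) + monomial (diagram mu) (snd q) = \<alpha>})"
    by (simp add: sum.inter_filter[OF fin, symmetric])
  also have "{q \<in> ?P. monomial (diagram lam) (fst q) + monomial (diagram mu) (snd q) = \<alpha>} =
      {(T, U). T \<in> semistandard N lam \<and> U \<in> semistandard N mu \<and> monomial (diagram lam) T + monomial (diagram mu) U = \<alpha>}"
    by auto
  finally show ?thesis .
qed

lemma lookup_of_nat_mult: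
  "Poly_Mapping.lookup (of_nat k * p) \<alpha> = int k * Poly_Mapping.lookup p \<alpha>" for p :: "(nat \<Rightarrow>\<^sub>0 nat) \<Rightarrow>\<^sub>0 int"
  by (induction k) (auto simp: distrib_right lookup_add)

text \<open>The bound \<open>N\<close> is automatic once the content is that of \<open>c\<close>,
  because every entry is then a letter of \<open>c\<close>.\<close>

lemma ssyt_word_eq_semistandard:
  assumes c: "c ` letters (sum_list lam) \<subseteq> {..<N}"
  shows "{T \<in> semistandard N lam. monomial (diagram lam) T = monomial (letters (sum_list lam)) c} = ssyt_word lam c"
proof (intro subset_antisym subsetI)
  fix T assume "T \<in> {T \<in> semistandard N lam. monomial (diagram lam) T = monomial (letters (sum_list lam)) c}"
  then show "T \<in> ssyt_word lam c"
    by (auto simp: semistandard_def ssyt_word_def monomial_eq_iff PiE_iff)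
next
  fix T assume T: "T \<in> ssyt_word lam c"
  then have "T p < N" if "p \<in> diagram lam" for p using ssyt_word_values[OF T that] c by auto
  then show "T \<in> {T \<in> semistandard N lam. monomial (diagram lam) T = monomial (letters (sum_list lam)) c}"
    using T by (auto simp: semistandard_def ssyt_word_def monomial_eq_iff PiE_iff)
qed

lemma lookup_schur_word:
  assumes "c ` letters (sum_list lam) \<subseteq> {..<N}"
  shows "Poly_Mapping.lookup (schur N lam) (monomial (letters (sum_list lam)) c) = int (card (ssyt_word lam c))"
  by (simp add: lookup_schur ssyt_word_eq_semistandard[OF assms])

lemma semistandard_word:
  assumes T: "T \<in> semistandard N lam"
  obtains c where "c ` letters (sum_list lam) \<subseteq> {..<N}" "monomial (diagram lam) T = monomial (letters (sum_list lam)) c"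
proof -
  obtain t where t: "bij_betw t (letters (sum_list lam)) (diagram lam)"
    using finite_same_card_bij[of "letters (sum_list lam)" "diagram lam"] by (auto simp: card_diagram)
  have "(T \<circ> t) ` letters (sum_list lam) \<subseteq> {..<N}"
    using T t by (auto simp: semistandard_def bij_betw_def PiE_iff)
  moreover have "monomial (diagram lam) T = monomial (letters (sum_list lam)) (T \<circ> t)"
    unfolding monomial_def using sum.reindex_bij_betw[OF t, of "\<lambda>p. Poly_Mapping.single (T p) (1 :: nat)"] by simp
  ultimately show thesis by (rule that)
qed

lemma ssyt_word_cong:
  assumes "content (sum_list lam) c = content (sum_list lam) c'"
  shows "ssyt_word lam c = ssyt_word lam c'"
  using fun_cong[OF assms] by (simp add: ssyt_word_def content_def)

lemma words_bounded:
  assumes m: "m = a + b" and n: "n = Suc m" and d: "d \<in> fix1 n" and c: "c ` letters m \<subseteq> {..<N :: nat}"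
  shows "left_word c d ` letters a \<subseteq> {..<N}" "right_word a c d ` letters b \<subseteq> {..<N}"
proof -
  have dm: "d \<in> fix1 (Suc m)" using d n by simp
  have "d (Suc x) - 1 \<in> letters m" if "x \<in> letters m" for x using fix1D(2)[OF dm that] .
  then have "c (d (Suc x) - 1) < N" if "x \<in> letters m" for x using c that by auto
  moreover have "x \<in> letters a \<Longrightarrow> x \<in> letters m" "x \<in> letters b \<Longrightarrow> a + x \<in> letters m" for x
    by (auto simp: letters_iff m)
  ultimately show "left_word c d ` letters a \<subseteq> {..<N}" "right_word a c d ` letters b \<subseteq> {..<N}"
    by (auto simp: left_word_def right_word_def)
qed

section \<open>Products of Schur polynomials and Littlewood-Richardson coefficients\<close>

context
  fixes a b m n :: nat and lam mu :: "nat list"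
  assumes m: "m = a + b" and n: "n = Suc m" and lam: "lam \<in> partitions a" and mu: "mu \<in> partitions b"
begin

lemma sizes: "sum_list lam = a" "sum_list mu = b"
  using partitionsD(1)[OF lam] partitionsD(1)[OF mu] by auto

text \<open>Pairs of tableaux with total content \<open>c\<close> are sorted by the content of the
  first one, that is by a double coset. The coefficient of the product thus becomes the sum that
  computes the invariants of the induced representation.\<close>

lemma lookup_schur_mult_word:
  assumes c: "c ` letters m \<subseteq> {..<N}" and D: "D \<subseteq> fix1 n"
      "\<And>g. g \<in> fix1 n \<Longrightarrow> \<exists>d\<in>D. content a (left_word c g) = content a (left_word c d)"
      "\<And>d d'. d \<in> D \<Longrightarrow> d' \<in> D \<Longrightarrow> content a (left_word c d) = content a (left_word c d') \<Longrightarrow> d = d'"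
  shows "Poly_Mapping.lookup (schur N lam * schur N mu) (monomial (letters m) c) =
    int (\<Sum>d\<in>D. card (ssyt_word lam (left_word c d)) * card (ssyt_word mu (right_word a c d)))"
proof -
  let ?Q = "\<lambda>d. ssyt_word lam (left_word c d) \<times> ssyt_word mu (right_word a c d)"
  let ?P = "{(T, U). T \<in> semistandard N lam \<and> U \<in> semistandard N mu
    \<and> monomial (diagram lam) T + monomial (diagram mu) U = monomial (letters m) c}"
  have "?P = (\<Union>d\<in>D. ?Q d)"
  proof (intro subset_antisym subsetI)
    fix q assume "q \<in> ?P"
    then obtain T U where q: "q = (T, U)" and T: "T \<in> semistandard N lam" and U: "U \<in> semistandard N mu"
      and TU: "monomial (diagram lam) T + monomial (diagram mu) U = monomial (letters m) c" by auto
    obtain w1 where w1: "w1 ` letters a \<subseteq> {..<N}" "monomial (diagram lam) T = monomial (letters a) w1"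
      using semistandard_word[OF T] sizes by auto
    obtain w2 where w2: "w2 ` letters b \<subseteq> {..<N}" "monomial (diagram mu) U = monomial (letters b) w2"
      using semistandard_word[OF U] sizes by auto
    have "content a w1 j + content b w2 j = content m c j" for j
      using arg_cong[OF TU, of "\<lambda>\<alpha>. Poly_Mapping.lookup \<alpha> j"] unfolding w1(2) w2(2)
      by (simp add: lookup_add lookup_monomial content_def)
    then obtain g where g: "g \<in> fix1 n" "content a (left_word c g) = content a w1" "content b (right_word a c g) = content b w2"
      using words_from_double_coset[OF m n, of w1 w2 c] by blast
    obtain d where d: "d \<in> D" "content a (left_word c g) = content a (left_word c d)" using D(2)[OF g(1)] by blast
    have df: "d \<in> fix1 n" using d(1) D(1) by blast
    have "content b (right_word a c d) j = content b w2 j" for j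
      using content_sum[OF m n g(1), of c j] content_sum[OF m n df, of c j] d(2) g(3) by simp
    then have e: "content a (left_word c d) = content a w1" "content b (right_word a c d) = content b w2" using d(2) g(2) by auto
    have "T \<in> ssyt_word lam w1" using ssyt_word_eq_semistandard[of w1 lam N] T w1 sizes by auto
    moreover have "U \<in> ssyt_word mu w2" using ssyt_word_eq_semistandard[of w2 mu N] U w2 sizes by auto
    ultimately have "q \<in> ?Q d"
      using ssyt_word_cong[of lam w1 "left_word c d"] ssyt_word_cong[of mu w2 "right_word a c d"] e sizes q by simp
    then show "q \<in> (\<Union>d\<in>D. ?Q d)" using d(1) by blast
  next
    fix q assume "q \<in> (\<Union>d\<in>D. ?Q d)"
    then obtain d T U where d: "d \<in> D" and q: "q = (T, U)" and TU: "T \<in> ssyt_word lam (left_word c d)" "U \<in> ssyt_word mu (right_word a c d)"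
      by auto
    have df: "d \<in> fix1 n" using d D(1) by blast
    note bd = words_bounded[OF m n df c]
    have T: "T \<in> semistandard N lam" "monomial (diagram lam) T = monomial (letters a) (left_word c d)"
      using ssyt_word_eq_semistandard[of "left_word c d" lam N] TU(1) bd sizes by auto
    have U: "U \<in> semistandard N mu" "monomial (diagram mu) U = monomial (letters b) (right_word a c d)"
      using ssyt_word_eq_semistandard[of "right_word a c d" mu N] TU(2) bd sizes by auto
    have "monomial (letters a) (left_word c d) + monomial (letters b) (right_word a c d) = monomial (letters m) c"
      using content_sum[OF m n df, of c] by (intro poly_mapping_eqI) (simp add: lookup_add lookup_monomial content_def)
    then show "q \<in> ?P" using T U q by simp
  qed
  moreover have "card (\<Union>d\<in>D. ?Q d) = (\<Sum>d\<in>D. card (?Q d))"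
  proof (rule card_UN_disjoint)
    show "finite D" by (rule finite_subset[OF D(1) finite_fix1])
    show "\<forall>i\<in>D. \<forall>j\<in>D. i \<noteq> j \<longrightarrow> ?Q i \<inter> ?Q j = {}"
    proof (intro ballI impI, rule ccontr)
      fix d d' assume dd: "d \<in> D" "d' \<in> D" "d \<noteq> d'" "?Q d \<inter> ?Q d' \<noteq> {}"
      then obtain T where "T \<in> ssyt_word lam (left_word c d)" "T \<in> ssyt_word lam (left_word c d')" by auto
      then have "content a (left_word c d) = content a (left_word c d')"
        using sizes by (auto simp: ssyt_word_def content_def fun_eq_iff)
      then show False using D(3)[OF dd(1,2)] dd(3) by blast
    qed
  qed auto
  ultimately show ?thesis by (simp add: lookup_schur_mult card_cartesian_product)
qed

lemma specht_tensor_1_eq: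
  "specht_tensor 1 lam mu = tensor_rep (pullback (block_perm 1 a) (specht lam)) (pullback (block_perm (Suc a) b) (specht mu))"
  by (simp add: specht_tensor_def specht_at_eq sizes)

lemma representation_factors: "representation (sym_group a) (specht lam)" "representation (sym_group b) (specht mu)"
  using representation_specht[of lam] representation_specht[of mu] by (simp_all add: sizes)

lemma representation_Ind_specht:
  "representation (sym_group_fix1 n) (Ind (sym_group_fix1 n) (parabolic a n) (specht_tensor 1 lam mu))"
  unfolding specht_tensor_1_eq
  by (rule representation_Ind[OF m n representation_parabolic_tensor[OF m n representation_factors]])

lemma dim_fixed_Ind_specht:
  assumes D: "D \<subseteq> fix1 n"
      "\<And>g. g \<in> fix1 n \<Longrightarrow> \<exists>d\<in>D. content a (left_word c g) = content a (left_word c d)"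
      "\<And>d d'. d \<in> D \<Longrightarrow> d' \<in> D \<Longrightarrow> content a (left_word c d) = content a (left_word c d') \<Longrightarrow> d = d'"
  shows "cfun.dim (fixed (young m c) (Ind (sym_group_fix1 n) (parabolic a n) (specht_tensor 1 lam mu))) =
    (\<Sum>d\<in>D. card (ssyt_word lam (left_word c d)) * card (ssyt_word mu (right_word a c d)))"
proof -
  have "cfun.dim (fixed (word_stab a w) (specht lam)) = card (ssyt_word lam w)"
    "cfun.dim (fixed (word_stab b w) (specht mu)) = card (ssyt_word mu w)" for w
    using dim_fixed_specht[OF lam, of w] dim_fixed_specht[OF mu, of w] by (simp_all add: sizes)
  note dims = this
  show ?thesis
    unfolding specht_tensor_1_eq dims[symmetric] by (rule dim_fixed_Ind[OF m n representation_factors D])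
qed

text \<open>Homogeneity: the product has no monomials besides those of words of length
  \<open>m\<close>, so it suffices to compare coefficients at words.\<close>

lemma schur_mult_word:
  assumes "Poly_Mapping.lookup (schur N lam * schur N mu) \<alpha> \<noteq> 0"
  obtains c where "c ` letters m \<subseteq> {..<N}" "\<alpha> = monomial (letters m) c"
proof -
  from assms have "{(T, U). T \<in> semistandard N lam \<and> U \<in> semistandard N mu
    \<and> monomial (diagram lam) T + monomial (diagram mu) U = \<alpha>} \<noteq> {}" unfolding lookup_schur_mult by (metis card.empty of_nat_0)
  then obtain T U where T: "T \<in> semistandard N lam" and U: "U \<in> semistandard N mu"
      and TU: "monomial (diagram lam) T + monomial (diagram mu) U = \<alpha>" by auto
  obtain w1 where w1: "w1 ` letters a \<subseteq> {..<N}" "monomial (diagram lam) T = monomial (letters a) w1"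
    using semistandard_word[OF T] sizes by auto
  obtain w2 where w2: "w2 ` letters b \<subseteq> {..<N}" "monomial (diagram mu) U = monomial (letters b) w2"
    using semistandard_word[OF U] sizes by auto
  define w where "w x = (if x \<in> letters a then w1 x else w2 (x - a))" for x
  have L: "letters m = letters a \<union> (+) a ` letters b" using letters_split[OF m n] by auto
  have na: "a + y \<notin> letters a" if "y \<in> letters b" for y using that by (auto simp: letters_iff)
  have "monomial (letters m) w = (\<Sum>x\<in>letters a. Poly_Mapping.single (w x) 1) + (\<Sum>x\<in>(+) a ` letters b. Poly_Mapping.single (w x) 1)"
    unfolding monomial_def L by (rule sum.union_disjoint) (use na in auto)
  also have "(\<Sum>x\<in>letters a. Poly_Mapping.single (w x) 1) = monomial (letters a) w1"
    unfolding monomial_def by (rule sum.cong) (auto simp: w_def)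
  also have "(\<Sum>x\<in>(+) a ` letters b. Poly_Mapping.single (w x) 1) = monomial (letters b) w2"
    unfolding monomial_def by (subst sum.reindex) (auto simp: w_def na intro!: sum.cong)
  finally have "\<alpha> = monomial (letters m) w" using TU w1 w2 by simp
  moreover have "w ` letters m \<subseteq> {..<N}" using w1(1) w2(1) na unfolding L by (auto simp: w_def)
  ultimately show thesis using that by blast
qed

text \<open>The multiplicities of Specht modules in the induced representation satisfy the identity
  defining the Littlewood-Richardson coefficients, since both sides have dimensions of invariants as
  coefficients. The uniqueness demanded by \<open>THE\<close> comes from the triangularity of Kostka
  numbers.\<close>

theorem littlewood_richardson_dim:
  "cfun.dim (fixed (young m c) (Ind (sym_group_fix1 n) (parabolic a n) (specht_tensor 1 lam mu))) =
    (\<Sum>nu\<in>partitions m. littlewood_richardson lam mu nu * card (ssyt_word nu c))"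
proof -
  let ?I = "Ind (sym_group_fix1 n) (parabolic a n) (specht_tensor 1 lam mu)"
  have "representation (sym_group m) (pullback (shift m) ?I)"
    using representation_pullback_shift[of m ?I] representation_Ind_specht n by simp
  then obtain e where e: "\<And>c :: nat \<Rightarrow> nat. cfun.dim (fixed (word_stab m c) (pullback (shift m) ?I)) = (\<Sum>nu\<in>partitions m. e nu * card (ssyt_word nu c))"
    using specht_multiplicities by blast
  have e_word: "cfun.dim (fixed (young m c) ?I) = (\<Sum>nu\<in>partitions m. e nu * card (ssyt_word nu c))" for c :: "nat \<Rightarrow> nat"
    using e[of c] by (simp add: fixed_pullback_shift)
  \<comment> \<open>The description requires the value 0 outside the partitions of \<open>m\<close>,
    where nothing is known about \<open>e\<close>.\<close>
  define f where "f nu = (if nu \<in> partitions m then e nu else 0)" for nu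
  define P where "P = (\<lambda>c. (\<forall>nu. nu \<notin> partitions m \<longrightarrow> c nu = (0 :: nat))
    \<and> (\<forall>N. schur N lam * schur N mu = (\<Sum>nu\<in>partitions m. of_nat (c nu) * schur N nu)))"
  have rhs_lookup: "Poly_Mapping.lookup (\<Sum>nu\<in>partitions m. of_nat (h nu) * schur N nu) (monomial (letters m) w) =
      int (\<Sum>nu\<in>partitions m. h nu * card (ssyt_word nu w))" if "w ` letters m \<subseteq> {..<N}" for h N w
  proof -
    have "Poly_Mapping.lookup (schur N nu) (monomial (letters m) w) = int (card (ssyt_word nu w))" if "nu \<in> partitions m" for nu
      using lookup_schur_word[of w nu N] \<open>w ` letters m \<subseteq> {..<N}\<close> partitionsD(1)[OF that] by simp
    then show ?thesis by (simp add: lookup_sum lookup_of_nat_mult)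
  qed
  have "P f"
    unfolding P_def
  proof (intro conjI allI impI)
    fix N
    show "schur N lam * schur N mu = (\<Sum>nu\<in>partitions m. of_nat (f nu) * schur N nu)"
    proof (rule poly_mapping_eqI)
      fix \<alpha>
      show "Poly_Mapping.lookup (schur N lam * schur N mu) \<alpha> = Poly_Mapping.lookup (\<Sum>nu\<in>partitions m. of_nat (f nu) * schur N nu) \<alpha>"
      proof (cases "\<exists>w. w ` letters m \<subseteq> {..<N} \<and> \<alpha> = monomial (letters m) w")
        case True
        then obtain w where w: "w ` letters m \<subseteq> {..<N}" "\<alpha> = monomial (letters m) w" by blast
        obtain D where D: "D \<subseteq> fix1 n"
          "\<And>g. g \<in> fix1 n \<Longrightarrow> \<exists>d\<in>D. content a (left_word w g) = content a (left_word w d)"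
          "\<And>d d'. d \<in> D \<Longrightarrow> d' \<in> D \<Longrightarrow> content a (left_word w d) = content a (left_word w d') \<Longrightarrow> d = d'"
          by (rule double_coset_representatives[OF m n, of w]) (rule that)
        have "Poly_Mapping.lookup (schur N lam * schur N mu) \<alpha> = int (cfun.dim (fixed (young m w) ?I))"
        proof -
          have "cfun.dim (fixed (young m w) ?I) =
              (\<Sum>d\<in>D. card (ssyt_word lam (left_word w d)) * card (ssyt_word mu (right_word a w d)))"
            by (rule dim_fixed_Ind_specht[OF D])
          moreover have "Poly_Mapping.lookup (schur N lam * schur N mu) \<alpha> =
              int (\<Sum>d\<in>D. card (ssyt_word lam (left_word w d)) * card (ssyt_word mu (right_word a w d)))"
            unfolding w(2) by (rule lookup_schur_mult_word[OF w(1) D])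
          ultimately show ?thesis by simp
        qed
        also have "\<dots> = int (\<Sum>nu\<in>partitions m. f nu * card (ssyt_word nu w))"
          unfolding e_word by (simp add: f_def)
        finally show ?thesis unfolding w(2) rhs_lookup[OF w(1)] .
      next
        case False
        have "Poly_Mapping.lookup (schur N nu) \<alpha> = 0" if nu: "nu \<in> partitions m" for nu
        proof (rule ccontr)
          assume "Poly_Mapping.lookup (schur N nu) \<alpha> \<noteq> 0"
          then have "{T \<in> semistandard N nu. monomial (diagram nu) T = \<alpha>} \<noteq> {}" unfolding lookup_schur by (metis card.empty of_nat_0)
          then obtain T where "T \<in> semistandard N nu" "monomial (diagram nu) T = \<alpha>" by blast
          then show False using semistandard_word[of T N nu] partitionsD(1)[OF nu] False by metis
        qed
        then have "Poly_Mapping.lookup (\<Sum>nu\<in>partitions m. of_nat (f nu) * schur N nu) \<alpha> = 0"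
          by (simp add: lookup_sum lookup_of_nat_mult)
        moreover have "Poly_Mapping.lookup (schur N lam * schur N mu) \<alpha> = 0" using schur_mult_word[of N \<alpha>] False by blast
        ultimately show ?thesis by simp
      qed
    qed
  qed (simp add: f_def)
  moreover have "h = f" if h: "P h" for h
  proof (rule ccontr)
    assume ne: "h \<noteq> f"
    \<comment> \<open>Let \<open>nu\<close> have the least sum of row indices among the shapes where
      the solutions differ, and compare coefficients at a word with content \<open>nu\<close>.
      Another shape having a tableau of that content has a strictly smaller sum, so the solutions
      agree there and only the term of \<open>nu\<close> is left.\<close>
    define st where "st nu = (\<Sum>p\<in>diagram nu. fst p)" for nu
    have "\<exists>nu. h nu \<noteq> f nu" using ne by auto
    then obtain nu where nu: "h nu \<noteq> f nu" and min: "\<And>nu'. h nu' \<noteq> f nu' \<Longrightarrow> st nu \<le> st nu'"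
      using ex_has_least_nat[of "\<lambda>nu. h nu \<noteq> f nu" _ st] by metis
    have nuP: "nu \<in> partitions m" using nu h \<open>P f\<close> unfolding P_def by metis
    have s: "sum_list nu = m" by (rule partitionsD(1)[OF nuP])
    obtain t where t: "t \<in> tableaux nu"
      using finite_same_card_bij[of "letters (sum_list nu)" "diagram nu"] by (auto simp: card_diagram tableaux_iff)
    define r where "r = tabloid nu t"
    have r: "r \<in> tabloids nu" using t by (auto simp: r_def tabloids_def)
    \<comment> \<open>The letters of the word are row indices of \<open>nu\<close>, so
      \<open>length nu\<close> variables suffice for the comparison.\<close>
    have rm: "r ` letters m \<subseteq> {..<length nu}" using tabloids_less[OF r] s by auto
    have "(\<Sum>nu'\<in>partitions m. h nu' * card (ssyt_word nu' r)) = (\<Sum>nu'\<in>partitions m. f nu' * card (ssyt_word nu' r))"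
    proof -
      have "(\<Sum>nu'\<in>partitions m. of_nat (h nu') * schur (length nu) nu') = (\<Sum>nu'\<in>partitions m. of_nat (f nu') * schur (length nu) nu')"
        using h \<open>P f\<close> unfolding P_def by metis
      then have "int (\<Sum>nu'\<in>partitions m. h nu' * card (ssyt_word nu' r)) = int (\<Sum>nu'\<in>partitions m. f nu' * card (ssyt_word nu' r))"
        using rhs_lookup[OF rm, of h] rhs_lookup[OF rm, of f] by simp
      then show ?thesis by (simp only: of_nat_eq_iff)
    qed
    moreover have "h nu' * card (ssyt_word nu' r) = f nu' * card (ssyt_word nu' r)" if nu': "nu' \<in> partitions m - {nu}" for nu'
    proof (cases "h nu' = f nu'")
      case False
      have "ssyt_word nu' r = {}"
      proof (rule ccontr)
        assume "ssyt_word nu' r \<noteq> {}"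
        then obtain T where T: "T \<in> ssyt_word nu' r" by blast
        have p': "nu' \<in> partitions m" using nu' by simp
        have s': "sum_list nu' = m" by (rule partitionsD(1)[OF p'])
        have sum: "(\<Sum>x\<in>letters m. r x) = st nu" using sum_tabloid[OF r] by (simp add: s st_def)
        have "st nu' \<le> st nu" using ssyt_word_sum(1)[OF p' T] sum by (simp add: s' st_def)
        then have "st nu' = st nu" using min[OF False] by simp
        then have T_eq: "T = restrict fst (diagram nu')" using ssyt_word_sum(2)[OF p' T] sum by (simp add: s' st_def)
        have "row_length nu' i = row_length nu i" for i
        proof -
          have "row_length nu' i = card {p \<in> diagram nu'. T p = i}"
            unfolding card_row[symmetric] T_eq by (intro arg_cong[of _ _ card]) auto
          also have "\<dots> = card {x \<in> letters m. r x = i}" using T by (simp add: ssyt_word_def s')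
          also have "\<dots> = row_length nu i" using r by (simp add: tabloids_iff s)
          finally show ?thesis .
        qed
        then have "nu' = nu" by (rule partition_eqI[OF p' nuP])
        then show False using nu' by simp
      qed
      then show ?thesis by simp
    qed simp
    then have "(\<Sum>nu'\<in>partitions m - {nu}. h nu' * card (ssyt_word nu' r)) = (\<Sum>nu'\<in>partitions m - {nu}. f nu' * card (ssyt_word nu' r))"
      by (rule sum.cong[OF refl])
    ultimately have "h nu * card (ssyt_word nu r) = f nu * card (ssyt_word nu r)"
      by (simp add: sum.remove[OF finite_partitions nuP])
    moreover have "restrict fst (diagram nu) \<in> ssyt_word nu r"
    proof -
      have "card {p \<in> diagram nu. restrict fst (diagram nu) p = i} = card {x \<in> letters (sum_list nu). r x = i}" for i
      proof -
        have "{p \<in> diagram nu. restrict fst (diagram nu) p = i} = {p \<in> diagram nu. fst p = i}" by auto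
        then show ?thesis using r card_row[of nu i] by (simp add: tabloids_iff)
      qed
      then show ?thesis by (auto simp: ssyt_word_def)
    qed
    then have "card (ssyt_word nu r) \<noteq> 0" using card_0_eq[OF finite_ssyt_word] by blast
    ultimately show False using nu by simp
  qed
  ultimately have "(THE c. P c) = f" by (intro the_equality)
  then have "littlewood_richardson lam mu = f" unfolding littlewood_richardson_def P_def sizes m[symmetric] .
  then show ?thesis unfolding e_word by (simp add: f_def)
qed

end

section \<open>Assembling the isomorphisms over the stabilizer of 1\<close>

lemma representation_specht_at_1:
  assumes "nu \<in> partitions m"
  shows "representation (sym_group_fix1 (Suc m)) (specht_at 1 nu)"
  unfolding specht_at_eq partitionsD(1)[OF assms]
proof (rule representation_pullback)
  show "representation (sym_group m) (specht nu)" using representation_specht[of nu] partitionsD(1)[OF assms] by simp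
  show "block_perm 1 m \<in> hom (sym_group_fix1 (Suc m)) (sym_group m)"
  proof (rule homI)
    fix g h assume g: "g \<in> carrier (sym_group_fix1 (Suc m))" and h: "h \<in> carrier (sym_group_fix1 (Suc m))"
    show "block_perm 1 m g \<in> carrier (sym_group m)" using g block_perm_fix1(1)[of g m] by (simp add: carrier_sym_group)
    have "block_perm 1 m (g \<circ> h) = block_perm 1 m (shift m (block_perm 1 m g \<circ> block_perm 1 m h))"
      using g h block_perm_fix1[of g m] block_perm_fix1[of h m] by (simp add: shift_comp)
    also have "\<dots> = block_perm 1 m g \<circ> block_perm 1 m h"
      using g h block_perm_fix1(1)[of g m] block_perm_fix1(1)[of h m] by (intro block_perm_shift permutes_compose) auto
    finally show "block_perm 1 m (g \<otimes>\<^bsub>sym_group_fix1 (Suc m)\<^esub> h) = block_perm 1 m g \<otimes>\<^bsub>sym_group m\<^esub> block_perm 1 m h"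
      by (simp add: sym_group_mult)
  qed
  show "block_perm 1 m \<one>\<^bsub>sym_group_fix1 (Suc m)\<^esub> = \<one>\<^bsub>sym_group m\<^esub>"
    by (auto simp: sym_group_one block_perm_def fun_eq_iff)
qed

lemma dim_fixed_specht_at_1:
  assumes "nu \<in> partitions m"
  shows "cfun.dim (fixed (young m c) (specht_at 1 nu)) = card (ssyt_word nu c)"
proof -
  have "block_perm 1 m ` young m c = word_stab m c"
  proof -
    have "block_perm 1 m (shift m \<sigma>) = \<sigma>" if "\<sigma> \<in> word_stab m c" for \<sigma>
      using that by (intro block_perm_shift) (simp add: word_stab_def)
    then show ?thesis unfolding young_def image_image by simp
  qed
  then show ?thesis
    using dim_fixed_specht[OF assms, of c] partitionsD(1)[OF assms] by (simp add: specht_at_eq fixed_pullback)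
qed

text \<open>Transports the criterion by dimensions of invariants along \<open>shift\<close>; as
  \<open>shift\<close> reaches the whole stabilizer of 1, an intertwiner of the pullbacks is one of
  the original representations.\<close>

lemma rep_iso_fix1I:
  assumes R: "representation (sym_group_fix1 (Suc m)) R" and S: "representation (sym_group_fix1 (Suc m)) S"
    and eq: "\<And>c :: nat \<Rightarrow> nat. cfun.dim (fixed (young m c) R) = cfun.dim (fixed (young m c) S)"
  shows "rep_iso (sym_group_fix1 (Suc m)) R S"
proof (rule rep_iso_pullback[OF _ R S])
  show "rep_iso (sym_group m) (pullback (shift m) R) (pullback (shift m) S)"
    by (rule rep_iso_if_dim_fixed_eq[OF representation_pullback_shift[OF R] representation_pullback_shift[OF S]])
      (simp add: fixed_pullback_shift eq)
  show "shift m ` carrier (sym_group m) = carrier (sym_group_fix1 (Suc m))" by (simp add: shift_image)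
qed

theorem mainTheorem11:
  fixes k n :: nat and lam mu :: "nat list"
  assumes "1 \<le> k" and "k \<le> n"
    and "lam \<in> partitions k" and "mu \<in> partitions (n - k)"
  shows "rep_iso (sym_group_fix1 n)
           (Res (fix1 n) (V_pair lam mu))
           (direct_sum (remove_corner lam)
             (\<lambda>lam1. Ind (sym_group_fix1 n) (block_stabilizer n k \<inter> fix1 n) (specht_tensor 1 lam1 mu)))
       \<and> rep_iso (sym_group_fix1 n)
           (direct_sum (remove_corner lam)
             (\<lambda>lam1. Ind (sym_group_fix1 n) (block_stabilizer n k \<inter> fix1 n) (specht_tensor 1 lam1 mu)))
           (direct_sum (partitions (n - 1))
             (\<lambda>nu. rep_multiple (\<Sum>lam1\<in>remove_corner lam. littlewood_richardson lam1 mu nu)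
                     (specht_at 1 nu)))"
proof -
  \<comment> \<open>With 1 set aside, the two blocks have \<open>a\<close> and \<open>b\<close>
    letters, and the stabilizer of 1 is a symmetric group on \<open>m\<close> letters.\<close>
  define a b m where "a = k - 1" and "b = n - k" and "m = a + b"
  have k: "k = Suc a" and n: "n = Suc m" and m: "m = a + b" using assms(1,2) by (auto simp: a_def b_def m_def)
  have lam: "lam \<in> partitions (Suc a)" and mu: "mu \<in> partitions b" using assms(3,4) k by (auto simp: b_def)
  have P: "block_stabilizer n k \<inter> fix1 n = parabolic a n" by (simp add: parabolic_def k)
  let ?I = "\<lambda>lam1. Ind (sym_group_fix1 n) (parabolic a n) (specht_tensor 1 lam1 mu)"
  let ?S2 = "direct_sum (remove_corner lam) ?I"
  let ?S3 = "direct_sum (partitions m) (\<lambda>nu. rep_multiple (\<Sum>lam1\<in>remove_corner lam. littlewood_richardson lam1 mu nu) (specht_at 1 nu))"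
  have l1: "lam1 \<in> partitions a" if "lam1 \<in> remove_corner lam" for lam1 using that remove_corner_iff[OF lam] by blast
  have R1: "representation (sym_group_fix1 n) (Res (fix1 n) (V_pair lam mu))" by (rule representation_V_pair(2)[OF m n lam mu])
  have RI: "representation (sym_group_fix1 n) (?I lam1)" if "lam1 \<in> remove_corner lam" for lam1
    by (rule representation_Ind_specht[OF m n l1[OF that] mu])
  have R2: "representation (sym_group_fix1 n) ?S2" by (rule representation_direct_sum[OF finite_remove_corner RI])
  have Rnu: "representation (sym_group_fix1 n) (specht_at 1 nu)" if "nu \<in> partitions m" for nu
    using representation_specht_at_1[OF that] n by simp
  have Rm: "representation (sym_group_fix1 n) (rep_multiple d (specht_at 1 nu))" if "nu \<in> partitions m" for nu d
    unfolding rep_multiple_def by (rule representation_direct_sum[OF finite_lessThan Rnu[OF that]])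
  have R3: "representation (sym_group_fix1 n) ?S3" by (rule representation_direct_sum[OF finite_partitions Rm])
  have sub: "young m c \<subseteq> carrier (sym_group_fix1 n)" for c :: "nat \<Rightarrow> nat" using young_subset[of m c] n by simp
  have dim2: "cfun.dim (fixed (young m c) ?S2) = (\<Sum>lam1\<in>remove_corner lam. cfun.dim (fixed (young m c) (?I lam1)))" for c :: "nat \<Rightarrow> nat"
    by (rule dim_fixed_direct_sum[OF finite_remove_corner RI sub])
  have dim3: "cfun.dim (fixed (young m c) ?S3) =
      (\<Sum>nu\<in>partitions m. (\<Sum>lam1\<in>remove_corner lam. littlewood_richardson lam1 mu nu) * card (ssyt_word nu c))" for c :: "nat \<Rightarrow> nat"
  proof -
    have "cfun.dim (fixed (young m c) (rep_multiple d (specht_at 1 nu))) = d * card (ssyt_word nu c)" if nu: "nu \<in> partitions m" for nu d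
    proof -
      have "cfun.dim (fixed (young m c) (rep_multiple d (specht_at 1 nu))) =
          (\<Sum>i<d. cfun.dim (fixed (young m c) (specht_at 1 nu)))"
        unfolding rep_multiple_def by (rule dim_fixed_direct_sum[OF finite_lessThan Rnu[OF nu] sub])
      then show ?thesis using dim_fixed_specht_at_1[OF nu, of c] by simp
    qed
    note mult = this
    have "cfun.dim (fixed (young m c) ?S3) = (\<Sum>nu\<in>partitions m. cfun.dim (fixed (young m c)
        (rep_multiple (\<Sum>lam1\<in>remove_corner lam. littlewood_richardson lam1 mu nu) (specht_at 1 nu))))"
      by (rule dim_fixed_direct_sum[OF finite_partitions Rm sub])
    then show ?thesis using mult by simp
  qed
  have "rep_iso (sym_group_fix1 n) (Res (fix1 n) (V_pair lam mu)) ?S2"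
    using R1 R2 unfolding n
  proof (rule rep_iso_fix1I)
    fix c :: "nat \<Rightarrow> nat"
    \<comment> \<open>One set of representatives serves both sides, since the double cosets depend
      on \<open>a\<close>, \<open>b\<close> and \<open>c\<close> but not on the partitions.\<close>
    obtain D where D: "D \<subseteq> fix1 n"
      "\<And>g. g \<in> fix1 n \<Longrightarrow> \<exists>d\<in>D. content a (left_word c g) = content a (left_word c d)"
      "\<And>d d'. d \<in> D \<Longrightarrow> d' \<in> D \<Longrightarrow> content a (left_word c d) = content a (left_word c d') \<Longrightarrow> d = d'"
      by (rule double_coset_representatives[OF m n, of c]) (rule that)
    \<comment> \<open>Exceeds every letter of \<open>c\<close>, so that prepending it makes 1 the
      position of a unique largest letter, whose cell is the corner to be removed.\<close>
    define M where "M = Suc (\<Sum>x\<in>letters m. c x)"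
    have "c x < M" if "x \<in> letters m" for x
      using member_le_sum[OF that, of c] by (simp add: M_def)
    then have c: "c ` letters m \<subseteq> {..<M}" by auto
    have dim_left: "cfun.dim (fixed (word_stab a (left_word c d)) (pullback (shift a) (specht lam))) =
        (\<Sum>lam1\<in>remove_corner lam. card (ssyt_word lam1 (left_word c d)))" if "d \<in> D" for d
    proof -
      have "d \<in> fix1 n" using that D(1) by blast
      then have "left_word c d ` letters a \<subseteq> {..<M}"
        by (rule words_bounded(1)[OF m n _ c])
      then have less: "left_word c d x < M" if "x \<in> letters a" for x using that by auto
      then have "M \<notin> left_word c d ` letters a" by auto
      from dim_fixed_specht_shift[OF lam this] show ?thesis using card_ssyt_word_prepend[OF lam less] by simp
    qed
    have "cfun.dim (fixed (young m c) (Res (fix1 n) (V_pair lam mu))) = cfun.dim (fixed (young m c) (V_pair lam mu))"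
      using sub[of c] by (simp add: fixed_Res)
    also have "\<dots> = (\<Sum>d\<in>D. cfun.dim (fixed (word_stab a (left_word c d)) (pullback (shift a) (specht lam))) *
      cfun.dim (fixed (word_stab b (right_word a c d)) (specht mu)))" by (rule dim_fixed_V_pair[OF m n lam mu D])
    also have "\<dots> = (\<Sum>d\<in>D. \<Sum>lam1\<in>remove_corner lam. card (ssyt_word lam1 (left_word c d)) * card (ssyt_word mu (right_word a c d)))"
    proof (rule sum.cong[OF refl])
      fix d assume "d \<in> D"
      then show "cfun.dim (fixed (word_stab a (left_word c d)) (pullback (shift a) (specht lam))) * cfun.dim (fixed (word_stab b (right_word a c d)) (specht mu)) =
          (\<Sum>lam1\<in>remove_corner lam. card (ssyt_word lam1 (left_word c d)) * card (ssyt_word mu (right_word a c d)))"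
        using dim_left dim_fixed_specht[OF mu, of "right_word a c d"] partitionsD(1)[OF mu] by (simp add: sum_distrib_right)
    qed
    also have "\<dots> = (\<Sum>lam1\<in>remove_corner lam. cfun.dim (fixed (young m c) (?I lam1)))"
    proof (subst sum.swap, rule sum.cong[OF refl])
      fix lam1 assume l: "lam1 \<in> remove_corner lam"
      show "(\<Sum>d\<in>D. card (ssyt_word lam1 (left_word c d)) * card (ssyt_word mu (right_word a c d))) =
          cfun.dim (fixed (young m c) (?I lam1))"
        by (rule dim_fixed_Ind_specht[OF m n l1[OF l] mu D, symmetric])
    qed
    finally show "cfun.dim (fixed (young m c) (Res (fix1 (Suc m)) (V_pair lam mu))) =
        cfun.dim (fixed (young m c) (direct_sum (remove_corner lam) (\<lambda>lam1. Ind (sym_group_fix1 (Suc m)) (parabolic a (Suc m)) (specht_tensor 1 lam1 mu))))"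
      using dim2[of c] unfolding n by simp
  qed
  moreover have "rep_iso (sym_group_fix1 n) ?S2 ?S3"
    using R2 R3 unfolding n
  proof (rule rep_iso_fix1I)
    fix c :: "nat \<Rightarrow> nat"
    have "cfun.dim (fixed (young m c) ?S2) =
        (\<Sum>lam1\<in>remove_corner lam. \<Sum>nu\<in>partitions m. littlewood_richardson lam1 mu nu * card (ssyt_word nu c))"
      unfolding dim2 by (intro sum.cong refl) (rule littlewood_richardson_dim[OF m n l1 mu])
    also have "\<dots> = cfun.dim (fixed (young m c) ?S3)"
      unfolding dim3 sum_distrib_right by (rule sum.swap)
    finally show "cfun.dim (fixed (young m c) (direct_sum (remove_corner lam) (\<lambda>lam1. Ind (sym_group_fix1 (Suc m)) (parabolic a (Suc m)) (specht_tensor 1 lam1 mu)))) =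
        cfun.dim (fixed (young m c) ?S3)"
      unfolding n .
  qed
  ultimately show ?thesis unfolding P using n by simp
qed

end
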